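(* Let $(U_1,U_2,A)$ be strip-admissible with values in $U(2)$ and $GL(2,\mathbb C)$, admitting a dominated splitting $E^s\oplus E^u$, over $\tau\in\mathrm{DC}(c,\nu)$ for some $c>0$, $\nu\ge1$. Write $(m_s,k_s)$ and $(m_u,k_u)$ for the charge and multiplier winding vector of $E^s$ and $E^u$. Then $$\sigma_{\mathrm{pt}}(T_A)=\bigsqcup_{i\in\{s,u\}:\,(m_i,k_i)=(0,0)}\Lambda_{E^i},$$ where $\Lambda_{E^i}=\lambda_0(E^i)\{\mathrm e^{-2\pi\mathrm i\nu\cdot\tau}:\nu\in\mathbb Z^2\}$ and $\lambda_0(E^i)=\exp(\langle\log|q_i|\rangle+2\pi\mathrm i\langle g_i\rangle)$. Thus $T_A$ has an eigenvalue if and only if at least one of the two lines has both invariants zero. All eigenvalues are geometrically simple in $\mathcal H_U$, i.e. $\dim\ker(T_A-\lambda)=1$ for every eigenvalue $\lambda$; eigenvalues contributed by distinct qualifying lines (lines with $(m_i,k_i)=(0,0)$) cannot coincide because their moduli $\mathrm e^{\lambda_s}<\mathrm e^{\lambda_u}$ differ. Moreover $m_s+m_u=c_1(V)[\mathbb T^2]$, so if $c_1(V)\ne0$ there is at most one qualifying line. Hence, if $c_1(V)\neq 0$, $$\sigma_{\mathrm{pt}}(T_A)\ne\emptyset\iff\text{one of }E^s,E^u\text{ has }m=0\text{ and }k=0,$$ and if a particular one of the two lines is known to be topologically trivial, this reduces to $k=0$ on that line.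
   Context: Notation. $\mathbb T^2=\mathbb R^2/\mathbb Z^2$, $w=(w_1,w_2)$, Haar probability measure $\mu$, orientation $dw_1\wedge dw_2$; $e_1=(1,0)$, $e_2=(0,1)$; $\langle h\rangle=\int_{\mathbb T^2}h\,d\mu$; the inner product on $\mathbb C^2$ is conjugate-linear in the first slot; $\tau=(\alpha,\beta)\in\mathbb R^2$, $Sw=w+\tau$. Chern classes are normalized by $c_1(\nabla)=\frac{\mathrm i}{2\pi}F_\nabla$. Sewing system and cocycle. A continuous unitary sewing system is a pair of continuous $U_1,U_2\colon\mathbb R^2\to U(2)$ with (K1) $U_1(w+e_2)U_2(w)=U_2(w+e_1)U_1(w)$; it presents the rank-two Hermitian bundle $V\to\mathbb T^2$ given as the quotient of $\mathbb R^2\times\mathbb C^2$ by the action generated by $(w,\xi)\mapsto(w+e_j,U_j(w)\xi)$. Measurable sections of $V$ are measurable $F\colon\mathbb R^2\to\mathbb C^2$ with $F(w+e_j)=U_j(w)F(w)$ a.e.; $\mathcal H_U$ is the Hilbert space of those with $\int_{[0,1)^2}|F|^2<\infty$ (mod null sets). A continuous equivariant cocycle is a continuous $A\colon\mathbb R^2\to GL(2,\mathbb C)$ with (K2) $A(w+e_j)U_j(w)=U_j(Sw)A(w)$. The transfer operator on $\mathcal H_U$ is $(T_AF)(w)=A(w-\tau)F(w-\tau)$; $T_AF=\lambda F$ is equivalent to $A(w)F(w)=\lambda F(Sw)$ a.e. $\sigma_{\mathrm{pt}}(T_A)$ is its set of eigenvalues. Invariant line. A continuous map $\ell\colon\mathbb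 R^2\to\mathbb{CP}^1$ with $\ell(w+e_j)=U_j(w)\ell(w)$ and $A(w)\ell(w)=\ell(Sw)$ for all $w$; it induces a line subbundle $L\subset V$. Charge and multiplier. There are a continuous $e\colon\mathbb R^2\to\mathbb C^2$ with $|e|=1$, $e(w)\in\ell(w)$, and a unique integer $m$ (the charge) with $e(w+e_1)=U_1(w)e(w)$, $e(w+e_2)=\mathrm e^{2\pi\mathrm i m w_1}U_2(w)e(w)$. The multiplier is $q(w)=\langle e(Sw),A(w)e(w)\rangle$ (continuous, zero-free, $|q|$ $\mathbb Z^2$-periodic); $p(w)=\frac{q(w)}{|q(w)|}\mathrm e^{2\pi\mathrm i m\alpha w_2}$ is continuous, $\mathbb Z^2$-periodic, unimodular; $k\in\mathbb Z^2$ is its winding vector (independent of $e$) and $g\colon\mathbb T^2\to\mathbb R$ is continuous with $p(w)=\mathrm e^{2\pi\mathrm i(k\cdot w+g(w))}$. For $i\in\{s,u\}$, $q_i,g_i$ denote these objects for $E^i$ and $\lambda_i=\langle\log|q_i|\rangle$ is its Lyapunov exponent. Strip-admissible. For $\delta>0$ let $\Omega_\delta=\{w\in\mathbb C^2:|\operatorname{Im}w_1|\le\delta,|\operatorname{Im}w_2|\le\delta\}$. $(U_1,U_2,A)$ is strip-admissible if for some $\delta_0>0$ the maps $U_1,U_2,A$ extend to matrix functions holomorphic on an open neighborhood of $\Omega_{\delta_0}$ and bounded on $\Omega_{\delta_0}$, with $U_j(w)$ unitary and $\det A(w)\ne0$ for real $w$, and (K1), (K2) holding on $\mathbb R^2$.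 Dominated splitting. A pair of invariant lines $\ell_s,\ell_u$ with $\ell_s(w)\ne\ell_u(w)$ for all $w$, inducing $E^s,E^u$ with $V=E^s\oplus E^u$, such that for some integer $N\ge1$ and $0<\kappa_0<1$, $\|A^{(N)}(z)|_{\ell_s(z)}\|/\mathfrak m(A^{(N)}(z)|_{\ell_u(z)})\le\kappa_0^2$ for all $z\in\mathbb R^2$, where $A^{(N)}(w)=A(S^{N-1}w)\cdots A(w)$ and $\mathfrak m(M)=\min_{|v|=1}|Mv|$. Diophantine condition. $\tau\in\mathrm{DC}(c,\nu)$, $c>0,\nu\ge1$, means $\|\nu_1'\alpha+\nu_2'\beta\|_{\mathbb R/\mathbb Z}\ge c\,(|\nu_1'|+|\nu_2'|)^{-\nu}$ for all $(\nu_1',\nu_2')\in\mathbb Z^2\setminus\{0\}$ (distance to the nearest integer). *)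

theory Defs
  imports "HOL-Analysis.Analysis"
begin

text \<open>
  The plane is \<open>real^2\<close>, with basis vectors \<open>axis j 1\<close> for \<open>j :: 2\<close>; integer vectors are \<open>int^2\<close>.
  Functions on the torus are \<open>\<int>\<^sup>2\<close>-periodic functions on the plane. A pair \<open>(U\<^sub>1, U\<^sub>2)\<close> is
  a function \<open>U\<close> on the two-element type \<open>2\<close> (whose elements are \<open>1\<close> and \<open>2\<close>).
\<close>

definition lattice_dot :: "int^2 \<Rightarrow> real^2 \<Rightarrow> real" where
  "lattice_dot n w = (\<Sum>j\<in>UNIV. of_int (n $ j) * w $ j)"

definition unit_cell :: "(real^2) set" where
  "unit_cell = {w. \<forall>j. 0 \<le> w $ j \<and> w $ j < 1}"

definition torus_mean :: "(real^2 \<Rightarrow> 'b::{banach, second_countable_topology}) \<Rightarrow> 'b" where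
  "torus_mean h = (LINT w:unit_cell|lebesgue. h w)"

definition periodic :: "(real^2 \<Rightarrow> 'b) \<Rightarrow> bool" where
  "periodic h \<longleftrightarrow> (\<forall>j w. h (w + axis j 1) = h w)"

definition hinner :: "complex^2 \<Rightarrow> complex^2 \<Rightarrow> complex" where
  "hinner v w = (\<Sum>i\<in>UNIV. cnj (v $ i) * w $ i)"

definition adjoint_matrix :: "complex^2^2 \<Rightarrow> complex^2^2" where
  "adjoint_matrix M = (\<chi> i j. cnj (M $ j $ i))"

definition unitary_matrix :: "complex^2^2 \<Rightarrow> bool" where
  "unitary_matrix M \<longleftrightarrow> adjoint_matrix M ** M = mat 1 \<and> M ** adjoint_matrix M = mat 1"


section \<open>Sewing systems, cocycles, strip-admissibility\<close>

definition sewing_system :: "(2 \<Rightarrow> real^2 \<Rightarrow> complex^2^2) \<Rightarrow> bool" where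
  "sewing_system U \<longleftrightarrow>
     (\<forall>j. continuous_on UNIV (U j) \<and> (\<forall>w. unitary_matrix (U j w))) \<and>
     (\<forall>w. U 1 (w + axis 2 1) ** U 2 w = U 2 (w + axis 1 1) ** U 1 w)"

definition equivariant_cocycle ::
    "(2 \<Rightarrow> real^2 \<Rightarrow> complex^2^2) \<Rightarrow> (real^2 \<Rightarrow> complex^2^2) \<Rightarrow> real^2 \<Rightarrow> bool" where
  "equivariant_cocycle U A \<tau> \<longleftrightarrow>
     continuous_on UNIV A \<and> (\<forall>w. det (A w) \<noteq> 0) \<and>
     (\<forall>j w. A (w + axis j 1) ** U j w = U j (w + \<tau>) ** A w)"

definition complexify :: "real^2 \<Rightarrow> complex^2" where
  "complexify w = (\<chi> j. complex_of_real (w $ j))"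

definition strip :: "real \<Rightarrow> (complex^2) set" where
  "strip \<delta> = {z. \<forall>j. \<bar>Im (z $ j)\<bar> \<le> \<delta>}"

text \<open>Holomorphy in two variables: complex differentiability, i.e. the real Frechet derivative
  exists and is complex-linear.\<close>

definition holomorphic2_on :: "(complex^2 \<Rightarrow> complex) \<Rightarrow> (complex^2) set \<Rightarrow> bool" where
  "holomorphic2_on f W \<longleftrightarrow>
     (\<forall>z\<in>W. \<exists>f'. (f has_derivative f') (at z) \<and> (\<forall>c v. f' (c *s v) = c * f' v))"

definition extends_to_strip :: "real \<Rightarrow> (real^2 \<Rightarrow> complex^2^2) \<Rightarrow> bool" where
  "extends_to_strip \<delta> M \<longleftrightarrow>
     (\<exists>G W. open W \<and> strip \<delta> \<subseteq> W \<and> (\<forall>i j. holomorphic2_on (\<lambda>z. G z $ i $ j) W) \<and>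
        bounded (G ` strip \<delta>) \<and> (\<forall>w. G (complexify w) = M w))"

definition strip_admissible ::
    "(2 \<Rightarrow> real^2 \<Rightarrow> complex^2^2) \<Rightarrow> (real^2 \<Rightarrow> complex^2^2) \<Rightarrow> real^2 \<Rightarrow> bool" where
  "strip_admissible U A \<tau> \<longleftrightarrow>
     sewing_system U \<and> equivariant_cocycle U A \<tau> \<and>
     (\<exists>\<delta>>0. (\<forall>j. extends_to_strip \<delta> (U j)) \<and> extends_to_strip \<delta> A)"


section \<open>The Hilbert space of sections and the transfer operator\<close>

text \<open>Functions on the plane modulo equality almost everywhere, as a complex vector space. The space
  of square-integrable sections is a subspace of it.\<close>

quotient_type ae_field = "real^2 \<Rightarrow> complex^2" / "\<lambda>F G. AE w in lebesgue. F w = G w"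
proof (rule equivpI)
  show "reflp (\<lambda>F G :: real^2 \<Rightarrow> complex^2. AE w in lebesgue. F w = G w)"
    by (rule reflpI) simp
  show "symp (\<lambda>F G :: real^2 \<Rightarrow> complex^2. AE w in lebesgue. F w = G w)"
    by (rule sympI) (auto elim: eventually_mono)
  show "transp (\<lambda>F G :: real^2 \<Rightarrow> complex^2. AE w in lebesgue. F w = G w)"
    by (rule transpI) (auto elim: eventually_elim2)
qed

instantiation ae_field :: ab_group_add
begin

lift_definition zero_ae_field :: ae_field is "\<lambda>w. 0" .

lift_definition plus_ae_field :: "ae_field \<Rightarrow> ae_field \<Rightarrow> ae_field" is "\<lambda>F G w. F w + G w"
  by (auto elim: eventually_elim2)

lift_definition uminus_ae_field :: "ae_field \<Rightarrow> ae_field" is "\<lambda>F w. - F w"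
  by (auto elim: eventually_mono)

lift_definition minus_ae_field :: "ae_field \<Rightarrow> ae_field \<Rightarrow> ae_field" is "\<lambda>F G w. F w - G w"
  by (auto elim: eventually_elim2)

instance
  by standard (transfer; simp add: algebra_simps)+

end

lift_definition cscale :: "complex \<Rightarrow> ae_field \<Rightarrow> ae_field" is "\<lambda>c F w. c *s F w"
  by (auto elim: eventually_mono)

global_interpretation ae_field: vector_space cscale
  by standard (transfer; simp add: vec.scale_right_distrib vec.scale_left_distrib)+

lemma AE_lebesgue_shift:
  fixes a :: "real^2"
  assumes "AE w in lebesgue. P w"
  shows "AE w in lebesgue. P (w - a)"
proof -
  from assms obtain N where N: "{w. \<not> P w} \<subseteq> N" "N \<in> null_sets lebesgue"
    by (auto simp: eventually_ae_filter)
  have "negligible N" using N(2) by (simp only: negligible_iff_null_sets)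
  then have "negligible ((+) a ` N)" by (rule negligible_translation)
  moreover have "{w. \<not> P (w - a)} \<subseteq> (+) a ` N"
  proof
    fix w assume "w \<in> {w. \<not> P (w - a)}"
    then have "w - a \<in> N" using N(1) by auto
    then show "w \<in> (+) a ` N" by (intro image_eqI[of _ _ "w - a"]) auto
  qed
  ultimately show ?thesis
    by (auto simp: eventually_ae_filter negligible_iff_null_sets)
qed

lift_definition transfer_op :: "(real^2 \<Rightarrow> complex^2^2) \<Rightarrow> real^2 \<Rightarrow> ae_field \<Rightarrow> ae_field"
  is "\<lambda>A \<tau> F w. A (w - \<tau>) *v F (w - \<tau>)"
proof -
  fix A :: "real^2 \<Rightarrow> complex^2^2" and \<tau> and F G :: "real^2 \<Rightarrow> complex^2"
  assume "AE w in lebesgue. F w = G w"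
  from AE_lebesgue_shift[OF this, of \<tau>]
  show "AE w in lebesgue. A (w - \<tau>) *v F (w - \<tau>) = A (w - \<tau>) *v G (w - \<tau>)"
    by (auto elim: eventually_mono)
qed

definition measurable_section ::
    "(2 \<Rightarrow> real^2 \<Rightarrow> complex^2^2) \<Rightarrow> (real^2 \<Rightarrow> complex^2) \<Rightarrow> bool" where
  "measurable_section U F \<longleftrightarrow>
     F \<in> borel_measurable lebesgue \<and>
     (\<forall>j. AE w in lebesgue. F (w + axis j 1) = U j w *v F w)"

definition L2_sections :: "(2 \<Rightarrow> real^2 \<Rightarrow> complex^2^2) \<Rightarrow> ae_field set" where
  "L2_sections U =
     {abs_ae_field F | F. measurable_section U F \<and>
        (\<integral>\<^sup>+ w\<in>unit_cell. ennreal ((norm (F w))\<^sup>2) \<partial>lebesgue) < \<infinity>}"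

definition eigenspace ::
    "(2 \<Rightarrow> real^2 \<Rightarrow> complex^2^2) \<Rightarrow> (real^2 \<Rightarrow> complex^2^2) \<Rightarrow> real^2 \<Rightarrow> complex \<Rightarrow> ae_field set" where
  "eigenspace U A \<tau> lam = {\<Phi> \<in> L2_sections U. transfer_op A \<tau> \<Phi> = cscale lam \<Phi>}"

definition point_spectrum ::
    "(2 \<Rightarrow> real^2 \<Rightarrow> complex^2^2) \<Rightarrow> (real^2 \<Rightarrow> complex^2^2) \<Rightarrow> real^2 \<Rightarrow> complex set" where
  "point_spectrum U A \<tau> = {lam. \<exists>\<Phi>\<in>eigenspace U A \<tau> lam. \<Phi> \<noteq> 0}"


section \<open>Invariant lines and dominated splittings\<close>

text \<open>The complex projective line as the set of complex lines through the origin, with the quotient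
  topology from the punctured space.\<close>

definition projective_line :: "(complex^2) set topology" where
  "projective_line =
     topology (\<lambda>X. X \<subseteq> (\<lambda>v. vec.span {v}) ` (- {0}) \<and> open {v. v \<noteq> 0 \<and> vec.span {v} \<in> X})"

lemma openin_projective_line:
  "openin projective_line X \<longleftrightarrow>
     X \<subseteq> (\<lambda>v. vec.span {v}) ` (- {0}) \<and> open {v. v \<noteq> 0 \<and> vec.span {v} \<in> X}"
proof -
  have "istopology (\<lambda>X. X \<subseteq> (\<lambda>v. vec.span {v}) ` (- {0 :: complex^2}) \<and>
                        open {v. v \<noteq> 0 \<and> vec.span {v} \<in> X})" (is "istopology ?P")
    unfolding istopology_def
  proof (intro conjI allI impI)
    fix S T assume S: "?P S" and T: "?P T"
    have "{v. v \<noteq> 0 \<and> vec.span {v} \<in> S \<inter> T} =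
          {v. v \<noteq> 0 \<and> vec.span {v} \<in> S} \<inter> {v. v \<noteq> 0 \<and> vec.span {v} \<in> T}"
      by auto
    with S T show "open {v. v \<noteq> 0 \<and> vec.span {v} \<in> S \<inter> T}"
      by (simp only: open_Int)
    show "S \<inter> T \<subseteq> (\<lambda>v. vec.span {v}) ` (- {0})" using S by blast
  next
    fix K assume K: "\<forall>S\<in>K. ?P S"
    have "{v. v \<noteq> 0 \<and> vec.span {v} \<in> \<Union> K} = (\<Union>S\<in>K. {v. v \<noteq> 0 \<and> vec.span {v} \<in> S})"
      by auto
    moreover have "open (\<Union>S\<in>K. {v. v \<noteq> 0 \<and> vec.span {v} \<in> S})"
      using K by (intro open_UN) blast
    ultimately show "open {v. v \<noteq> 0 \<and> vec.span {v} \<in> \<Union> K}"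
      by (simp only:)
    show "\<Union> K \<subseteq> (\<lambda>v. vec.span {v}) ` (- {0})" using K by blast
  qed
  then show ?thesis
    unfolding projective_line_def by (simp only: topology_inverse')
qed

definition invariant_line ::
    "(2 \<Rightarrow> real^2 \<Rightarrow> complex^2^2) \<Rightarrow> (real^2 \<Rightarrow> complex^2^2) \<Rightarrow> real^2 \<Rightarrow>
     (real^2 \<Rightarrow> (complex^2) set) \<Rightarrow> bool" where
  "invariant_line U A \<tau> l \<longleftrightarrow>
     continuous_map euclidean projective_line l \<and>
     (\<forall>j w. l (w + axis j 1) = (*v) (U j w) ` l w) \<and>
     (\<forall>w. (*v) (A w) ` l w = l (w + \<tau>))"

fun cocycle_iterate :: "(real^2 \<Rightarrow> complex^2^2) \<Rightarrow> real^2 \<Rightarrow> nat \<Rightarrow> real^2 \<Rightarrow> complex^2^2" where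
  "cocycle_iterate A \<tau> 0 w = mat 1"
| "cocycle_iterate A \<tau> (Suc n) w = A (w + real n *\<^sub>R \<tau>) ** cocycle_iterate A \<tau> n w"

definition restricted_norm :: "complex^2^2 \<Rightarrow> (complex^2) set \<Rightarrow> real" where
  "restricted_norm M L = Sup {norm (M *v v) | v. v \<in> L \<and> norm v = 1}"

definition restricted_conorm :: "complex^2^2 \<Rightarrow> (complex^2) set \<Rightarrow> real" where
  "restricted_conorm M L = Inf {norm (M *v v) | v. v \<in> L \<and> norm v = 1}"

datatype branch = Stable | Unstable

definition dominated_splitting ::
    "(2 \<Rightarrow> real^2 \<Rightarrow> complex^2^2) \<Rightarrow> (real^2 \<Rightarrow> complex^2^2) \<Rightarrow> real^2 \<Rightarrow>
     (branch \<Rightarrow> real^2 \<Rightarrow> (complex^2) set) \<Rightarrow> bool" where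
  "dominated_splitting U A \<tau> l \<longleftrightarrow>
     (\<forall>i. invariant_line U A \<tau> (l i)) \<and>
     (\<forall>w. l Stable w \<noteq> l Unstable w) \<and>
     (\<exists>N\<ge>1. \<exists>\<kappa>. 0 < \<kappa> \<and> \<kappa> < 1 \<and>
        (\<forall>w. restricted_norm (cocycle_iterate A \<tau> N w) (l Stable w) /
             restricted_conorm (cocycle_iterate A \<tau> N w) (l Unstable w) \<le> \<kappa>\<^sup>2))"


section \<open>Charge, multiplier, winding vector\<close>

definition adapted_frame ::
    "(2 \<Rightarrow> real^2 \<Rightarrow> complex^2^2) \<Rightarrow> (real^2 \<Rightarrow> (complex^2) set) \<Rightarrow> int \<Rightarrow>
     (real^2 \<Rightarrow> complex^2) \<Rightarrow> bool" where
  "adapted_frame U l m e \<longleftrightarrow>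
     continuous_on UNIV e \<and> (\<forall>w. norm (e w) = 1 \<and> e w \<in> l w) \<and>
     (\<forall>w. e (w + axis 1 1) = U 1 w *v e w) \<and>
     (\<forall>w. e (w + axis 2 1) = cis (2 * pi * of_int m * w $ 1) *s (U 2 w *v e w))"

definition charge ::
    "(2 \<Rightarrow> real^2 \<Rightarrow> complex^2^2) \<Rightarrow> (real^2 \<Rightarrow> (complex^2) set) \<Rightarrow> int" where
  "charge U l = (THE m. \<exists>e. adapted_frame U l m e)"

definition multiplier ::
    "(real^2 \<Rightarrow> complex^2^2) \<Rightarrow> real^2 \<Rightarrow> (real^2 \<Rightarrow> complex^2) \<Rightarrow> real^2 \<Rightarrow> complex" where
  "multiplier A \<tau> e w = hinner (e (w + \<tau>)) (A w *v e w)"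

definition multiplier_phase ::
    "(real^2 \<Rightarrow> complex^2^2) \<Rightarrow> real^2 \<Rightarrow> int \<Rightarrow> (real^2 \<Rightarrow> complex^2) \<Rightarrow> real^2 \<Rightarrow> complex" where
  "multiplier_phase A \<tau> m e w =
     multiplier A \<tau> e w / of_real (norm (multiplier A \<tau> e w)) *
     cis (2 * pi * of_int m * \<tau> $ 1 * w $ 2)"

definition phase_data ::
    "(real^2 \<Rightarrow> complex^2^2) \<Rightarrow> real^2 \<Rightarrow> int \<Rightarrow> (real^2 \<Rightarrow> complex^2) \<Rightarrow>
     int^2 \<Rightarrow> (real^2 \<Rightarrow> real) \<Rightarrow> bool" where
  "phase_data A \<tau> m e k g \<longleftrightarrow>
     continuous_on UNIV g \<and> periodic g \<and>
     (\<forall>w. multiplier_phase A \<tau> m e w = cis (2 * pi * (lattice_dot k w + g w)))"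

definition winding_vector ::
    "(2 \<Rightarrow> real^2 \<Rightarrow> complex^2^2) \<Rightarrow> (real^2 \<Rightarrow> complex^2^2) \<Rightarrow> real^2 \<Rightarrow>
     (real^2 \<Rightarrow> (complex^2) set) \<Rightarrow> int^2" where
  "winding_vector U A \<tau> l =
     (THE k. \<exists>e g. adapted_frame U l (charge U l) e \<and> phase_data A \<tau> (charge U l) e k g)"

definition lyapunov ::
    "(real^2 \<Rightarrow> complex^2^2) \<Rightarrow> real^2 \<Rightarrow> (real^2 \<Rightarrow> complex^2) \<Rightarrow> real" where
  "lyapunov A \<tau> e = torus_mean (\<lambda>w. ln (norm (multiplier A \<tau> e w)))"

definition base_eigenvalue ::
    "(real^2 \<Rightarrow> complex^2^2) \<Rightarrow> real^2 \<Rightarrow> (real^2 \<Rightarrow> complex^2) \<Rightarrow> (real^2 \<Rightarrow> real) \<Rightarrow> complex" where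
  "base_eigenvalue A \<tau> e g =
     exp (of_real (lyapunov A \<tau> e) + 2 * of_real pi * \<i> * of_real (torus_mean g))"

definition line_spectrum ::
    "(real^2 \<Rightarrow> complex^2^2) \<Rightarrow> real^2 \<Rightarrow> (real^2 \<Rightarrow> complex^2) \<Rightarrow> (real^2 \<Rightarrow> real) \<Rightarrow> complex set" where
  "line_spectrum A \<tau> e g = {base_eigenvalue A \<tau> e g * cis (- 2 * pi * lattice_dot n \<tau>) | n. True}"

text \<open>Triviality of the induced line bundle: a nowhere vanishing continuous global section.\<close>

definition topologically_trivial ::
    "(2 \<Rightarrow> real^2 \<Rightarrow> complex^2^2) \<Rightarrow> (real^2 \<Rightarrow> (complex^2) set) \<Rightarrow> bool" where
  "topologically_trivial U l \<longleftrightarrow>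
     (\<exists>v. continuous_on UNIV v \<and> (\<forall>w. v w \<noteq> 0 \<and> v w \<in> l w) \<and>
        (\<forall>j w. v (w + axis j 1) = U j w *v v w))"


section \<open>The Chern number of the bundle\<close>

definition partial :: "2 \<Rightarrow> (real^2 \<Rightarrow> complex^2^2) \<Rightarrow> real^2 \<Rightarrow> complex^2^2" where
  "partial k f w = frechet_derivative f (at w) (axis k 1)"

text \<open>
  A connection \<open>\<nabla> = d + a\<^sub>1 dw\<^sub>1 + a\<^sub>2 dw\<^sub>2\<close> on the bundle presented by a differentiable sewing
  system: a continuously differentiable matrix-valued one-form on the plane such that
  \<open>\<nabla>\<close> preserves the sections \<open>F (w + e\<^sub>j) = U\<^sub>j w F w\<close>.
\<close>

definition connection ::
    "(2 \<Rightarrow> real^2 \<Rightarrow> complex^2^2) \<Rightarrow> (2 \<Rightarrow> real^2 \<Rightarrow> complex^2^2) \<Rightarrow> bool" where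
  "connection U a \<longleftrightarrow>
     (\<forall>k w. a k differentiable (at w)) \<and> (\<forall>k l. continuous_on UNIV (partial l (a k))) \<and>
     (\<forall>j k w. a k (w + axis j 1) ** U j w + partial k (U j) w = U j w ** a k w)"

definition curvature :: "(2 \<Rightarrow> real^2 \<Rightarrow> complex^2^2) \<Rightarrow> real^2 \<Rightarrow> complex^2^2" where
  "curvature a w =
     partial 1 (a 2) w - partial 2 (a 1) w + a 1 w ** a 2 w - a 2 w ** a 1 w"

text \<open>The integral over the torus of the trace of \<open>i / (2\<pi>)\<close> times the curvature; it is the same for
  every connection. Meaningful for continuously differentiable \<open>U\<close>.\<close>

definition chern_number :: "(2 \<Rightarrow> real^2 \<Rightarrow> complex^2^2) \<Rightarrow> complex" where
  "chern_number U =
     (THE c. \<exists>a. connection U a \<and>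
        c = torus_mean (\<lambda>w. \<i> / (2 * of_real pi) * trace (curvature a w)))"


section \<open>Diophantine translations\<close>

definition diophantine :: "real \<Rightarrow> real \<Rightarrow> (real^2) set" where
  "diophantine c \<nu> =
     {\<tau>. \<forall>n::int^2. n \<noteq> 0 \<longrightarrow>
        infdist (lattice_dot n \<tau>) \<int> \<ge> c * of_int (\<Sum>j\<in>UNIV. \<bar>n $ j\<bar>) powr (- \<nu>)}"

end

theory Submission
  imports Defs "HOL-Complex_Analysis.Cauchy_Integral_Formula"
begin

text \<open>
  Everything is reduced to constants attached to each of the two lines. On an invariant line the
  cocycle acts through a scalar multiplier, and the first half of the argument finds a frame of
  the line in which this multiplier is as simple as topology permits.

  A dominating line attracts its neighbours under forward iteration: in the coordinates given by
  the splitting along a backward orbit, iterates act on slopes as uniformly contracting Moebius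
  maps, also at complex points near the orbit. The slope of the line is the limit of these maps,
  so it is holomorphic and the line is analytic; for the other line the adjugate cocycle is
  iterated backwards (\<open>strong_line_analytic\<close>, \<open>lines_analytic\<close>). A line over the plane that is
  smooth has a nowhere vanishing section of any order of differentiability, and solving two
  difference equations makes it obey the sewing rule up to a factor with an integer charge \<open>m\<close>
  (\<open>line_lift\<close>, \<open>smooth_frame\<close>). Its multiplier is the exponential of a linear part with integer
  winding \<open>k\<close>, the quasi-periodic term forced by \<open>m\<close>, and a smooth periodic function \<open>H\<close>. The
  Diophantine condition enters here: the Fourier coefficients of \<open>H\<close> decay faster than the small
  divisors, so \<open>H\<close> is its mean \<open>\<eta>\<close> plus a coboundary, which is absorbed into the frame
  (\<open>cohomological_equation\<close>, \<open>normal_form\<close>). What remains of the line is the triple \<open>m\<close>, \<open>k\<close>,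
  \<open>\<eta>\<close>. The first two are the charge and the winding vector, \<open>Re \<eta>\<close> is the Lyapunov exponent, and
  the base eigenvalue is \<open>exp \<eta>\<close> up to the value of a character at \<open>\<tau>\<close> (\<open>normal_frame_data\<close>).

  The second half determines eigensections. In a pair of normal frames such a section has two
  measurable scalar coefficients, each satisfying a twisted eigenvalue equation for the
  translation by \<open>\<tau>\<close>. Let \<open>f\<close> be a nonzero one. All bounded eigenfunctions of the translation
  are multiples of characters (\<open>torus_rotation_eigenfunction\<close>), so that they have only countably
  many eigenvalues. The functions \<open>|f|\<close> to the power \<open>it\<close> are bounded eigenfunctions for all
  real \<open>t\<close>, which forces \<open>|\<lambda>| = exp (Re \<eta>)\<close>; then \<open>|f|\<close> is invariant, hence constant. The
  correlations of the phase of \<open>f\<close> with its translates are bounded eigenfunctions whose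
  eigenvalues depend on the translation through a phase linear in \<open>m\<close> and \<open>k\<close>, which forces
  \<open>m = 0\<close> and \<open>k = 0\<close>. Finally \<open>f\<close> itself is a multiple of a character. Conversely characters
  times a normal frame are eigensections. Domination separates the moduli of the eigenvalues
  from the two lines (\<open>lyapunov_gap\<close>), and distinct characters have distinct values at \<open>\<tau>\<close>; this
  gives disjointness and simplicity.

  For the Chern number, the trace of any connection matrix, corrected by the logarithmic
  derivative of the determinant of the two frames and by a linear term coming from the charges,
  is periodic. Derivatives of periodic functions have mean zero, so the integral of the
  curvature is read off the linear term and equals the sum of the charges (\<open>connection_chern\<close>);
  the frames also supply a connection (\<open>connection_exists\<close>).
\<close>

section \<open>Means over the torus\<close>

lemma vec2_decompose: "w = (w $ 1) *\<^sub>R axis 1 1 + (w $ 2) *\<^sub>R axis 2 (1::real)" for w :: "real^2"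
  by (simp add: vec_eq_iff forall_2 axis_def)

lemma distr_lebesgue_shift:
  fixes a :: "'a::euclidean_space"
  shows "distr lebesgue lebesgue (\<lambda>x. x + a) = lebesgue"
    and "(\<lambda>x. x + a) \<in> lebesgue \<rightarrow>\<^sub>M lebesgue"
proof -
  have eq: "(\<lambda>x. a + (\<Sum>j\<in>Basis. (1 * (x \<bullet> j)) *\<^sub>R j)) = (\<lambda>x::'a. x + a)"
    by (simp add: euclidean_representation add.commute)
  have "lebesgue = density (distr lebesgue lebesgue (\<lambda>x. x + a)) (\<lambda>x. ennreal (\<Prod>j\<in>(Basis::'a set). \<bar>1\<bar>))"
    using lebesgue_affine_euclidean[of "\<lambda>_. 1" a] unfolding eq by simp
  then show "distr lebesgue lebesgue (\<lambda>x. x + a) = lebesgue"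
    by (simp add: density_1)
  show "(\<lambda>x. x + a) \<in> lebesgue \<rightarrow>\<^sub>M lebesgue"
    using lebesgue_affine_measurable[of "\<lambda>_. 1" a] unfolding eq by simp
qed

lemma lebesgue_integral_shift:
  fixes f :: "'a::euclidean_space \<Rightarrow> 'b::{banach, second_countable_topology}"
  assumes "f \<in> borel_measurable lebesgue"
  shows "(\<integral>x. f (x + a) \<partial>lebesgue) = (\<integral>x. f x \<partial>lebesgue)"
  using integral_distr[OF distr_lebesgue_shift(2) assms, of a]
  by (simp add: distr_lebesgue_shift(1))

lemma AE_shift:
  fixes a :: "real^2"
  assumes "AE w in lebesgue. P w"
  shows "AE w in lebesgue. P (w + a)"
  using AE_lebesgue_shift[OF assms, of "- a"] by simp

lemma unit_cell_sets [measurable, simp]: "unit_cell \<in> sets lebesgue"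
proof -
  have "unit_cell = (\<Inter>j. {w. 0 \<le> w $ j} \<inter> {w. w $ j < 1})" by (auto simp: unit_cell_def)
  also have "\<dots> \<in> sets borel" by (intro sets.countable_INT'') (auto intro!: borel_measurable_le borel_measurable_less sets.Int)
  finally show ?thesis by simp
qed

lemma emeasure_unit_cell: "emeasure lebesgue unit_cell = 1"
proof -
  define u :: "real^2" where "u = (\<chi> i. 1)"
  have b: "box 0 u \<subseteq> unit_cell" "unit_cell \<subseteq> cbox 0 u"
    by (auto simp: unit_cell_def mem_box_cart less_eq_real_def u_def)
  have "u \<bullet> i = 1" if "i \<in> Basis" for i
    using that by (auto simp: u_def Basis_vec_def inner_axis)
  then have "emeasure lebesgue (box 0 u) = 1" "emeasure lebesgue (cbox 0 u) = 1"
    by (auto simp: emeasure_lborel_box_eq emeasure_lborel_cbox_eq)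
  with emeasure_mono[OF b(1), of lebesgue] emeasure_mono[OF b(2), of lebesgue] show ?thesis
    by (simp add: antisym)
qed

lemma measure_unit_cell [simp]: "measure lebesgue unit_cell = 1"
  by (simp add: measure_def emeasure_unit_cell)

lemma torus_mean_const [simp]:
  "torus_mean (\<lambda>w. c) = (c :: 'b::{banach, second_countable_topology})"
  by (simp add: torus_mean_def emeasure_unit_cell set_integral_const)

text \<open>
  Periodicity is required only almost everywhere because the functions to be tested are built
  from measurable sections, which satisfy the sewing rules only almost everywhere.
\<close>

definition torus_bounded :: "(real^2 \<Rightarrow> complex) \<Rightarrow> bool" where
  "torus_bounded f \<longleftrightarrow> f \<in> borel_measurable lebesgue \<and> (\<exists>C. \<forall>w. norm (f w) \<le> C) \<and>
     (\<forall>j. AE w in lebesgue. f (w + axis j 1) = f w)"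

lemma torus_bounded_shift:
  assumes "torus_bounded f" shows "torus_bounded (\<lambda>w. f (w + a))"
proof -
  have "AE w in lebesgue. f (w + axis j 1 + a) = f (w + a)" for j
    using AE_shift[of "\<lambda>w. f (w + axis j 1) = f w" a] assms unfolding torus_bounded_def
    by (simp add: add_ac)
  moreover have "(\<lambda>w. f (w + a)) \<in> borel_measurable lebesgue"
    using measurable_compose[OF distr_lebesgue_shift(2)] assms unfolding torus_bounded_def by blast
  ultimately show ?thesis using assms unfolding torus_bounded_def by blast
qed

lemma torus_bounded_mult:
  assumes "torus_bounded f" "torus_bounded g" shows "torus_bounded (\<lambda>w. f w * g w)"
proof -
  obtain C D where "\<forall>w. norm (f w) \<le> C" "\<forall>w. norm (g w) \<le> D"
    using assms unfolding torus_bounded_def by blast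
  then have "\<forall>w. norm (f w * g w) \<le> C * D"
    by (auto simp: norm_mult intro!: mult_mono order_trans[OF norm_ge_zero])
  moreover have "AE w in lebesgue. f (w + axis j 1) * g (w + axis j 1) = f w * g w" for j
    using assms unfolding torus_bounded_def by (auto elim!: allE[of _ j] eventually_elim2)
  ultimately show ?thesis using assms unfolding torus_bounded_def by (auto intro!: borel_measurable_times)
qed

lemma torus_bounded_add:
  assumes "torus_bounded f" "torus_bounded g" shows "torus_bounded (\<lambda>w. f w + g w)"
proof -
  obtain C D where "\<forall>w. norm (f w) \<le> C" "\<forall>w. norm (g w) \<le> D"
    using assms unfolding torus_bounded_def by blast
  then have "\<forall>w. norm (f w + g w) \<le> C + D" by (meson add_mono norm_triangle_le order_trans)
  moreover have "AE w in lebesgue. f (w + axis j 1) + g (w + axis j 1) = f w + g w" for j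
    using assms unfolding torus_bounded_def by (auto elim!: allE[of _ j] eventually_elim2)
  ultimately show ?thesis using assms unfolding torus_bounded_def by (auto intro!: borel_measurable_add)
qed

lemma torus_bounded_integrable:
  assumes "torus_bounded f"
  shows "set_integrable lebesgue unit_cell f"
proof -
  obtain C where C: "\<forall>w. norm (f w) \<le> C" using assms unfolding torus_bounded_def by blast
  show ?thesis unfolding set_integrable_def
    using assms C by (intro integrableI_bounded_set_indicator[of unit_cell _ _ C])
      (auto simp: torus_bounded_def emeasure_unit_cell)
qed

text \<open>
  The translated cell is cut along a face of the original one, and the protruding part is moved
  back by a unit vector. A shift by at most 1 needs a single cut.
\<close>

lemma torus_mean_shift_axis:
  assumes f: "torus_bounded f" and t: "0 \<le> t" "t \<le> 1"
  shows "torus_mean (\<lambda>w. f (w + t *\<^sub>R axis j 1)) = torus_mean f"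
proof -
  let ?e = "axis j (1::real) :: real^2"
  define A where "A = {w\<in>unit_cell. t \<le> w $ j}"
  define B where "B = {w\<in>unit_cell. w $ j < t}"
  have "{w::real^2. t \<le> w $ j} \<in> sets lebesgue" "{w::real^2. w $ j < t} \<in> sets lebesgue"
    by (auto intro!: borel_measurable_le borel_measurable_less)
  then have AB: "A \<in> sets lebesgue" "B \<in> sets lebesgue"
    unfolding A_def B_def Collect_conj_eq by auto
  have fm: "f \<in> borel_measurable lebesgue" using f by (auto simp: torus_bounded_def)
  obtain C where C: "\<forall>w. norm (f w) \<le> C" using f unfolding torus_bounded_def by blast
  have iA: "set_integrable lebesgue A f" and iB: "set_integrable lebesgue B f"
    by (rule set_integrable_subset[OF torus_bounded_integrable[OF f]]; use AB in \<open>auto simp: A_def B_def\<close>)+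
  have iB': "integrable lebesgue (\<lambda>w. indicator B (w - ?e) *\<^sub>R f w)"
  proof -
    have "{w. w - ?e \<in> B} \<in> sets lebesgue"
      using measurable_sets[OF distr_lebesgue_shift(2)[of "-?e"] AB(2)] by (simp add: vimage_def)
    moreover have "emeasure lebesgue {w. w - ?e \<in> B} < \<infinity>"
    proof -
      have "emeasure lebesgue {w. w - ?e \<in> B} = emeasure (distr lebesgue lebesgue (\<lambda>w. w + - ?e)) B"
        by (subst emeasure_distr) (use distr_lebesgue_shift(2)[of "-?e"] AB in \<open>auto simp: vimage_def\<close>)
      also have "\<dots> = emeasure lebesgue B" by (simp only: distr_lebesgue_shift(1))
      also have "\<dots> \<le> emeasure lebesgue unit_cell" by (rule emeasure_mono) (auto simp: B_def)
      finally show ?thesis by (simp add: emeasure_unit_cell less_top[symmetric] top_unique)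
        (metis emeasure_unit_cell ennreal_one_neq_top top.extremum_unique)
    qed
    ultimately have "integrable lebesgue (\<lambda>w. indicator {w. w - ?e \<in> B} w *\<^sub>R f w)"
      using C fm by (intro integrableI_bounded_set_indicator[of _ _ _ C]) auto
    moreover have "(\<lambda>w. indicator {w. w - ?e \<in> B} w *\<^sub>R f w) = (\<lambda>w. indicator B (w - ?e) *\<^sub>R f w)"
      by (auto simp: indicator_def)
    ultimately show ?thesis by simp
  qed
  have ind: "indicator unit_cell (w - t *\<^sub>R ?e) = (indicator A w + indicator B (w - ?e) :: real)" for w
  proof -
    have "w - t *\<^sub>R ?e \<in> unit_cell \<longleftrightarrow> w \<in> A \<or> w - ?e \<in> B"
      using t unfolding A_def B_def unit_cell_def
      using exhaust_2[of j] by (auto simp: axis_def forall_2)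
    moreover have "\<not> (w \<in> A \<and> w - ?e \<in> B)"
      by (auto simp: A_def B_def unit_cell_def axis_def dest!: spec[of _ j])
    ultimately show ?thesis by (auto simp: indicator_def)
  qed
  have "torus_mean (\<lambda>w. f (w + t *\<^sub>R ?e)) = (\<integral>w. (\<lambda>w. indicator unit_cell (w - t *\<^sub>R ?e) *\<^sub>R f w) (w + t *\<^sub>R ?e) \<partial>lebesgue)"
    by (simp add: torus_mean_def set_lebesgue_integral_def)
  also have "\<dots> = (\<integral>w. indicator unit_cell (w - t *\<^sub>R ?e) *\<^sub>R f w \<partial>lebesgue)"
  proof (rule lebesgue_integral_shift)
    have "(\<lambda>w. indicator unit_cell (w - t *\<^sub>R ?e) :: real) \<in> borel_measurable lebesgue"
      using measurable_compose[OF distr_lebesgue_shift(2)[of "- t *\<^sub>R ?e"], of "indicator unit_cell" borel] by simp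
    then show "(\<lambda>w. indicator unit_cell (w - t *\<^sub>R ?e) *\<^sub>R f w) \<in> borel_measurable lebesgue"
      using fm by (intro borel_measurable_scaleR)
  qed
  also have "\<dots> = (\<integral>w. indicator A w *\<^sub>R f w + indicator B (w - ?e) *\<^sub>R f w \<partial>lebesgue)"
    by (simp add: ind scaleR_add_left)
  also have "\<dots> = (\<integral>w. indicator A w *\<^sub>R f w \<partial>lebesgue) + (\<integral>w. indicator B (w - ?e) *\<^sub>R f w \<partial>lebesgue)"
    using iA iB' by (intro Bochner_Integration.integral_add) (auto simp: set_integrable_def)
  also have "(\<integral>w. indicator B (w - ?e) *\<^sub>R f w \<partial>lebesgue) = (\<integral>w. indicator B w *\<^sub>R f (w + ?e) \<partial>lebesgue)"
    using lebesgue_integral_shift[of "\<lambda>w. indicator B (w - ?e) *\<^sub>R f w" ?e, OF borel_measurable_integrable[OF iB']] by simp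
  also have "\<dots> = (\<integral>w. indicator B w *\<^sub>R f w \<partial>lebesgue)"
  proof (rule integral_cong_AE)
    have "AE w in lebesgue. f (w + ?e) = f w" using f unfolding torus_bounded_def by blast
    then show "AE w in lebesgue. indicator B w *\<^sub>R f (w + ?e) = indicator B w *\<^sub>R f w"
      by (rule eventually_mono) simp
    have "(\<lambda>w. f (w + ?e)) \<in> borel_measurable lebesgue"
      using torus_bounded_shift[OF f] by (auto simp: torus_bounded_def)
    then show "(\<lambda>w. indicator B w *\<^sub>R f (w + ?e)) \<in> borel_measurable lebesgue" using AB by auto
  qed (use AB fm in auto)
  also have "(\<integral>w. indicator A w *\<^sub>R f w \<partial>lebesgue) + \<dots> = (\<integral>w. indicator A w *\<^sub>R f w + indicator B w *\<^sub>R f w \<partial>lebesgue)"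
    using iA iB by (subst Bochner_Integration.integral_add) (auto simp: set_integrable_def)
  also have "\<dots> = torus_mean f"
    unfolding torus_mean_def set_lebesgue_integral_def
    by (rule Bochner_Integration.integral_cong) (auto simp: indicator_def A_def B_def)
  finally show ?thesis .
qed

text \<open>
  Long shifts are repetitions of short ones, and a general shift is composed of shifts along the
  two axes.
\<close>

lemma torus_mean_shift:
  assumes f: "torus_bounded f"
  shows "torus_mean (\<lambda>w. f (w + a)) = torus_mean f"
proof -
  have nat: "torus_mean (\<lambda>w. g (w + (of_nat k * t) *\<^sub>R axis j 1)) = torus_mean g"
    if g: "torus_bounded g" and t: "0 \<le> t" "t \<le> 1" for g k t j
  proof (induction k)
    case (Suc k)
    have "torus_mean (\<lambda>w. g (w + (of_nat (Suc k) * t) *\<^sub>R axis j 1))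
        = torus_mean (\<lambda>w. (\<lambda>w. g (w + (of_nat k * t) *\<^sub>R axis j 1)) (w + t *\<^sub>R axis j 1))"
      by (simp add: algebra_simps)
    also have "\<dots> = torus_mean (\<lambda>w. g (w + (of_nat k * t) *\<^sub>R axis j 1))"
      by (rule torus_mean_shift_axis[OF torus_bounded_shift[OF g] t])
    finally show ?case using Suc by simp
  qed simp
  have pos: "torus_mean (\<lambda>w. g (w + t *\<^sub>R axis j 1)) = torus_mean g"
    if g: "torus_bounded g" and t: "0 \<le> t" for g t j
  proof -
    obtain k :: nat where k: "t < real k" using reals_Archimedean2 by blast
    then have "k > 0" using t by (cases k) auto
    then show ?thesis using nat[OF g, of "t / real k" k j] k t by auto
  qed
  have any: "torus_mean (\<lambda>w. g (w + t *\<^sub>R axis j 1)) = torus_mean g" if g: "torus_bounded g" for g t j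
  proof (cases "0 \<le> t")
    case False
    then show ?thesis using pos[OF torus_bounded_shift[OF g, of "t *\<^sub>R axis j 1"], of "- t" j] by simp
  qed (use pos g in auto)
  have "torus_mean (\<lambda>w. f (w + a)) = torus_mean (\<lambda>w. (\<lambda>w. f (w + (a$1) *\<^sub>R axis 1 1)) (w + (a$2) *\<^sub>R axis 2 1))"
    by (subst vec2_decompose[of a]) (simp add: add_ac)
  also have "\<dots> = torus_mean f" using any[OF torus_bounded_shift[OF f]] any[OF f] by simp
  finally show ?thesis .
qed

section \<open>Fourier uniqueness and eigenfunctions of translations\<close>

definition torus_char :: "int^2 \<Rightarrow> real^2 \<Rightarrow> complex" where
  "torus_char n w = cis (2 * pi * lattice_dot n w)"

lemma lattice_dot_add [simp]: "lattice_dot n (w + v) = lattice_dot n w + lattice_dot n v"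
  by (simp add: lattice_dot_def sum_2 algebra_simps)

lemma lattice_dot_add_left: "lattice_dot (n + m) w = lattice_dot n w + lattice_dot m w"
  by (simp add: lattice_dot_def sum_2 algebra_simps)

lemma lattice_dot_minus_left: "lattice_dot (- n) w = - lattice_dot n w"
  by (simp add: lattice_dot_def sum_2 algebra_simps)

lemma lattice_dot_zero [simp]: "lattice_dot 0 w = 0"
  by (simp add: lattice_dot_def)

lemma lattice_dot_scaleR [simp]: "lattice_dot n (t *\<^sub>R w) = t * lattice_dot n w"
  by (simp add: lattice_dot_def sum_2 algebra_simps)

lemma lattice_dot_axis [simp]: "lattice_dot n (axis j 1) = of_int (n $ j)"
  using exhaust_2[of j] by (auto simp: lattice_dot_def sum_2 axis_def)

lemma continuous_lattice_dot [continuous_intros]: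
  "continuous_on S f \<Longrightarrow> continuous_on S (\<lambda>w. lattice_dot n (f w))"
  unfolding lattice_dot_def by (intro continuous_intros)

lemma cis_2pi_int [simp]: "cis (2 * pi * of_int n) = 1"
  by (metis cis_2pi cis_power_int power_int_1_left mult.commute)

lemma torus_char_add: "torus_char n (w + v) = torus_char n w * torus_char n v"
  by (simp add: torus_char_def distrib_left cis_mult)

lemma torus_char_add_left: "torus_char (n + m) w = torus_char n w * torus_char m w"
  by (simp add: torus_char_def lattice_dot_add_left distrib_left cis_mult)

lemma norm_torus_char [simp]: "norm (torus_char n w) = 1"
  by (simp add: torus_char_def)

lemma torus_char_nonzero [simp]: "torus_char n w \<noteq> 0"
  by (simp add: torus_char_def)

lemma torus_char_zero [simp]: "torus_char 0 w = 1"
  by (simp add: torus_char_def)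

lemma torus_char_minus: "torus_char (- n) w = inverse (torus_char n w)"
  by (simp add: torus_char_def lattice_dot_minus_left cis_inverse)

lemma torus_char_axis [simp]: "torus_char n (axis j 1) = 1"
  by (simp add: torus_char_def)

lemma periodic_torus_char: "periodic (torus_char n)"
  by (simp add: periodic_def torus_char_add)

lemma continuous_torus_char [continuous_intros]:
  "continuous_on S f \<Longrightarrow> continuous_on S (\<lambda>w. torus_char n (f w))"
  unfolding torus_char_def cis_conv_exp by (intro continuous_intros)

lemma borel_measurable_lebesgue_continuous:
  fixes f :: "'a::euclidean_space \<Rightarrow> 'b::topological_space"
  shows "continuous_on UNIV f \<Longrightarrow> f \<in> borel_measurable lebesgue"
  by (simp add: borel_measurable_continuous_onI measurable_completion)

lemma periodic_int_shift:
  assumes "periodic h" shows "h (w + (\<chi> j. of_int (n $ j))) = h w"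
proof -
  have 1: "h (w + of_int k *\<^sub>R axis j 1) = h w" for w k j
  proof (induction k arbitrary: w rule: int_induct[of _ 0])
    case (step1 i)
    have "h (w + of_int (i + 1) *\<^sub>R axis j 1) = h ((w + of_int i *\<^sub>R axis j 1) + axis j 1)"
      by (simp add: algebra_simps)
    also have "\<dots> = h (w + of_int i *\<^sub>R axis j 1)" using assms unfolding periodic_def by blast
    finally show ?case using step1 by simp
  next
    case (step2 i)
    have "h (w + of_int i *\<^sub>R axis j 1) = h ((w + of_int (i - 1) *\<^sub>R axis j 1) + axis j 1)"
      by (simp add: algebra_simps)
    also have "\<dots> = h (w + of_int (i - 1) *\<^sub>R axis j 1)" using assms unfolding periodic_def by blast
    finally show ?case using step2 by simp
  qed simp
  have "w + (\<chi> j. of_int (n $ j)) = (w + of_int (n $ 1) *\<^sub>R axis 1 1) + of_int (n $ 2) *\<^sub>R axis 2 1"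
    by (simp add: vec_eq_iff forall_2 axis_def)
  then show ?thesis using 1 by metis
qed

lemma periodic_reduce:
  fixes w :: "real^2"
  obtains n :: "int^2" and v where "v \<in> unit_cell" "w = v + (\<chi> j. of_int (n $ j))"
proof -
  have "(\<chi> j. frac (w $ j)) \<in> unit_cell" by (auto simp: unit_cell_def frac_ge_0 frac_lt_1)
  moreover have "w = (\<chi> j. frac (w $ j)) + (\<chi> j. of_int ((\<chi> j. \<lfloor>w $ j\<rfloor>) $ j))"
    by (simp add: vec_eq_iff frac_def)
  ultimately show ?thesis using that by blast
qed

lemma unit_cell_subset_cbox: "unit_cell \<subseteq> cbox 0 (\<chi> i. 1)"
  by (auto simp: unit_cell_def mem_box_cart less_eq_real_def)

lemma continuous_periodic_bounded:
  fixes f :: "real^2 \<Rightarrow> 'b::real_normed_vector"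
  assumes "continuous_on UNIV f" "periodic f"
  obtains C where "C > 0" "\<And>w. norm (f w) \<le> C"
proof -
  have "compact (f ` cbox 0 (\<chi> i. 1))"
    using assms by (intro compact_continuous_image) (auto intro: continuous_on_subset)
  then obtain C where C: "C > 0" "\<And>w. w \<in> cbox 0 (\<chi> i. 1) \<Longrightarrow> norm (f w) \<le> C"
    using compact_imp_bounded bounded_pos by (metis imageI)
  have "norm (f w) \<le> C" for w
  proof -
    obtain n :: "int^2" and v where v: "v \<in> unit_cell" "w = v + (\<chi> j. of_int (n $ j))"
      using periodic_reduce by blast
    then have "f w = f v" using periodic_int_shift[OF assms(2)] by blast
    then show ?thesis using C(2)[of v] v unit_cell_subset_cbox by auto
  qed
  with C(1) show ?thesis using that by blast
qed

lemma torus_bounded_continuous: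
  assumes "continuous_on UNIV f" "periodic f"
  shows "torus_bounded f"
proof -
  obtain C where "\<And>w. norm (f w) \<le> C" using continuous_periodic_bounded[OF assms] by blast
  then show ?thesis
    using assms unfolding torus_bounded_def
    by (auto simp: periodic_def intro: borel_measurable_lebesgue_continuous)
qed

lemma torus_bounded_char [simp]: "torus_bounded (torus_char n)"
  by (intro torus_bounded_continuous periodic_torus_char continuous_intros)

lemma torus_bounded_const [simp]: "torus_bounded (\<lambda>w. c)"
  by (intro torus_bounded_continuous continuous_intros) (simp add: periodic_def)

lemma torus_mean_add:
  "torus_bounded f \<Longrightarrow> torus_bounded g \<Longrightarrow>
   torus_mean (\<lambda>w. f w + g w) = torus_mean f + torus_mean g"
  unfolding torus_mean_def by (intro set_integral_add torus_bounded_integrable)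

lemma torus_mean_cmult: "torus_mean (\<lambda>w. c * f w) = c * torus_mean f" for f :: "_ \<Rightarrow> complex"
  unfolding torus_mean_def by simp

lemma torus_mean_cong_AE:
  fixes f :: "_ \<Rightarrow> complex"
  assumes "AE w in lebesgue. f w = g w" "f \<in> borel_measurable lebesgue" "g \<in> borel_measurable lebesgue"
  shows "torus_mean f = torus_mean g"
  unfolding torus_mean_def by (rule set_lebesgue_integral_cong_AE) (use assms in \<open>auto elim: eventually_mono\<close>)

text \<open>
  Test functions for Fourier coefficients: finite combinations of characters, which form an
  algebra.
\<close>

inductive trig_poly :: "(real^2 \<Rightarrow> complex) \<Rightarrow> bool" where
  char: "trig_poly (torus_char n)"
| cmult: "trig_poly g \<Longrightarrow> trig_poly (\<lambda>w. c * g w)"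
| add: "trig_poly g \<Longrightarrow> trig_poly h \<Longrightarrow> trig_poly (\<lambda>w. g w + h w)"

lemma trig_poly_mult_char: "trig_poly g \<Longrightarrow> trig_poly (\<lambda>w. g w * torus_char n w)"
proof (induction rule: trig_poly.induct)
  case (char m)
  show ?case using trig_poly.char[of "m + n"] by (simp add: torus_char_add_left[abs_def])
next
  case (cmult g c)
  show ?case using trig_poly.cmult[OF cmult.IH, of c] by (simp add: mult.assoc)
next
  case (add g h)
  show ?case using trig_poly.add[OF add.IH] by (simp add: algebra_simps)
qed

lemma trig_poly_mult: "trig_poly h \<Longrightarrow> trig_poly g \<Longrightarrow> trig_poly (\<lambda>w. g w * h w)"
proof (induction rule: trig_poly.induct)
  case (char m)
  then show ?case by (rule trig_poly_mult_char)
next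
  case (cmult h c)
  show ?case using trig_poly.cmult[OF cmult.IH[OF cmult.prems], of c] by (simp add: mult_ac)
next
  case (add h1 h2)
  show ?case using trig_poly.add[OF add.IH[OF add.prems]] by (simp add: algebra_simps)
qed

lemma trig_poly_const: "trig_poly (\<lambda>w. c)"
  using trig_poly.cmult[OF trig_poly.char[of 0], of c] by simp

lemma trig_poly_power: "trig_poly g \<Longrightarrow> trig_poly (\<lambda>w. g w ^ k)"
  by (induction k) (auto intro: trig_poly_const trig_poly_mult)

lemma trig_poly_sum: "finite I \<Longrightarrow> (\<And>i. i \<in> I \<Longrightarrow> trig_poly (g i)) \<Longrightarrow> trig_poly (\<lambda>w. \<Sum>i\<in>I. g i w)"
  by (induction I rule: finite_induct) (auto intro: trig_poly_const trig_poly.add)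

lemma trig_poly_torus_bounded: "trig_poly g \<Longrightarrow> torus_bounded g"
  by (induction rule: trig_poly.induct) (auto intro: torus_bounded_mult torus_bounded_add)

lemma torus_mean_trig_poly_eq_0:
  assumes f: "torus_bounded f" and 0: "\<And>n. torus_mean (\<lambda>w. f w * torus_char n w) = 0"
  shows "trig_poly g \<Longrightarrow> torus_mean (\<lambda>w. f w * g w) = 0"
proof (induction rule: trig_poly.induct)
  case (cmult g c)
  then show ?case using torus_mean_cmult[of c "\<lambda>w. f w * g w"] by (simp add: mult_ac)
next
  case (add g h)
  then show ?case
    using torus_mean_add[OF torus_bounded_mult[OF f trig_poly_torus_bounded[OF add(1)]]
        torus_bounded_mult[OF f trig_poly_torus_bounded[OF add(2)]]] by (simp add: distrib_left)
qed (use 0 in auto)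

text \<open>
  A trigonometric polynomial with values in the unit interval whose superlevel sets are, modulo
  1, intervals centred at \<open>a\<close> in the direction \<open>j\<close>.
\<close>

definition bump :: "2 \<Rightarrow> real \<Rightarrow> real^2 \<Rightarrow> real" where
  "bump j a w = (1 + cos (2 * pi * (w $ j - a))) / 2"

lemma bump_range: "0 \<le> bump j a w" "bump j a w \<le> 1"
  using cos_ge_minus_one[of "2 * pi * (w $ j - a)"] cos_le_one[of "2 * pi * (w $ j - a)"]
  by (auto simp: bump_def simp del: cos_ge_minus_one cos_le_one)

lemma continuous_bump: "continuous_on UNIV (bump j a)"
  unfolding bump_def by (intro continuous_intros) auto

lemma trig_poly_bump: "trig_poly (\<lambda>w. complex_of_real (bump j a w))"
proof -
  have e: "lattice_dot (axis j 1) w = w $ j" for w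
    using exhaust_2[of j] by (auto simp: lattice_dot_def sum_2 axis_def)
  have "complex_of_real (bump j a w) = 1/2 + (cis (- 2 * pi * a) / 4 * torus_char (axis j 1) w
        + cis (2 * pi * a) / 4 * torus_char (- axis j 1) w)" for w
    unfolding bump_def torus_char_def lattice_dot_minus_left e
    by (simp add: complex_eq_iff cos_diff sin_diff field_simps)
  then show ?thesis
    by (simp only: ) (intro trig_poly.add trig_poly_const trig_poly.cmult trig_poly.char)
qed

text \<open>
  Bernstein polynomials of \<open>p\<close> and \<open>q\<close>, evaluated at the bumps, are trigonometric polynomials
  that converge boundedly.
\<close>

lemma torus_mean_bump_eq_0:
  assumes f: "torus_bounded f" and 0: "\<And>n. torus_mean (\<lambda>w. f w * torus_char n w) = 0"
    and p: "continuous_on {0..1} p" "continuous_on {0..1} q"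
  shows "torus_mean (\<lambda>w. f w * complex_of_real (p (bump 1 a w) * q (bump 2 b w))) = 0"
proof -
  define P where "P p n y = (\<Sum>k\<le>n. p (real k / real n) * Bernstein n k y)" for p :: "real \<Rightarrow> real" and n y
  have trigP: "trig_poly (\<lambda>w. complex_of_real (P p n (bump j a w)))" for p n j a
  proof -
    have "trig_poly (\<lambda>w. 1 + (-1) * complex_of_real (bump j a w))"
      by (intro trig_poly.add trig_poly_const trig_poly.cmult trig_poly_bump)
    then have "trig_poly (\<lambda>w. complex_of_real (Bernstein n k (bump j a w)))" for k
      unfolding Bernstein_def
      by (auto intro!: trig_poly_mult trig_poly_power trig_poly_bump trig_poly_const)
    then show ?thesis unfolding P_def of_real_sum of_real_mult
      by (intro trig_poly_sum trig_poly_mult trig_poly_const) auto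
  qed
  have lim: "(\<lambda>n. P p n y) \<longlonglongrightarrow> p y" if "continuous_on {0..1} p" "y \<in> {0..1}" for p y
    unfolding LIMSEQ_def
  proof (intro allI impI)
    fix r :: real assume "r > 0"
    from Bernstein_Weierstrass[OF that(1) this] that(2)
    show "\<exists>no. \<forall>n\<ge>no. dist (P p n y) (p y) < r"
      by (fastforce simp: P_def dist_real_def abs_minus_commute)
  qed
  have bnd: "\<exists>C. \<forall>n. \<forall>y\<in>{0..1}. \<bar>P p n y\<bar> \<le> C" if c: "continuous_on {0..1} p" for p
  proof -
    obtain C where C: "\<And>y. y \<in> {0..1} \<Longrightarrow> \<bar>p y\<bar> \<le> C"
      using compact_imp_bounded[OF compact_continuous_image[OF c]] unfolding bounded_iff by fastforce
    have "\<bar>P p n y\<bar> \<le> C" if y: "y \<in> {0..1}" for n y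
    proof -
      have "\<bar>P p n y\<bar> \<le> (\<Sum>k\<le>n. C * Bernstein n k y)" unfolding P_def
      proof (rule order_trans[OF sum_abs sum_mono])
        fix k assume k: "k \<in> {..n}"
        have "real k / real n \<in> {0..1}" using k by (auto simp: divide_simps)
        then have "\<bar>p (real k / real n)\<bar> * Bernstein n k y \<le> C * Bernstein n k y"
          using y by (intro mult_right_mono C Bernstein_nonneg) auto
        then show "\<bar>p (real k / real n) * Bernstein n k y\<bar> \<le> C * Bernstein n k y"
          using y by (simp add: abs_mult Bernstein_nonneg)
      qed
      also have "\<dots> = C" by (simp add: sum_distrib_left[symmetric])
      finally show ?thesis .
    qed
    then show ?thesis by blast
  qed
  obtain Cp where Cp: "\<And>n y. y \<in> {0..1} \<Longrightarrow> \<bar>P p n y\<bar> \<le> Cp" using bnd[OF p(1)] by blast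
  obtain Cq where Cq: "\<And>n y. y \<in> {0..1} \<Longrightarrow> \<bar>P q n y\<bar> \<le> Cq" using bnd[OF p(2)] by blast
  obtain C where C: "\<And>w. norm (f w) \<le> C" using f unfolding torus_bounded_def by blast
  have b: "bump j a w \<in> {0..1}" for j a w using bump_range by auto
  have fm: "f \<in> borel_measurable lebesgue" using f by (simp add: torus_bounded_def)
  let ?g = "\<lambda>n w. complex_of_real (P p n (bump 1 a w)) * complex_of_real (P q n (bump 2 b w))"
  have z: "torus_mean (\<lambda>w. f w * ?g n w) = 0" for n
    by (rule torus_mean_trig_poly_eq_0[OF f 0]) (intro trig_poly_mult trigP)
  have "(\<lambda>n. torus_mean (\<lambda>w. f w * ?g n w)) \<longlonglongrightarrow>
     torus_mean (\<lambda>w. f w * complex_of_real (p (bump 1 a w) * q (bump 2 b w)))"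
    unfolding torus_mean_def set_lebesgue_integral_def
  proof (rule integral_dominated_convergence[where w="\<lambda>w. indicator unit_cell w * (C * (Cp * Cq))"])
    have "trig_poly (?g n)" for n by (intro trig_poly_mult trigP)
    then have gm: "?g n \<in> borel_measurable lebesgue" for n
      using trig_poly_torus_bounded by (auto simp: torus_bounded_def)
    show "(\<lambda>w. indicator unit_cell w *\<^sub>R (f w * ?g n w)) \<in> borel_measurable lebesgue" for n
      using fm gm[of n] by auto
    have "continuous_on UNIV (\<lambda>w. p (bump 1 a w))" "continuous_on UNIV (\<lambda>w. q (bump 2 b w))"
      using b by (auto intro!: continuous_on_compose2[OF p(1)] continuous_on_compose2[OF p(2)] continuous_bump)
    then have "(\<lambda>w. p (bump 1 a w)) \<in> borel_measurable lebesgue" "(\<lambda>w. q (bump 2 b w)) \<in> borel_measurable lebesgue"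
      by (auto intro: borel_measurable_lebesgue_continuous)
    then show "(\<lambda>w. indicator unit_cell w *\<^sub>R (f w * complex_of_real (p (bump 1 a w) * q (bump 2 b w)))) \<in> borel_measurable lebesgue"
      using fm by auto
    show "integrable lebesgue (\<lambda>w. indicator unit_cell w * (C * (Cp * Cq)))"
      by (simp add: emeasure_unit_cell)
    have "(\<lambda>n. indicator unit_cell w *\<^sub>R (f w * ?g n w)) \<longlonglongrightarrow>
      indicator unit_cell w *\<^sub>R (f w * complex_of_real (p (bump 1 a w) * q (bump 2 b w)))" for w
      unfolding of_real_mult
      by (intro tendsto_intros lim p b)
    then show "AE w in lebesgue. (\<lambda>n. indicator unit_cell w *\<^sub>R (f w * ?g n w)) \<longlonglongrightarrow>
      indicator unit_cell w *\<^sub>R (f w * complex_of_real (p (bump 1 a w) * q (bump 2 b w)))" by simp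
    have "norm (f w * ?g n w) \<le> C * (Cp * Cq)" for w n
      unfolding norm_mult norm_of_real
      using order_trans[OF norm_ge_zero C] order_trans[OF abs_ge_zero Cp[OF b]] order_trans[OF abs_ge_zero Cq[OF b]]
      by (intro mult_mono C Cp Cq b) auto
    then show "AE w in lebesgue. norm (indicator unit_cell w *\<^sub>R (f w * ?g n w)) \<le> indicator unit_cell w * (C * (Cp * Cq))" for n
      by (auto simp: indicator_def)
  qed
  then show ?thesis unfolding z by (simp add: LIMSEQ_const_iff)
qed

text \<open>
  For an interval of half-length \<open>h\<close> inside the unit interval, no point of the unit interval is
  farther than \<open>1 - h\<close> from its centre; within that distance the superlevel set of the cosine
  has a single component.
\<close>

lemma cos_greater_iff:
  assumes h: "0 < h" "h \<le> 1/2" and x: "\<bar>x\<bar> \<le> 1 - h"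
  shows "cos (2 * pi * h) < cos (2 * pi * x) \<longleftrightarrow> \<bar>x\<bar> < h"
proof -
  have e: "cos (2 * pi * x) = cos (2 * pi * \<bar>x\<bar>)" by (simp add: abs_if)
  show ?thesis
  proof (cases "\<bar>x\<bar> \<le> 1/2")
    case True
    show ?thesis unfolding e by (subst cos_mono_less_eq) (use h True in auto)
  next
    case False
    have "cos (2 * pi * \<bar>x\<bar>) = cos (2 * pi * (1 - \<bar>x\<bar>))"
      using cos_periodic[of "- 2 * pi * \<bar>x\<bar>"] by (simp add: algebra_simps)
    also have "\<dots> \<le> cos (2 * pi * h)"
      by (rule cos_monotone_0_pi_le) (use h x False in auto)
    finally show ?thesis using False h by (simp add: e)
  qed
qed

text \<open>
  The indicator of a rectangle is the pointwise limit, on the cell, of products of ramps of two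
  bumps. The ramps \<open>p k j\<close> steepen at the level that the bump around the midpoint of a side
  attains at the end points of that side.
\<close>

lemma torus_mean_rectangle_eq_0:
  assumes f: "torus_bounded f" and 0: "\<And>n. torus_mean (\<lambda>w. f w * torus_char n w) = 0"
    and ab: "\<And>j. 0 \<le> a $ j" "\<And>j. a $ j < b $ j" "\<And>j. b $ j \<le> 1"
  shows "torus_mean (\<lambda>w. f w * indicator (box a b) w) = 0"
proof -
  define \<mu> where "\<mu> j = (a $ j + b $ j) / 2" for j
  define h where "h j = (b $ j - a $ j) / 2" for j
  \<comment> \<open>The level of the bump around \<mu> j at the distance h j.\<close>
  define \<gamma> where "\<gamma> j = (1 + cos (2 * pi * h j)) / 2" for j
  define p where "p k j y = min 1 (real k * max 0 (y - \<gamma> j))" for k :: nat and j :: 2 and y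
  have cp: "continuous_on S (p k j)" for S k j unfolding p_def by (intro continuous_intros)
  have plim: "(\<lambda>k. p k j y) \<longlonglongrightarrow> (if y > \<gamma> j then 1 else 0)" for j y
  proof (cases "y > \<gamma> j")
    case True
    obtain N :: nat where N: "1 / (y - \<gamma> j) < real N" using reals_Archimedean2 by blast
    have "p k j y = 1" if "k \<ge> N" for k
    proof -
      have "1 / (y - \<gamma> j) \<le> real k" using N that by linarith
      then have "1 \<le> real k * (y - \<gamma> j)" using True by (simp add: field_simps)
      then show ?thesis using True by (simp add: p_def)
    qed
    then show ?thesis using True by (auto intro!: tendsto_eventually eventually_sequentiallyI)
  qed (auto simp: p_def)
  have ind: "(if bump j (\<mu> j) w > \<gamma> j then 1 else 0) = (if a $ j < w $ j \<and> w $ j < b $ j then 1 else (0::real))"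
    if "w \<in> unit_cell" for w j
  proof -
    have w: "0 \<le> w $ j" "w $ j < 1" using that by (auto simp: unit_cell_def)
    have "\<gamma> j < bump j (\<mu> j) w \<longleftrightarrow> cos (2 * pi * h j) < cos (2 * pi * (w $ j - \<mu> j))"
      by (simp add: \<gamma>_def bump_def)
    also have "\<dots> \<longleftrightarrow> \<bar>w $ j - \<mu> j\<bar> < h j"
    proof (rule cos_greater_iff)
      show "0 < h j" "h j \<le> 1/2" using ab(1)[of j] ab(2)[of j] ab(3)[of j] by (auto simp: h_def)
      show "\<bar>w $ j - \<mu> j\<bar> \<le> 1 - h j"
        using ab(1)[of j] ab(2)[of j] ab(3)[of j] w by (auto simp: h_def \<mu>_def field_simps)
    qed
    also have "\<dots> \<longleftrightarrow> a $ j < w $ j \<and> w $ j < b $ j"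
      unfolding abs_less_iff by (auto simp: h_def \<mu>_def field_simps)
    finally show ?thesis by simp
  qed
  obtain C where C: "\<And>w. norm (f w) \<le> C" using f unfolding torus_bounded_def by blast
  have fm: "f \<in> borel_measurable lebesgue" using f by (simp add: torus_bounded_def)
  let ?g = "\<lambda>k w. complex_of_real (p k 1 (bump 1 (\<mu> 1) w) * p k 2 (bump 2 (\<mu> 2) w))"
  have z: "torus_mean (\<lambda>w. f w * ?g n w) = 0" for n
    by (rule torus_mean_bump_eq_0[OF f 0 cp cp])
  have "(\<lambda>n. torus_mean (\<lambda>w. f w * ?g n w)) \<longlonglongrightarrow> torus_mean (\<lambda>w. f w * indicator (box a b) w)"
    unfolding torus_mean_def set_lebesgue_integral_def
  proof (rule integral_dominated_convergence[where w="\<lambda>w. indicator unit_cell w * C"])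
    have "continuous_on UNIV (\<lambda>w. p n j (bump j (\<mu> j) w))" for n j
      by (rule continuous_on_compose2[OF cp[of UNIV] continuous_bump]) auto
    then have "continuous_on UNIV (?g n)" for n by (intro continuous_intros)
    then have "?g n \<in> borel_measurable lebesgue" for n by (rule borel_measurable_lebesgue_continuous)
    then show "(\<lambda>w. indicator unit_cell w *\<^sub>R (f w * ?g n w)) \<in> borel_measurable lebesgue" for n
      using fm by (auto intro!: borel_measurable_scaleR borel_measurable_times)
    show "(\<lambda>w. indicator unit_cell w *\<^sub>R (f w * indicator (box a b) w)) \<in> borel_measurable lebesgue"
      using fm by (intro borel_measurable_scaleR borel_measurable_times borel_measurable_indicator) auto
    show "integrable lebesgue (\<lambda>w. indicator unit_cell w * C)" by (simp add: emeasure_unit_cell)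
    have glim: "(\<lambda>n. ?g n w) \<longlonglongrightarrow> indicator (box a b) w" if "w \<in> unit_cell" for w
    proof -
      have "(\<lambda>n. ?g n w) \<longlonglongrightarrow> complex_of_real ((if bump 1 (\<mu> 1) w > \<gamma> 1 then 1 else 0) * (if bump 2 (\<mu> 2) w > \<gamma> 2 then 1 else 0))"
        by (intro tendsto_intros plim)
      then show ?thesis unfolding ind[OF that] by (auto simp: indicator_def mem_box_cart forall_2 split: if_splits)
    qed
    have "(\<lambda>n. indicator unit_cell w *\<^sub>R (f w * ?g n w)) \<longlonglongrightarrow> indicator unit_cell w *\<^sub>R (f w * indicator (box a b) w)" for w
    proof (cases "w \<in> unit_cell")
      case True
      then show ?thesis using tendsto_mult[OF tendsto_const[of "f w"] glim[OF True]] by simp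
    qed simp
    then show "AE w in lebesgue. (\<lambda>n. indicator unit_cell w *\<^sub>R (f w * ?g n w)) \<longlonglongrightarrow>
      indicator unit_cell w *\<^sub>R (f w * indicator (box a b) w)" by simp
    have "norm (f w * ?g n w) \<le> C" for w n
    proof -
      have "0 \<le> p n 1 (bump 1 (\<mu> 1) w) * p n 2 (bump 2 (\<mu> 2) w)"
           "p n 1 (bump 1 (\<mu> 1) w) * p n 2 (bump 2 (\<mu> 2) w) \<le> 1"
        by (auto simp: p_def intro!: mult_le_one)
      then have "norm (?g n w) \<le> 1" by (simp only: norm_of_real abs_of_nonneg)
      then have "norm (f w) * norm (?g n w) \<le> C * 1"
        using order_trans[OF norm_ge_zero C] by (intro mult_mono C) auto
      then show ?thesis by (simp add: norm_mult)
    qed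
    then show "AE w in lebesgue. norm (indicator unit_cell w *\<^sub>R (f w * ?g n w)) \<le> indicator unit_cell w * C" for n
      by (auto simp: indicator_def)
  qed
  then show ?thesis unfolding z by (simp add: LIMSEQ_const_iff)
qed

lemma AE_lattice_shift:
  assumes "\<And>j. AE w in lebesgue. f (w + axis j 1) = f (w::real^2)"
  shows "AE w in lebesgue. f (w + (\<chi> j. of_int (n $ j))) = f w"
proof -
  have 1: "AE w in lebesgue. f (w + of_int k *\<^sub>R axis j 1) = f w" for k j
  proof (induction k rule: int_induct[of _ 0])
    case (step1 i)
    show ?case using step1(2) AE_shift[OF assms[of j], of "of_int i *\<^sub>R axis j 1"]
      by eventually_elim (simp add: algebra_simps)
  next
    case (step2 i)
    show ?case using step2(2) AE_shift[OF assms[of j], of "of_int (i - 1) *\<^sub>R axis j 1"]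
      by eventually_elim (simp add: algebra_simps)
  qed simp
  have e: "(\<chi> j. of_int (n $ j)) = of_int (n $ 1) *\<^sub>R axis 1 1 + of_int (n $ 2) *\<^sub>R (axis 2 1 :: real^2)"
    by (simp add: vec_eq_iff forall_2 axis_def)
  show ?thesis using 1[of "n $ 1" 1] AE_shift[OF 1[of "n $ 2" 2], of "of_int (n $ 1) *\<^sub>R axis 1 1"]
    unfolding e by eventually_elim (simp add: add.assoc)
qed

lemma AE_coord_nonzero: "AE w in lebesgue. (w::real^2) $ j \<noteq> 0"
proof -
  have "negligible {w::real^2. w $ j = 0}" by (rule negligible_standard_hyperplane_cart)
  then have "{w::real^2. w $ j = 0} \<in> null_sets lebesgue" by (simp add: negligible_iff_null_sets)
  then show ?thesis by (rule AE_I') auto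
qed

lemma sigma_finite_lebesgue: "sigma_finite_measure (lebesgue :: 'a::euclidean_space measure)"
proof
  obtain A :: "'a set set" where A: "countable A" "A \<subseteq> sets lborel" "\<Union>A = space lborel" "\<forall>a\<in>A. emeasure lborel a \<noteq> \<infinity>"
    using lborel.sigma_finite_countable by blast
  then have "countable A \<and> A \<subseteq> sets lebesgue \<and> \<Union>A = space lebesgue \<and> (\<forall>a\<in>A. emeasure lebesgue a \<noteq> \<infinity>)"
    by (auto simp: subset_iff)
  then show "\<exists>A::'a set set. countable A \<and> A \<subseteq> sets lebesgue \<and> \<Union>A = space lebesgue \<and> (\<forall>a\<in>A. emeasure lebesgue a \<noteq> \<infinity>)"
    by blast
qed

text \<open>
  The integrals over rectangles vanish, and rectangles form an intersection-stable generator of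
  the Borel sets. So all integrals over measurable subsets of the cell vanish, and periodicity
  extends the conclusion from the cell to the plane.
\<close>

theorem torus_fourier_complete:
  assumes f: "torus_bounded f" and 0: "\<And>n. torus_mean (\<lambda>w. f w * torus_char n w) = 0"
  shows "AE w in lebesgue. f w = 0"
proof -
  define g where "g w = indicator unit_cell w *\<^sub>R f w" for w
  have g: "integrable lebesgue g" using torus_bounded_integrable[OF f] by (simp add: g_def[abs_def] set_integrable_def)
  have gA: "set_integrable lebesgue A g" if "A \<in> sets lebesgue" for A
    using integrable_mult_indicator[OF that g] by (simp add: set_integrable_def)
  have fm: "f \<in> borel_measurable lebesgue" using f by (simp add: torus_bounded_def)
  have box: "set_lebesgue_integral lebesgue (box a b) g = 0" for a b
  proof -
    define a' :: "real^2" where "a' = (\<chi> j. max 0 (a $ j))"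
    define b' :: "real^2" where "b' = (\<chi> j. min 1 (b $ j))"
    have "set_lebesgue_integral lebesgue (box a b) g = torus_mean (\<lambda>w. f w * indicator (box a' b') w)"
      unfolding set_lebesgue_integral_def torus_mean_def
    proof (rule integral_cong_AE)
      show "AE w in lebesgue. indicator (box a b) w *\<^sub>R g w = indicator unit_cell w *\<^sub>R (f w * indicator (box a' b') w)"
        using AE_coord_nonzero[of 1] AE_coord_nonzero[of 2]
        by eventually_elim
           (auto simp: g_def indicator_def unit_cell_def mem_box_cart forall_2 a'_def b'_def less_eq_real_def)
      show "(\<lambda>w. indicator unit_cell w *\<^sub>R (f w * indicator (box a' b') w)) \<in> borel_measurable lebesgue"
        using fm by (intro borel_measurable_scaleR borel_measurable_times borel_measurable_indicator) auto
      show "(\<lambda>w. indicat_real (box a b) w *\<^sub>R g w) \<in> borel_measurable lebesgue"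
        using g by (intro borel_measurable_scaleR borel_measurable_indicator) auto
    qed
    also have "\<dots> = 0"
    proof (cases "\<forall>j. a' $ j < b' $ j")
      case True
      show ?thesis by (rule torus_mean_rectangle_eq_0[OF f 0]) (use True in \<open>auto simp: a'_def b'_def\<close>)
    next
      case False
      then have "box a' b' = {}" unfolding set_eq_iff mem_box_cart by (metis empty_iff less_trans)
      then show ?thesis by simp
    qed
    finally show ?thesis .
  qed
  have borel: "set_lebesgue_integral lebesgue A g = 0" if "A \<in> sets borel" for A
  proof -
    let ?G = "range (\<lambda>(a, b). box a b) :: (real^2) set set"
    have sb: "sets borel = sigma_sets UNIV ?G" by (subst borel_eq_box) simp
    have leb: "B \<in> sets lebesgue" if "B \<in> sigma_sets UNIV ?G" for B
      using that sb by auto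
    have "Int_stable ?G"
    proof (rule Int_stableI)
      fix A B assume "A \<in> ?G" "B \<in> ?G"
      then obtain a b c d where "A = box a b" "B = box c d" by auto
      then have "A \<inter> B = box (\<chi> j. max (a $ j) (c $ j)) (\<chi> j. min (b $ j) (d $ j))"
        by (auto simp: mem_box_cart)
      then show "A \<inter> B \<in> ?G" by auto
    qed
    moreover have "?G \<subseteq> Pow UNIV" by simp
    moreover have "A \<in> sigma_sets UNIV ?G" using that sb by simp
    ultimately show ?thesis
    proof (induction rule: sigma_sets_induct_disjoint)
      case (basic A) then show ?case using box by auto
    next
      case empty then show ?case by (simp add: set_lebesgue_integral_def)
    next
      case (compl A)
      have "set_lebesgue_integral lebesgue UNIV g = torus_mean f"
        by (simp add: set_lebesgue_integral_def torus_mean_def g_def[abs_def])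
      also have "\<dots> = 0" using 0[of 0] by simp
      finally have "set_lebesgue_integral lebesgue (A \<union> (UNIV - A)) g = 0" by simp
      moreover have "set_lebesgue_integral lebesgue (A \<union> (UNIV - A)) g =
        set_lebesgue_integral lebesgue A g + set_lebesgue_integral lebesgue (UNIV - A) g"
        using leb[OF compl(1)] by (intro set_integral_Un gA) auto
      ultimately show ?case using compl(2) by simp
    next
      case (union A)
      have "set_lebesgue_integral lebesgue (\<Union>i. A i) g = (\<Sum>i. set_lebesgue_integral lebesgue (A i) g)"
      proof (rule lebesgue_integral_countable_add)
        show "A i \<in> sets lebesgue" for i using union(2) leb by auto
        then show "set_integrable lebesgue (\<Union>i. A i) g" by (intro gA) auto
        show "\<And>i j. i \<noteq> j \<Longrightarrow> A i \<inter> A j = {}" using union(1) by (auto simp: disjoint_family_on_def)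
      qed
      then show ?case using union(3) by simp
    qed
  qed
  have "AE w in lebesgue. g w = 0"
  proof (rule sigma_finite_measure.density_zero[OF sigma_finite_lebesgue g])
    fix A :: "(real^2) set" assume "A \<in> sets lebesgue"
    then obtain S N N' where A: "A = S \<union> N" "N \<subseteq> N'" "N' \<in> null_sets lborel" "S \<in> sets lborel"
      by (rule sets_completionE)
    have "N' \<in> null_sets lebesgue" using A(3) by (rule null_sets_completionI)
    then have ae: "AE w in lebesgue. w \<notin> N'" by (rule AE_not_in)
    have "set_lebesgue_integral lebesgue A g = set_lebesgue_integral lebesgue S g"
      unfolding set_lebesgue_integral_def
    proof (rule integral_cong_AE)
      show "AE w in lebesgue. indicator A w *\<^sub>R g w = indicator S w *\<^sub>R g w"
        using ae by eventually_elim (use A in \<open>auto simp: indicator_def\<close>)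
      show "(\<lambda>w. indicat_real S w *\<^sub>R g w) \<in> borel_measurable lebesgue"
        using A(4) g by (intro borel_measurable_scaleR borel_measurable_indicator) auto
    qed (use \<open>A \<in> sets lebesgue\<close> g in auto)
    also have "\<dots> = 0" using A(4) by (intro borel) simp
    finally show "set_lebesgue_integral lebesgue A g = 0" .
  qed
  then have "AE w in lebesgue. w \<in> unit_cell \<longrightarrow> f w = 0"
    by eventually_elim (auto simp: g_def indicator_def)
  then have 1: "AE w in lebesgue. w + (\<chi> j. of_int (n $ j)) \<in> unit_cell \<longrightarrow> f (w + (\<chi> j. of_int (n $ j))) = 0" for n :: "int^2"
    by (rule AE_shift)
  have per: "\<And>j. AE w in lebesgue. f (w + axis j 1) = f w"
    using f unfolding torus_bounded_def by blast
  have 2: "AE w in lebesgue. \<forall>n::int^2. f (w + (\<chi> j. of_int (n $ j))) = f w"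
    unfolding AE_all_countable using AE_lattice_shift[of f, OF per] by blast
  have "AE w in lebesgue. \<forall>n::int^2. w + (\<chi> j. of_int (n $ j)) \<in> unit_cell \<longrightarrow> f (w + (\<chi> j. of_int (n $ j))) = 0"
    unfolding AE_all_countable using 1 by blast
  with 2 show ?thesis
  proof eventually_elim
    fix w :: "real^2"
    assume 2: "\<forall>n::int^2. f (w + (\<chi> j. of_int (n $ j))) = f w"
      and 1: "\<forall>n::int^2. w + (\<chi> j. of_int (n $ j)) \<in> unit_cell \<longrightarrow> f (w + (\<chi> j. of_int (n $ j))) = 0"
    obtain n :: "int^2" and v where v: "v \<in> unit_cell" "w = v + (\<chi> j. of_int (n $ j))"
      by (rule periodic_reduce)
    then have "w + (\<chi> j. of_int ((- n) $ j)) = v" by (simp add: vec_eq_iff)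
    with 1 2 v(1) show "f w = 0" by metis
  qed
qed

lemma torus_mean_char: "torus_mean (torus_char n) = (if n = 0 then 1 else 0)"
proof (cases "n = 0")
  case True
  then have "torus_char n = (\<lambda>w. 1)" by auto
  then show ?thesis using True by simp
next
  case False
  then obtain j where j: "n $ j \<noteq> 0" by (auto simp: vec_eq_iff)
  let ?a = "(1 / (2 * of_int (n $ j))) *\<^sub>R axis j 1 :: real^2"
  have "torus_char n ?a = -1"
    using j by (simp add: torus_char_def cis_pi)
  then have "torus_mean (\<lambda>w. torus_char n (w + ?a)) = - torus_mean (torus_char n)"
    using torus_mean_cmult[of "-1" "torus_char n"] by (simp add: torus_char_add)
  then show ?thesis using torus_mean_shift[OF torus_bounded_char, of n ?a] False by simp
qed

definition nonresonant :: "real^2 \<Rightarrow> bool" where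
  "nonresonant \<tau> \<longleftrightarrow> (\<forall>n. n \<noteq> 0 \<longrightarrow> torus_char n \<tau> \<noteq> 1)"

lemma torus_mean_shift_char:
  assumes "torus_bounded f"
  shows "torus_mean (\<lambda>w. f (w + a) * torus_char n w) = torus_char (- n) a * torus_mean (\<lambda>w. f w * torus_char n w)"
proof -
  have "torus_mean (\<lambda>w. f (w + a) * torus_char n w)
      = torus_mean (\<lambda>w. torus_char (- n) a * (f (w + a) * torus_char n (w + a)))"
    by (simp add: torus_char_add torus_char_minus field_simps)
  also have "\<dots> = torus_char (- n) a * torus_mean (\<lambda>w. f w * torus_char n w)"
    unfolding torus_mean_cmult
    using torus_mean_shift[OF torus_bounded_mult[OF assms torus_bounded_char[of n]], of a] by simp
  finally show ?thesis .
qed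

text \<open>
  Translation multiplies the Fourier coefficients by character values at \<open>\<tau>\<close>, which are distinct
  by nonresonance, so exactly one coefficient survives. The frequency has the opposite sign of
  the index of that coefficient, since \<open>C n\<close> pairs with \<open>torus_char n\<close> and not with its
  conjugate.
\<close>

theorem torus_rotation_eigenfunction:
  assumes \<tau>: "nonresonant \<tau>" and D: "torus_bounded D"
    and eq: "AE w in lebesgue. D (w + \<tau>) = \<omega> * D w" and nz: "\<not> (AE w in lebesgue. D w = 0)"
  obtains n c where "c \<noteq> 0" "\<omega> = torus_char n \<tau>" "AE w in lebesgue. D w = c * torus_char n w"
proof -
  define C where "C n = torus_mean (\<lambda>w. D w * torus_char n w)" for n
  have Dm: "D \<in> borel_measurable lebesgue" using D by (simp add: torus_bounded_def)
  have Cn: "\<omega> * C n = torus_char (- n) \<tau> * C n" for n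
  proof -
    have "torus_bounded (\<lambda>w. D (w + \<tau>) * torus_char n w)" "torus_bounded (\<lambda>w. \<omega> * (D w * torus_char n w))"
      by (intro torus_bounded_mult torus_bounded_shift[OF D] D torus_bounded_char torus_bounded_const)+
    then have "torus_mean (\<lambda>w. D (w + \<tau>) * torus_char n w) = torus_mean (\<lambda>w. \<omega> * (D w * torus_char n w))"
      using eq by (intro torus_mean_cong_AE) (auto simp: torus_bounded_def mult.assoc elim!: eventually_mono)
    then show ?thesis unfolding torus_mean_shift_char[OF D] torus_mean_cmult C_def by metis
  qed
  obtain m where m: "C m \<noteq> 0" using torus_fourier_complete[OF D] nz unfolding C_def by blast
  have \<omega>: "\<omega> = torus_char (- m) \<tau>" using Cn[of m] m by simp
  have other: "C n = 0" if "n \<noteq> m" for n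
  proof (rule ccontr)
    assume "C n \<noteq> 0"
    then have "torus_char (- n) \<tau> = torus_char (- m) \<tau>" using Cn[of n] \<omega> by simp
    then have "torus_char (m - n) \<tau> = 1"
      using torus_char_add_left[of m "- n" \<tau>] by (simp add: torus_char_minus)
    then show False using \<tau> that unfolding nonresonant_def by (metis eq_iff_diff_eq_0)
  qed
  let ?R = "\<lambda>w. D w + (- C m) * torus_char (- m) w"
  have cm: "torus_bounded (\<lambda>w. (- C m) * torus_char (- m) w)"
    by (intro torus_bounded_mult torus_bounded_char torus_bounded_const)
  have R: "torus_bounded ?R" by (intro torus_bounded_add D cm)
  have "AE w in lebesgue. ?R w = 0"
  proof (rule torus_fourier_complete[OF R])
    fix n
    have "torus_mean (\<lambda>w. ?R w * torus_char n w) = C n + torus_mean (\<lambda>w. (- C m) * torus_char (n - m) w)"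
      using torus_mean_add[OF torus_bounded_mult[OF D torus_bounded_char[of n]]
          torus_bounded_mult[OF cm torus_bounded_char[of n]]] torus_char_add_left[of "-m" n]
      by (simp add: distrib_right C_def algebra_simps)
    also have "\<dots> = C n + (- C m) * (if n = m then 1 else 0)"
      unfolding torus_mean_cmult torus_mean_char[of "n - m"] by simp
    also have "\<dots> = 0" using other[of n] by auto
    finally show "torus_mean (\<lambda>w. ?R w * torus_char n w) = 0" .
  qed
  then have "AE w in lebesgue. D w = C m * torus_char (- m) w" by eventually_elim simp
  with m \<omega> that show ?thesis by blast
qed

section \<open>Differentiability of finite order on the plane\<close>

definition pd :: "2 \<Rightarrow> (real^2 \<Rightarrow> complex) \<Rightarrow> real^2 \<Rightarrow> complex" where
  "pd j f w = frechet_derivative f (at w) (axis j 1)"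

text \<open>
  A finite order of differentiability, with iterated partial derivatives: it admits piecewise
  polynomial cutoffs and is all that the decay of Fourier coefficients asks for.
\<close>

fun Ck :: "nat \<Rightarrow> (real^2) set \<Rightarrow> (real^2 \<Rightarrow> complex) \<Rightarrow> bool" where
  "Ck 0 S f \<longleftrightarrow> continuous_on S f"
| "Ck (Suc n) S f \<longleftrightarrow> (\<forall>w\<in>S. f differentiable at w) \<and> (\<forall>j. Ck n S (pd j f))"

lemma pd_eqI: "(f has_derivative f') (at w) \<Longrightarrow> pd j f w = f' (axis j 1)"
  unfolding pd_def by (simp add: frechet_derivative_at[symmetric])

lemma has_derivative_pd:
  assumes "f differentiable at w"
  shows "(f has_derivative (\<lambda>h. of_real (h $ 1) * pd 1 f w + of_real (h $ 2) * pd 2 f w)) (at w)"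
proof -
  let ?F = "frechet_derivative f (at w)"
  have F: "(f has_derivative ?F) (at w)" using assms by (simp add: frechet_derivative_works)
  then interpret bounded_linear ?F by (rule has_derivative_bounded_linear)
  have "?F h = of_real (h $ 1) * pd 1 f w + of_real (h $ 2) * pd 2 f w" for h
  proof -
    have "?F h = ?F ((h $ 1) *\<^sub>R axis 1 1 + (h $ 2) *\<^sub>R axis 2 1)"
      by (simp only: vec2_decompose[symmetric])
    also have "\<dots> = (h $ 1) *\<^sub>R ?F (axis 1 1) + (h $ 2) *\<^sub>R ?F (axis 2 1)"
      by (simp only: add scaleR)
    finally show ?thesis by (simp add: pd_def scaleR_conv_of_real)
  qed
  then have "?F = (\<lambda>h. of_real (h $ 1) * pd 1 f w + of_real (h $ 2) * pd 2 f w)" by blast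
  then show ?thesis using F by simp
qed

lemma Ck_cong:
  assumes "open S" "\<And>w. w \<in> S \<Longrightarrow> f w = g w" "Ck n S f"
  shows "Ck n S g"
  using assms
proof (induction n arbitrary: f g)
  case 0
  then show ?case by (simp cong: continuous_on_cong)
next
  case (Suc n)
  have d: "(g has_derivative f') (at w)" if "w \<in> S" "(f has_derivative f') (at w)" for w f'
    using has_derivative_transform_within_open[OF that(2) Suc.prems(1) that(1)] Suc.prems(2) by blast
  have "g differentiable at w" if "w \<in> S" for w
    using d[OF that] that Suc.prems(3) unfolding differentiable_def Ck.simps by blast
  moreover have "Ck n S (pd j g)" for j
  proof (rule Suc.IH[OF Suc.prems(1)])
    show "Ck n S (pd j f)" using Suc.prems by simp
    show "pd j f w = pd j g w" if "w \<in> S" for w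
    proof -
      have "(f has_derivative frechet_derivative f (at w)) (at w)"
        using that Suc.prems(3) by (simp add: frechet_derivative_works)
      from pd_eqI[OF this, of j] pd_eqI[OF d[OF that this], of j] show ?thesis by simp
    qed
  qed
  ultimately show ?case by simp
qed

lemma Ck_subset: "Ck n S f \<Longrightarrow> T \<subseteq> S \<Longrightarrow> Ck n T f"
  by (induction n arbitrary: f) (auto intro: continuous_on_subset)

lemma Ck_SucD: "Ck (Suc n) S f \<Longrightarrow> Ck n S f"
proof (induction n arbitrary: f)
  case 0
  then show ?case
    by (auto intro!: continuous_at_imp_continuous_on differentiable_imp_continuous_within)
qed auto

lemma Ck_le: "Ck n S f \<Longrightarrow> m \<le> n \<Longrightarrow> Ck m S f"
  by (induction n) (use Ck_SucD le_Suc_eq in auto)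

lemma Ck_continuous: "Ck n S f \<Longrightarrow> continuous_on S f"
  using Ck_le[of n S f 0] by simp

lemma Ck_local:
  assumes "\<And>w. w \<in> S \<Longrightarrow> \<exists>T. open T \<and> w \<in> T \<and> Ck n T f"
  shows "Ck n S f"
  using assms
proof (induction n arbitrary: f)
  case 0
  show ?case unfolding Ck.simps
  proof (rule continuous_at_imp_continuous_on, rule ballI)
    fix w assume "w \<in> S"
    then show "isCont f w" using 0[of w] by (auto simp: continuous_on_eq_continuous_at)
  qed
next
  case (Suc n)
  have "f differentiable at w" if "w \<in> S" for w using Suc.prems[OF that] by auto
  moreover have "Ck n S (pd j f)" for j using Suc.prems by (intro Suc.IH) (metis Ck.simps(2))
  ultimately show ?case by simp
qed

lemma Ck_cong_local:
  assumes "\<And>w. w \<in> S \<Longrightarrow> \<exists>T g. open T \<and> w \<in> T \<and> Ck n T g \<and> (\<forall>x\<in>T. f x = g x)"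
  shows "Ck n S f"
proof (rule Ck_local)
  fix w assume "w \<in> S"
  then obtain T g where "open T" "w \<in> T" "Ck n T g" "\<forall>x\<in>T. f x = g x" using assms by blast
  then show "\<exists>T. open T \<and> w \<in> T \<and> Ck n T f" using Ck_cong[of T g f n] by auto
qed

lemma Ck_SucI:
  assumes "open S"
    and "\<And>w. w \<in> S \<Longrightarrow> (f has_derivative f' w) (at w)"
    and "\<And>j. Ck n S (\<lambda>w. f' w (axis j 1))"
  shows "Ck (Suc n) S f"
proof -
  have "Ck n S (pd j f)" for j
    by (rule Ck_cong[OF assms(1) _ assms(3)[of j]]) (use assms(2) pd_eqI in metis)
  then show ?thesis using assms(2) by (auto simp: differentiable_def)
qed

lemma Ck_const: "open S \<Longrightarrow> Ck n S (\<lambda>w. c)"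
proof (induction n arbitrary: c)
  case (Suc n)
  show ?case by (rule Ck_SucI[where f'="\<lambda>w h. 0"]) (use Suc in auto)
qed simp

lemma Ck_differentiable: "Ck (Suc n) S f \<Longrightarrow> w \<in> S \<Longrightarrow> f differentiable at w"
  by simp

lemma Ck_has_derivative:
  "Ck (Suc n) S f \<Longrightarrow> w \<in> S \<Longrightarrow> (f has_derivative frechet_derivative f (at w)) (at w)"
  by (simp add: frechet_derivative_works)

lemma Ck_add: "open S \<Longrightarrow> Ck n S f \<Longrightarrow> Ck n S g \<Longrightarrow> Ck n S (\<lambda>w. f w + g w)"
proof (induction n arbitrary: f g)
  case (Suc n)
  show ?case
  proof (rule Ck_SucI[OF \<open>open S\<close>])
    show "((\<lambda>w. f w + g w) has_derivative (\<lambda>h. frechet_derivative f (at w) h + frechet_derivative g (at w) h)) (at w)"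
      if "w \<in> S" for w
      using Suc.prems that by (intro has_derivative_add Ck_has_derivative) auto
    show "Ck n S (\<lambda>w. frechet_derivative f (at w) (axis j 1) + frechet_derivative g (at w) (axis j 1))" for j
      using Suc.prems by (intro Suc.IH) (auto simp: pd_def[abs_def])
  qed
qed (auto intro: continuous_intros)

lemma Ck_mult: "open S \<Longrightarrow> Ck n S f \<Longrightarrow> Ck n S g \<Longrightarrow> Ck n S (\<lambda>w. f w * g w)"
proof (induction n arbitrary: f g)
  case (Suc n)
  show ?case
  proof (rule Ck_SucI[OF \<open>open S\<close>])
    show "((\<lambda>w. f w * g w) has_derivative (\<lambda>h. f w * frechet_derivative g (at w) h + frechet_derivative f (at w) h * g w)) (at w)"
      if "w \<in> S" for w
      using Suc.prems that by (intro has_derivative_mult Ck_has_derivative) auto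
    show "Ck n S (\<lambda>w. f w * frechet_derivative g (at w) (axis j 1) + frechet_derivative f (at w) (axis j 1) * g w)" for j
      using Suc.prems Ck_SucD[OF Suc.prems(2)] Ck_SucD[OF Suc.prems(3)]
      by (intro Ck_add Suc.IH) (auto simp: pd_def[abs_def])
  qed
qed (auto intro: continuous_intros)

lemma Ck_uminus: "open S \<Longrightarrow> Ck n S f \<Longrightarrow> Ck n S (\<lambda>w. - f w)"
  using Ck_mult[OF _ Ck_const[of S n "-1"]] by simp

lemma Ck_diff: "open S \<Longrightarrow> Ck n S f \<Longrightarrow> Ck n S g \<Longrightarrow> Ck n S (\<lambda>w. f w - g w)"
  using Ck_add[OF _ _ Ck_uminus] by simp

lemma Ck_sum: "open S \<Longrightarrow> (\<And>i. i \<in> I \<Longrightarrow> Ck n S (f i)) \<Longrightarrow> Ck n S (\<lambda>w. \<Sum>i\<in>I. f i w)"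
  by (induction I rule: infinite_finite_induct) (auto intro: Ck_const Ck_add)

lemma Ck_cnj: "open S \<Longrightarrow> Ck n S f \<Longrightarrow> Ck n S (\<lambda>w. cnj (f w))"
proof (induction n arbitrary: f)
  case (Suc n)
  show ?case
  proof (rule Ck_SucI[OF \<open>open S\<close>])
    show "((\<lambda>w. cnj (f w)) has_derivative (\<lambda>h. cnj (frechet_derivative f (at w) h))) (at w)" if "w \<in> S" for w
      using Suc.prems that by (intro bounded_linear.has_derivative[OF bounded_linear_cnj] Ck_has_derivative)
    show "Ck n S (\<lambda>w. cnj (frechet_derivative f (at w) (axis j 1)))" for j
      using Suc.prems by (intro Suc.IH) (auto simp: pd_def[abs_def])
  qed
qed (auto intro: continuous_intros)

lemma Ck_inverse:
  "open S \<Longrightarrow> Ck n S f \<Longrightarrow> (\<And>w. w \<in> S \<Longrightarrow> f w \<noteq> 0) \<Longrightarrow> Ck n S (\<lambda>w. inverse (f w))"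
proof (induction n)
  case (Suc n)
  have IH: "Ck n S (\<lambda>w. inverse (f w))" using Suc Ck_SucD by blast
  show ?case
  proof (rule Ck_SucI[OF \<open>open S\<close>])
    show "((\<lambda>w. inverse (f w)) has_derivative (\<lambda>h. - (inverse (f w) * frechet_derivative f (at w) h * inverse (f w)))) (at w)"
      if "w \<in> S" for w
      using Suc.prems that by (intro Deriv.has_derivative_inverse Ck_has_derivative) auto
    show "Ck n S (\<lambda>w. - (inverse (f w) * frechet_derivative f (at w) (axis j 1) * inverse (f w)))" for j
      using Suc.prems IH by (intro Ck_uminus Ck_mult) (auto simp: pd_def[abs_def])
  qed
qed (auto intro: continuous_intros)

lemma Ck_divide:
  "open S \<Longrightarrow> Ck n S f \<Longrightarrow> Ck n S g \<Longrightarrow> (\<And>w. w \<in> S \<Longrightarrow> g w \<noteq> 0) \<Longrightarrow> Ck n S (\<lambda>w. f w / g w)"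
  unfolding divide_inverse by (intro Ck_mult Ck_inverse)

lemma Ck_exp: "open S \<Longrightarrow> Ck n S f \<Longrightarrow> Ck n S (\<lambda>w. exp (f w))"
proof (induction n)
  case (Suc n)
  have IH: "Ck n S (\<lambda>w. exp (f w))" using Suc Ck_SucD by blast
  show ?case
  proof (rule Ck_SucI[OF \<open>open S\<close>])
    show "((\<lambda>w. exp (f w)) has_derivative (\<lambda>h. exp (f w) * frechet_derivative f (at w) h)) (at w)"
      if "w \<in> S" for w
      using has_derivative_compose[OF Ck_has_derivative[OF Suc.prems(2) that], of exp "(*) (exp (f w))"]
        DERIV_exp[of "f w"] by (simp add: has_field_derivative_def)
    show "Ck n S (\<lambda>w. exp (f w) * frechet_derivative f (at w) (axis j 1))" for j
      using Suc.prems IH by (intro Ck_mult) (auto simp: pd_def[abs_def])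
  qed
qed (auto intro: continuous_intros)

text \<open>
  Near \<open>w\<close> a continuous logarithm stays within distance \<open>\<pi>\<close> of \<open>g w\<close>, so it differs from the
  principal logarithm of \<open>f x / f w\<close> by the constant \<open>g w\<close>.
\<close>

lemma has_derivative_log:
  assumes S: "open S" "w \<in> S" and g: "continuous_on S g" and e: "\<And>x. x \<in> S \<Longrightarrow> exp (g x) = (f x :: complex)"
    and f: "(f has_derivative f') (at w)"
  shows "(g has_derivative (\<lambda>h. f' h / f w)) (at w)"
proof -
  have fw: "f w \<noteq> 0" using e[OF S(2)] by (metis exp_not_eq_zero)
  have "isCont g w" using g S by (simp add: continuous_on_eq_continuous_at)
  then have "\<forall>\<^sub>F x in nhds w. dist (g x) (g w) < pi"
    by (intro tendstoD) (auto simp: isCont_def tendsto_at_iff_tendsto_nhds)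
  then obtain T where T: "open T" "w \<in> T" "\<And>x. x \<in> T \<Longrightarrow> dist (g x) (g w) < pi"
    by (auto simp: eventually_nhds)
  let ?L = "\<lambda>x. g w + Ln (f x / f w)"
  have L: "?L x = g x" if "x \<in> S \<inter> T" for x
  proof -
    have "f x / f w = exp (g x - g w)" using e that S by (simp add: exp_diff)
    moreover have "\<bar>Im (g x - g w)\<bar> < pi" using T(3)[of x] that abs_Im_le_cmod[of "g x - g w"] by (auto simp: dist_norm)
    ultimately have "Ln (f x / f w) = g x - g w" by (auto intro!: Ln_exp)
    then show ?thesis by simp
  qed
  have "(?L has_derivative (\<lambda>h. 0 + (1 / (f w / f w)) * (f' h / f w))) (at w)"
  proof (intro has_derivative_add has_derivative_const)
    have "(Ln has_field_derivative 1 / (f w / f w)) (at (f w / f w))"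
      using fw by (auto intro!: derivative_eq_intros)
    then have 1: "(Ln has_derivative (*) (1 / (f w / f w))) (at (f w / f w))"
      by (simp add: has_field_derivative_def)
    have 2: "((\<lambda>x. f x / f w) has_derivative (\<lambda>h. f' h / f w)) (at w)"
      using bounded_linear.has_derivative[OF bounded_linear_divide[of "f w"] f] .
    show "((\<lambda>x. Ln (f x / f w)) has_derivative (\<lambda>h. (1 / (f w / f w)) * (f' h / f w))) (at w)"
      using has_derivative_compose[OF 2 1] .
  qed
  then have "(?L has_derivative (\<lambda>h. f' h / f w)) (at w)" using fw by simp
  moreover have "open (S \<inter> T)" "w \<in> S \<inter> T" using S T by auto
  ultimately show ?thesis by (rule has_derivative_transform_within_open) (use L in auto)
qed

lemma Ck_log:
  assumes S: "open S" and g: "continuous_on S g" and e: "\<And>x. x \<in> S \<Longrightarrow> exp (g x) = f x"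
    and f: "Ck n S f"
  shows "Ck n S g"
proof (cases n)
  case (Suc m)
  have nz: "f w \<noteq> 0" if "w \<in> S" for w using e[OF that] by (metis exp_not_eq_zero)
  show ?thesis unfolding Suc
  proof (rule Ck_SucI[OF S])
    show "(g has_derivative (\<lambda>h. frechet_derivative f (at w) h / f w)) (at w)" if "w \<in> S" for w
      using has_derivative_log[OF S that g e Ck_has_derivative] f that Suc by simp
    show "Ck m S (\<lambda>w. frechet_derivative f (at w) (axis j 1) / f w)" for j
      using f Suc nz Ck_SucD[of m S f] by (intro Ck_divide S) (auto simp: pd_def[abs_def])
  qed
qed (use g in simp)

lemma Ck_compose:
  assumes "Ck n UNIV f" "\<And>j. Ck n UNIV (\<lambda>w. complex_of_real (Y w $ j))"
  shows "Ck n UNIV (\<lambda>w. f (Y w))"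
  using assms
proof (induction n arbitrary: f)
  case 0
  have cj: "continuous_on UNIV (\<lambda>w. Y w $ j)" for j
  proof -
    have "continuous_on UNIV (\<lambda>w. Re (complex_of_real (Y w $ j)))"
      using 0(2)[of j] by (intro continuous_on_Re) simp
    then show ?thesis by simp
  qed
  have "continuous_on UNIV (\<lambda>w. \<chi> j. Y w $ j)"
    by (rule continuous_on_vec_lambda) (rule cj)
  then have "continuous_on UNIV Y" by simp
  then show ?case using 0(1) continuous_on_compose2[of UNIV f UNIV Y] by simp
next
  case (Suc n)
  let ?dY = "\<lambda>j w. frechet_derivative (\<lambda>w. complex_of_real (Y w $ j)) (at w)"
  have Y: "((\<lambda>w. complex_of_real (Y w $ j)) has_derivative ?dY j w) (at w)" for j w
    using Ck_has_derivative[OF Suc.prems(2)] by simp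
  have Y': "(Y has_derivative (\<lambda>h. \<chi> j. Re (?dY j w h))) (at w)" for w
  proof -
    have "((\<lambda>w. Y w $ j) has_derivative (\<lambda>h. Re (?dY j w h))) (at w)" for j
      using bounded_linear.has_derivative[OF bounded_linear_Re Y[of j w]] by simp
    then show ?thesis by (auto simp: has_derivative_componentwise_within[of Y] Basis_vec_def inner_axis)
  qed
  have real: "complex_of_real (Re (?dY j w h)) = ?dY j w h" for j w h
  proof -
    have "((\<lambda>w. Im (complex_of_real (Y w $ j))) has_derivative (\<lambda>h. Im (?dY j w h))) (at w)"
      by (rule bounded_linear.has_derivative[OF bounded_linear_Im Y])
    then have "((\<lambda>w. 0) has_derivative (\<lambda>h. Im (?dY j w h))) (at w)" by simp
    from has_derivative_unique[OF this has_derivative_const] have "Im (?dY j w h) = 0" by metis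
    then show ?thesis by (simp add: complex_eq_iff)
  qed
  show ?case
  proof (rule Ck_SucI)
    show "((\<lambda>w. f (Y w)) has_derivative (\<lambda>h. ?dY 1 w h * pd 1 f (Y w) + ?dY 2 w h * pd 2 f (Y w))) (at w)" for w
      using has_derivative_compose[OF Y' has_derivative_pd[of f]] Suc.prems(1) by (simp add: real)
    have "Ck n UNIV (\<lambda>w. pd i f (Y w))" for i
      using Suc.IH[OF _ Ck_SucD[OF Suc.prems(2)]] Suc.prems(1) by simp
    then show "Ck n UNIV (\<lambda>w. ?dY 1 w (axis j 1) * pd 1 f (Y w) + ?dY 2 w (axis j 1) * pd 2 f (Y w))" for j
      using Suc.prems(2) by (intro Ck_add Ck_mult) (auto simp: pd_def[abs_def])
  qed simp
qed

lemma Ck_coord: "Ck n UNIV (\<lambda>w. complex_of_real (w $ j))"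
proof (cases n)
  case (Suc m)
  show ?thesis unfolding Suc
  proof (rule Ck_SucI)
    show "((\<lambda>w. complex_of_real (w $ j)) has_derivative (\<lambda>h. complex_of_real (h $ j))) (at w)" for w
      by (intro bounded_linear.has_derivative[OF bounded_linear_of_real] bounded_linear.has_derivative[OF bounded_linear_vec_nth] has_derivative_ident)
  qed (auto intro: Ck_const)
qed (auto intro!: continuous_intros)

lemma Ck_shift:
  assumes "Ck n UNIV f" shows "Ck n UNIV (\<lambda>w. f (w + a))"
proof (rule Ck_compose[OF assms])
  show "Ck n UNIV (\<lambda>w. complex_of_real ((w + a) $ j))" for j
    using Ck_add[OF _ Ck_coord Ck_const[of UNIV n "complex_of_real (a $ j)"], of j] by simp
qed

text \<open>The exponent \<open>n + 1\<close> gives \<open>n\<close> continuous derivatives at 0.\<close>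

definition truncated_power :: "nat \<Rightarrow> real \<Rightarrow> real" where "truncated_power n t = max 0 t ^ Suc n"

lemma has_derivative_truncated_power: "(truncated_power (Suc n) has_real_derivative real (Suc (Suc n)) * truncated_power n t) (at t)"
proof -
  consider "t < 0" | "t > 0" | "t = 0" by linarith
  then show ?thesis
  proof cases
    case 1
    have "((\<lambda>t. 0) has_real_derivative 0) (at t)" by simp
    then have "(truncated_power (Suc n) has_real_derivative 0) (at t)"
      by (rule DERIV_cong_ev[THEN iffD1, rotated -1, OF _ refl _ refl])
         (use eventually_nhds_in_open[of "{..<0}" t] 1 in \<open>auto simp: truncated_power_def elim!: eventually_mono\<close>)
    then show ?thesis using 1 by (simp add: truncated_power_def)
  next
    case 2
    have "((\<lambda>t. t ^ Suc (Suc n)) has_real_derivative real (Suc (Suc n)) * t ^ Suc n) (at t)"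
      using DERIV_pow[of "Suc (Suc n)" t] by simp
    then have "(truncated_power (Suc n) has_real_derivative real (Suc (Suc n)) * t ^ Suc n) (at t)"
      by (rule DERIV_cong_ev[THEN iffD1, rotated -1, OF _ refl _ refl])
         (use eventually_nhds_in_open[of "{0<..}" t] 2 in \<open>auto simp: truncated_power_def elim!: eventually_mono\<close>)
    then show ?thesis using 2 by (simp add: truncated_power_def)
  next
    case 3
    have "((\<lambda>h. truncated_power (Suc n) h / h) \<longlongrightarrow> 0) (at 0)"
    proof (rule Lim_null_comparison)
      show "\<forall>\<^sub>F h in at 0. norm (truncated_power (Suc n) h / h) \<le> \<bar>h\<bar> ^ Suc n"
      proof (rule always_eventually, rule allI)
        fix h :: real
        show "norm (truncated_power (Suc n) h / h) \<le> \<bar>h\<bar> ^ Suc n"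
          by (cases "h > 0") (simp_all add: truncated_power_def power_abs max_def mult_nonpos_nonneg)
      qed
      show "((\<lambda>h. \<bar>h\<bar> ^ Suc n) \<longlongrightarrow> 0) (at (0::real))"
        by (rule tendsto_eq_intros refl | simp)+
    qed
    then show ?thesis using 3 by (simp add: DERIV_def truncated_power_def)
  qed
qed

lemma Ck_truncated_power: "Ck n UNIV (\<lambda>w. complex_of_real (truncated_power n (a * w $ j + b)))"
proof (induction n)
  case 0
  show ?case by (auto simp: truncated_power_def intro!: continuous_intros)
next
  case (Suc n)
  show ?case
  proof (rule Ck_SucI)
    fix w :: "real^2"
    have "((\<lambda>w. a * w $ j + b) has_derivative (\<lambda>h. a * h $ j)) (at w)"
      by (auto intro!: derivative_eq_intros bounded_linear.has_derivative[OF bounded_linear_vec_nth])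
    from has_derivative_compose[OF this has_derivative_truncated_power[of n, THEN has_field_derivative_imp_has_derivative]]
    have "((\<lambda>w. truncated_power (Suc n) (a * w $ j + b)) has_derivative (\<lambda>h. real (Suc (Suc n)) * truncated_power n (a * w $ j + b) * (a * h $ j))) (at w)" .
    from bounded_linear.has_derivative[OF bounded_linear_of_real this]
    show "((\<lambda>w. complex_of_real (truncated_power (Suc n) (a * w $ j + b))) has_derivative
       (\<lambda>h. complex_of_real (real (Suc (Suc n)) * truncated_power n (a * w $ j + b) * (a * h $ j)))) (at w)" .
  next
    show "Ck n UNIV (\<lambda>w. complex_of_real (real (Suc (Suc n)) * truncated_power n (a * w $ j + b) * (a * axis i 1 $ j)))" for i
      unfolding of_real_mult by (intro Ck_mult Ck_const Suc) auto
  qed simp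
qed

text \<open>A step from 0 to 1 across the unit interval, with \<open>n\<close> continuous derivatives.\<close>

definition cutoff :: "nat \<Rightarrow> real \<Rightarrow> real" where
  "cutoff n t = truncated_power n t / (truncated_power n t + truncated_power n (1 - t))"

lemma cutoff_0: "t \<le> 0 \<Longrightarrow> cutoff n t = 0" and cutoff_1: "t \<ge> 1 \<Longrightarrow> cutoff n t = 1"
  by (auto simp: cutoff_def truncated_power_def)

lemma truncated_power_pos: "0 < truncated_power n t + truncated_power n (1 - t)"
proof -
  have "0 \<le> truncated_power n t" "0 \<le> truncated_power n (1 - t)" by (auto simp: truncated_power_def)
  moreover have "0 < truncated_power n t \<or> 0 < truncated_power n (1 - t)"
  proof (cases "t > 0")
    case True
    then have "0 < max 0 t ^ Suc n" by (intro zero_less_power) auto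
    then show ?thesis unfolding truncated_power_def by blast
  next
    case False
    then have "0 < max 0 (1 - t) ^ Suc n" by (intro zero_less_power) auto
    then show ?thesis unfolding truncated_power_def by blast
  qed
  ultimately show ?thesis by linarith
qed

lemma cutoff_range: "0 \<le> cutoff n t" "cutoff n t \<le> 1"
  using truncated_power_pos[of n t] by (auto simp: cutoff_def truncated_power_def divide_simps)

lemma Ck_cutoff: "Ck n UNIV (\<lambda>w. complex_of_real (cutoff n (a * w $ j + b)))"
proof -
  have e: "1 - (a * w $ j + b) = (- a) * w $ j + (1 - b)" for w :: "real^2" by simp
  have nz: "complex_of_real (truncated_power n (a * w $ j + b)) + complex_of_real (truncated_power n ((- a) * w $ j + (1 - b))) \<noteq> 0" for w :: "real^2"
    using truncated_power_pos[of n "a * w $ j + b"] unfolding e by (metis of_real_add of_real_eq_0_iff less_irrefl)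
  show ?thesis unfolding cutoff_def of_real_divide of_real_add e
    using nz by (intro Ck_divide Ck_add Ck_truncated_power) auto
qed

section \<open>The cohomological equation\<close>

lemma norm_torus_mean_le:
  assumes "torus_bounded f" "\<And>w. norm (f w) \<le> B"
  shows "norm (torus_mean f) \<le> B"
proof -
  have i: "integrable lebesgue (\<lambda>w. indicator unit_cell w *\<^sub>R f w)"
    using torus_bounded_integrable[OF assms(1)] by (simp add: set_integrable_def)
  have "norm (torus_mean f) \<le> (\<integral>w. norm (indicator unit_cell w *\<^sub>R f w) \<partial>lebesgue)"
    unfolding torus_mean_def set_lebesgue_integral_def by (rule integral_norm_bound)
  also have "\<dots> \<le> (\<integral>w. indicator unit_cell w * B \<partial>lebesgue)"
  proof (rule integral_mono)
    show "integrable lebesgue (\<lambda>w. norm (indicator unit_cell w *\<^sub>R f w))" by (rule integrable_norm[OF i])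
    show "integrable lebesgue (\<lambda>w. indicator unit_cell w * B)" by (simp add: emeasure_unit_cell)
  qed (use assms(2) in \<open>auto simp: indicator_def\<close>)
  also have "\<dots> = B" by simp
  finally show ?thesis .
qed

text \<open>A nonempty open set is not negligible.\<close>

lemma continuous_AE_zero:
  fixes f :: "'a::euclidean_space \<Rightarrow> 'b::real_normed_vector"
  assumes f: "continuous_on UNIV f" and ae: "AE w in lebesgue. f w = 0"
  shows "f w = 0"
proof (rule ccontr)
  assume "f w \<noteq> 0"
  have "open {w. f w \<noteq> 0}" using f by (intro open_Collect_neq continuous_intros) auto
  moreover have "{w. f w \<noteq> 0} \<in> null_sets lebesgue"
  proof -
    obtain N where N: "{w. f w \<noteq> 0} \<subseteq> N" "N \<in> null_sets lebesgue"
      using ae by (auto simp: eventually_ae_filter)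
    then show ?thesis using null_sets_completion_subset by blast
  qed
  ultimately show False using open_not_negligible[of "{w. f w \<noteq> 0}"] \<open>f w \<noteq> 0\<close>
    by (auto simp: negligible_iff_null_sets)
qed

lemma periodic_pd:
  assumes "periodic f" "Ck (Suc n) UNIV f"
  shows "periodic (pd j f)"
  unfolding periodic_def
proof (intro allI)
  fix i w
  let ?F = "frechet_derivative f (at (w + axis i 1))"
  have "(f has_derivative ?F) (at (w + axis i 1))" using assms(2) by (intro Ck_has_derivative) auto
  moreover have "((\<lambda>x. x + axis i 1) has_derivative (\<lambda>h. h)) (at w)" by (auto intro!: derivative_eq_intros)
  ultimately have "((\<lambda>x. f (x + axis i 1)) has_derivative ?F) (at w)"
    using has_derivative_compose[of "\<lambda>x. x + axis i 1" "\<lambda>h. h" w UNIV f ?F] by simp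
  moreover have "(\<lambda>x. f (x + axis i 1)) = f" using assms(1) by (auto simp: periodic_def)
  ultimately have "(f has_derivative ?F) (at w)" by simp
  from pd_eqI[OF this, of j] show "pd j f (w + axis i 1) = pd j f w" by (simp add: pd_def)
qed

lemma pd_line:
  assumes f: "Ck (Suc 0) UNIV f"
  shows "((\<lambda>t. f (w + t *\<^sub>R axis j 1)) has_vector_derivative pd j f (w + t *\<^sub>R axis j 1)) (at t)"
proof -
  let ?e = "axis j 1 :: real^2"
  have "((\<lambda>t. w + t *\<^sub>R ?e) has_derivative (\<lambda>h. h *\<^sub>R ?e)) (at t)" by (auto intro!: derivative_eq_intros)
  from has_derivative_compose[OF this Ck_has_derivative[OF f(1)]]
  have "((\<lambda>t. f (w + t *\<^sub>R ?e)) has_derivative (\<lambda>h. frechet_derivative f (at (w + t *\<^sub>R ?e)) (h *\<^sub>R ?e))) (at t)" by simp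
  moreover have "bounded_linear (frechet_derivative f (at (w + t *\<^sub>R ?e)))"
    using has_derivative_bounded_linear[OF Ck_has_derivative[OF f(1)]] by simp
  ultimately show ?thesis unfolding has_vector_derivative_def pd_def
    by (simp add: linear_simps(5))
qed

text \<open>
  Difference quotients have mean zero by invariance of the mean, and they are bounded by the
  supremum of the derivative, so dominated convergence applies.
\<close>

lemma torus_mean_pd:
  assumes f: "Ck (Suc 0) UNIV f" "periodic f"
  shows "torus_mean (pd j f) = 0"
proof -
  let ?e = "axis j 1 :: real^2"
  have pc: "continuous_on UNIV (pd j f)" using f(1) by simp
  obtain B where B: "B > 0" "\<And>w. norm (pd j f w) \<le> B"
    using continuous_periodic_bounded[OF pc periodic_pd[OF f(2,1)]] by blast
  note der = pd_line[OF f(1), of _ j]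
  define h where "h k = 1 / real (Suc k)" for k
  have h0: "h k > 0" for k by (simp add: h_def)
  define q where "q k w = (f (w + h k *\<^sub>R ?e) + (- 1) * f w) / complex_of_real (h k)" for k w
  have fb: "torus_bounded f" using torus_bounded_continuous[OF Ck_continuous[OF f(1)] f(2)] .
  have "torus_mean (q k) = 0" for k
  proof -
    have "torus_mean (q k) = 1 / complex_of_real (h k) * torus_mean (\<lambda>w. f (w + h k *\<^sub>R ?e) + (- 1) * f w)"
      unfolding q_def[abs_def] by (subst torus_mean_cmult[symmetric]) simp
    also have "torus_mean (\<lambda>w. f (w + h k *\<^sub>R ?e) + (- 1) * f w) = torus_mean f + torus_mean (\<lambda>w. (- 1) * f w)"
      by (subst torus_mean_add) (auto intro!: torus_bounded_shift torus_bounded_mult[OF torus_bounded_const, of _ "-1", simplified] fb simp: torus_mean_shift[OF fb])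
    also have "\<dots> = 0" by (subst torus_mean_cmult) simp
    finally show ?thesis by simp
  qed
  moreover have "(\<lambda>k. torus_mean (q k)) \<longlonglongrightarrow> torus_mean (pd j f)"
    unfolding torus_mean_def set_lebesgue_integral_def
  proof (rule integral_dominated_convergence[where w="\<lambda>w. indicator unit_cell w * B"])
    have fm: "continuous_on UNIV (q k)" for k
    proof -
      have "continuous_on UNIV (\<lambda>w. f (w + h k *\<^sub>R ?e))"
        by (rule continuous_on_compose2[OF Ck_continuous[OF f(1)]]) (auto intro!: continuous_intros)
      then show ?thesis using h0[of k] unfolding q_def by (intro continuous_intros Ck_continuous[OF f(1)]) auto
    qed
    show "(\<lambda>w. indicator unit_cell w *\<^sub>R pd j f w) \<in> borel_measurable lebesgue"
      using borel_measurable_lebesgue_continuous[OF pc] by auto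
    show "(\<lambda>w. indicator unit_cell w *\<^sub>R q k w) \<in> borel_measurable lebesgue" for k
      using borel_measurable_lebesgue_continuous[OF fm] by auto
    show "integrable lebesgue (\<lambda>w. indicator unit_cell w * B)" by (simp add: emeasure_unit_cell)
    have "(\<lambda>k. q k w) \<longlonglongrightarrow> pd j f w" for w
    proof -
      let ?N = "\<lambda>t. norm (f (w + t *\<^sub>R ?e) - f w - t *\<^sub>R pd j f w) / norm t"
      have "(?N \<longlongrightarrow> 0) (at 0)"
        using der[of w 0] by (simp add: has_vector_derivative_def has_derivative_at)
      moreover have "filterlim h (at 0) sequentially"
        using LIMSEQ_inverse_real_of_nat h0 unfolding h_def
        by (intro filterlim_atI) (auto simp: inverse_eq_divide)
      ultimately have "(\<lambda>k. ?N (h k)) \<longlonglongrightarrow> 0" by (rule filterlim_compose)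
      moreover have "?N (h k) = norm (q k w - pd j f w)" for k
      proof -
        have "q k w - pd j f w = (f (w + h k *\<^sub>R ?e) - f w - h k *\<^sub>R pd j f w) / complex_of_real (h k)"
          using h0[of k] by (simp add: q_def scaleR_conv_of_real field_simps)
        then show ?thesis by (simp add: norm_divide)
      qed
      ultimately have "(\<lambda>k. norm (q k w - pd j f w)) \<longlonglongrightarrow> 0" by simp
      then show ?thesis by (simp add: tendsto_norm_zero_iff LIM_zero_iff)
    qed
    then show "AE w in lebesgue. (\<lambda>k. indicator unit_cell w *\<^sub>R q k w) \<longlonglongrightarrow> indicator unit_cell w *\<^sub>R pd j f w"
      by (auto intro!: tendsto_intros)
    have "norm (q k w) \<le> B" for k w
    proof -
      have "norm (f (w + h k *\<^sub>R ?e) - f (w + 0 *\<^sub>R ?e)) \<le> B * norm (h k - 0)"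
      proof (rule differentiable_bound[of UNIV "\<lambda>t. f (w + t *\<^sub>R ?e)" "\<lambda>t h. h *\<^sub>R pd j f (w + t *\<^sub>R ?e)"])
        show "((\<lambda>t. f (w + t *\<^sub>R ?e)) has_derivative (\<lambda>h. h *\<^sub>R pd j f (w + t *\<^sub>R ?e))) (at t)" for t
          using der by (simp add: has_vector_derivative_def)
        show "onorm (\<lambda>h. h *\<^sub>R pd j f (w + t *\<^sub>R ?e)) \<le> B" for t
          by (intro onorm_le) (simp add: mult.commute[of B] mult_left_mono[OF B(2)])
      qed auto
      then show ?thesis using h0[of k] by (simp add: q_def norm_divide field_simps)
    qed
    then show "AE w in lebesgue. norm (indicator unit_cell w *\<^sub>R q k w) \<le> indicator unit_cell w * B" for k
      by (auto simp: indicator_def)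
  qed
  ultimately show ?thesis by (simp add: LIMSEQ_const_iff)
qed

lemma has_derivative_torus_char:
  "(torus_char n has_derivative (\<lambda>h. 2 * pi * \<i> * (\<Sum>j\<in>UNIV. of_int (n $ j) * of_real (h $ j)) * torus_char n w)) (at w)"
proof -
  have "((\<lambda>w. lattice_dot n w) has_derivative (\<lambda>h. lattice_dot n h)) (at w)"
    unfolding lattice_dot_def
    by (auto intro!: derivative_eq_intros bounded_linear.has_derivative[OF bounded_linear_vec_nth] simp: sum_2)
  from bounded_linear.has_derivative[OF bounded_linear_of_real this]
  have "((\<lambda>w. 2 * pi * \<i> * complex_of_real (lattice_dot n w)) has_derivative (\<lambda>h. 2 * pi * \<i> * complex_of_real (lattice_dot n h))) (at w)"
    by (rule has_derivative_mult_right)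
  from has_derivative_compose[OF this DERIV_exp[THEN has_field_derivative_imp_has_derivative]]
  have "((\<lambda>w. exp (2 * pi * \<i> * complex_of_real (lattice_dot n w))) has_derivative
     (\<lambda>h. exp (2 * pi * \<i> * complex_of_real (lattice_dot n w)) * (2 * pi * \<i> * complex_of_real (lattice_dot n h)))) (at w)" .
  moreover have "exp (2 * pi * \<i> * complex_of_real (lattice_dot n w)) = torus_char n w" for w
    by (simp add: torus_char_def cis_conv_exp mult_ac)
  ultimately show ?thesis by (simp add: lattice_dot_def mult_ac)
qed

lemma Ck_torus_char: "Ck k UNIV (torus_char n)"
proof -
  have "torus_char n = (\<lambda>w. exp (2 * pi * \<i> * (of_int (n $ 1) * of_real (w $ 1) + of_int (n $ 2) * of_real (w $ 2))))"
    by (simp add: fun_eq_iff torus_char_def cis_conv_exp lattice_dot_def sum_2 mult_ac)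
  then show ?thesis by (simp only:) (intro Ck_exp Ck_mult Ck_add Ck_const Ck_coord open_UNIV)
qed

lemma pd_torus_char: "pd j (torus_char n) w = 2 * pi * \<i> * of_int (n $ j) * torus_char n w"
  using exhaust_2[of j] by (subst pd_eqI[OF has_derivative_torus_char]) (auto simp: sum_2 axis_def)

text \<open>Integration by parts: the derivative of the product with a character has mean zero.\<close>

lemma torus_mean_pd_char:
  assumes f: "Ck (Suc k) UNIV f" "periodic f"
  shows "torus_mean (\<lambda>w. pd j f w * torus_char n w) = - (2 * pi * \<i> * of_int (n $ j)) * torus_mean (\<lambda>w. f w * torus_char n w)"
proof -
  have f1: "Ck (Suc 0) UNIV f" using Ck_le[OF f(1), of "Suc 0"] by simp
  have fb: "torus_bounded f" using torus_bounded_continuous[OF Ck_continuous[OF f(1)] f(2)] .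
  have pb: "torus_bounded (pd j f)"
    using f1 by (intro torus_bounded_continuous periodic_pd[OF f(2,1)]) simp
  let ?g = "\<lambda>w. f w * torus_char n w"
  have g: "Ck (Suc 0) UNIV ?g" by (intro Ck_mult f1 Ck_torus_char open_UNIV)
  have "periodic ?g" using f(2) by (simp add: periodic_def torus_char_add)
  from torus_mean_pd[OF g this, of j]
  have "torus_mean (pd j ?g) = 0" .
  moreover have "pd j ?g = (\<lambda>w. (2 * pi * \<i> * of_int (n $ j)) * ?g w + pd j f w * torus_char n w)"
  proof
    fix w
    show "pd j ?g w = (2 * pi * \<i> * of_int (n $ j)) * ?g w + pd j f w * torus_char n w"
      by (subst pd_eqI[OF has_derivative_mult[OF Ck_has_derivative[OF f1] Ck_has_derivative[OF Ck_torus_char]]])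
         (auto simp: pd_torus_char[unfolded pd_def] pd_def)
  qed
  moreover have tb: "torus_bounded (\<lambda>w. (2 * pi * \<i> * of_int (n $ j)) * ?g w)" "torus_bounded (\<lambda>w. pd j f w * torus_char n w)"
    by (intro torus_bounded_mult torus_bounded_const torus_bounded_char fb pb)+
  ultimately have "torus_mean (\<lambda>w. (2 * pi * \<i> * of_int (n $ j)) * ?g w) + torus_mean (\<lambda>w. pd j f w * torus_char n w) = 0"
    using torus_mean_add[OF tb] by simp
  then show ?thesis unfolding torus_mean_cmult by (simp add: add_eq_0_iff)
qed

lemma fourier_decay_direction:
  assumes "Ck k UNIV f" "periodic f"
  shows "\<exists>C. \<forall>n. norm (torus_mean (\<lambda>w. f w * torus_char n w)) * (2 * pi * \<bar>of_int (n $ j)\<bar>) ^ k \<le> C"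
  using assms
proof (induction k arbitrary: f)
  case 0
  obtain C where C: "\<And>w. norm (f w) \<le> C" using continuous_periodic_bounded[of f] 0 by auto
  have fb: "torus_bounded f" using torus_bounded_continuous 0 by simp
  have "norm (torus_mean (\<lambda>w. f w * torus_char n w)) \<le> C" for n
    using C by (intro norm_torus_mean_le torus_bounded_mult torus_bounded_char fb) (simp add: norm_mult)
  then show ?case by auto
next
  case (Suc k)
  have "Ck k UNIV (pd j f)" using Suc.prems by simp
  from Suc.IH[OF this periodic_pd[OF Suc.prems(2,1)]] obtain C where
    C: "\<And>n. norm (torus_mean (\<lambda>w. pd j f w * torus_char n w)) * (2 * pi * \<bar>of_int (n $ j)\<bar>) ^ k \<le> C" by blast
  have "norm (torus_mean (\<lambda>w. f w * torus_char n w)) * (2 * pi * \<bar>of_int (n $ j)\<bar>) ^ Suc k \<le> C" for n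
    using C[of n] unfolding torus_mean_pd_char[OF Suc.prems] by (simp add: norm_mult mult_ac)
  then show ?case by blast
qed

text \<open>Integrate by parts \<open>k\<close> times in the direction of the larger component of \<open>n\<close>.\<close>

lemma fourier_decay:
  assumes "Ck k UNIV f" "periodic f"
  obtains C where "C \<ge> 0" "\<And>n. norm (torus_mean (\<lambda>w. f w * torus_char n w)) * (\<bar>of_int (n $ 1)\<bar> + \<bar>of_int (n $ 2)\<bar>) ^ k \<le> C"
proof -
  let ?c = "\<lambda>n. norm (torus_mean (\<lambda>w. f w * torus_char n w))"
  obtain C1 where C1: "\<And>n. ?c n * (2 * pi * \<bar>of_int (n $ 1)\<bar>) ^ k \<le> C1" using fourier_decay_direction[OF assms, of 1] by blast
  obtain C2 where C2: "\<And>n. ?c n * (2 * pi * \<bar>of_int (n $ 2)\<bar>) ^ k \<le> C2" using fourier_decay_direction[OF assms, of 2] by blast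
  have pi2: "a + b \<le> 2 * pi * a \<or> a + b \<le> 2 * pi * b" if "a \<ge> 0" "b \<ge> 0" for a b :: real
  proof -
    have "2 * a \<le> 2 * pi * a" "2 * b \<le> 2 * pi * b"
      using mult_right_mono[of 2 "2 * pi" a] mult_right_mono[of 2 "2 * pi" b] pi_ge_two that by auto
    then show ?thesis by linarith
  qed
  have "?c n * (\<bar>of_int (n $ 1)\<bar> + \<bar>of_int (n $ 2)\<bar>) ^ k \<le> max 0 (max C1 C2)" for n
  proof -
    obtain j where "\<bar>of_int (n $ 1)\<bar> + \<bar>of_int (n $ 2)\<bar> \<le> 2 * pi * \<bar>real_of_int (n $ j)\<bar>" "j = 1 \<or> j = 2"
      using pi2[of "\<bar>of_int (n $ 1)\<bar>" "\<bar>of_int (n $ 2)\<bar>"] by fastforce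
    then have "?c n * (\<bar>of_int (n $ 1)\<bar> + \<bar>of_int (n $ 2)\<bar>) ^ k \<le> ?c n * (2 * pi * \<bar>of_int (n $ j)\<bar>) ^ k"
      by (intro mult_left_mono power_mono) auto
    also have "\<dots> \<le> max 0 (max C1 C2)" using C1[of n] C2[of n] \<open>j = 1 \<or> j = 2\<close> by auto
    finally show ?thesis .
  qed
  then show ?thesis using that[of "max 0 (max C1 C2)"] by simp
qed

lemma x_cos_le_sin: "0 \<le> x \<Longrightarrow> x \<le> pi \<Longrightarrow> x * cos x \<le> sin x"
proof -
  assume x: "0 \<le> x" "x \<le> pi"
  have "(\<lambda>x. sin x - x * cos x) 0 \<le> (\<lambda>x. sin x - x * cos x) x"
  proof (rule DERIV_nonneg_imp_nondecreasing[OF x(1)])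
    fix y assume y: "0 \<le> y" "y \<le> x"
    have "((\<lambda>x. sin x - x * cos x) has_real_derivative y * sin y) (at y)"
      by (auto intro!: derivative_eq_intros)
    moreover have "0 \<le> y * sin y" using y x by (intro mult_nonneg_nonneg sin_ge_zero) auto
    ultimately show "\<exists>z. ((\<lambda>x. sin x - x * cos x) has_real_derivative z) (at y) \<and> 0 \<le> z" by blast
  qed
  then show ?thesis by simp
qed

lemma half_le_sin:
  assumes "0 \<le> y" "y \<le> pi / 2" shows "y / 2 \<le> sin y"
proof -
  have c: "0 \<le> cos (y/2)" using assms by (intro cos_ge_zero) auto
  have "0 \<le> cos y" using assms by (intro cos_ge_zero) auto
  then have 1: "1/2 \<le> (cos (y/2))\<^sup>2" using cos_double_cos[of "y/2"] by simp
  have "y / 2 \<le> y * (cos (y/2))\<^sup>2" using mult_left_mono[OF 1 assms(1)] by simp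
  also have "\<dots> = 2 * ((y/2) * cos (y/2)) * cos (y/2)" by (simp add: power2_eq_square)
  also have "\<dots> \<le> 2 * sin (y/2) * cos (y/2)"
    using x_cos_le_sin[of "y/2"] assms c by (intro mult_right_mono mult_left_mono) auto
  also have "\<dots> = sin y" using sin_double[of "y/2"] by simp
  finally show ?thesis .
qed

text \<open>
  The distance \<open>d\<close> of \<open>x\<close> to the nearest integer is at most \<open>1/2\<close>, and the chord has length
  \<open>2 sin (\<pi> d)\<close>, which is at least \<open>\<pi> d\<close>.
\<close>

lemma infdist_le_cis: "infdist x \<int> \<le> norm (cis (2 * pi * x) - 1)"
proof -
  define k where "k = round x"
  define d where "d = \<bar>x - of_int k\<bar>"
  have d: "0 \<le> d" "d \<le> 1/2" using of_int_round_abs_le[of x] by (auto simp: d_def k_def abs_minus_commute)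
  have "infdist x \<int> \<le> d" unfolding d_def using infdist_le[of "of_int k" \<int> x] by (simp add: dist_real_def)
  also have "d \<le> pi * d" using pi_ge_two d by (simp add: mult_le_cancel_right1)
  also have "\<dots> \<le> 2 * sin (pi * d)" using half_le_sin[of "pi * d"] d by simp
  also have "\<dots> = norm (cis (2 * pi * d) - 1)"
  proof -
    have "(norm (cis (2 * pi * d) - 1))\<^sup>2 = (2 * sin (pi * d))\<^sup>2"
      using cos_double_sin[of "pi * d"] sin_cos_squared_add[of "2 * pi * d"]
      by (simp add: cmod_power2 power2_diff algebra_simps)
    moreover have "0 \<le> sin (pi * d)" using d by (intro sin_ge_zero) auto
    ultimately show ?thesis using power2_eq_imp_eq[of "norm (cis (2 * pi * d) - 1)" "2 * sin (pi * d)"] by simp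
  qed
  also have "\<dots> = norm (cis (2 * pi * (x - of_int k)) - 1)"
  proof (cases "x \<ge> of_int k")
    case False
    then have "cis (2 * pi * d) - 1 = cnj (cis (2 * pi * (x - of_int k)) - 1)"
      by (simp add: d_def cis_cnj algebra_simps)
    then show ?thesis by (metis complex_mod_cnj)
  qed (simp add: d_def)
  also have "cis (2 * pi * (x - of_int k)) = cis (2 * pi * x)"
    using cis_divide[of "2 * pi * x" "2 * pi * of_int k"] by (simp add: right_diff_distrib)
  finally show ?thesis .
qed

lemma diophantine_char:
  assumes "\<tau> \<in> diophantine c \<nu>" "n \<noteq> 0"
  shows "c * (\<bar>of_int (n $ 1)\<bar> + \<bar>of_int (n $ 2)\<bar>) powr (- \<nu>) \<le> norm (torus_char n \<tau> - 1)"
proof -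
  have "infdist (lattice_dot n \<tau>) \<int> \<ge> c * of_int (\<Sum>j\<in>UNIV. \<bar>n $ j\<bar>) powr (- \<nu>)"
    using assms unfolding diophantine_def by blast
  with infdist_le_cis[of "lattice_dot n \<tau>"] show ?thesis by (simp add: torus_char_def sum_2)
qed

lemma diophantine_nonresonant:
  assumes "\<tau> \<in> diophantine c \<nu>" "c > 0" shows "nonresonant \<tau>"
  unfolding nonresonant_def
proof (intro allI impI)
  fix n :: "int^2" assume n: "n \<noteq> 0"
  then have "0 < \<bar>real_of_int (n $ 1)\<bar> + \<bar>of_int (n $ 2)\<bar>" by (auto simp: vec_eq_iff forall_2)
  then have "0 < c * (\<bar>of_int (n $ 1)\<bar> + \<bar>of_int (n $ 2)\<bar>) powr (- \<nu>)" using assms(2) by simp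
  with diophantine_char[OF assms(1) n] show "torus_char n \<tau> \<noteq> 1" by auto
qed

text \<open>Two new terms are together at most the decrease of \<open>4 / (N + 1)\<close>, so the bound telescopes.\<close>

lemma sum_int_square_bound: "(\<Sum>a\<in>{- int N..int N}. 1 / (1 + (real_of_int a)\<^sup>2)) \<le> 5 - 4 / real (Suc N)"
proof (induction N)
  case (Suc N)
  have e: "{- int (Suc N)..int (Suc N)} = insert (- int (Suc N)) (insert (int (Suc N)) {- int N..int N})" by auto
  have "(\<Sum>a\<in>{- int (Suc N)..int (Suc N)}. 1 / (1 + (real_of_int a)\<^sup>2))
     = 2 / (1 + (real (Suc N))\<^sup>2) + (\<Sum>a\<in>{- int N..int N}. 1 / (1 + (real_of_int a)\<^sup>2))"
    unfolding e by (subst sum.insert; (subst sum.insert)?; auto simp: power2_eq_square field_simps)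
  also have "\<dots> \<le> 2 / (1 + (real (Suc N))\<^sup>2) + (5 - 4 / real (Suc N))" using Suc by simp
  also have "2 / (1 + (real (Suc N))\<^sup>2) \<le> 4 / (real (Suc N) * real (Suc (Suc N)))"
    by (simp add: divide_simps power2_eq_square) (simp add: algebra_simps)
  also have "4 / (real (Suc N) * real (Suc (Suc N))) = 4 / real (Suc N) - 4 / real (Suc (Suc N))"
    by (simp add: divide_simps)
  finally show ?case by simp
qed simp

text \<open>
  A summable majorant on the lattice. For nonzero \<open>n\<close> it is at least a fixed multiple of the
  inverse fourth power of the length of \<open>n\<close>, which is why four derivatives beyond \<open>\<nu>\<close> suffice
  for the cohomological equation.
\<close>

definition lattice_weight :: "int^2 \<Rightarrow> real" where
  "lattice_weight n = 1 / ((1 + (of_int (n $ 1))\<^sup>2) * (1 + (of_int (n $ 2))\<^sup>2))"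

lemma summable_lattice_weight: "lattice_weight summable_on UNIV"
proof (rule nonneg_bdd_above_summable_on)
  show "0 \<le> lattice_weight n" for n by (simp add: lattice_weight_def)
  let ?g = "\<lambda>a::int. 1 / (1 + (real_of_int a)\<^sup>2)"
  have fin: "sum ?g A \<le> 5" if "finite A" for A
  proof -
    obtain N where N: "\<And>a. a \<in> A \<Longrightarrow> nat \<bar>a\<bar> \<le> N"
      using finite_nat_set_iff_bounded_le[of "(\<lambda>a. nat \<bar>a\<bar>) ` A"] \<open>finite A\<close> by auto
    then have "A \<subseteq> {- int N..int N}" by fastforce
    then have "sum ?g A \<le> sum ?g {- int N..int N}" by (intro sum_mono2) auto
    also have "\<dots> \<le> 5" using sum_int_square_bound[of N] by (smt (verit) divide_nonneg_nonneg of_nat_0_le_iff)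
    finally show ?thesis .
  qed
  have "sum lattice_weight F \<le> 25" if F: "finite F" for F :: "(int^2) set"
  proof -
    let ?p = "\<lambda>n::int^2. (n $ 1, n $ 2)"
    have inj: "inj_on ?p F" by (auto simp: inj_on_def vec_eq_iff forall_2)
    let ?A = "(\<lambda>n. n $ 1) ` F" let ?B = "(\<lambda>n. n $ 2) ` F"
    have "sum lattice_weight F = sum (\<lambda>(a, b). ?g a * ?g b) (?p ` F)"
      by (subst sum.reindex[OF inj]) (simp add: lattice_weight_def)
    also have "\<dots> \<le> sum (\<lambda>(a, b). ?g a * ?g b) (?A \<times> ?B)"
      using F by (intro sum_mono2) auto
    also have "\<dots> = sum ?g ?A * sum ?g ?B" by (simp add: sum_product sum.cartesian_product)
    also have "\<dots> \<le> 5 * 5" using F by (intro mult_mono fin sum_nonneg) auto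
    finally show ?thesis by simp
  qed
  then show "bdd_above (sum lattice_weight ` {F. F \<subseteq> UNIV \<and> finite F})" by (auto simp: bdd_above_def)
qed

lemma tendsto_torus_mean:
  assumes u: "uniform_limit UNIV f g F" and f: "\<And>x. torus_bounded (f x)" and g: "torus_bounded g"
  shows "((\<lambda>x. torus_mean (f x)) \<longlongrightarrow> torus_mean g) F"
proof (rule tendstoI)
  fix e :: real assume "e > 0"
  then have "\<forall>\<^sub>F x in F. \<forall>w\<in>UNIV. dist (f x w) (g w) < e / 2"
    using uniform_limitD[OF u, of "e / 2"] by simp
  then show "\<forall>\<^sub>F x in F. dist (torus_mean (f x)) (torus_mean g) < e"
  proof eventually_elim
    case (elim x)
    have g': "torus_bounded (\<lambda>w. (- 1) * g w)" by (intro torus_bounded_mult torus_bounded_const g)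
    have "torus_mean (f x) - torus_mean g = torus_mean (\<lambda>w. f x w + (- 1) * g w)"
      unfolding torus_mean_add[OF f g'] torus_mean_cmult by simp
    also have "norm \<dots> \<le> e / 2"
      using elim by (intro norm_torus_mean_le torus_bounded_add f g') (simp add: dist_norm less_imp_le)
    finally show ?case using \<open>e > 0\<close> by (simp add: dist_norm)
  qed
qed

text \<open>
  The coefficients of \<open>\<psi>\<close> are those of \<open>H\<close> divided by \<open>torus_char n \<tau> - 1\<close>. Of the \<open>r\<close> orders of
  decay, \<open>\<nu>\<close> pay for the small divisors and four for absolute convergence. The two sides of the
  equation have the same Fourier coefficients and are continuous, so they agree everywhere.
\<close>

theorem cohomological_equation:
  assumes \<tau>: "\<tau> \<in> diophantine c \<nu>" "c > 0" and H: "Ck r UNIV H" "periodic H" and r: "real r \<ge> \<nu> + 4"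
  obtains \<psi> where "continuous_on UNIV \<psi>" "periodic \<psi>" "\<And>w. H w = torus_mean H + \<psi> (w + \<tau>) - \<psi> w"
proof -
  define fc where "fc n = torus_mean (\<lambda>w. H w * torus_char (- n) w)" for n
  define a where "a n = (if n = 0 then 0 else fc n / (torus_char n \<tau> - 1))" for n
  have Hc: "continuous_on UNIV H" using Ck_continuous[OF H(1)] .
  have Hb: "torus_bounded H" using torus_bounded_continuous[OF Hc H(2)] .
  have nr: "torus_char n \<tau> - 1 \<noteq> 0" if "n \<noteq> 0" for n
    using diophantine_nonresonant[OF \<tau>] that unfolding nonresonant_def by simp
  obtain C where C: "C \<ge> 0" "\<And>n. norm (torus_mean (\<lambda>w. H w * torus_char n w)) * (\<bar>of_int (n $ 1)\<bar> + \<bar>of_int (n $ 2)\<bar>) ^ r \<le> C"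
    using fourier_decay[OF H] by blast
  define K where "K = 4 * C / c"
  have K: "K \<ge> 0" using C(1) \<tau>(2) by (simp add: K_def)
  have an: "norm (a n) \<le> K * lattice_weight n" for n
  proof (cases "n = 0")
    case True
    then show ?thesis using K by (simp add: a_def lattice_weight_def)
  next
    case False
    define s where "s = \<bar>real_of_int (n $ 1)\<bar> + \<bar>real_of_int (n $ 2)\<bar>"
    have "1 \<le> \<bar>n $ 1\<bar> + \<bar>n $ 2\<bar>" using False by (auto simp: vec_eq_iff forall_2)
    then have s1: "s \<ge> 1" unfolding s_def by linarith
    have f: "norm (fc n) * s ^ r \<le> C" using C(2)[of "- n"] by (simp add: fc_def s_def)
    have d: "c * s powr (- \<nu>) \<le> norm (torus_char n \<tau> - 1)"
      using diophantine_char[OF \<tau>(1) False] by (simp add: s_def)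
    have p: "s ^ 4 * s powr \<nu> \<le> s ^ r"
    proof -
      have "s ^ 4 * s powr \<nu> = s powr (4 + \<nu>)"
        using s1 by (simp add: powr_add powr_numeral)
      also have "\<dots> \<le> s powr (real r)" using s1 r by (intro powr_mono) auto
      finally show ?thesis using s1 by (simp add: powr_realpow)
    qed
    have sp: "s powr \<nu> > 0" using s1 by simp
    have "norm (fc n) * (s ^ 4 * s powr \<nu>) \<le> C"
      using mult_left_mono[OF p norm_ge_zero[of "fc n"]] f by linarith
    then have f2: "norm (fc n) * s ^ 4 \<le> C * s powr (- \<nu>)"
      using sp by (simp add: powr_minus field_simps)
    have pos: "norm (torus_char n \<tau> - 1) > 0" using nr[OF False] by simp
    have cs: "0 < c * s powr (- \<nu>)" using \<tau>(2) s1 by simp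
    have "norm (a n) * s ^ 4 \<le> C / c"
    proof -
      have "norm (a n) * s ^ 4 = norm (fc n) * s ^ 4 / norm (torus_char n \<tau> - 1)"
        using False by (simp add: a_def norm_divide)
      also have "\<dots> \<le> C * s powr (- \<nu>) / norm (torus_char n \<tau> - 1)"
        using f2 by (intro divide_right_mono) auto
      also have "\<dots> \<le> C * s powr (- \<nu>) / (c * s powr (- \<nu>))"
        using d C(1) mult_pos_pos[OF pos cs] by (intro divide_left_mono) auto
      also have "\<dots> = C / c" using s1 by simp
      finally show ?thesis .
    qed
    moreover have w: "(1 + (real_of_int (n $ 1))\<^sup>2) * (1 + (real_of_int (n $ 2))\<^sup>2) \<le> 4 * s ^ 4"
    proof -
      have "(real_of_int (n $ j))\<^sup>2 \<le> s\<^sup>2" for j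
        using exhaust_2[of j] by (auto simp: s_def abs_le_square_iff[symmetric])
      moreover have "1 \<le> s\<^sup>2" using s1 by simp
      ultimately have "1 + (real_of_int (n $ j))\<^sup>2 \<le> 2 * s\<^sup>2" for j by (smt (verit))
      then have "(1 + (real_of_int (n $ 1))\<^sup>2) * (1 + (real_of_int (n $ 2))\<^sup>2) \<le> (2 * s\<^sup>2) * (2 * s\<^sup>2)"
        by (intro mult_mono) auto
      then show ?thesis by (simp add: power4_eq_xxxx power2_eq_square)
    qed
    ultimately have "norm (a n) * ((1 + (real_of_int (n $ 1))\<^sup>2) * (1 + (real_of_int (n $ 2))\<^sup>2)) \<le> K"
      using mult_left_mono[OF w norm_ge_zero[of "a n"]] by (simp add: K_def)
    moreover have "0 < (1 + (real_of_int (n $ 1))\<^sup>2) * (1 + (real_of_int (n $ 2))\<^sup>2)"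
      by (intro mult_pos_pos) (auto simp: add_pos_nonneg)
    ultimately show ?thesis by (simp add: lattice_weight_def pos_le_divide_eq)
  qed
  define \<psi> where "\<psi> w = (\<Sum>\<^sub>\<infinity>n. a n * torus_char n w)" for w
  have wsum: "(\<lambda>n. K * lattice_weight n) summable_on UNIV"
    by (intro summable_on_cmult_right summable_lattice_weight)
  have ul: "uniform_limit UNIV (\<lambda>X w. \<Sum>n\<in>X. a n * torus_char n w) \<psi> (finite_subsets_at_top UNIV)"
    unfolding \<psi>_def by (rule Weierstrass_m_test_general[OF _ wsum]) (simp add: norm_mult an)
  have \<psi>c: "continuous_on UNIV \<psi>"
    by (rule uniform_limit_theorem[OF _ ul]) (auto intro!: always_eventually continuous_intros)
  have \<psi>p: "periodic \<psi>"
    using periodic_torus_char by (simp add: periodic_def \<psi>_def)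
  have \<psi>b: "torus_bounded \<psi>" using torus_bounded_continuous[OF \<psi>c \<psi>p] .
  have coeff: "torus_mean (\<lambda>w. \<psi> w * torus_char m w) = a (- m)" for m
  proof -
    let ?F = "\<lambda>X w. \<Sum>n\<in>X. a n * torus_char n w * torus_char m w"
    have "uniform_limit UNIV (\<lambda>X w. (\<Sum>n\<in>X. a n * torus_char n w) * torus_char m w) (\<lambda>w. \<psi> w * torus_char m w) (finite_subsets_at_top UNIV)"
    proof (rule uniform_limitI)
      fix e :: real assume "e > 0"
      from uniform_limitD[OF ul this]
      show "\<forall>\<^sub>F X in finite_subsets_at_top UNIV. \<forall>w\<in>UNIV. dist ((\<Sum>n\<in>X. a n * torus_char n w) * torus_char m w) (\<psi> w * torus_char m w) < e"
        by eventually_elim (simp add: dist_norm norm_mult flip: left_diff_distrib)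
    qed
    then have u: "uniform_limit UNIV ?F (\<lambda>w. \<psi> w * torus_char m w) (finite_subsets_at_top UNIV)"
      by (simp add: sum_distrib_right)
    have tb: "trig_poly (?F X)" for X
      by (induction X rule: infinite_finite_induct)
         (auto intro!: trig_poly_const trig_poly.add trig_poly_mult trig_poly.char)
    have tF: "torus_mean (?F X) = (if - m \<in> X then a (- m) else 0)" if "finite X" for X
      using that
    proof (induction X rule: finite_induct)
      case (insert x X)
      have t: "torus_bounded (\<lambda>w. a x * torus_char x w * torus_char m w)"
        by (intro torus_bounded_mult torus_bounded_const torus_bounded_char)
      have "torus_mean (?F (insert x X)) = torus_mean (\<lambda>w. a x * torus_char x w * torus_char m w) + torus_mean (?F X)"
        using insert torus_mean_add[OF t trig_poly_torus_bounded[OF tb[of X]]] by simp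
      also have "torus_mean (\<lambda>w. a x * torus_char x w * torus_char m w) = a x * torus_mean (torus_char (x + m))"
        unfolding torus_mean_cmult[symmetric] by (simp add: torus_char_add_left[abs_def] mult.assoc)
      also have "\<dots> = (if x = - m then a (- m) else 0)"
        unfolding torus_mean_char by (auto simp: add_eq_0_iff2)
      finally show ?case using insert by auto
    qed simp
    have "((\<lambda>X. torus_mean (?F X)) \<longlongrightarrow> torus_mean (\<lambda>w. \<psi> w * torus_char m w)) (finite_subsets_at_top UNIV)"
      by (intro tendsto_torus_mean[OF u] trig_poly_torus_bounded[OF tb] torus_bounded_mult \<psi>b torus_bounded_char)
    moreover have "((\<lambda>X. torus_mean (?F X)) \<longlongrightarrow> a (- m)) (finite_subsets_at_top UNIV)"
      by (rule tendsto_eventually) (auto simp: eventually_finite_subsets_at_top tF intro!: exI[of _ "{- m}"])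
    ultimately show ?thesis by (rule tendsto_unique[OF finite_subsets_at_top_neq_bot])
  qed
  define R where "R w = H w + ((- torus_mean H) + ((- 1) * \<psi> (w + \<tau>) + \<psi> w))" for w
  have "continuous_on UNIV (\<lambda>w. \<psi> (w + \<tau>))"
    by (rule continuous_on_compose2[OF \<psi>c]) (auto intro!: continuous_intros)
  then have Rc: "continuous_on UNIV R" unfolding R_def by (intro continuous_intros Hc \<psi>c)
  have sb: "torus_bounded (\<lambda>w. (- 1) * \<psi> (w + \<tau>))"
    by (intro torus_bounded_mult torus_bounded_const torus_bounded_shift \<psi>b)
  have R0: "AE w in lebesgue. R w = 0"
  proof (rule torus_fourier_complete)
    show "torus_bounded R" unfolding R_def by (intro torus_bounded_add Hb sb \<psi>b torus_bounded_const)
    fix m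
    have "torus_mean (\<lambda>w. R w * torus_char m w) = torus_mean (\<lambda>w. H w * torus_char m w +
       ((- torus_mean H) * torus_char m w + ((- 1) * (\<psi> (w + \<tau>) * torus_char m w) + \<psi> w * torus_char m w)))"
      by (simp add: R_def algebra_simps)
    also have "\<dots> = torus_mean (\<lambda>w. H w * torus_char m w) + (torus_mean (\<lambda>w. (- torus_mean H) * torus_char m w)
       + (torus_mean (\<lambda>w. (- 1) * (\<psi> (w + \<tau>) * torus_char m w)) + torus_mean (\<lambda>w. \<psi> w * torus_char m w)))"
      by (subst torus_mean_add; (subst torus_mean_add)?; (subst torus_mean_add)?;
          (intro refl torus_bounded_add torus_bounded_mult torus_bounded_const torus_bounded_shift torus_bounded_char Hb \<psi>b)?)
    also have "\<dots> = fc (- m) - torus_mean H * (if m = 0 then 1 else 0) - (torus_char (- m) \<tau> - 1) * a (- m)"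
      unfolding torus_mean_cmult torus_mean_shift_char[OF \<psi>b] coeff torus_mean_char
      by (simp add: fc_def algebra_simps)
    also have "\<dots> = 0"
      using nr[of "- m"] by (auto simp: a_def fc_def)
    finally show "torus_mean (\<lambda>w. R w * torus_char m w) = 0" .
  qed
  have "H w = torus_mean H + \<psi> (w + \<tau>) - \<psi> w" for w
    using continuous_AE_zero[OF Rc R0, of w] by (simp add: R_def algebra_simps)
  with \<psi>c \<psi>p that show ?thesis by blast
qed

section \<open>Holomorphic extensions to polydiscs\<close>

abbreviation polydisc :: "real \<Rightarrow> (complex \<times> complex) set" where
  "polydisc r \<equiv> ball 0 r \<times> ball 0 r"

text \<open>
  Holomorphy in two variables in a form that passes to uniform limits and reduces to statements
  about one complex variable.
\<close>

definition sep_hol :: "real \<Rightarrow> (complex \<times> complex \<Rightarrow> complex) \<Rightarrow> bool" where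
  "sep_hol r \<phi> \<longleftrightarrow> continuous_on (polydisc r) \<phi> \<and>
     (\<forall>b\<in>ball 0 r. (\<lambda>a. \<phi> (a, b)) holomorphic_on ball 0 r) \<and>
     (\<forall>a\<in>ball 0 r. (\<lambda>b. \<phi> (a, b)) holomorphic_on ball 0 r)"

lemma sep_hol_subset: "sep_hol r \<phi> \<Longrightarrow> s \<le> r \<Longrightarrow> sep_hol s \<phi>"
  unfolding sep_hol_def
  by (auto intro!: holomorphic_on_subset[of _ "ball 0 r" "ball 0 s"] elim: continuous_on_subset)

lemma sep_hol_continuous_compose:
  assumes "sep_hol r \<phi>" "continuous_on S p" "\<And>x. x \<in> S \<Longrightarrow> p x \<in> polydisc r"
  shows "continuous_on S (\<lambda>x. \<phi> (p x))"
proof (rule continuous_on_compose2[OF _ assms(2)])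
  show "continuous_on (polydisc r) \<phi>" using assms(1) by (simp add: sep_hol_def)
  show "p ` S \<subseteq> polydisc r" using assms(3) by blast
qed

lemma sep_hol_const [intro]: "sep_hol r (\<lambda>z. c)"
  by (simp add: sep_hol_def)

lemma sep_hol_add [intro]: "sep_hol r f \<Longrightarrow> sep_hol r g \<Longrightarrow> sep_hol r (\<lambda>z. f z + g z)"
  unfolding sep_hol_def by (auto intro!: continuous_intros holomorphic_intros)

lemma sep_hol_diff [intro]: "sep_hol r f \<Longrightarrow> sep_hol r g \<Longrightarrow> sep_hol r (\<lambda>z. f z - g z)"
  unfolding sep_hol_def by (auto intro!: continuous_intros holomorphic_intros)

lemma sep_hol_mult [intro]: "sep_hol r f \<Longrightarrow> sep_hol r g \<Longrightarrow> sep_hol r (\<lambda>z. f z * g z)"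
  unfolding sep_hol_def by (auto intro!: continuous_intros holomorphic_intros)

lemma sep_hol_uminus [intro]: "sep_hol r f \<Longrightarrow> sep_hol r (\<lambda>z. - f z)"
  unfolding sep_hol_def by (auto intro!: continuous_intros holomorphic_intros)

lemma sep_hol_divide:
  "sep_hol r f \<Longrightarrow> sep_hol r g \<Longrightarrow> (\<And>z. z \<in> polydisc r \<Longrightarrow> g z \<noteq> 0) \<Longrightarrow> sep_hol r (\<lambda>z. f z / g z)"
  unfolding sep_hol_def by (auto intro!: continuous_intros holomorphic_intros simp del: mem_ball mem_ball_0)

lemma sep_hol_swap: "sep_hol r \<phi> \<Longrightarrow> sep_hol r (\<lambda>(a, b). \<phi> (b, a))"
proof -
  assume \<phi>: "sep_hol r \<phi>"
  have "continuous_on (polydisc r) (\<lambda>z. \<phi> (snd z, fst z))"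
    by (rule sep_hol_continuous_compose[OF \<phi>]) (auto intro!: continuous_intros)
  then show ?thesis using \<phi> by (simp add: sep_hol_def case_prod_unfold)
qed

lemma sep_hol_uniform_limit:
  assumes f: "\<And>n. sep_hol r (f n)" and u: "uniform_limit (polydisc r) f g sequentially"
  shows "sep_hol r g"
  unfolding sep_hol_def
proof (intro conjI ballI)
  show "continuous_on (polydisc r) g"
    by (rule uniform_limit_theorem[OF _ u]) (use f in \<open>auto simp: sep_hol_def\<close>)
  have sub: "\<exists>d>0. cball x d \<subseteq> ball 0 r" if "x \<in> ball 0 r" for x :: complex
    using that open_contains_cball[of "ball (0::complex) r"] by auto
  show "(\<lambda>a. g (a, b)) holomorphic_on ball 0 r" if b: "b \<in> ball 0 r" for b
  proof (rule holomorphic_uniform_sequence[of _ "\<lambda>n a. f n (a, b)"])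
    fix x :: complex assume "x \<in> ball 0 r"
    then obtain d where d: "d > 0" "cball x d \<subseteq> ball 0 r" using sub by blast
    have "uniform_limit (cball x d) (\<lambda>n a. f n (a, b)) (\<lambda>a. g (a, b)) sequentially"
    proof (rule uniform_limitI)
      fix e :: real assume "e > 0"
      from uniform_limitD[OF u this]
      show "\<forall>\<^sub>F n in sequentially. \<forall>a\<in>cball x d. dist (f n (a, b)) (g (a, b)) < e"
        by eventually_elim (use d b in blast)
    qed
    then show "\<exists>d>0. cball x d \<subseteq> ball 0 r \<and> uniform_limit (cball x d) (\<lambda>n a. f n (a, b)) (\<lambda>a. g (a, b)) sequentially"
      using d by blast
  qed (use f b in \<open>auto simp: sep_hol_def\<close>)
  show "(\<lambda>b. g (a, b)) holomorphic_on ball 0 r" if a: "a \<in> ball 0 r" for a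
  proof (rule holomorphic_uniform_sequence[of _ "\<lambda>n b. f n (a, b)"])
    fix x :: complex assume "x \<in> ball 0 r"
    then obtain d where d: "d > 0" "cball x d \<subseteq> ball 0 r" using sub by blast
    have "uniform_limit (cball x d) (\<lambda>n b. f n (a, b)) (\<lambda>b. g (a, b)) sequentially"
    proof (rule uniform_limitI)
      fix e :: real assume "e > 0"
      from uniform_limitD[OF u this]
      show "\<forall>\<^sub>F n in sequentially. \<forall>b\<in>cball x d. dist (f n (a, b)) (g (a, b)) < e"
        by eventually_elim (use d a in blast)
    qed
    then show "\<exists>d>0. cball x d \<subseteq> ball 0 r \<and> uniform_limit (cball x d) (\<lambda>n b. f n (a, b)) (\<lambda>b. g (a, b)) sequentially"
      using d by blast
  qed (use f a in \<open>auto simp: sep_hol_def\<close>)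
qed

lemma cauchy_deriv_bound:
  assumes f: "f holomorphic_on ball 0 R" and M: "\<And>z. z \<in> ball 0 R \<Longrightarrow> norm (f z) \<le> M"
    and d: "d > 0" "norm z + d < R"
  shows "norm ((deriv ^^ n) f z) \<le> fact n * M / d ^ n"
proof (rule Cauchy_inequality)
  have s: "cball z d \<subseteq> ball 0 R"
  proof
    fix x assume "x \<in> cball z d"
    then have "norm x \<le> norm z + d" using norm_triangle_sub[of x z] by (simp add: dist_norm norm_minus_commute)
    then show "x \<in> ball 0 R" using d by simp
  qed
  then show "f holomorphic_on ball z d" using f by (meson ball_subset_cball holomorphic_on_subset order_trans)
  show "continuous_on (cball z d) f" using holomorphic_on_imp_continuous_on[OF f] s by (rule continuous_on_subset)
  show "norm (f x) \<le> M" if "norm (z - x) = d" for x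
    using that s by (intro M) (auto simp: dist_norm)
qed (use d in simp)

text \<open>
  Taylor's formula with the Cauchy estimate for the second derivative; the rate depends only on
  \<open>M\<close> and \<open>d\<close>.
\<close>

lemma difference_quotient_bound:
  assumes f: "f holomorphic_on ball 0 R" and M: "\<And>z. z \<in> ball 0 R \<Longrightarrow> norm (f z) \<le> M"
    and d: "d > 0" "norm z + 2 * d < R" and h: "h \<noteq> 0" "norm h \<le> d"
  shows "norm ((f (z + h) - f z) / h - deriv f z) \<le> 2 * M / d\<^sup>2 * norm h"
proof -
  let ?S = "cball 0 (norm z + d) :: complex set"
  have sub: "?S \<subseteq> ball 0 R" using d by auto
  have "norm ((deriv ^^ 0) f (z + h) - (\<Sum>i\<le>1. (deriv ^^ i) f z * ((z + h) - z) ^ i / fact i)) \<le> (2 * M / d\<^sup>2) * norm ((z + h) - z) ^ Suc 1 / fact 1"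
  proof (rule complex_Taylor[of ?S 1 "\<lambda>i. (deriv ^^ i) f"])
    show "((deriv ^^ i) f has_field_derivative (deriv ^^ Suc i) f x) (at x within ?S)" if "x \<in> ?S" for i x
      by (rule has_field_derivative_at_within, rule has_field_derivative_higher_deriv[OF f open_ball]) (use that sub in blast)
    show "norm ((deriv ^^ Suc 1) f x) \<le> 2 * M / d\<^sup>2" if "x \<in> ?S" for x
    proof -
      have "norm x + d < R" using that d by simp
      then have "norm ((deriv ^^ 2) f x) \<le> fact 2 * M / d ^ 2"
        using cauchy_deriv_bound[of f R M d x 2] f M d(1) by blast
      then show ?thesis by (simp only: Suc_1 fact_2)
    qed
    show "z + h \<in> ?S" using h norm_triangle_le[of z h "norm z + d"] by simp
    show "z \<in> ?S" using d by simp
  qed simp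
  then have "norm (f (z + h) - f z - deriv f z * h) \<le> 2 * M / d\<^sup>2 * norm h * norm h"
    by (simp add: algebra_simps power2_eq_square)
  then have "norm (f (z + h) - f z - deriv f z * h) / norm h \<le> 2 * M / d\<^sup>2 * norm h"
    using h by (simp add: pos_divide_le_eq)
  moreover have "(f (z + h) - f z) / h - deriv f z = (f (z + h) - f z - deriv f z * h) / h"
    using h by (simp add: field_simps)
  ultimately show ?thesis by (simp add: norm_divide)
qed

definition deriv1 :: "(complex \<times> complex \<Rightarrow> complex) \<Rightarrow> complex \<times> complex \<Rightarrow> complex" where
  "deriv1 \<phi> = (\<lambda>(a, b). deriv (\<lambda>a. \<phi> (a, b)) a)"

definition deriv2 :: "(complex \<times> complex \<Rightarrow> complex) \<Rightarrow> complex \<times> complex \<Rightarrow> complex" where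
  "deriv2 \<phi> = (\<lambda>(a, b). deriv (\<lambda>b. \<phi> (a, b)) b)"

text \<open>
  On the polydisc of half the radius the partial derivative is the uniform limit of difference
  quotients, so it is again holomorphic in each variable.
\<close>

lemma sep_hol_deriv1:
  assumes \<phi>: "sep_hol r \<phi>" and K: "\<And>z. z \<in> polydisc r \<Longrightarrow> norm (\<phi> z) \<le> K" and r: "r > 0"
  shows "sep_hol (r/2) (deriv1 \<phi>)" "\<And>z. z \<in> polydisc (r/2) \<Longrightarrow> norm (deriv1 \<phi> z) \<le> 4 * K / r"
proof -
  define d where "d = r / 8"
  define h where "h k = d * inverse (real (Suc k))" for k
  have h: "h k > 0" "h k \<le> d" for k
    using r by (auto simp: h_def d_def field_simps)
  define D where "D k = (\<lambda>z. (\<phi> (fst z + complex_of_real (h k), snd z) - \<phi> z) * (1 / complex_of_real (h k)))" for k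
  have in_r: "a + complex_of_real (h k) \<in> ball 0 r" if "a \<in> ball 0 (r/2)" for a k
    using that h[of k] norm_triangle_ineq[of a "complex_of_real (h k)"] r by (auto simp: d_def)
  have half: "a \<in> ball 0 r" if "a \<in> ball 0 (r/2)" for a :: complex using that r by auto
  have sh: "sep_hol (r/2) (\<lambda>z. \<phi> (fst z + complex_of_real (h k), snd z))" for k
    unfolding sep_hol_def
  proof (intro conjI ballI)
    show "continuous_on (polydisc (r/2)) (\<lambda>z. \<phi> (fst z + complex_of_real (h k), snd z))"
    proof (rule continuous_on_compose2[of "polydisc r" \<phi>])
      show "continuous_on (polydisc r) \<phi>" using \<phi> by (simp add: sep_hol_def)
      show "(\<lambda>z. (fst z + complex_of_real (h k), snd z)) ` polydisc (r/2) \<subseteq> polydisc r"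
      proof (rule image_subsetI)
        fix z assume "z \<in> polydisc (r/2)"
        then have "fst z \<in> ball 0 (r/2)" "snd z \<in> ball 0 (r/2)" by auto
        then show "(fst z + complex_of_real (h k), snd z) \<in> polydisc r"
          using in_r[of "fst z" k] half[of "snd z"] by blast
      qed
    qed (intro continuous_intros)
    show "(\<lambda>a. \<phi> (fst (a, b) + complex_of_real (h k), snd (a, b))) holomorphic_on ball 0 (r/2)" if "b \<in> ball 0 (r/2)" for b
    proof -
      have "(\<lambda>a. \<phi> (a, b)) holomorphic_on ball 0 r" using \<phi> half[OF that] by (auto simp: sep_hol_def)
      then have "((\<lambda>a. \<phi> (a, b)) \<circ> (\<lambda>a. a + complex_of_real (h k))) holomorphic_on ball 0 (r/2)"
        using in_r by (intro holomorphic_on_compose_gen[of _ _ _ "ball 0 r"] holomorphic_intros) blast+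
      then show ?thesis by (simp add: o_def)
    qed
    show "(\<lambda>b. \<phi> (fst (a, b) + complex_of_real (h k), snd (a, b))) holomorphic_on ball 0 (r/2)" if "a \<in> ball 0 (r/2)" for a
    proof -
      have "(\<lambda>b. \<phi> (a + complex_of_real (h k), b)) holomorphic_on ball 0 r"
        using \<phi> in_r[OF that, of k] unfolding sep_hol_def by blast
      then show ?thesis unfolding fst_conv snd_conv by (rule holomorphic_on_subset) (use half in blast)
    qed
  qed
  have Dh: "sep_hol (r/2) (D k)" for k
    unfolding D_def using sep_hol_subset[OF \<phi>, of "r/2"] r by (intro sep_hol_mult sep_hol_diff sh sep_hol_const) auto
  have Mb: "norm (D k z - deriv1 \<phi> z) \<le> 2 * K / d\<^sup>2 * h k" if "z \<in> polydisc (r/2)" for k z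
  proof -
    obtain a b where z: "z = (a, b)" "a \<in> ball 0 (r/2)" "b \<in> ball 0 (r/2)" using \<open>z \<in> _\<close> by auto
    have f: "(\<lambda>a. \<phi> (a, b)) holomorphic_on ball 0 r" using \<phi> half[OF z(3)] by (auto simp: sep_hol_def)
    have "norm ((\<phi> (a + complex_of_real (h k), b) - \<phi> (a, b)) / complex_of_real (h k) - deriv (\<lambda>a. \<phi> (a, b)) a)
       \<le> 2 * K / d\<^sup>2 * norm (complex_of_real (h k))"
    proof (rule difference_quotient_bound[OF f])
      show "norm (\<phi> (x, b)) \<le> K" if "x \<in> ball 0 r" for x
        using K[of "(x, b)"] that half[OF z(3)] by simp
    qed (use h[of k] r z(2) in \<open>auto simp: d_def\<close>)
    then show ?thesis using h[of k] z by (simp add: D_def deriv1_def)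
  qed
  have lim: "(\<lambda>k. 2 * K / d\<^sup>2 * h k) \<longlonglongrightarrow> 0"
    unfolding h_def using tendsto_mult_right_zero[OF LIMSEQ_inverse_real_of_nat, of "2 * K / d\<^sup>2 * d"]
    by (simp add: mult.assoc)
  have u: "uniform_limit (polydisc (r/2)) D (deriv1 \<phi>) sequentially"
  proof (rule uniform_limitI)
    fix e :: real assume "e > 0"
    then have "\<forall>\<^sub>F k in sequentially. 2 * K / d\<^sup>2 * h k < e" using lim by (rule order_tendstoD(2)[rotated])
    then show "\<forall>\<^sub>F k in sequentially. \<forall>z\<in>polydisc (r/2). dist (D k z) (deriv1 \<phi> z) < e"
    proof eventually_elim
      case (elim k)
      show ?case
      proof
        fix z assume "z \<in> polydisc (r/2)"
        from Mb[OF this, of k] elim show "dist (D k z) (deriv1 \<phi> z) < e" by (simp add: dist_norm)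
      qed
    qed
  qed
  show "sep_hol (r/2) (deriv1 \<phi>)" by (rule sep_hol_uniform_limit[OF Dh u])
  show "norm (deriv1 \<phi> z) \<le> 4 * K / r" if "z \<in> polydisc (r/2)" for z
  proof -
    obtain a b where z: "z = (a, b)" "a \<in> ball 0 (r/2)" "b \<in> ball 0 (r/2)" using \<open>z \<in> _\<close> by auto
    have f: "(\<lambda>a. \<phi> (a, b)) holomorphic_on ball 0 r" using \<phi> half[OF z(3)] by (auto simp: sep_hol_def)
    have "norm ((deriv ^^ 1) (\<lambda>a. \<phi> (a, b)) a) \<le> fact 1 * K / (r/4) ^ 1"
    proof (rule cauchy_deriv_bound[OF f])
      show "norm (\<phi> (x, b)) \<le> K" if "x \<in> ball 0 r" for x
        using K[of "(x, b)"] that half[OF z(3)] by simp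
    qed (use r z(2) in auto)
    then show ?thesis using z by (simp add: deriv1_def mult.commute)
  qed
qed

lemma sep_hol_deriv2:
  assumes \<phi>: "sep_hol r \<phi>" and K: "\<And>z. z \<in> polydisc r \<Longrightarrow> norm (\<phi> z) \<le> K" and r: "r > 0"
  shows "sep_hol (r/2) (deriv2 \<phi>)" "\<And>z. z \<in> polydisc (r/2) \<Longrightarrow> norm (deriv2 \<phi> z) \<le> 4 * K / r"
proof -
  let ?s = "\<lambda>(a, b). \<phi> (b, a)"
  have e: "deriv2 \<phi> = (\<lambda>(a, b). deriv1 ?s (b, a))" by (auto simp: deriv1_def deriv2_def)
  have s: "sep_hol r ?s" using sep_hol_swap[OF \<phi>] .
  have K': "norm (?s z) \<le> K" if "z \<in> polydisc r" for z using K that by (auto split: prod.splits)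
  show "sep_hol (r/2) (deriv2 \<phi>)" unfolding e by (rule sep_hol_swap[OF sep_hol_deriv1(1)[OF s K' r]])
  show "norm (deriv2 \<phi> z) \<le> 4 * K / r" if "z \<in> polydisc (r/2)" for z
  proof -
    have "norm (deriv1 ?s (snd z, fst z)) \<le> 4 * K / r"
      using sep_hol_deriv1(2)[OF s K' r, of "(snd z, fst z)"] that by auto
    then show ?thesis unfolding e by (simp add: case_prod_unfold)
  qed
qed

text \<open>
  Differentiability in both real variables follows from the two partial derivatives because the
  second one is jointly continuous.
\<close>

lemma sep_hol_real_derivative:
  assumes \<phi>: "sep_hol r \<phi>" and K: "\<And>z. z \<in> polydisc r \<Longrightarrow> norm (\<phi> z) \<le> K" and r: "r > 0"
    and xy: "\<bar>x\<bar> < r/2" "\<bar>y\<bar> < r/2"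
  shows "((\<lambda>(x, y). \<phi> (complex_of_real x, complex_of_real y)) has_derivative
     (\<lambda>(s, t). complex_of_real s * deriv1 \<phi> (complex_of_real x, complex_of_real y) +
               complex_of_real t * deriv2 \<phi> (complex_of_real x, complex_of_real y))) (at (x, y))"
proof -
  let ?X = "{-r/2<..<r/2}"
  let ?fy = "\<lambda>x y. blinfun_scaleR_left (deriv2 \<phi> (complex_of_real x, complex_of_real y))"
  have mem: "complex_of_real t \<in> ball 0 (r/2)" "complex_of_real t \<in> ball 0 r" if "t \<in> ?X" for t
    using that r by auto
  have "((\<lambda>(x, y). \<phi> (complex_of_real x, complex_of_real y)) has_derivative
     (\<lambda>(s, t). s *\<^sub>R deriv1 \<phi> (complex_of_real x, complex_of_real y) + blinfun_apply (?fy x y) t)) (at (x, y) within ?X \<times> ?X)"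
  proof (rule has_derivative_partialsI)
    have x: "x \<in> ?X" and y: "y \<in> ?X" using xy by auto
    have "((\<lambda>a. \<phi> (a, complex_of_real y)) has_field_derivative deriv1 \<phi> (complex_of_real x, complex_of_real y)) (at (complex_of_real x))"
      using \<phi> mem[OF x] mem[OF y] unfolding sep_hol_def deriv1_def
      by (auto intro!: holomorphic_derivI[of _ "ball 0 r"] simp del: mem_ball mem_ball_0)
    then have "((\<lambda>x. \<phi> (complex_of_real x, complex_of_real y)) has_vector_derivative deriv1 \<phi> (complex_of_real x, complex_of_real y)) (at x)"
      by (rule has_vector_derivative_real_field)
    then show "((\<lambda>x. \<phi> (complex_of_real x, complex_of_real y)) has_derivative (\<lambda>s. s *\<^sub>R deriv1 \<phi> (complex_of_real x, complex_of_real y))) (at x within ?X)"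
      unfolding has_vector_derivative_def by (rule has_derivative_at_withinI)
    show "((\<lambda>y. \<phi> (complex_of_real x, complex_of_real y)) has_derivative blinfun_apply (?fy x y)) (at y within ?X)"
      if "x \<in> ?X" "y \<in> ?X" for x y
    proof -
      have "((\<lambda>b. \<phi> (complex_of_real x, b)) has_field_derivative deriv2 \<phi> (complex_of_real x, complex_of_real y)) (at (complex_of_real y))"
        using \<phi> mem[OF that(1)] mem[OF that(2)] unfolding sep_hol_def deriv2_def
        by (auto intro!: holomorphic_derivI[of _ "ball 0 r"] simp del: mem_ball mem_ball_0)
      then have "((\<lambda>y. \<phi> (complex_of_real x, complex_of_real y)) has_vector_derivative deriv2 \<phi> (complex_of_real x, complex_of_real y)) (at y)"
        by (rule has_vector_derivative_real_field)
      then show ?thesis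
        unfolding has_vector_derivative_def by (simp add: has_derivative_at_withinI)
    qed
    show "y \<in> ?X" by fact
    show "convex ?X" by simp
    have "continuous_on (?X \<times> ?X) (\<lambda>z. deriv2 \<phi> (complex_of_real (fst z), complex_of_real (snd z)))"
    proof (rule sep_hol_continuous_compose[OF sep_hol_deriv2(1)[OF \<phi> K r]])
      show "(complex_of_real (fst z), complex_of_real (snd z)) \<in> polydisc (r/2)" if "z \<in> ?X \<times> ?X" for z
        using that mem[of "fst z"] mem[of "snd z"] by (auto simp: mem_Times_iff)
    qed (auto intro!: continuous_intros)
    then have "continuous_on (?X \<times> ?X) (\<lambda>z. blinfun_scaleR_left (deriv2 \<phi> (complex_of_real (fst z), complex_of_real (snd z))))"
      by (rule bounded_linear.continuous_on[OF bounded_linear_blinfun_scaleR_left])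
    then show "continuous (at (x, y) within ?X \<times> ?X) (\<lambda>(x, y). ?fy x y)"
      using x y by (auto simp: continuous_on_eq_continuous_within case_prod_unfold)
  qed
  moreover have "(x, y) \<in> ?X \<times> ?X" "open (?X \<times> ?X)" using xy by (auto intro: open_Times)
  moreover from this have "at (x, y) within ?X \<times> ?X = at (x, y)" by (rule at_within_open)
  ultimately show ?thesis by (simp only: scaleR_conv_of_real blinfun_scaleR_left.rep_eq)
qed

definition square :: "real^2 \<Rightarrow> real \<Rightarrow> (real^2) set" where
  "square c r = {w. \<forall>j. \<bar>w $ j - c $ j\<bar> < r}"

lemma open_square: "open (square c r)"
proof -
  have "square c r = (\<Inter>j. {w. \<bar>w $ j - c $ j\<bar> < r})" by (auto simp: square_def)
  also have "open \<dots>" by (intro open_INT) (auto intro!: open_Collect_less continuous_intros)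
  finally show ?thesis .
qed

lemma center_in_square: "r > 0 \<Longrightarrow> c \<in> square c r"
  by (simp add: square_def)

definition real_point :: "real^2 \<Rightarrow> complex \<times> complex" where
  "real_point h = (complex_of_real (h $ 1), complex_of_real (h $ 2))"

lemma real_point_in: "w \<in> square c r \<longleftrightarrow> real_point (w - c) \<in> polydisc r"
  by (simp add: square_def real_point_def forall_2 del: of_real_diff)

lemma continuous_real_point [continuous_intros]:
  "continuous_on S f \<Longrightarrow> continuous_on S (\<lambda>x. real_point (f x))"
  unfolding real_point_def by (intro continuous_intros)

text \<open>Each differentiation halves the radius, hence the neighbourhood depends on the order \<open>n\<close>.\<close>

lemma sep_hol_Ck:
  assumes "sep_hol r \<phi>" "\<And>z. z \<in> polydisc r \<Longrightarrow> norm (\<phi> z) \<le> K" "r > 0"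
  shows "\<exists>s>0. s \<le> r \<and> Ck n (square c s) (\<lambda>w. \<phi> (real_point (w - c)))"
  using assms
proof (induction n arbitrary: r \<phi> K)
  case 0
  have "continuous_on (square c r) (\<lambda>w. \<phi> (real_point (w - c)))"
    by (rule sep_hol_continuous_compose[OF 0(1)]) (auto intro!: continuous_intros simp: real_point_in[symmetric] simp del: mem_ball mem_ball_0)
  then show ?case using 0(3) by auto
next
  case (Suc n)
  have r2: "r/2 > 0" using Suc.prems by simp
  obtain s1 where s1: "s1 > 0" "s1 \<le> r/2" "Ck n (square c s1) (\<lambda>w. deriv1 \<phi> (real_point (w - c)))"
    using Suc.IH[OF sep_hol_deriv1[OF Suc.prems] r2] by blast
  obtain s2 where s2: "s2 > 0" "s2 \<le> r/2" "Ck n (square c s2) (\<lambda>w. deriv2 \<phi> (real_point (w - c)))"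
    using Suc.IH[OF sep_hol_deriv2[OF Suc.prems] r2] by blast
  let ?s = "min s1 s2"
  have sub: "square c ?s \<subseteq> square c s1" "square c ?s \<subseteq> square c s2" by (auto simp: square_def)
  have "Ck (Suc n) (square c ?s) (\<lambda>w. \<phi> (real_point (w - c)))"
  proof (rule Ck_SucI[OF open_square])
    fix w assume w: "w \<in> square c ?s"
    let ?g = "\<lambda>w::real^2. (w $ 1 - c $ 1, w $ 2 - c $ 2)"
    have g: "(?g has_derivative (\<lambda>h. (h $ 1, h $ 2))) (at w)"
      by (auto intro!: derivative_eq_intros bounded_linear.has_derivative[OF bounded_linear_vec_nth])
    have "\<bar>w $ 1 - c $ 1\<bar> < r/2" "\<bar>w $ 2 - c $ 2\<bar> < r/2"
      using w s1(2) s2(2) by (auto simp: square_def forall_2)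
    from has_derivative_compose[OF g sep_hol_real_derivative[OF Suc.prems this]]
    show "((\<lambda>w. \<phi> (real_point (w - c))) has_derivative
      (\<lambda>h. complex_of_real (h $ 1) * deriv1 \<phi> (real_point (w - c)) + complex_of_real (h $ 2) * deriv2 \<phi> (real_point (w - c)))) (at w)"
      by (simp add: real_point_def)
  next
    show "Ck n (square c ?s) (\<lambda>w. complex_of_real (axis j 1 $ 1) * deriv1 \<phi> (real_point (w - c)) + complex_of_real (axis j 1 $ 2) * deriv2 \<phi> (real_point (w - c)))" for j
      using Ck_subset[OF s1(3) sub(1)] Ck_subset[OF s2(3) sub(2)]
      by (intro Ck_add Ck_mult Ck_const open_square)
  qed
  then show ?case using s1 s2 by (intro exI[of _ ?s]) auto
qed

lemma sep_hol_lipschitz: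
  assumes \<phi>: "sep_hol r \<phi>" and K: "\<And>z. z \<in> polydisc r \<Longrightarrow> norm (\<phi> z) \<le> K" and r: "r > 0"
    and ab: "norm a < r/2" "norm b < r/2"
  shows "norm (\<phi> (a, b) - \<phi> (0, 0)) \<le> 4 * K / r * (norm a + norm b)"
proof -
  have 1: "norm (\<phi> (a, b) - \<phi> (0, b)) \<le> 4 * K / r * norm (a - 0)"
  proof (rule field_differentiable_bound[of "ball 0 (r/2)" "\<lambda>a. \<phi> (a, b)" "\<lambda>a. deriv1 \<phi> (a, b)"])
    show "((\<lambda>a. \<phi> (a, b)) has_field_derivative deriv1 \<phi> (z, b)) (at z within ball 0 (r/2))" if "z \<in> ball 0 (r/2)" for z
    proof -
      have "b \<in> ball 0 r" using ab r by simp
      then have "(\<lambda>a. \<phi> (a, b)) holomorphic_on ball 0 r" using \<phi> unfolding sep_hol_def by blast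
      moreover have "z \<in> ball 0 r" using that r by simp
      ultimately have "((\<lambda>a. \<phi> (a, b)) has_field_derivative deriv (\<lambda>a. \<phi> (a, b)) z) (at z)"
        using holomorphic_derivI open_ball by blast
      then show ?thesis unfolding deriv1_def by (simp add: has_field_derivative_at_within)
    qed
    show "norm (deriv1 \<phi> (z, b)) \<le> 4 * K / r" if "z \<in> ball 0 (r/2)" for z
      using sep_hol_deriv1(2)[OF \<phi> K r, of "(z, b)"] that ab by simp
  qed (use ab r in auto)
  have 2: "norm (\<phi> (0, b) - \<phi> (0, 0)) \<le> 4 * K / r * norm (b - 0)"
  proof (rule field_differentiable_bound[of "ball 0 (r/2)" "\<lambda>b. \<phi> (0, b)" "\<lambda>b. deriv2 \<phi> (0, b)"])
    show "((\<lambda>b. \<phi> (0, b)) has_field_derivative deriv2 \<phi> (0, z)) (at z within ball 0 (r/2))" if "z \<in> ball 0 (r/2)" for z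
    proof -
      have "0 \<in> ball (0::complex) r" using r by simp
      then have "(\<lambda>b. \<phi> (0, b)) holomorphic_on ball 0 r" using \<phi> unfolding sep_hol_def by blast
      moreover have "z \<in> ball 0 r" using that r by simp
      ultimately have "((\<lambda>b. \<phi> (0, b)) has_field_derivative deriv (\<lambda>b. \<phi> (0, b)) z) (at z)"
        using holomorphic_derivI open_ball by blast
      then show ?thesis unfolding deriv2_def by (simp add: has_field_derivative_at_within)
    qed
    show "norm (deriv2 \<phi> (0, z)) \<le> 4 * K / r" if "z \<in> ball 0 (r/2)" for z
      using sep_hol_deriv2(2)[OF \<phi> K r, of "(0, z)"] that r by simp
  qed (use ab r in auto)
  have "norm (\<phi> (a, b) - \<phi> (0, 0)) \<le> norm (\<phi> (a, b) - \<phi> (0, b)) + norm (\<phi> (0, b) - \<phi> (0, 0))"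
    using norm_triangle_ineq[of "\<phi> (a, b) - \<phi> (0, b)" "\<phi> (0, b) - \<phi> (0, 0)"] by simp
  then show ?thesis using 1 2 by (simp add: distrib_left)
qed

text \<open>
  The extension is written in the displacement from the centre \<open>c\<close>, so that extensions at
  different points of an orbit have a common domain.
\<close>

definition extension_at :: "real \<Rightarrow> real \<Rightarrow> real^2 \<Rightarrow> (real^2 \<Rightarrow> complex^2^2) \<Rightarrow> (complex \<times> complex \<Rightarrow> complex^2^2) \<Rightarrow> bool" where
  "extension_at r K c M G \<longleftrightarrow>
     (\<forall>i j. sep_hol r (\<lambda>z. G z $ i $ j) \<and> (\<forall>z\<in>polydisc r. norm (G z $ i $ j) \<le> K)) \<and>
     (\<forall>w\<in>square c r. G (real_point (w - c)) = M w)"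

text \<open>
  One radius and one bound serve all centres: the plane is not compact, and the matrices to
  which this applies are periodic only up to sewing.
\<close>

definition uniformly_analytic :: "(real^2 \<Rightarrow> complex^2^2) \<Rightarrow> bool" where
  "uniformly_analytic M \<longleftrightarrow> (\<exists>r K. r > 0 \<and> K > 0 \<and> (\<forall>c. \<exists>G. extension_at r K c M G))"

text \<open>The polydisc of radius \<open>\<delta>\<close> around a real point lies in the strip.\<close>

lemma extends_to_strip_uniformly_analytic:
  assumes ext: "extends_to_strip \<delta> M" and \<delta>: "\<delta> > 0"
  shows "uniformly_analytic M"
proof -
  obtain G W where W: "open W" "strip \<delta> \<subseteq> W" and hol: "\<And>i j. holomorphic2_on (\<lambda>z. G z $ i $ j) W"
    and bd: "bounded (G ` strip \<delta>)" and GM: "\<And>w. G (complexify w) = M w"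
    using ext unfolding extends_to_strip_def by blast
  obtain K where K: "K > 0" "\<And>z. z \<in> strip \<delta> \<Longrightarrow> norm (G z) \<le> K" using bd bounded_pos by (metis imageI)
  have "extension_at \<delta> K c M (\<lambda>(a, b). G (complexify c + vector [a, b]))" for c
  proof -
    let ?p = "\<lambda>z::complex \<times> complex. complexify c + vector [fst z, snd z]"
    have comp: "?p z $ 1 = complex_of_real (c $ 1) + fst z" "?p z $ 2 = complex_of_real (c $ 2) + snd z" for z
      by (auto simp: complexify_def vector_2)
    have instrip: "?p z \<in> strip \<delta>" if "z \<in> polydisc \<delta>" for z
    proof -
      have "\<bar>Im (fst z)\<bar> \<le> \<delta>" "\<bar>Im (snd z)\<bar> \<le> \<delta>"
        using that abs_Im_le_cmod[of "fst z"] abs_Im_le_cmod[of "snd z"] by auto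
      then show ?thesis by (simp add: strip_def forall_2 comp del: vector_add_component)
    qed
    have der: "\<exists>f'. ((\<lambda>z. G z $ i $ j) has_derivative f') (at (?p z)) \<and> (\<forall>c v. f' (c *s v) = c * f' v)" if "z \<in> polydisc \<delta>" for i j z
      using hol[of i j] instrip[OF that] W(2) unfolding holomorphic2_on_def by blast
    have pc: "continuous_on S ?p" for S
    proof -
      have c1: "continuous_on S (\<lambda>z. \<chi> j::2. if j = 1 then complex_of_real (c $ 1) + fst z else complex_of_real (c $ 2) + snd z)"
      proof (rule continuous_on_vec_lambda)
        show "continuous_on S (\<lambda>z. if j = 1 then complex_of_real (c $ 1) + fst z else complex_of_real (c $ 2) + snd z)" for j :: 2
          by (cases "j = 1") (simp_all add: continuous_on_add continuous_on_fst continuous_on_snd)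
      qed
      have e1: "(\<lambda>z. \<chi> j::2. if j = 1 then complex_of_real (c $ 1) + fst z else complex_of_real (c $ 2) + snd z) = ?p"
        by (simp add: fun_eq_iff vec_eq_iff forall_2 complexify_def vector_2)
      show ?thesis using c1 unfolding e1 .
    qed
    have slice1: "((\<lambda>a. ?p (a, b)) has_derivative (\<lambda>h. h *s axis 1 1)) (at a)" for a b
    proof -
      have "(\<lambda>a. ?p (a, b)) = (\<lambda>a. ?p (0, b) + a *s axis 1 1)"
        by (simp add: fun_eq_iff vec_eq_iff forall_2 vector_2 axis_def)
      moreover have "linear (\<lambda>h::complex. h *s (axis 1 1 :: complex^2))"
        by (rule linearI) (simp_all add: vec_eq_iff algebra_simps)
      then have "bounded_linear (\<lambda>h::complex. h *s (axis 1 1 :: complex^2))"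
        by (simp add: linear_conv_bounded_linear)
      ultimately show ?thesis by (auto intro!: derivative_eq_intros bounded_linear_imp_has_derivative)
    qed
    have slice2: "((\<lambda>b. ?p (a, b)) has_derivative (\<lambda>h. h *s axis 2 1)) (at b)" for a b
    proof -
      have "(\<lambda>b. ?p (a, b)) = (\<lambda>b. ?p (a, 0) + b *s axis 2 1)"
        by (simp add: fun_eq_iff vec_eq_iff forall_2 vector_2 axis_def)
      moreover have "linear (\<lambda>h::complex. h *s (axis 2 1 :: complex^2))"
        by (rule linearI) (simp_all add: vec_eq_iff algebra_simps)
      then have "bounded_linear (\<lambda>h::complex. h *s (axis 2 1 :: complex^2))"
        by (simp add: linear_conv_bounded_linear)
      ultimately show ?thesis by (auto intro!: derivative_eq_intros bounded_linear_imp_has_derivative)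
    qed
    have sh: "sep_hol \<delta> (\<lambda>z. G (?p z) $ i $ j)" for i j
      unfolding sep_hol_def
    proof (intro conjI ballI)
      have "continuous_on (?p ` polydisc \<delta>) (\<lambda>z. G z $ i $ j)"
      proof (rule continuous_at_imp_continuous_on, rule ballI)
        fix x assume "x \<in> ?p ` polydisc \<delta>"
        then obtain z where "z \<in> polydisc \<delta>" "x = ?p z" by blast
        then show "isCont (\<lambda>z. G z $ i $ j) x" using der[of z i j] has_derivative_continuous by blast
      qed
      from continuous_on_compose2[OF this pc[of "polydisc \<delta>"] order_refl]
      show "continuous_on (polydisc \<delta>) (\<lambda>z. G (?p z) $ i $ j)" .
      show "(\<lambda>a. G (?p (a, b)) $ i $ j) holomorphic_on ball 0 \<delta>" if "b \<in> ball 0 \<delta>" for b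
      proof (rule holomorphic_onI)
        fix a :: complex assume "a \<in> ball 0 \<delta>"
        then obtain f' where f': "((\<lambda>z. G z $ i $ j) has_derivative f') (at (?p (a, b)))" "\<forall>c v. f' (c *s v) = c * f' v"
          using der[of "(a, b)" i j] \<open>b \<in> _\<close> by blast
        from has_derivative_compose[OF slice1 f'(1)]
        have "((\<lambda>a. G (?p (a, b)) $ i $ j) has_derivative (\<lambda>h. f' (h *s axis 1 1))) (at a)" .
        then have "((\<lambda>a. G (?p (a, b)) $ i $ j) has_field_derivative f' (axis 1 1)) (at a)"
          using f'(2) by (simp add: has_field_derivative_def mult_commute_abs)
        then show "(\<lambda>a. G (?p (a, b)) $ i $ j) field_differentiable at a within ball 0 \<delta>"
          using field_differentiable_at_within field_differentiable_def by blast
      qed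
      show "(\<lambda>b. G (?p (a, b)) $ i $ j) holomorphic_on ball 0 \<delta>" if "a \<in> ball 0 \<delta>" for a
      proof (rule holomorphic_onI)
        fix b :: complex assume "b \<in> ball 0 \<delta>"
        then obtain f' where f': "((\<lambda>z. G z $ i $ j) has_derivative f') (at (?p (a, b)))" "\<forall>c v. f' (c *s v) = c * f' v"
          using der[of "(a, b)" i j] \<open>a \<in> _\<close> by blast
        from has_derivative_compose[OF slice2 f'(1)]
        have "((\<lambda>b. G (?p (a, b)) $ i $ j) has_derivative (\<lambda>h. f' (h *s axis 2 1))) (at b)" .
        then have "((\<lambda>b. G (?p (a, b)) $ i $ j) has_field_derivative f' (axis 2 1)) (at b)"
          using f'(2) by (simp add: has_field_derivative_def mult_commute_abs)
        then show "(\<lambda>b. G (?p (a, b)) $ i $ j) field_differentiable at b within ball 0 \<delta>"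
          using field_differentiable_at_within field_differentiable_def by blast
      qed
    qed
    have "norm (G (?p z) $ i $ j) \<le> K" if "z \<in> polydisc \<delta>" for z i j
      using K(2)[OF instrip[OF that]] Finite_Cartesian_Product.norm_nth_le[of "G (?p z)" i]
        Finite_Cartesian_Product.norm_nth_le[of "G (?p z) $ i" j] by linarith
    moreover have "G (?p (real_point (w - c))) = M w" for w
    proof -
      have "?p (real_point (w - c)) = complexify w"
        by (simp add: vec_eq_iff forall_2 complexify_def vector_2 real_point_def)
      then show ?thesis using GM by simp
    qed
    ultimately show ?thesis using sh unfolding extension_at_def by (simp add: case_prod_beta del: mem_ball mem_ball_0)
  qed
  then show ?thesis unfolding uniformly_analytic_def using K(1) \<delta> by blast
qed

section \<open>Analyticity of a dominating line\<close>

text \<open>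
  For unit vectors the modulus of the wedge is the sine of the angle between the lines they
  span.
\<close>

definition wedge :: "complex^2 \<Rightarrow> complex^2 \<Rightarrow> complex" where
  "wedge x y = x $ 1 * y $ 2 - x $ 2 * y $ 1"

lemma wedge_simps:
  "wedge (x + x') y = wedge x y + wedge x' y" "wedge x (y + y') = wedge x y + wedge x y'"
  "wedge (x - x') y = wedge x y - wedge x' y" "wedge x (y - y') = wedge x y - wedge x y'"
  "wedge (c *s x) y = c * wedge x y" "wedge x (c *s y) = c * wedge x y" "wedge x x = 0"
  by (simp_all add: wedge_def algebra_simps)

lemma wedge_commute: "wedge x y = - wedge y x"
  by (simp add: wedge_def)

lemma wedge_basis: "wedge a b *s x = wedge x b *s a + wedge a x *s b"
  by (simp add: vec_eq_iff forall_2 wedge_def algebra_simps)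

lemma wedge_pluecker: "wedge x y * wedge a b = wedge x a * wedge y b - wedge x b * wedge y a"
  by (simp add: wedge_def algebra_simps)

lemma wedge_matrix: "wedge (M *v x) (M *v y) = det M * wedge x y"
  by (simp add: wedge_def matrix_vector_mult_def sum_2 det_2 algebra_simps)

lemma norm_vec2_sq: "(norm (x :: complex^2))\<^sup>2 = (norm (x $ 1))\<^sup>2 + (norm (x $ 2))\<^sup>2"
  by (simp add: norm_vec_def L2_set_def sum_2)

lemma norm_component_le: "norm (x $ i) \<le> norm (x :: complex^2)"
  by (rule Finite_Cartesian_Product.norm_nth_le)

lemma norm_vec2_le: "norm (x :: complex^2) \<le> norm (x $ 1) + norm (x $ 2)"
  using L2_set_le_sum[of "UNIV :: 2 set" "\<lambda>i. norm (x $ i)"] by (simp add: norm_vec_def sum_2)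

lemma norm_smult [simp]: "norm (c *s (x :: complex^2)) = norm c * norm x"
proof -
  have "(norm (c *s x))\<^sup>2 = (norm c * norm x)\<^sup>2"
    by (simp add: norm_vec2_sq power_mult_distrib norm_mult algebra_simps)
  then show ?thesis by (simp add: power2_eq_iff_nonneg)
qed

lemma norm_wedge_le: "norm (wedge x y) \<le> 2 * (norm x * norm y)"
proof -
  have "norm (wedge x y) \<le> norm (x $ 1) * norm (y $ 2) + norm (x $ 2) * norm (y $ 1)"
    unfolding wedge_def using norm_triangle_ineq4[of "x $ 1 * y $ 2" "x $ 2 * y $ 1"] by (simp add: norm_mult)
  also have "\<dots> \<le> norm x * norm y + norm x * norm y"
    by (intro add_mono mult_mono norm_component_le) auto
  finally show ?thesis by simp
qed

lemma norm_matrix_vector_le: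
  assumes "\<And>i j. norm ((X :: complex^2^2) $ i $ j) \<le> e"
  shows "norm (X *v x) \<le> 4 * e * norm x"
proof -
  have e: "0 \<le> e" using order_trans[OF norm_ge_zero assms] .
  have 1: "norm ((X *v x) $ i) \<le> 2 * e * norm x" for i
  proof -
    have "norm ((X *v x) $ i) \<le> norm (X $ i $ 1) * norm (x $ 1) + norm (X $ i $ 2) * norm (x $ 2)"
      using norm_triangle_ineq[of "X $ i $ 1 * x $ 1" "X $ i $ 2 * x $ 2"]
      by (simp add: matrix_vector_mult_def sum_2 norm_mult)
    also have "\<dots> \<le> e * norm x + e * norm x"
      by (intro add_mono mult_mono norm_component_le assms) (use e in auto)
    finally show ?thesis by simp
  qed
  show ?thesis using norm_vec2_le[of "X *v x"] 1[of 1] 1[of 2] by linarith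
qed

lemma wedge_matrix_le:
  assumes "\<And>i j. norm ((X :: complex^2^2) $ i $ j) \<le> e" "norm x = 1" "norm y = 1"
  shows "norm (wedge (X *v x) y) \<le> 8 * e" "norm (wedge y (X *v x)) \<le> 8 * e"
  using norm_wedge_le[of "X *v x" y] norm_wedge_le[of y "X *v x"] norm_matrix_vector_le[OF assms(1), of x] assms
  by auto

lemma hinner_self: "hinner x x = of_real ((norm x)\<^sup>2)"
  by (simp add: hinner_def sum_2 norm_vec2_sq complex_norm_square mult.commute[of "cnj _"] del: of_real_power)

lemma unitary_hinner:
  assumes "unitary_matrix U" shows "hinner (U *v x) (U *v y) = hinner x y"
proof -
  have "(adjoint_matrix U ** U) $ i $ j = mat 1 $ i $ j" for i j
    using assms by (simp add: unitary_matrix_def)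
  then have e: "cnj (U $ 1 $ i) * U $ 1 $ j + cnj (U $ 2 $ i) * U $ 2 $ j = (if i = j then 1 else 0)" for i j
    by (simp add: matrix_matrix_mult_def adjoint_matrix_def sum_2 mat_def)
  have "hinner (U *v x) (U *v y) =
     cnj (x $ 1) * y $ 1 * (cnj (U $ 1 $ 1) * U $ 1 $ 1 + cnj (U $ 2 $ 1) * U $ 2 $ 1)
   + cnj (x $ 1) * y $ 2 * (cnj (U $ 1 $ 1) * U $ 1 $ 2 + cnj (U $ 2 $ 1) * U $ 2 $ 2)
   + cnj (x $ 2) * y $ 1 * (cnj (U $ 1 $ 2) * U $ 1 $ 1 + cnj (U $ 2 $ 2) * U $ 2 $ 1)
   + cnj (x $ 2) * y $ 2 * (cnj (U $ 1 $ 2) * U $ 1 $ 2 + cnj (U $ 2 $ 2) * U $ 2 $ 2)"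
    by (simp add: hinner_def matrix_vector_mult_def sum_2) (simp add: algebra_simps)
  then show ?thesis unfolding e by (simp add: hinner_def sum_2)
qed

lemma unitary_norm:
  assumes "unitary_matrix U" shows "norm (U *v x) = norm x"
proof -
  have "complex_of_real ((norm (U *v x))\<^sup>2) = complex_of_real ((norm x)\<^sup>2)"
    using unitary_hinner[OF assms, of x x] unfolding hinner_self .
  then have "(norm (U *v x))\<^sup>2 = (norm x)\<^sup>2" unfolding of_real_eq_iff .
  then show ?thesis by (simp add: power2_eq_iff_nonneg)
qed

lemma unitary_det: "unitary_matrix U \<Longrightarrow> norm (det U) = 1"
proof -
  assume "unitary_matrix U"
  then have "det (adjoint_matrix U) * det U = 1"
    by (metis det_I det_mul unitary_matrix_def)
  moreover have "det (adjoint_matrix U) = cnj (det U)" by (simp add: adjoint_matrix_def det_2 mult.commute)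
  ultimately have "cnj (det U) * det U = 1" by simp
  then have "norm (det U) * norm (det U) = 1" by (metis norm_mult norm_one complex_mod_cnj)
  then show ?thesis using norm_ge_zero[of "det U"] by (metis abs_of_nonneg power2_eq_1_iff power2_eq_square abs_1 abs_minus_cancel)
qed

text \<open>
  The coefficients are within \<open>1/16\<close> of those of a multiplication by a number of modulus at most
  \<open>1/4\<close>.
\<close>

lemma moebius_contraction:
  assumes "norm a \<le> 5/16" "norm b \<le> 1/16" "norm c \<le> 1/16" "norm (d - 1) \<le> (1/16::real)"
    and x: "norm (x::complex) \<le> 1" and y: "norm y \<le> 1"
  shows "c * x + d \<noteq> 0" "norm ((a * x + b) / (c * x + d)) \<le> 1"
    "norm ((a * x + b) / (c * x + d) - (a * y + b) / (c * y + d)) \<le> 1/2 * norm (x - y)"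
proof -
  have den: "7/8 \<le> norm (c * u + d)" if "norm u \<le> 1" for u
  proof -
    have "norm (c * u) \<le> 1/16 * 1" unfolding norm_mult using assms(3) that by (intro mult_mono) auto
    moreover have "1 \<le> norm (c * u + d) + norm (c * u) + norm (d - 1)"
      using norm_triangle_ineq4[of "c * u + d" "c * u + (d - 1)"] norm_triangle_ineq[of "c * u" "d - 1"] by simp
    ultimately show ?thesis using assms(4) by simp
  qed
  show nz: "c * x + d \<noteq> 0" using den[OF x] by auto
  have nzy: "c * y + d \<noteq> 0" using den[OF y] by auto
  have "norm (a * x + b) \<le> norm a * norm x + norm b" using norm_triangle_ineq[of "a * x" b] by (simp add: norm_mult)
  also have "norm a * norm x \<le> 5/16 * 1" using assms(1) x by (intro mult_mono) auto
  finally have "norm (a * x + b) \<le> 3/8" using assms(2) by simp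
  then show "norm ((a * x + b) / (c * x + d)) \<le> 1" unfolding norm_divide
    using den[OF x] by (simp add: divide_le_eq)
  have "norm d \<le> 17/16" using norm_triangle_ineq[of "d - 1" 1] assms(4) by simp
  have "norm (a * d - b * c) \<le> norm a * norm d + norm b * norm c"
    using norm_triangle_ineq4[of "a * d" "b * c"] by (simp add: norm_mult)
  also have "\<dots> \<le> 5/16 * (17/16) + 1/16 * (1/16)"
    using assms \<open>norm d \<le> 17/16\<close> by (intro add_mono mult_mono) auto
  finally have det: "norm (a * d - b * c) \<le> 3/8" by simp
  have "49/64 \<le> norm (c * x + d) * norm (c * y + d)"
    using mult_mono[OF den[OF x] den[OF y]] by simp
  have eq: "(a * x + b) / (c * x + d) - (a * y + b) / (c * y + d) = (a * d - b * c) * (x - y) / ((c * x + d) * (c * y + d))"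
    using nz nzy by (simp add: field_simps)
  have "norm (a * d - b * c) / (norm (c * x + d) * norm (c * y + d)) \<le> (3/8) / (49/64)"
    using det \<open>49/64 \<le> _\<close> by (intro frac_le) auto
  then have "norm (a * d - b * c) / (norm (c * x + d) * norm (c * y + d)) * norm (x - y) \<le> 1/2 * norm (x - y)"
    by (intro mult_right_mono) auto
  then show "norm ((a * x + b) / (c * x + d) - (a * y + b) / (c * y + d)) \<le> 1/2 * norm (x - y)"
    unfolding eq by (simp add: norm_divide norm_mult)
qed

text \<open>
  The map with the highest index acts first: a slope is prescribed at time \<open>n\<close> in the past and
  transported to time 0, so that the values for all \<open>n\<close> are comparable.
\<close>

primrec back_compose :: "(nat \<Rightarrow> 'z \<Rightarrow> 'x \<Rightarrow> 'x) \<Rightarrow> nat \<Rightarrow> 'z \<Rightarrow> 'x \<Rightarrow> 'x" where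
  "back_compose F 0 z x = x"
| "back_compose F (Suc n) z x = back_compose F n z (F n z x)"

text \<open>
  The images of the unit disc under longer and longer compositions shrink uniformly to one
  point, which depends holomorphically on \<open>z\<close>; a bounded backward orbit passes through all these
  images, so its present value is that point.
\<close>

lemma moebius_limit:
  fixes a b c d :: "nat \<Rightarrow> complex \<times> complex \<Rightarrow> complex"
  assumes hol: "\<And>n. sep_hol r (a n)" "\<And>n. sep_hol r (b n)" "\<And>n. sep_hol r (c n)" "\<And>n. sep_hol r (d n)"
    and bd: "\<And>n z. z \<in> polydisc r \<Longrightarrow> norm (a n z) \<le> 5/16" "\<And>n z. z \<in> polydisc r \<Longrightarrow> norm (b n z) \<le> 1/16"
      "\<And>n z. z \<in> polydisc r \<Longrightarrow> norm (c n z) \<le> 1/16" "\<And>n z. z \<in> polydisc r \<Longrightarrow> norm (d n z - 1) \<le> 1/16"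
  obtains \<phi> where "sep_hol r \<phi>" "\<And>z. z \<in> polydisc r \<Longrightarrow> norm (\<phi> z) \<le> 1"
    "\<And>z s. z \<in> polydisc r \<Longrightarrow> (\<And>n. norm (s n) \<le> 1) \<Longrightarrow>
       (\<And>n. s n = (a n z * s (Suc n) + b n z) / (c n z * s (Suc n) + d n z)) \<Longrightarrow> s 0 = \<phi> z"
proof -
  define F where "F n z x = (a n z * x + b n z) / (c n z * x + d n z)" for n z x
  have mc: "c n z * x + d n z \<noteq> 0" "norm (F n z x) \<le> 1" "norm (F n z x - F n z y) \<le> 1/2 * norm (x - y)"
    if "z \<in> polydisc r" "norm x \<le> 1" "norm y \<le> 1" for n z x y
    unfolding F_def
    using moebius_contraction[of "a n z" "b n z" "c n z" "d n z" x y] bd[OF that(1), of n] that(2,3) by blast+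
  have lip: "norm (back_compose F n z x - back_compose F n z y) \<le> (1/2) ^ n * norm (x - y)
      \<and> norm (back_compose F n z x) \<le> 1" if "z \<in> polydisc r" "norm x \<le> 1" "norm y \<le> 1" for n z x y
    using that
  proof (induction n arbitrary: x y)
    case (Suc n)
    have F: "norm (F n z x) \<le> 1" "norm (F n z y) \<le> 1" "norm (F n z x - F n z y) \<le> 1/2 * norm (x - y)"
      using mc(2,3) Suc.prems by blast+
    have "norm (back_compose F n z (F n z x) - back_compose F n z (F n z y)) \<le> (1/2) ^ n * norm (F n z x - F n z y)"
      using Suc.IH[OF Suc.prems(1) F(1,2)] by blast
    also have "\<dots> \<le> (1/2) ^ n * (1/2 * norm (x - y))" by (intro mult_left_mono F) auto
    finally show ?case using Suc.IH[OF Suc.prems(1) F(1,2)] by simp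
  qed simp
  have sh: "sep_hol r (\<lambda>z. back_compose F n z (\<xi> z))"
    if "sep_hol r \<xi>" "\<And>z. z \<in> polydisc r \<Longrightarrow> norm (\<xi> z) \<le> 1" for n \<xi>
    using that
  proof (induction n arbitrary: \<xi>)
    case (Suc n)
    have "sep_hol r (\<lambda>z. F n z (\<xi> z))"
      unfolding F_def
    proof (rule sep_hol_divide)
      show "c n z * \<xi> z + d n z \<noteq> 0" if "z \<in> polydisc r" for z
        using mc(1) Suc.prems(2) that by blast
    qed (intro sep_hol_add sep_hol_mult hol Suc.prems(1))+
    moreover have "norm (F n z (\<xi> z)) \<le> 1" if "z \<in> polydisc r" for z
      using mc(2) Suc.prems(2) that by blast
    ultimately show ?case using Suc.IH[of "\<lambda>z. F n z (\<xi> z)"] by simp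
  qed simp
  define X where "X n z = back_compose F n z 0" for n z
  have Xh: "sep_hol r (X n)" for n unfolding X_def by (rule sh) auto
  have step: "norm (X (Suc n) z - X n z) \<le> (1/2) ^ n" if "z \<in> polydisc r" for n z
  proof -
    have F: "norm (F n z 0) \<le> 1" using mc(2)[OF that, of 0 0] by simp
    have "norm (X (Suc n) z - X n z) \<le> (1/2) ^ n * norm (F n z 0 - 0)"
      unfolding X_def using lip[OF that F, of 0 n] by simp
    also have "\<dots> \<le> (1/2) ^ n * 1" using F by (intro mult_left_mono) auto
    finally show ?thesis by simp
  qed
  define \<phi> where "\<phi> z = (\<Sum>i. X (Suc i) z - X i z)" for z
  have "uniform_limit (polydisc r) (\<lambda>n z. \<Sum>i<n. X (Suc i) z - X i z) \<phi> sequentially"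
    unfolding \<phi>_def by (rule Weierstrass_m_test[of _ _ "\<lambda>n. (1/2) ^ n"]) (use step in \<open>auto simp: summable_geometric\<close>)
  moreover have "(\<lambda>n z. \<Sum>i<n. X (Suc i) z - X i z) = X"
  proof (intro ext)
    fix n z
    have "X 0 z = 0" by (simp add: X_def)
    then show "(\<Sum>i<n. X (Suc i) z - X i z) = X n z"
      using sum_lessThan_telescope[of "\<lambda>i. X i z" n] by simp
  qed
  ultimately have u: "uniform_limit (polydisc r) X \<phi> sequentially" by simp
  have lim: "(\<lambda>n. X n z) \<longlonglongrightarrow> \<phi> z" if "z \<in> polydisc r" for z
    using tendsto_uniform_limitI[OF u that] .
  show ?thesis
  proof
    show "sep_hol r \<phi>" by (rule sep_hol_uniform_limit[OF Xh u])
    show "norm (\<phi> z) \<le> 1" if z: "z \<in> polydisc r" for z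
    proof (rule Lim_norm_ubound[OF _ lim[OF z]])
      show "\<forall>\<^sub>F n in sequentially. norm (X n z) \<le> 1"
        unfolding X_def using lip[OF z, of 0 0] by (intro always_eventually) auto
    qed simp
    show "s 0 = \<phi> z" if z: "z \<in> polydisc r" and s1: "\<And>n. norm (s n) \<le> 1"
      and rec: "\<And>n. s n = (a n z * s (Suc n) + b n z) / (c n z * s (Suc n) + d n z)" for s z
    proof -
      have s0: "s 0 = back_compose F n z (s n)" for n
      proof (induction n)
        case (Suc n)
        then show ?case using rec[of n] by (simp add: F_def)
      qed simp
      have "norm (X n z - s 0) \<le> (1/2) ^ n" for n
      proof -
        have "norm (X n z - s 0) \<le> (1/2) ^ n * norm (0 - s n)"
          unfolding s0[of n] X_def using lip[OF z, of 0 "s n" n] s1 by simp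
        also have "\<dots> \<le> (1/2) ^ n * 1" using s1 by (intro mult_left_mono) auto
        finally show ?thesis by simp
      qed
      then have "(\<lambda>n. X n z - s 0) \<longlonglongrightarrow> 0"
        by (intro Lim_null_comparison[OF always_eventually LIMSEQ_realpow_zero[of "1/2"]]) auto
      then have "(\<lambda>n. X n z) \<longlonglongrightarrow> s 0" by (simp add: LIM_zero_iff)
      then show ?thesis using lim[OF z] LIMSEQ_unique by blast
    qed
  qed
qed

lemma square_mono: "r \<le> s \<Longrightarrow> square c r \<subseteq> square c s"
  unfolding square_def by (auto intro: less_le_trans)

text \<open>
  On a small polydisc the extension hardly departs from its value at the centre, uniformly in
  the centre.
\<close>

lemma extension_at_deviation:
  assumes G: "extension_at r0 K c B G" and r0: "r0 > 0" and K: "K > 0"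
    and r: "r \<le> r0 / 2" and z: "z \<in> polydisc r"
  shows "norm ((G z - B c) $ i $ j) \<le> 8 * K / r0 * r"
proof -
  have "G (0, 0) = B c"
    using G center_in_square[OF r0, of c] unfolding extension_at_def by (force simp: real_point_def)
  obtain a b where ab: "z = (a, b)" "norm a < r" "norm b < r" using z by auto
  have "norm (G (a, b) $ i $ j - G (0, 0) $ i $ j) \<le> 4 * K / r0 * (norm a + norm b)"
  proof (rule sep_hol_lipschitz[where \<phi>="\<lambda>z. G z $ i $ j"])
    show "sep_hol r0 (\<lambda>z. G z $ i $ j)" using G by (simp add: extension_at_def)
    show "norm (G z $ i $ j) \<le> K" if "z \<in> polydisc r0" for z
      using G that unfolding extension_at_def by blast
  qed (use r r0 ab in auto)
  also have "\<dots> \<le> 4 * K / r0 * (r + r)" using ab K r0 by (intro mult_left_mono) auto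
  finally show ?thesis using \<open>G (0, 0) = B c\<close> ab(1) by simp
qed

text \<open>
  The line of \<open>q\<close> is expanded more than that of \<open>p\<close> by a factor of at least \<open>1/t\<close>, \<open>c0\<close> bounds
  the angle between them, and \<open>c1\<close> bounds the expansion from below. The unit vectors \<open>p w\<close> and
  \<open>q w\<close> may depend on \<open>w\<close> in any way.
\<close>

locale dominated_pair =
  fixes B :: "real^2 \<Rightarrow> complex^2^2" and T :: "real^2" and p q :: "real^2 \<Rightarrow> complex^2"
    and bp bq :: "real^2 \<Rightarrow> complex" and c0 c1 t :: real
  assumes an: "uniformly_analytic B"
    and unit: "norm (p w) = 1" "norm (q w) = 1"
    and angle: "c0 > 0" "c0 \<le> norm (wedge (p w) (q w))"
    and eig: "B w *v p w = bp w *s p (w + T)" "B w *v q w = bq w *s q (w + T)"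
    and c1: "c1 > 0" "c1 \<le> norm (bq w)"
    and t: "t \<le> 1/4" "t \<le> c0 ^ 3 / 256" and dom: "norm (bp w) \<le> t * norm (bq w)"
begin

definition coord_p :: "real^2 \<Rightarrow> complex^2 \<Rightarrow> complex" where
  "coord_p w x = wedge x (q w) / wedge (p w) (q w)"

definition coord_q :: "real^2 \<Rightarrow> complex^2 \<Rightarrow> complex" where
  "coord_q w x = wedge (p w) x / wedge (p w) (q w)"

lemma wedge_nonzero: "wedge (p w) (q w) \<noteq> 0"
  using angle(1) angle(2)[of w] by auto

lemma coords: "x = coord_p w x *s p w + coord_q w x *s q w"
proof -
  have "wedge (p w) (q w) *s x = wedge (p w) (q w) *s (coord_p w x *s p w + coord_q w x *s q w)"
    using wedge_basis[of "p w" "q w" x] wedge_nonzero[of w]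
    by (simp add: coord_p_def coord_q_def vec.scale_right_distrib)
  then show ?thesis using wedge_nonzero[of w] by (simp add: vec.scale_left_imp_eq)
qed

lemma coord_bound: "norm (coord_p w x) \<le> 2 / c0 * norm x" "norm (coord_q w x) \<le> 2 / c0 * norm x"
proof -
  have "norm (wedge x (q w)) / norm (wedge (p w) (q w)) \<le> (2 * norm x) / c0"
    using norm_wedge_le[of x "q w"] angle unit by (intro frac_le) auto
  then show "norm (coord_p w x) \<le> 2 / c0 * norm x" by (simp add: coord_p_def norm_divide)
  have "norm (wedge (p w) x) / norm (wedge (p w) (q w)) \<le> (2 * norm x) / c0"
    using norm_wedge_le[of "p w" x] angle unit by (intro frac_le) auto
  then show "norm (coord_q w x) \<le> 2 / c0 * norm x" by (simp add: coord_q_def norm_divide)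
qed

lemma apply_B: "B w *v x = (coord_p w x * bp w) *s p (w + T) + (coord_q w x * bq w) *s q (w + T)"
proof -
  have "B w *v x = B w *v (coord_p w x *s p w + coord_q w x *s q w)" using coords by metis
  then show ?thesis
    by (simp add: matrix_vector_right_distrib vector_scalar_commute eig)
qed

lemma c0_le_2: "c0 \<le> 2"
  using angle(2)[of 0] norm_wedge_le[of "p 0" "q 0"] unit by simp

text \<open>
  Uniform continuity of the line of \<open>q\<close> over the whole plane is extracted from the dynamics. For
  \<open>v\<close> near \<open>w\<close> the vector \<open>B v *v q w\<close> has almost the direction of \<open>q (w + T)\<close>, because \<open>B v\<close> is
  close to \<open>B w\<close>, and also almost that of \<open>q (v + T)\<close>, because \<open>B v\<close> suppresses the component
  along \<open>p v\<close>.
\<close>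

lemma strong_line_close:
  obtains r where "r > 0" "\<And>w v. v \<in> square w r \<Longrightarrow> norm (wedge (q v) (q w)) \<le> c0 / 4"
proof -
  obtain r0 K where r0: "r0 > 0" "K > 0" "\<And>c. \<exists>G. extension_at r0 K c B G"
    using an unfolding uniformly_analytic_def by blast
  \<comment> \<open>This is the value for which (16 / c0 + 8) * e = c0 * c1 / 16; the left-hand side bounds
    the sum of the errors below.\<close>
  define e where "e = c0 * c1 / (16 * (16 / c0 + 8))"
  have e: "e > 0" using angle(1) c1(1) unfolding e_def
    by (intro divide_pos_pos mult_pos_pos add_pos_pos) auto
  define r where "r = min (r0 / 2) (e / (8 * K / r0))"
  have r: "r > 0" "r \<le> r0 / 2" using r0 e by (auto simp: r_def)
  have re: "8 * K / r0 * r \<le> e"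
  proof -
    have "8 * K / r0 * r \<le> 8 * K / r0 * (e / (8 * K / r0))"
      using r0 by (intro mult_left_mono) (auto simp: r_def)
    then show ?thesis using r0 by simp
  qed
  have close: "norm (wedge (q (v + T)) (q (w + T))) \<le> c0 / 4" if v: "v \<in> square w r" for w v
  proof -
    obtain G where G: "extension_at r0 K w B G" using r0(3) by blast
    have "real_point (v - w) \<in> polydisc r" using v by (simp only: real_point_in)
    moreover have "G (real_point (v - w)) = B v"
    proof -
      have "v \<in> square w r0" using v square_mono[of r r0 w] r r0 by auto
      then show ?thesis using G unfolding extension_at_def by blast
    qed
    ultimately have X: "norm ((B v - B w) $ i $ j) \<le> e" for i j
      using extension_at_deviation[OF G r0(1,2) r(2), of "real_point (v - w)" i j] re by simp
    have X': "norm ((B w - B v) $ i $ j) \<le> e" for i j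
      using X[of i j] by (simp add: norm_minus_commute)
    have Bsplit: "B w *v x = B v *v x + (B w - B v) *v x" "B v *v x = B w *v x + (B v - B w) *v x" for x
      by (simp_all add: matrix_vector_mult_diff_rdistrib)
    have 1: "norm (bq w) * norm (wedge (q (v + T)) (q (w + T))) \<le> norm (wedge (q (v + T)) (B v *v q w)) + 8 * e"
    proof -
      have "bq w * wedge (q (v + T)) (q (w + T)) = wedge (q (v + T)) (B w *v q w)"
        by (simp add: eig wedge_simps)
      also have "\<dots> = wedge (q (v + T)) (B v *v q w) + wedge (q (v + T)) ((B w - B v) *v q w)"
        unfolding Bsplit(1) wedge_simps by simp
      finally have "norm (bq w) * norm (wedge (q (v + T)) (q (w + T))) \<le>
          norm (wedge (q (v + T)) (B v *v q w)) + norm (wedge (q (v + T)) ((B w - B v) *v q w))"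
        using norm_triangle_ineq norm_mult by metis
      then show ?thesis using wedge_matrix_le(2)[OF X' unit(2) unit(2), of "v + T" w] by linarith
    qed
    have 2: "norm (wedge (q (v + T)) (B v *v q w)) \<le> 4 / c0 * norm (bp v)"
    proof -
      have "wedge (q (v + T)) (B v *v q w) = coord_p v (q w) * bp v * wedge (q (v + T)) (p (v + T))"
        unfolding apply_B[of v "q w"] wedge_simps by simp
      then have "norm (wedge (q (v + T)) (B v *v q w)) = norm (coord_p v (q w)) * norm (bp v) * norm (wedge (q (v + T)) (p (v + T)))"
        by (simp add: norm_mult)
      also have "\<dots> \<le> (2 / c0) * norm (bp v) * 2"
        using coord_bound(1)[of v "q w"] norm_wedge_le[of "q (v + T)" "p (v + T)"] unit angle(1)
        by (intro mult_mono) auto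
      finally show ?thesis by simp
    qed
    have 3: "norm (bq v) \<le> 4 / c0 * norm (bq w) + 4 * e"
    proof -
      have "norm (bq v) = norm (B v *v q v)" by (simp add: eig unit)
      also have "\<dots> \<le> norm (B w *v q v) + norm ((B v - B w) *v q v)"
        unfolding Bsplit(2)[of "q v"] by (rule norm_triangle_ineq)
      also have "norm ((B v - B w) *v q v) \<le> 4 * e" using norm_matrix_vector_le[OF X, of "q v"] unit by simp
      also have "norm (B w *v q v) \<le> norm (coord_p w (q v)) * norm (bp w) + norm (coord_q w (q v)) * norm (bq w)"
        unfolding apply_B[of w "q v"] using unit
        by (intro norm_triangle_le) (simp add: norm_mult)
      also have "\<dots> \<le> (2 / c0) * norm (bq w) + (2 / c0) * norm (bq w)"
      proof -
        have "norm (bp w) \<le> 1 * norm (bq w)"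
          by (rule order_trans[OF dom]) (use t in \<open>intro mult_right_mono; simp\<close>)
        then show ?thesis
          using coord_bound[of w "q v"] unit angle(1) by (intro add_mono mult_mono) auto
      qed
      finally show ?thesis by simp
    qed
    have tpos: "norm (bp v) \<le> (c0 ^ 3 / 256) * norm (bq v)"
      by (rule order_trans[OF dom]) (use t in \<open>intro mult_right_mono; simp\<close>)
    have "norm (bq w) * norm (wedge (q (v + T)) (q (w + T))) \<le> 4 / c0 * ((c0 ^ 3 / 256) * (4 / c0 * norm (bq w) + 4 * e)) + 8 * e"
    proof -
      have "norm (bp v) \<le> (c0 ^ 3 / 256) * (4 / c0 * norm (bq w) + 4 * e)"
        by (rule order_trans[OF tpos]) (use 3 angle(1) in \<open>intro mult_left_mono; simp\<close>)
      then have "4 / c0 * norm (bp v) \<le> 4 / c0 * ((c0 ^ 3 / 256) * (4 / c0 * norm (bq w) + 4 * e))"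
        using angle(1) by (intro mult_left_mono) auto
      then show ?thesis using 1 2 by linarith
    qed
    also have "\<dots> = c0 / 16 * norm (bq w) + (c0\<^sup>2 / 16 + 8) * e"
      using angle(1) by (simp add: field_simps power2_eq_square power3_eq_cube)
    also have "(c0\<^sup>2 / 16 + 8) * e \<le> (16 / c0 + 8) * e"
    proof -
      have "c0\<^sup>2 / 16 \<le> 16 / c0"
      proof -
        have "c0\<^sup>2 \<le> 2\<^sup>2" using c0_le_2 angle(1) by (intro power_mono) auto
        then have "c0\<^sup>2 / 16 \<le> 1" by simp
        also have "1 \<le> 16 / c0" using c0_le_2 angle(1) by (simp add: le_divide_eq)
        finally show ?thesis .
      qed
      then show ?thesis using e by (intro mult_right_mono) auto
    qed
    also have "(16 / c0 + 8) * e = c0 / 16 * c1"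
      using angle(1) add_pos_pos[of "16 / c0" 8] by (simp add: e_def divide_simps)
    also have "\<dots> \<le> c0 / 16 * norm (bq w)" using c1 angle(1) by (intro mult_left_mono) auto
    finally have "norm (bq w) * norm (wedge (q (v + T)) (q (w + T))) \<le> norm (bq w) * (c0 / 8)" by (simp add: mult.commute)
    moreover have "norm (bq w) > 0" using c1(1) c1(2)[of w] by linarith
    ultimately have "norm (wedge (q (v + T)) (q (w + T))) \<le> c0 / 8" by simp
    then show ?thesis using angle(1) by simp
  qed
  show ?thesis
  proof (rule that[OF r(1)])
    fix w v assume "v \<in> square w r"
    then have "v - T \<in> square (w - T) r" by (simp add: square_def)
    from close[OF this] show "norm (wedge (q v) (q w)) \<le> c0 / 4" by simp
  qed
qed

text \<open>
  Along the backward orbit \<open>x n = w - n T\<close>, the slope \<open>s n\<close> of the line of \<open>q\<close> at the displaced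
  point \<open>x n + (v - w)\<close>, in the coordinates given by \<open>p\<close> and \<open>q\<close> at \<open>x n\<close>, is a Moebius image of
  \<open>s (n + 1)\<close>. The coefficients are holomorphic in the displacement and, after division by the
  multiplier of \<open>q\<close>, lie in the range where these maps contract. So the slope at time 0 is a
  holomorphic function of \<open>v - w\<close>.
\<close>

theorem strong_line_analytic:
  obtains r where "r > 0" "\<And>w v. v \<in> square w r \<Longrightarrow> norm (wedge (q v) (q w)) \<le> c0 / 4"
    "\<And>w. \<exists>\<phi>. sep_hol r \<phi> \<and> (\<forall>z\<in>polydisc r. norm (\<phi> z) \<le> 1) \<and>
       (\<forall>v\<in>square w r. \<exists>a. a \<noteq> 0 \<and> q v = a *s (\<phi> (real_point (v - w)) *s p w + q w))"
proof -
  obtain r1 where r1: "r1 > 0" "\<And>w v. v \<in> square w r1 \<Longrightarrow> norm (wedge (q v) (q w)) \<le> c0 / 4"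
    using strong_line_close by blast
  obtain r0 K where r0: "r0 > 0" "K > 0" "\<And>c. \<exists>G. extension_at r0 K c B G"
    using an unfolding uniformly_analytic_def by blast
  then obtain G where G: "\<And>c. extension_at r0 K c B (G c)" by metis
  \<comment> \<open>Perturbing B by e changes coordinates by at most 8 * e / c0 = c1 / 16, a sixteenth of the
    smallest multiplier of q.\<close>
  define e where "e = c0 * c1 / 128"
  have e: "e > 0" using angle(1) c1(1) by (simp add: e_def)
  define r where "r = min r1 (min (r0 / 2) (e / (8 * K / r0)))"
  have r: "r > 0" "r \<le> r0 / 2" "r \<le> r1" using r0 r1 e by (auto simp: r_def)
  have re: "8 * K / r0 * r \<le> e"
  proof -
    have "8 * K / r0 * r \<le> 8 * K / r0 * (e / (8 * K / r0))"
      using r0 by (intro mult_left_mono) (auto simp: r_def)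
    then show ?thesis using r0 by simp
  qed
  have dev: "norm ((G w z - B w) $ i $ j) \<le> e" if "z \<in> polydisc r" for w z i j
    using extension_at_deviation[OF G r0(1,2) r(2) that, of w i j] re by linarith
  have close: "norm (coord_p v x) \<le> 1/3 * norm (coord_q v x) \<and> coord_q v x \<noteq> 0"
    if "v' \<in> square v r" "x = q v'" for v v' x
  proof -
    have "norm (wedge x (q v)) \<le> c0 / 4" using r1(2)[of v' v] that r(3) by (auto simp: square_def intro: less_le_trans)
    then have "norm (wedge x (q v)) / norm (wedge (p v) (q v)) \<le> (c0 / 4) / c0"
      using angle by (intro frac_le) auto
    then have 1: "norm (coord_p v x) \<le> 1/4" using angle(1) by (simp add: coord_p_def norm_divide)
    have "1 = norm (coord_p v x *s p v + coord_q v x *s q v)" using coords[of x v] that unit by metis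
    also have "\<dots> \<le> norm (coord_p v x) + norm (coord_q v x)"
      using norm_triangle_ineq[of "coord_p v x *s p v" "coord_q v x *s q v"] unit by simp
    finally show ?thesis using 1 by auto
  qed
  have main: "\<exists>\<phi>. sep_hol r \<phi> \<and> (\<forall>z\<in>polydisc r. norm (\<phi> z) \<le> 1) \<and>
       (\<forall>v\<in>square w r. \<exists>a. a \<noteq> 0 \<and> q v = a *s (\<phi> (real_point (v - w)) *s p w + q w))" for w
  proof -
    define x where "x n = w - real n *\<^sub>R T" for n
    have xS: "x (Suc n) + T = x n" for n by (simp add: x_def algebra_simps)
    let ?b = "\<lambda>n. bq (x (Suc n))"
    define ma where "ma n z = coord_p (x n) (G (x (Suc n)) z *v p (x (Suc n)))" for n z
    define mb where "mb n z = coord_p (x n) (G (x (Suc n)) z *v q (x (Suc n)))" for n z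
    define mc where "mc n z = coord_q (x n) (G (x (Suc n)) z *v p (x (Suc n)))" for n z
    define md where "md n z = coord_q (x n) (G (x (Suc n)) z *v q (x (Suc n)))" for n z
    have sh: "sep_hol r (\<lambda>z. G c z $ i $ j)" for c i j
    proof -
      have "sep_hol r0 (\<lambda>z. G c z $ i $ j)" using G[of c] unfolding extension_at_def by blast
      then show ?thesis by (rule sep_hol_subset) (use r(2) r0(1) in simp)
    qed
    have mv: "sep_hol r (\<lambda>z. wedge (G c z *v u) v)" "sep_hol r (\<lambda>z. wedge v (G c z *v u))" for c u v
      by (simp_all only: wedge_def matrix_vector_mult_def sum_2 vec_lambda_beta)
         (intro sep_hol_diff sep_hol_mult sep_hol_add sep_hol_const sh)+
    have cp: "sep_hol r (\<lambda>z. coord_p v (G c z *v u) / k)" "sep_hol r (\<lambda>z. coord_q v (G c z *v u) / k)" for v c u k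
      unfolding coord_p_def coord_q_def divide_inverse by (rule sep_hol_mult[OF sep_hol_mult[OF _ sep_hol_const] sep_hol_const], rule mv)+
    have b0: "?b n \<noteq> 0" for n using c1(1) c1(2)[of "x (Suc n)"] by auto
    have diff_p: "norm (coord_p v (X *v u)) \<le> norm (?b n) / 16" "norm (coord_q v (X *v u)) \<le> norm (?b n) / 16"
      if X: "\<And>i j. norm (X $ i $ j) \<le> e" and u: "norm u = 1" for v u n and X :: "complex^2^2"
    proof -
      have "8 * e / c0 \<le> c1 / 16" using angle(1) by (simp add: e_def)
      also have "\<dots> \<le> norm (?b n) / 16" using c1(2) by simp
      finally have ec: "8 * e / c0 \<le> norm (?b n) / 16" .
      have "norm (wedge (X *v u) (q v)) / norm (wedge (p v) (q v)) \<le> 8 * e / c0"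
        using wedge_matrix_le(1)[OF X u unit(2)] angle e by (intro frac_le) auto
      then show "norm (coord_p v (X *v u)) \<le> norm (?b n) / 16" unfolding coord_p_def norm_divide using ec by (rule order_trans)
      have "norm (wedge (p v) (X *v u)) / norm (wedge (p v) (q v)) \<le> 8 * e / c0"
        using wedge_matrix_le(2)[OF X u unit(1)] angle e by (intro frac_le) auto
      then show "norm (coord_q v (X *v u)) \<le> norm (?b n) / 16" unfolding coord_q_def norm_divide using ec by (rule order_trans)
    qed
    have lin: "coord_p v (y + y') = coord_p v y + coord_p v y'" "coord_q v (y + y') = coord_q v y + coord_q v y'"
      "coord_p v (k *s y) = k * coord_p v y" "coord_q v (k *s y) = k * coord_q v y"
      "coord_p v (p v) = 1" "coord_p v (q v) = 0" "coord_q v (p v) = 0" "coord_q v (q v) = 1" for v y y' k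
      using wedge_nonzero[of v] by (simp_all add: coord_p_def coord_q_def wedge_simps add_divide_distrib)
    have Gs: "G c z *v u = B c *v u + (G c z - B c) *v u" for c z u
      by (simp add: matrix_vector_mult_diff_rdistrib)
    have base: "B (x (Suc n)) *v p (x (Suc n)) = bp (x (Suc n)) *s p (x n)" "B (x (Suc n)) *v q (x (Suc n)) = ?b n *s q (x n)" for n
      using eig xS by metis+
    have bd: "norm (ma n z) \<le> 5/16 * norm (?b n)" "norm (mb n z) \<le> 1/16 * norm (?b n)"
       "norm (mc n z) \<le> 1/16 * norm (?b n)" "norm (md n z - ?b n) \<le> 1/16 * norm (?b n)"
      if z: "z \<in> polydisc r" for n z
    proof -
      let ?X = "G (x (Suc n)) z - B (x (Suc n))"
      note d = diff_p[OF dev[OF z, of "x (Suc n)"], where n = n and v = "x n"]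
      have "norm (bp (x (Suc n))) \<le> 1/4 * norm (?b n)"
        by (rule order_trans[OF dom]) (use t in \<open>intro mult_right_mono; simp\<close>)
      moreover have ma_eq: "ma n z = bp (x (Suc n)) + coord_p (x n) (?X *v p (x (Suc n)))"
        unfolding ma_def Gs base lin by simp
      ultimately show "norm (ma n z) \<le> 5/16 * norm (?b n)"
        unfolding ma_eq using d(1)[OF unit(1)[of "x (Suc n)"]]
          norm_triangle_ineq[of "bp (x (Suc n))" "coord_p (x n) (?X *v p (x (Suc n)))"] by linarith
      have "mb n z = coord_p (x n) (?X *v q (x (Suc n)))" unfolding mb_def Gs base lin by simp
      then show "norm (mb n z) \<le> 1/16 * norm (?b n)" using d(1)[OF unit(2)[of "x (Suc n)"]] by simp
      have "mc n z = coord_q (x n) (?X *v p (x (Suc n)))" unfolding mc_def Gs base lin by simp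
      then show "norm (mc n z) \<le> 1/16 * norm (?b n)" using d(2)[OF unit(1)[of "x (Suc n)"]] by simp
      have "md n z - ?b n = coord_q (x n) (?X *v q (x (Suc n)))" unfolding md_def Gs base lin by simp
      then show "norm (md n z - ?b n) \<le> 1/16 * norm (?b n)" using d(2)[OF unit(2)[of "x (Suc n)"]] by simp
    qed
    have quot: "norm (u / ?b n) \<le> k" if "norm u \<le> k * norm (?b n)" for u n k
      using that b0[of n] by (simp add: norm_divide pos_divide_le_eq)
    obtain \<phi> where \<phi>: "sep_hol r \<phi>" "\<And>z. z \<in> polydisc r \<Longrightarrow> norm (\<phi> z) \<le> 1"
      and lim: "\<And>z s. z \<in> polydisc r \<Longrightarrow> (\<And>n. norm (s n) \<le> 1) \<Longrightarrow>
       (\<And>n. s n = (ma n z / ?b n * s (Suc n) + mb n z / ?b n) / (mc n z / ?b n * s (Suc n) + md n z / ?b n)) \<Longrightarrow> s 0 = \<phi> z"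
    proof (rule moebius_limit[of r "\<lambda>n z. ma n z / ?b n" "\<lambda>n z. mb n z / ?b n" "\<lambda>n z. mc n z / ?b n" "\<lambda>n z. md n z / ?b n"])
      show "sep_hol r (\<lambda>z. ma n z / ?b n)" "sep_hol r (\<lambda>z. mb n z / ?b n)"
        "sep_hol r (\<lambda>z. mc n z / ?b n)" "sep_hol r (\<lambda>z. md n z / ?b n)" for n
        unfolding ma_def mb_def mc_def md_def by (rule cp)+
      show "norm (ma n z / ?b n) \<le> 5/16" "norm (mb n z / ?b n) \<le> 1/16" "norm (mc n z / ?b n) \<le> 1/16"
        if "z \<in> polydisc r" for n z using bd[OF that] quot by blast+
      show "norm (md n z / ?b n - 1) \<le> 1/16" if "z \<in> polydisc r" for n z
        using quot[OF bd(4)[OF that, of n]] b0[of n] by (simp add: diff_divide_distrib)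
    qed blast
    have "\<exists>a. a \<noteq> 0 \<and> q v = a *s (\<phi> (real_point (v - w)) *s p w + q w)" if v: "v \<in> square w r" for v
    proof -
      let ?z = "real_point (v - w)"
      have z: "?z \<in> polydisc r" using v by (simp only: real_point_in)
      define y where "y n = q (x n + (v - w))" for n
      define s where "s n = coord_p (x n) (y n) / coord_q (x n) (y n)" for n
      have sq: "x n + (v - w) \<in> square (x n) r" for n using v by (simp add: square_def)
      have cl: "norm (coord_p (x n) (y n)) \<le> 1/3 * norm (coord_q (x n) (y n))" "coord_q (x n) (y n) \<noteq> 0" for n
        using close[OF sq, of "y n"] by (auto simp: y_def)
      have s1: "norm (s n) \<le> 1" for n
      proof -
        have "norm (coord_p (x n) (y n)) \<le> norm (coord_q (x n) (y n))"
          using cl(1)[of n] norm_ge_zero[of "coord_q (x n) (y n)"] by linarith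
        then show ?thesis using cl(2)[of n] by (simp add: s_def norm_divide)
      qed
      have rec: "s n = (ma n ?z / ?b n * s (Suc n) + mb n ?z / ?b n) / (mc n ?z / ?b n * s (Suc n) + md n ?z / ?b n)" for n
      proof -
        let ?\<alpha> = "coord_p (x (Suc n)) (y (Suc n))" let ?\<beta> = "coord_q (x (Suc n)) (y (Suc n))"
        let ?v = "x (Suc n) + (v - w)"
        have in0: "?v \<in> square (x (Suc n)) r0" using sq[of "Suc n"] square_mono[of r r0 "x (Suc n)"] r r0 by auto
        have "?v - x (Suc n) = v - w" by simp
        then have "G (x (Suc n)) ?z = B ?v"
          using G[of "x (Suc n)", unfolded extension_at_def, THEN conjunct2, rule_format, OF in0] by simp
        moreover have "B ?v *v q ?v = bq ?v *s q (?v + T)" by (rule eig)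
        moreover have "?v + T = x n + (v - w)" using xS[of n] by (simp add: algebra_simps)
        ultimately have Gy: "G (x (Suc n)) ?z *v y (Suc n) = bq ?v *s y n" by (simp add: y_def)
        have "G (x (Suc n)) ?z *v y (Suc n) = G (x (Suc n)) ?z *v (?\<alpha> *s p (x (Suc n)) + ?\<beta> *s q (x (Suc n)))"
          using coords by metis
        then have e2: "bq ?v *s y n = ?\<alpha> *s (G (x (Suc n)) ?z *v p (x (Suc n))) + ?\<beta> *s (G (x (Suc n)) ?z *v q (x (Suc n)))"
          unfolding Gy by (simp add: matrix_vector_right_distrib vector_scalar_commute)
        have bv: "bq ?v \<noteq> 0" using c1(1) c1(2)[of ?v] by auto
        have 1: "bq ?v * coord_p (x n) (y n) = ?\<alpha> * ma n ?z + ?\<beta> * mb n ?z"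
          using arg_cong[OF e2, of "coord_p (x n)"] unfolding lin ma_def mb_def .
        have 2: "bq ?v * coord_q (x n) (y n) = ?\<alpha> * mc n ?z + ?\<beta> * md n ?z"
          using arg_cong[OF e2, of "coord_q (x n)"] unfolding lin mc_def md_def .
        have \<beta>: "?\<beta> \<noteq> 0" by (rule cl)
        have "s n = (bq ?v * coord_p (x n) (y n)) / (bq ?v * coord_q (x n) (y n))" using bv by (simp add: s_def)
        also have "\<dots> = (?\<alpha> * ma n ?z + ?\<beta> * mb n ?z) / (?\<alpha> * mc n ?z + ?\<beta> * md n ?z)" unfolding 1 2 ..
        also have "\<dots> = ((?\<alpha> * ma n ?z + ?\<beta> * mb n ?z) / (?\<beta> * ?b n)) / ((?\<alpha> * mc n ?z + ?\<beta> * md n ?z) / (?\<beta> * ?b n))"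
          using \<beta> b0[of n] by simp
        also have "\<dots> = (ma n ?z / ?b n * s (Suc n) + mb n ?z / ?b n) / (mc n ?z / ?b n * s (Suc n) + md n ?z / ?b n)"
          using \<beta> b0[of n] by (simp add: s_def add_divide_distrib mult_ac)
        finally show ?thesis .
      qed
      have "s 0 = \<phi> ?z" by (rule lim[OF z s1 rec])
      moreover have "x 0 = w" "y 0 = q v" by (simp_all add: x_def y_def)
      ultimately have sl: "coord_p w (q v) = coord_q w (q v) * \<phi> ?z" "coord_q w (q v) \<noteq> 0"
        using cl(2)[of 0] by (auto simp: s_def field_simps)
      have "q v = coord_p w (q v) *s p w + coord_q w (q v) *s q w" by (rule coords)
      then have "q v = coord_q w (q v) *s (\<phi> ?z *s p w + q w)"
        unfolding sl(1) by (simp add: vec.scale_right_distrib)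
      then show ?thesis using sl(2) by blast
    qed
    then show ?thesis using \<phi> by blast
  qed
  show ?thesis
  proof (rule that[OF r(1) _ main])
    fix w v assume "v \<in> square w r"
    then show "norm (wedge (q v) (q w)) \<le> c0 / 4"
      using r1(2)[of v w] r(3) by (auto simp: square_def intro: less_le_trans)
  qed
qed

end

section \<open>Uniformly analytic matrices and projective lines\<close>

lemma uniformly_analytic_const: "uniformly_analytic (\<lambda>w. M)"
proof -
  have "\<forall>c. extension_at 1 (1 + norm M) c (\<lambda>w. M) (\<lambda>z. M)"
  proof
    fix c
    have "norm (M $ i $ j) \<le> 1 + norm M" for i j
      using Finite_Cartesian_Product.norm_nth_le[of M i] Finite_Cartesian_Product.norm_nth_le[of "M $ i" j] by linarith
    then show "extension_at 1 (1 + norm M) c (\<lambda>w. M) (\<lambda>z. M)" by (auto simp: extension_at_def)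
  qed
  moreover have "(1::real) > 0" "1 + norm M > 0" by (auto simp: add_pos_nonneg)
  ultimately show ?thesis unfolding uniformly_analytic_def by blast
qed

lemma uniformly_analytic_shift:
  assumes "uniformly_analytic M" shows "uniformly_analytic (\<lambda>w. M (w + a))"
proof -
  obtain r K where r: "r > 0" "K > 0" "\<And>c. \<exists>G. extension_at r K c M G"
    using assms unfolding uniformly_analytic_def by blast
  have "\<exists>G. extension_at r K c (\<lambda>w. M (w + a)) G" for c
  proof -
    obtain G where G: "extension_at r K (c + a) M G" using r(3) by blast
    have "G (real_point (w - c)) = M (w + a)" if "w \<in> square c r" for w
    proof -
      have "w + a \<in> square (c + a) r" using that by (simp add: square_def)
      moreover have "(w + a) - (c + a) = w - c" by simp
      ultimately show ?thesis using G unfolding extension_at_def by metis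
    qed
    then have "extension_at r K c (\<lambda>w. M (w + a)) G" using G unfolding extension_at_def by blast
    then show ?thesis by blast
  qed
  then show ?thesis using r unfolding uniformly_analytic_def by blast
qed

lemma extension_at_mono:
  assumes "extension_at r K c M G" "s \<le> r" "K \<le> L" shows "extension_at s L c M G"
proof -
  have "polydisc s \<subseteq> polydisc r" using assms(2) by auto
  moreover have "square c s \<subseteq> square c r" using square_mono assms(2) by blast
  moreover have "sep_hol s (\<lambda>z. G z $ i $ j)" for i j
    using assms(1) unfolding extension_at_def by (intro sep_hol_subset[OF _ assms(2)]) blast
  moreover have "norm (G z $ i $ j) \<le> L" if "z \<in> polydisc r" for z i j
    using assms(1) that unfolding extension_at_def by (intro order_trans[OF _ assms(3)]) blast
  moreover have "G (real_point (w - c)) = M w" if "w \<in> square c r" for w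
    using assms(1) that unfolding extension_at_def by blast
  ultimately show ?thesis unfolding extension_at_def by blast
qed

lemma uniformly_analytic_mult:
  assumes "uniformly_analytic M" "uniformly_analytic N" shows "uniformly_analytic (\<lambda>w. M w ** N w)"
proof -
  obtain r1 K1 where M: "r1 > 0" "K1 > 0" "\<And>c. \<exists>G. extension_at r1 K1 c M G"
    using assms(1) unfolding uniformly_analytic_def by blast
  obtain r2 K2 where N: "r2 > 0" "K2 > 0" "\<And>c. \<exists>G. extension_at r2 K2 c N G"
    using assms(2) unfolding uniformly_analytic_def by blast
  let ?r = "min r1 r2" let ?K = "2 * (K1 * K2)"
  have "\<exists>G. extension_at ?r ?K c (\<lambda>w. M w ** N w) G" for c
  proof -
    obtain G H where GH: "extension_at r1 K1 c M G" "extension_at r2 K2 c N H" using M(3) N(3) by blast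
    have G: "extension_at ?r K1 c M G" and H: "extension_at ?r K2 c N H"
      using extension_at_mono[OF GH(1)] extension_at_mono[OF GH(2)] by simp_all
    have e: "(G z ** H z) $ i $ j = G z $ i $ 1 * H z $ 1 $ j + G z $ i $ 2 * H z $ 2 $ j" for z i j
      by (simp add: matrix_matrix_mult_def sum_2)
    have gh: "sep_hol ?r (\<lambda>z. G z $ i $ j)" "sep_hol ?r (\<lambda>z. H z $ i $ j)" for i j
      using G H unfolding extension_at_def by blast+
    have "sep_hol ?r (\<lambda>z. (G z ** H z) $ i $ j)" for i j
      unfolding e by (intro sep_hol_add sep_hol_mult gh)
    moreover have "norm ((G z ** H z) $ i $ j) \<le> ?K" if z: "z \<in> polydisc ?r" for z i j
    proof -
      have "norm (G z $ i $ k * H z $ k $ j) \<le> K1 * K2" for k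
        unfolding norm_mult using G H z M N unfolding extension_at_def by (intro mult_mono) auto
      from add_mono[OF this[of 1] this[of 2]] show ?thesis
        unfolding e using norm_triangle_ineq[of "G z $ i $ 1 * H z $ 1 $ j" "G z $ i $ 2 * H z $ 2 $ j"] by linarith
    qed
    moreover have "\<forall>w\<in>square c ?r. G (real_point (w - c)) ** H (real_point (w - c)) = M w ** N w"
      using G H unfolding extension_at_def by simp
    ultimately have "extension_at ?r ?K c (\<lambda>w. M w ** N w) (\<lambda>z. G z ** H z)"
      unfolding extension_at_def by blast
    then show ?thesis by blast
  qed
  moreover have "?r > 0" "?K > 0" using M N by auto
  ultimately show ?thesis unfolding uniformly_analytic_def by blast
qed

text \<open>
  Plays the part of the inverse without a division, so that bounds and analyticity of the
  entries carry over as they are.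
\<close>

definition adjugate2 :: "complex^2^2 \<Rightarrow> complex^2^2" where
  "adjugate2 M = (\<chi> i j. if i = j then (if i = 1 then M $ 2 $ 2 else M $ 1 $ 1) else - M $ i $ j)"

lemma adjugate2_apply: "adjugate2 M *v (M *v x) = det M *s x"
proof -
  have c: "adjugate2 M $ 1 $ 1 = M $ 2 $ 2" "adjugate2 M $ 2 $ 2 = M $ 1 $ 1"
    "adjugate2 M $ 1 $ 2 = - M $ 1 $ 2" "adjugate2 M $ 2 $ 1 = - M $ 2 $ 1"
    by (simp_all add: adjugate2_def)
  have "(adjugate2 M *v (M *v x)) $ 1 = (det M *s x) $ 1"
    unfolding matrix_vector_mult_def sum_2 vec_lambda_beta c det_2 vector_smult_component by algebra
  moreover have "(adjugate2 M *v (M *v x)) $ 2 = (det M *s x) $ 2"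
    unfolding matrix_vector_mult_def sum_2 vec_lambda_beta c det_2 vector_smult_component by algebra
  ultimately show ?thesis by (simp only: vec_eq_iff forall_2)
qed

lemma uniformly_analytic_adjugate:
  assumes "uniformly_analytic M" shows "uniformly_analytic (\<lambda>w. adjugate2 (M w))"
proof -
  obtain r K where M: "r > 0" "K > 0" "\<And>c. \<exists>G. extension_at r K c M G"
    using assms(1) unfolding uniformly_analytic_def by blast
  have "\<exists>G. extension_at r K c (\<lambda>w. adjugate2 (M w)) G" for c
  proof -
    obtain G where G: "extension_at r K c M G" using M(3) by blast
    have g: "sep_hol r (\<lambda>z. G z $ i $ j)" "z \<in> polydisc r \<Longrightarrow> norm (G z $ i $ j) \<le> K" for i j z
      using G unfolding extension_at_def by blast+
    have "sep_hol r (\<lambda>z. adjugate2 (G z) $ i $ j)" for i j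
      unfolding adjugate2_def by (cases "i = j"; cases "i = 1"; simp add: g sep_hol_uminus)
    moreover have "norm (adjugate2 (G z) $ i $ j) \<le> K" if "z \<in> polydisc r" for z i j
      using g(2)[OF that] by (simp add: adjugate2_def)
    moreover have "\<forall>w\<in>square c r. adjugate2 (G (real_point (w - c))) = adjugate2 (M w)"
      using G unfolding extension_at_def by simp
    ultimately have "extension_at r K c (\<lambda>w. adjugate2 (M w)) (\<lambda>z. adjugate2 (G z))"
      unfolding extension_at_def by blast
    then show ?thesis by blast
  qed
  then show ?thesis using M unfolding uniformly_analytic_def by blast
qed

lemma uniformly_analytic_bounded:
  assumes "uniformly_analytic M" obtains K where "K > 0" "\<And>w i j. norm (M w $ i $ j) \<le> K"
proof -
  obtain r K where M: "r > 0" "K > 0" "\<And>c. \<exists>G. extension_at r K c M G"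
    using assms(1) unfolding uniformly_analytic_def by blast
  have "norm (M w $ i $ j) \<le> K" for w i j
  proof -
    obtain G where G: "extension_at r K w M G" using M(3) by blast
    have "G (real_point (w - w)) = M w" "real_point (w - w) \<in> polydisc r"
      using G center_in_square[OF M(1), of w] unfolding extension_at_def real_point_in[symmetric] by blast+
    then show ?thesis using G unfolding extension_at_def by metis
  qed
  with M(2) that show ?thesis by blast
qed

lemma uniformly_analytic_Ck:
  assumes "uniformly_analytic M" shows "Ck n UNIV (\<lambda>w. M w $ i $ j)"
proof (rule Ck_cong_local)
  fix c :: "real^2"
  obtain r K where M: "r > 0" "K > 0" "\<And>c. \<exists>G. extension_at r K c M G"
    using assms(1) unfolding uniformly_analytic_def by blast
  obtain G where G: "extension_at r K c M G" using M(3) by blast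
  have g: "sep_hol r (\<lambda>z. G z $ i $ j)" "\<And>z. z \<in> polydisc r \<Longrightarrow> norm (G z $ i $ j) \<le> K"
    using G unfolding extension_at_def by blast+
  obtain s where s: "s > 0" "s \<le> r" "Ck n (square c s) (\<lambda>w. G (real_point (w - c)) $ i $ j)"
    using sep_hol_Ck[OF g M(1)] by blast
  have "\<forall>x\<in>square c s. M x $ i $ j = G (real_point (x - c)) $ i $ j"
    using G square_mono[OF s(2), of c] unfolding extension_at_def by auto
  then show "\<exists>T g. open T \<and> c \<in> T \<and> Ck n T g \<and> (\<forall>x\<in>T. M x $ i $ j = g x)"
    using s(3) open_square[of c s] center_in_square[OF s(1), of c]
    by (intro exI[of _ "square c s"] exI[of _ "\<lambda>w. G (real_point (w - c)) $ i $ j"] conjI)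
qed

lemma mem_span_singleton: "x \<in> vec.span {v} \<longleftrightarrow> (\<exists>c. x = c *s v)"
  by (auto simp: vec.span_singleton)

lemma span_eq_smult: "c \<noteq> 0 \<Longrightarrow> vec.span {c *s v} = vec.span {v}"
  for v :: "complex^2"
proof (intro set_eqI iffI)
  fix x assume "c \<noteq> 0" "x \<in> vec.span {v}"
  then obtain k where "x = k *s v" unfolding mem_span_singleton by blast
  then have "x = (k / c) *s (c *s v)" using \<open>c \<noteq> 0\<close> by (simp add: vec_eq_iff)
  then show "x \<in> vec.span {c *s v}" unfolding mem_span_singleton by blast
next
  fix x assume "x \<in> vec.span {c *s v}"
  then obtain k where "x = k *s (c *s v)" unfolding mem_span_singleton by blast
  then have "x = (k * c) *s v" by (simp add: vec_eq_iff mult.assoc)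
  then show "x \<in> vec.span {v}" unfolding mem_span_singleton by blast
qed

lemma topspace_projective_line: "topspace projective_line = (\<lambda>v. vec.span {v}) ` (- {0})"
proof
  show "topspace projective_line \<subseteq> (\<lambda>v. vec.span {v}) ` (- {0})"
    using openin_topspace[of projective_line] unfolding openin_projective_line by blast
  have "openin projective_line ((\<lambda>v. vec.span {v}) ` (- {0}))"
    unfolding openin_projective_line
  proof (intro conjI order_refl)
    have "{v. v \<noteq> 0 \<and> vec.span {v} \<in> (\<lambda>v. vec.span {v}) ` (- {0::complex^2})} = - {0}" by auto
    then show "open {v. v \<noteq> 0 \<and> vec.span {v} \<in> (\<lambda>v. vec.span {v}) ` (- {0::complex^2})}"
      using open_Compl[OF closed_singleton[of "0::complex^2"]] by simp
  qed
  then show "(\<lambda>v. vec.span {v}) ` (- {0}) \<subseteq> topspace projective_line" by (rule openin_subset)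
qed

lemma projective_unit_vector:
  assumes "L \<in> topspace projective_line"
  obtains v where "norm v = 1" "L = vec.span {v}"
proof -
  obtain u where u: "u \<noteq> 0" "L = vec.span {u}" using assms unfolding topspace_projective_line by auto
  have "norm (complex_of_real (1 / norm u) *s u) = 1" using u(1) by (simp add: norm_divide)
  moreover have "L = vec.span {complex_of_real (1 / norm u) *s u}" using u span_eq_smult[of "complex_of_real (1 / norm u)" u] by simp
  ultimately show ?thesis using that by blast
qed

text \<open>
  In the quotient topology openness is tested on the preimage, which is the open cone of vectors
  whose wedge with \<open>a\<close> is small.
\<close>

lemma open_near_line:
  assumes a: "norm a = 1" and k: "k > 0"
  shows "openin projective_line {vec.span {v} | v. v \<noteq> 0 \<and> norm (wedge v a) < k * norm v}" (is "openin _ ?V")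
  unfolding openin_projective_line
proof
  show "?V \<subseteq> (\<lambda>v. vec.span {v}) ` (- {0})" by auto
  have "{v. v \<noteq> 0 \<and> vec.span {v} \<in> ?V} = {v. v \<noteq> 0} \<inter> {v. norm (wedge v a) < k * norm v}"
  proof (intro set_eqI iffI)
    fix v assume "v \<in> {v. v \<noteq> 0 \<and> vec.span {v} \<in> ?V}"
    then obtain u where v: "v \<noteq> 0" "vec.span {v} = vec.span {u}" "norm (wedge u a) < k * norm u" by auto
    have "v \<in> vec.span {u}" using v(2) vec.span_base[of v "{v}"] by simp
    then obtain c where c: "v = c *s u" unfolding mem_span_singleton by blast
    then have "c \<noteq> 0" using v(1) by auto
    then have "norm c * norm (wedge u a) < norm c * (k * norm u)" using v(3) by simp
    then show "v \<in> {v. v \<noteq> 0} \<inter> {v. norm (wedge v a) < k * norm v}"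
      using v(1) c by (simp add: wedge_simps norm_mult mult.left_commute)
  qed auto
  moreover have "open ({v. v \<noteq> 0} \<inter> {v. norm (wedge v a) < k * norm v})"
    unfolding wedge_def by (intro open_Int open_Collect_neq open_Collect_less continuous_intros)
  ultimately show "open {v. v \<noteq> 0 \<and> vec.span {v} \<in> ?V}" by simp
qed

text \<open>Continuity of a line field, expressed for arbitrarily chosen unit vectors.\<close>

lemma projective_near:
  assumes l: "continuous_map euclidean projective_line l" and a: "norm a = 1" "l w0 = vec.span {a}" and k: "k > 0"
  obtains S where "open S" "w0 \<in> S" "\<And>w v. w \<in> S \<Longrightarrow> norm v = 1 \<Longrightarrow> l w = vec.span {v} \<Longrightarrow> norm (wedge v a) < k"
proof -
  let ?V = "{vec.span {v} | v. v \<noteq> 0 \<and> norm (wedge v a) < k * norm v}"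
  have o: "openin projective_line ?V" by (rule open_near_line[OF a(1) k])
  have "open {w. l w \<in> ?V}"
    using openin_continuous_map_preimage[OF l o] by simp
  moreover have "l w0 \<in> ?V"
  proof -
    have "a \<noteq> 0 \<and> norm (wedge a a) < k * norm a" using a k by (auto simp: wedge_simps)
    then show ?thesis unfolding a(2) by blast
  qed
  moreover have "norm (wedge v a) < k" if w: "l w \<in> ?V" and v: "norm v = 1" "l w = vec.span {v}" for w v
  proof -
    obtain u where u: "u \<noteq> 0" "vec.span {v} = vec.span {u}" "norm (wedge u a) < k * norm u" using w v(2) by auto
    have "v \<in> vec.span {u}" using u(2) vec.span_base[of v "{v}"] by simp
    then obtain c where c: "v = c *s u" unfolding mem_span_singleton by blast
    have cu: "norm c * norm u = 1" using v(1) c by simp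
    then have "norm c > 0" by (metis norm_ge_zero less_eq_real_def mult_zero_left zero_neq_one)
    then have "norm c * norm (wedge u a) < norm c * (k * norm u)" using u(3) by simp
    then show ?thesis using cu by (simp add: c wedge_simps norm_mult mult.left_commute)
  qed
  ultimately show ?thesis using that[of "{w. l w \<in> ?V}"] by blast
qed

text \<open>
  Distinct lines have nonzero wedge, and the Pluecker relation carries a fixed fraction of this
  bound over to unit vectors in nearby lines, however they are chosen.
\<close>

lemma lines_separated_nearby:
  assumes l: "continuous_map euclidean projective_line l" "continuous_map euclidean projective_line l'"
    and ne: "l w0 \<noteq> l' w0"
  obtains S \<epsilon> where "open S" "w0 \<in> S" "\<epsilon> > 0"
    "\<And>w x y. w \<in> S \<Longrightarrow> norm x = 1 \<Longrightarrow> l w = vec.span {x} \<Longrightarrow> norm y = 1 \<Longrightarrow> l' w = vec.span {y} \<Longrightarrow> \<epsilon> \<le> norm (wedge x y)"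
proof -
  have "l w0 \<in> topspace projective_line" "l' w0 \<in> topspace projective_line"
    using l by (auto simp: continuous_map_def)
  then obtain a b where a: "norm a = 1" "l w0 = vec.span {a}" and b: "norm b = 1" "l' w0 = vec.span {b}"
    by (meson projective_unit_vector)
  define \<delta> where "\<delta> = norm (wedge a b)"
  have "wedge a b \<noteq> 0"
  proof
    assume 0: "wedge a b = 0"
    obtain i where i: "a $ i \<noteq> 0" using a(1) by (metis norm_zero vec_eq_iff zero_index zero_neq_one)
    then have "b = (b $ i / a $ i) *s a"
      using 0 exhaust_2[of i] by (auto simp: vec_eq_iff forall_2 wedge_def field_simps)
    moreover then have "b $ i / a $ i \<noteq> 0" using b(1) by (metis norm_zero vec.scale_zero_left zero_neq_one)
    ultimately have "vec.span {b} = vec.span {a}" using span_eq_smult by metis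
    then show False using ne a b by simp
  qed
  then have \<delta>: "\<delta> > 0" by (simp add: \<delta>_def)
  then have k: "\<delta> / 4 > 0" by simp
  obtain S where S: "open S" "w0 \<in> S" "\<And>w v. w \<in> S \<Longrightarrow> norm v = 1 \<Longrightarrow> l w = vec.span {v} \<Longrightarrow> norm (wedge v a) < \<delta> / 4"
    using projective_near[OF l(1) a k] by blast
  obtain R where R: "open R" "w0 \<in> R" "\<And>w v. w \<in> R \<Longrightarrow> norm v = 1 \<Longrightarrow> l' w = vec.span {v} \<Longrightarrow> norm (wedge v b) < \<delta> / 4"
    using projective_near[OF l(2) b k] by blast
  have "\<delta> / 4 \<le> norm (wedge x y)"
    if w: "w \<in> S \<inter> R" and x: "norm x = 1" "l w = vec.span {x}" and y: "norm y = 1" "l' w = vec.span {y}" for w x y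
  proof -
    have xa: "norm (wedge x a) < \<delta> / 4" using S(3) w x by blast
    have yb: "norm (wedge y b) < \<delta> / 4" using R(3) w y by blast
    have "\<delta> = norm (wedge a b *s x)" by (simp add: \<delta>_def x)
    also have "\<dots> \<le> norm (wedge x b) + norm (wedge a x)"
      unfolding wedge_basis[of a b x] using norm_triangle_ineq[of "wedge x b *s a" "wedge a x *s b"] a b by simp
    finally have xb: "3/4 * \<delta> \<le> norm (wedge x b)" using xa wedge_commute[of a x] by simp
    have "\<delta> = norm (wedge a b *s y)" by (simp add: \<delta>_def y)
    also have "\<dots> \<le> norm (wedge y b) + norm (wedge a y)"
      unfolding wedge_basis[of a b y] using norm_triangle_ineq[of "wedge y b *s a" "wedge a y *s b"] a b by simp
    finally have ya: "3/4 * \<delta> \<le> norm (wedge y a)" using yb wedge_commute[of a y] by simp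
    have "norm (wedge x b) * norm (wedge y a) \<le> norm (wedge x y) * \<delta> + norm (wedge x a) * norm (wedge y b)"
    proof -
      have "wedge x b * wedge y a = wedge x a * wedge y b - wedge x y * wedge a b"
        using wedge_pluecker[of x y a b] by simp
      then have "norm (wedge x b * wedge y a) \<le> norm (wedge x a * wedge y b) + norm (wedge x y * wedge a b)"
        by (simp add: norm_triangle_ineq4)
      then show ?thesis by (simp add: norm_mult \<delta>_def)
    qed
    moreover have "3/4 * \<delta> * (3/4 * \<delta>) \<le> norm (wedge x b) * norm (wedge y a)"
      using xb ya \<delta> by (intro mult_mono) auto
    moreover have "norm (wedge x a) * norm (wedge y b) \<le> \<delta>/4 * (\<delta>/4)"
      using xa yb \<delta> by (intro mult_mono) auto
    ultimately have "\<delta> / 2 * \<delta> \<le> norm (wedge x y) * \<delta>" by (simp add: field_simps)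
    then have "\<delta> / 2 \<le> norm (wedge x y)" using \<delta> by simp
    then show ?thesis using \<delta> by simp
  qed
  then show ?thesis using that[of "S \<inter> R" "\<delta> / 4"] S R k by blast
qed

lemma periodic_lower_bound:
  fixes m :: "real^2 \<Rightarrow> real"
  assumes per: "periodic m" and loc: "\<And>w0. \<exists>S \<epsilon>. open S \<and> w0 \<in> S \<and> \<epsilon> > 0 \<and> (\<forall>w\<in>S. \<epsilon> \<le> m w)"
  obtains \<epsilon> where "\<epsilon> > 0" "\<And>w. \<epsilon> \<le> m w"
proof -
  let ?C = "cbox 0 (\<chi> i. 1) :: (real^2) set"
  obtain S \<epsilon> where S: "\<And>w0. open (S w0) \<and> w0 \<in> S w0 \<and> \<epsilon> w0 > (0::real) \<and> (\<forall>w\<in>S w0. \<epsilon> w0 \<le> m w)"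
    using loc by metis
  have "?C \<subseteq> (\<Union>w0\<in>?C. S w0)" using S by blast
  then obtain D where D: "D \<subseteq> ?C" "finite D" "?C \<subseteq> (\<Union>w0\<in>D. S w0)"
    using compactE_image[OF compact_cbox[of 0 "\<chi> i. 1"], of ?C S] S by metis
  define e where "e = Min (insert 1 (\<epsilon> ` D))"
  have e: "e > 0" unfolding e_def using D(2) S by (subst Min_gr_iff) auto
  have "e \<le> m w" for w
  proof -
    obtain n :: "int^2" and v where v: "v \<in> unit_cell" "w = v + (\<chi> j. of_int (n $ j))" by (rule periodic_reduce)
    then have "v \<in> ?C" using unit_cell_subset_cbox by blast
    then obtain w0 where "w0 \<in> D" "v \<in> S w0" using D(3) by blast
    then have "e \<le> \<epsilon> w0" "\<epsilon> w0 \<le> m v" using D(2) S by (auto simp: e_def)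
    moreover have "m w = m v" using v(2) periodic_int_shift[OF per] by simp
    ultimately show ?thesis by simp
  qed
  with e that show ?thesis by blast
qed

text \<open>A matrix scales all unit vectors of one line by the same factor.\<close>

lemma restricted_norm_span:
  assumes "norm v = 1"
  shows "restricted_norm M (vec.span {v}) = norm (M *v v)" "restricted_conorm M (vec.span {v}) = norm (M *v v)"
proof -
  have "{norm (M *v x) | x. x \<in> vec.span {v} \<and> norm x = 1} = {norm (M *v v)}"
  proof (intro set_eqI iffI)
    fix r assume "r \<in> {norm (M *v x) | x. x \<in> vec.span {v} \<and> norm x = 1}"
    then obtain c where "r = norm (M *v (c *s v))" "norm (c *s v) = 1" unfolding mem_span_singleton by auto
    then show "r \<in> {norm (M *v v)}" using assms by (simp add: vector_scalar_commute)
  next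
    fix r assume "r \<in> {norm (M *v v)}"
    then show "r \<in> {norm (M *v x) | x. x \<in> vec.span {v} \<and> norm x = 1}"
      using assms vec.span_base[of v "{v}"] by auto
  qed
  then show "restricted_norm M (vec.span {v}) = norm (M *v v)" "restricted_conorm M (vec.span {v}) = norm (M *v v)"
    by (simp_all add: restricted_norm_def restricted_conorm_def)
qed

lemma cocycle_iterate_add:
  "cocycle_iterate A \<tau> (m + n) w = cocycle_iterate A \<tau> m (w + real n *\<^sub>R \<tau>) ** cocycle_iterate A \<tau> n w"
proof (induction m)
  case (Suc m)
  have "w + real (m + n) *\<^sub>R \<tau> = (w + real n *\<^sub>R \<tau>) + real m *\<^sub>R \<tau>" by (simp add: algebra_simps)
  then show ?case by (simp only: add_Suc cocycle_iterate.simps matrix_mul_assoc Suc.IH)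
qed simp

section \<open>Analyticity of the invariant lines\<close>

text \<open>
  Around every point \<open>w\<close> the line is the graph of a bounded holomorphic slope over the fixed
  direction \<open>e w\<close>, on squares of one common size. For unit vectors the condition concerns only
  the lines that they span.
\<close>

definition analytic_line :: "(real^2 \<Rightarrow> complex^2) \<Rightarrow> bool" where
  "analytic_line e \<longleftrightarrow> (\<exists>r>0. (\<forall>w. \<forall>v\<in>square w r. norm (wedge (e v) (e w)) \<le> 1/2) \<and>
     (\<forall>w. \<exists>\<phi> p. sep_hol r \<phi> \<and> (\<forall>z\<in>polydisc r. norm (\<phi> z) \<le> 1) \<and>
        (\<forall>v\<in>square w r. \<exists>a. a \<noteq> 0 \<and> e v = a *s (\<phi> (real_point (v - w)) *s p + e w))))"

locale splitting =
  fixes U :: "2 \<Rightarrow> real^2 \<Rightarrow> complex^2^2" and A :: "real^2 \<Rightarrow> complex^2^2" and \<tau> :: "real^2"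
    and l :: "branch \<Rightarrow> real^2 \<Rightarrow> (complex^2) set"
  assumes sa: "strip_admissible U A \<tau>" and ds: "dominated_splitting U A \<tau> l"
begin

lemma sewing: "continuous_on UNIV (U j)" "unitary_matrix (U j w)"
    "U 1 (w + axis 2 1) ** U 2 w = U 2 (w + axis 1 1) ** U 1 w"
  using sa unfolding strip_admissible_def sewing_system_def by auto

lemma cocycle: "continuous_on UNIV A" "det (A w) \<noteq> 0" "A (w + axis j 1) ** U j w = U j (w + \<tau>) ** A w"
  using sa unfolding strip_admissible_def equivariant_cocycle_def by auto

lemma analytic: "uniformly_analytic (U j)" "uniformly_analytic A"
proof -
  obtain \<delta> where "\<delta> > 0" "\<forall>j. extends_to_strip \<delta> (U j)" "extends_to_strip \<delta> A"
    using sa unfolding strip_admissible_def by blast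
  then show "uniformly_analytic (U j)" "uniformly_analytic A"
    using extends_to_strip_uniformly_analytic by blast+
qed

lemma line: "continuous_map euclidean projective_line (l i)" "l i (w + axis j 1) = (*v) (U j w) ` l i w"
    "(*v) (A w) ` l i w = l i (w + \<tau>)"
  using ds unfolding dominated_splitting_def invariant_line_def by auto

text \<open>
  A unit vector of the line at each point, without any continuity in \<open>w\<close>; continuity is a
  property of the line alone.
\<close>

definition e :: "branch \<Rightarrow> real^2 \<Rightarrow> complex^2" where
  "e i w = (SOME v. norm v = 1 \<and> l i w = vec.span {v})"

lemma e: "norm (e i w) = 1" "l i w = vec.span {e i w}"
proof -
  have "l i w \<in> topspace projective_line" using line(1)[of i] by (auto simp: continuous_map_def)
  then have "\<exists>v. norm v = 1 \<and> l i w = vec.span {v}" using projective_unit_vector by metis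
  from someI_ex[OF this] show "norm (e i w) = 1" "l i w = vec.span {e i w}" by (auto simp: e_def)
qed

lemma e_in_line: "e i w \<in> l i w"
  using vec.span_base[of "e i w" "{e i w}"] e(2)[of i w] by simp

lemma in_line: "x \<in> l i w \<Longrightarrow> \<exists>c. x = c *s e i w"
  unfolding e(2)[of i w] mem_span_singleton .

lemma e_sew: "\<exists>c. norm c = 1 \<and> e i (w + axis j 1) = c *s (U j w *v e i w)"
proof -
  have "U j w *v e i w \<in> l i (w + axis j 1)" unfolding line(2) using e_in_line by blast
  then obtain k where k: "U j w *v e i w = k *s e i (w + axis j 1)" using in_line by blast
  have "norm (U j w *v e i w) = 1" using unitary_norm[OF sewing(2)] e(1) by simp
  then have "norm k = 1" unfolding k by (simp add: e(1))
  moreover then have "e i (w + axis j 1) = (1 / k) *s (U j w *v e i w)" unfolding k by (auto simp: vec_eq_iff)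
  ultimately show ?thesis by (metis norm_divide norm_one div_by_1)
qed

lemma e_cocycle: "\<exists>k. A w *v e i w = k *s e i (w + \<tau>)"
proof -
  have "A w *v e i w \<in> l i (w + \<tau>)" unfolding line(3)[symmetric] using e_in_line by blast
  then show ?thesis using in_line by blast
qed

lemma e_iterate: "\<exists>k. cocycle_iterate A \<tau> n w *v e i w = k *s e i (w + real n *\<^sub>R \<tau>)"
proof (induction n)
  case 0
  show ?case by (rule exI[of _ 1]) simp
next
  case (Suc n)
  then obtain k where k: "cocycle_iterate A \<tau> n w *v e i w = k *s e i (w + real n *\<^sub>R \<tau>)" by blast
  obtain k' where k': "A (w + real n *\<^sub>R \<tau>) *v e i (w + real n *\<^sub>R \<tau>) = k' *s e i (w + real n *\<^sub>R \<tau> + \<tau>)"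
    using e_cocycle by blast
  have "cocycle_iterate A \<tau> (Suc n) w *v e i w = A (w + real n *\<^sub>R \<tau>) *v (k *s e i (w + real n *\<^sub>R \<tau>))"
    by (simp add: matrix_vector_mul_assoc[symmetric] k)
  also have "\<dots> = (k * k') *s e i (w + real n *\<^sub>R \<tau> + \<tau>)"
    by (simp add: vector_scalar_commute k')
  also have "w + real n *\<^sub>R \<tau> + \<tau> = w + real (Suc n) *\<^sub>R \<tau>" by (simp add: algebra_simps)
  finally show ?case by blast
qed

text \<open>The multiplier of the \<open>n\<close>-th iterate with respect to these unit vectors.\<close>

definition b :: "branch \<Rightarrow> nat \<Rightarrow> real^2 \<Rightarrow> complex" where
  "b i n w = (SOME k. cocycle_iterate A \<tau> n w *v e i w = k *s e i (w + real n *\<^sub>R \<tau>))"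

lemma b: "cocycle_iterate A \<tau> n w *v e i w = b i n w *s e i (w + real n *\<^sub>R \<tau>)"
  using someI_ex[OF e_iterate[of n w i]] by (simp add: b_def)

lemma e_nonzero: "e i w \<noteq> 0" using e(1)[of i w] by auto

lemma norm_b: "norm (b i n w) = norm (cocycle_iterate A \<tau> n w *v e i w)"
  unfolding b by (simp add: e(1))

lemma b_add: "b i (m + n) w = b i m (w + real n *\<^sub>R \<tau>) * b i n w"
proof -
  have "b i (m + n) w *s e i (w + real (m + n) *\<^sub>R \<tau>) = cocycle_iterate A \<tau> (m + n) w *v e i w"
    by (rule b[symmetric])
  also have "\<dots> = cocycle_iterate A \<tau> m (w + real n *\<^sub>R \<tau>) *v (cocycle_iterate A \<tau> n w *v e i w)"
    unfolding cocycle_iterate_add by (simp add: matrix_vector_mul_assoc)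
  also have "\<dots> = (b i n w * b i m (w + real n *\<^sub>R \<tau>)) *s e i (w + real n *\<^sub>R \<tau> + real m *\<^sub>R \<tau>)"
    unfolding b by (simp add: vector_scalar_commute b)
  also have "w + real n *\<^sub>R \<tau> + real m *\<^sub>R \<tau> = w + real (m + n) *\<^sub>R \<tau>" by (simp add: algebra_simps)
  finally show ?thesis using e_nonzero by (simp add: mult.commute)
qed

lemma det_iterate_nonzero: "det (cocycle_iterate A \<tau> n w) \<noteq> 0"
  by (induction n) (auto simp: det_mul cocycle(2))

lemma b_nonzero: "b i n w \<noteq> 0"
proof
  assume "b i n w = 0"
  then have "cocycle_iterate A \<tau> n w *v e i w = 0" using b[of n w i] by simp
  then have "adjugate2 (cocycle_iterate A \<tau> n w) *v (cocycle_iterate A \<tau> n w *v e i w) = 0" by simp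
  then show False unfolding adjugate2_apply using det_iterate_nonzero e_nonzero by simp
qed

text \<open>
  The unitary sewing maps preserve the angle between the lines, so its sine is periodic and
  bounded below by compactness.
\<close>

lemma angle_bound: obtains c0 where "c0 > 0" "\<And>w. c0 \<le> norm (wedge (e Stable w) (e Unstable w))"
proof (rule periodic_lower_bound[of "\<lambda>w. norm (wedge (e Stable w) (e Unstable w))"])
  show "periodic (\<lambda>w. norm (wedge (e Stable w) (e Unstable w)))"
    unfolding periodic_def
  proof (intro allI)
    fix j w
    obtain c d where c: "norm c = 1" "e Stable (w + axis j 1) = c *s (U j w *v e Stable w)"
      and d: "norm d = 1" "e Unstable (w + axis j 1) = d *s (U j w *v e Unstable w)"
      using e_sew by metis
    show "norm (wedge (e Stable (w + axis j 1)) (e Unstable (w + axis j 1))) = norm (wedge (e Stable w) (e Unstable w))"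
      unfolding c d wedge_simps wedge_matrix by (simp add: norm_mult c d unitary_det[OF sewing(2)])
  qed
  show "\<exists>S \<epsilon>. open S \<and> w0 \<in> S \<and> \<epsilon> > 0 \<and> (\<forall>w\<in>S. \<epsilon> \<le> norm (wedge (e Stable w) (e Unstable w)))" for w0
  proof -
    have "l Stable w0 \<noteq> l Unstable w0" using ds unfolding dominated_splitting_def by blast
    from lines_separated_nearby[OF line(1) line(1) this] show ?thesis using e by metis
  qed
qed (use that in blast)

lemma det_bound: obtains d0 where "d0 > 0" "\<And>w. d0 \<le> norm (det (A w))"
proof (rule periodic_lower_bound[of "\<lambda>w. norm (det (A w))"])
  show "periodic (\<lambda>w. norm (det (A w)))" unfolding periodic_def
  proof (intro allI)
    fix j w
    have "det (A (w + axis j 1)) * det (U j w) = det (U j (w + \<tau>)) * det (A w)"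
      using arg_cong[OF cocycle(3)[of w j], of det] by (simp add: det_mul)
    then have "norm (det (A (w + axis j 1))) * norm (det (U j w)) = norm (det (U j (w + \<tau>))) * norm (det (A w))"
      by (metis norm_mult)
    then show "norm (det (A (w + axis j 1))) = norm (det (A w))" by (simp add: unitary_det[OF sewing(2)])
  qed
  show "\<exists>S \<epsilon>. open S \<and> w0 \<in> S \<and> \<epsilon> > 0 \<and> (\<forall>w\<in>S. \<epsilon> \<le> norm (det (A w)))" for w0
  proof -
    have "continuous_on UNIV (\<lambda>w. det (A w))" unfolding det_2 by (intro continuous_intros cocycle(1))
    then have "open {w. norm (det (A w0)) / 2 < norm (det (A w))}"
      by (intro open_Collect_less continuous_intros)
    moreover have "norm (det (A w0)) > 0" using cocycle(2) by simp
    ultimately show ?thesis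
      by (intro exI[of _ "{w. norm (det (A w0)) / 2 < norm (det (A w))}"] exI[of _ "norm (det (A w0)) / 2"]) auto
  qed
qed (use that in blast)

lemma iterate_analytic: "uniformly_analytic (cocycle_iterate A \<tau> n)"
proof (induction n)
  case 0
  have "cocycle_iterate A \<tau> 0 = (\<lambda>w. mat 1)" by auto
  then show ?case using uniformly_analytic_const by simp
next
  case (Suc n)
  have "cocycle_iterate A \<tau> (Suc n) = (\<lambda>w. A (w + real n *\<^sub>R \<tau>) ** cocycle_iterate A \<tau> n w)" by auto
  then show ?case using uniformly_analytic_mult[OF uniformly_analytic_shift[OF analytic(2)] Suc] by simp
qed

lemma strongly_dominated:
  assumes "\<epsilon> > 0"
  obtains n where "\<And>w. norm (b Stable n w) \<le> \<epsilon> * norm (b Unstable n w)"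
proof -
  obtain N \<kappa> where N: "0 < \<kappa>" "\<kappa> < 1"
    "\<And>w. restricted_norm (cocycle_iterate A \<tau> N w) (l Stable w) / restricted_conorm (cocycle_iterate A \<tau> N w) (l Unstable w) \<le> \<kappa>\<^sup>2"
    using ds unfolding dominated_splitting_def by blast
  have 1: "norm (b Stable N w) \<le> \<kappa>\<^sup>2 * norm (b Unstable N w)" for w
  proof -
    have s: "restricted_norm (cocycle_iterate A \<tau> N w) (l Stable w) = norm (b Stable N w)"
      by (simp only: e(2)[of Stable w] restricted_norm_span(1)[OF e(1)] norm_b)
    have u: "restricted_conorm (cocycle_iterate A \<tau> N w) (l Unstable w) = norm (b Unstable N w)"
      by (simp only: e(2)[of Unstable w] restricted_norm_span(2)[OF e(1)] norm_b)
    have "norm (b Stable N w) / norm (b Unstable N w) \<le> \<kappa>\<^sup>2"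
      using N(3)[of w] unfolding s u .
    then show ?thesis using b_nonzero[of Unstable N w] by (simp add: pos_divide_le_eq)
  qed
  have k: "norm (b Stable (N * k) w) \<le> (\<kappa>\<^sup>2) ^ k * norm (b Unstable (N * k) w)" for k w
  proof (induction k arbitrary: w)
    case 0
    have "b i 0 w = 1" for i
    proof -
      have "b i 0 w *s e i w = 1 *s e i w" using b[of 0 w i] by simp
      then show ?thesis using e_nonzero vec.scale_right_imp_eq by blast
    qed
    then show ?case by simp
  next
    case (Suc k)
    have "norm (b Stable (N + N * k) w) = norm (b Stable N (w + real (N * k) *\<^sub>R \<tau>)) * norm (b Stable (N * k) w)"
      unfolding b_add norm_mult ..
    also have "\<dots> \<le> (\<kappa>\<^sup>2 * norm (b Unstable N (w + real (N * k) *\<^sub>R \<tau>))) * ((\<kappa>\<^sup>2) ^ k * norm (b Unstable (N * k) w))"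
      using N(1) by (intro mult_mono 1 Suc) auto
    also have "\<dots> = (\<kappa>\<^sup>2) ^ Suc k * norm (b Unstable (N + N * k) w)"
      unfolding b_add norm_mult by simp
    finally show ?case by simp
  qed
  have "\<kappa>\<^sup>2 < 1" using mult_strict_mono[of \<kappa> 1 \<kappa> 1] N by (simp add: power2_eq_square)
  then obtain m where m: "(\<kappa>\<^sup>2) ^ m < \<epsilon>" using real_arch_pow_inv[OF assms] by blast
  have "norm (b Stable (N * m) w) \<le> \<epsilon> * norm (b Unstable (N * m) w)" for w
    by (rule order_trans[OF k]) (use m in \<open>intro mult_right_mono; simp\<close>)
  then show ?thesis using that by blast
qed

text \<open>
  A high iterate \<open>B\<close> makes the unstable line dominate as strongly as required. For the stable
  line, the adjugate of \<open>B\<close> acts over the translation by \<open>- T\<close>; its multipliers on the two lines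
  are \<open>det B\<close> divided by those of \<open>B\<close>, which exchanges the roles of the lines and keeps the
  ratio.
\<close>

theorem lines_analytic: "analytic_line (e i)"
proof -
  obtain c0 where c0: "c0 > 0" "\<And>w. c0 \<le> norm (wedge (e Stable w) (e Unstable w))" using angle_bound by blast
  obtain d0 where d0: "d0 > 0" "\<And>w. d0 \<le> norm (det (A w))" using det_bound by blast
  define t where "t = min (1/4) (c0 ^ 3 / 256)"
  have t: "t > 0" "t \<le> 1/4" "t \<le> c0 ^ 3 / 256" using c0(1) by (auto simp: t_def)
  obtain n where dom: "\<And>w. norm (b Stable n w) \<le> t * norm (b Unstable n w)" using strongly_dominated[OF t(1)] by blast
  define B where "B = cocycle_iterate A \<tau> n"
  define T where "T = real n *\<^sub>R \<tau>"
  have Ban: "uniformly_analytic B" unfolding B_def by (rule iterate_analytic)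
  have Bb: "B w *v e i w = b i n w *s e i (w + T)" for i w unfolding B_def T_def by (rule b)
  have detB: "d0 ^ n \<le> norm (det (B w))" for w
  proof -
    have "d0 ^ m \<le> norm (det (cocycle_iterate A \<tau> m w))" for m
    proof (induction m)
      case (Suc m)
      show ?case using mult_mono[OF d0(2) Suc] d0(1) by (simp add: det_mul norm_mult)
    qed simp
    then show ?thesis by (simp add: B_def)
  qed
  have detB0: "det (B w) \<noteq> 0" for w unfolding B_def by (rule det_iterate_nonzero)
  obtain K where K: "K > 0" "\<And>w i j. norm (B w $ i $ j) \<le> K" using uniformly_analytic_bounded[OF Ban] by blast
  have bK: "norm (b i n w) \<le> 4 * K" for i w
    using norm_matrix_vector_le[of "B w" K "e i w"] K(2) unfolding norm_b B_def[symmetric] e(1) by simp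
  have bsu: "d0 ^ n * c0 / 2 \<le> norm (b Stable n w) * norm (b Unstable n w)" for w
  proof -
    have "wedge (B w *v e Stable w) (B w *v e Unstable w) = det (B w) * wedge (e Stable w) (e Unstable w)"
      by (rule wedge_matrix)
    then have "norm (b Stable n w) * norm (b Unstable n w) * norm (wedge (e Stable (w + T)) (e Unstable (w + T)))
       = norm (det (B w)) * norm (wedge (e Stable w) (e Unstable w))"
      unfolding Bb wedge_simps by (metis norm_mult mult.assoc mult.left_commute)
    moreover have "d0 ^ n * c0 \<le> norm (det (B w)) * norm (wedge (e Stable w) (e Unstable w))"
      using detB c0 d0 by (intro mult_mono) auto
    moreover have "norm (b Stable n w) * norm (b Unstable n w) * norm (wedge (e Stable (w + T)) (e Unstable (w + T)))
       \<le> norm (b Stable n w) * norm (b Unstable n w) * 2"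
      using norm_wedge_le[of "e Stable (w + T)" "e Unstable (w + T)"] by (intro mult_left_mono) (auto simp: e(1))
    ultimately show ?thesis by linarith
  qed
  have D: "d0 ^ n > 0" using d0 by simp
  have U: "dominated_pair B T (e Stable) (e Unstable) (b Stable n) (b Unstable n) c0 (d0 ^ n * c0 / 2 / (4 * K)) t"
  proof
    show "d0 ^ n * c0 / 2 / (4 * K) \<le> norm (b Unstable n w)" for w
    proof -
      have "norm (b Stable n w) * norm (b Unstable n w) \<le> (4 * K) * norm (b Unstable n w)"
        by (intro mult_right_mono bK) simp
      then have "d0 ^ n * c0 / 2 \<le> (4 * K) * norm (b Unstable n w)" using bsu[of w] by linarith
      then show ?thesis using K(1) by (simp add: pos_divide_le_eq mult.commute)
    qed
  qed (use Ban e(1) c0 Bb t dom D K(1) in auto)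
  let ?B' = "\<lambda>w. adjugate2 (B (w - T))"
  let ?b' = "\<lambda>i w. det (B (w - T)) / b i n (w - T)"
  have Bb': "?B' w *v e i w = ?b' i w *s e i (w + - T)" for i w
  proof -
    have "?b' i w *s e i (w - T) = (1 / b i n (w - T)) *s (det (B (w - T)) *s e i (w - T))"
      by (simp add: vec_eq_iff)
    also have "\<dots> = (1 / b i n (w - T)) *s (?B' w *v (b i n (w - T) *s e i (w - T + T)))"
      unfolding adjugate2_apply[symmetric] Bb ..
    also have "\<dots> = ?B' w *v e i w" using b_nonzero[of i n "w - T"] by (simp add: vector_scalar_commute vec_eq_iff)
    finally show ?thesis by simp
  qed
  have S: "dominated_pair ?B' (- T) (e Unstable) (e Stable) (?b' Unstable) (?b' Stable) c0 (d0 ^ n / (4 * K)) t"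
  proof
    show "uniformly_analytic ?B'"
      using uniformly_analytic_adjugate[OF uniformly_analytic_shift[OF Ban, of "- T"]] by simp
    show "d0 ^ n / (4 * K) \<le> norm (?b' Stable w)" for w
      unfolding norm_divide using detB bK b_nonzero by (intro frac_le) auto
    show "norm (?b' Unstable w) \<le> t * norm (?b' Stable w)" for w
    proof -
      have nz: "norm (b Unstable n (w - T)) > 0" "norm (b Stable n (w - T)) > 0" using b_nonzero by auto
      have "norm (det (B (w - T))) * norm (b Stable n (w - T)) \<le> norm (det (B (w - T))) * (t * norm (b Unstable n (w - T)))"
        by (intro mult_left_mono dom) simp
      then show ?thesis using nz by (simp add: norm_divide divide_simps mult_ac)
    qed
    show "c0 \<le> norm (wedge (e Unstable w) (e Stable w))" for w
      using c0(2)[of w] wedge_commute[of "e Unstable w"] by simp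
  qed (use e(1) c0 Bb' t D K(1) in auto)
  have c02: "c0 / 4 \<le> 1/2"
    using c0(2)[of 0] norm_wedge_le[of "e Stable 0" "e Unstable 0"] by (simp add: e(1))
  show ?thesis
  proof (cases i)
    case Stable
    obtain r where r: "r > 0" "\<And>w v. v \<in> square w r \<Longrightarrow> norm (wedge (e Stable v) (e Stable w)) \<le> c0 / 4"
      "\<And>w. \<exists>\<phi>. sep_hol r \<phi> \<and> (\<forall>z\<in>polydisc r. norm (\<phi> z) \<le> 1) \<and>
       (\<forall>v\<in>square w r. \<exists>a. a \<noteq> 0 \<and> e Stable v = a *s (\<phi> (real_point (v - w)) *s e Unstable w + e Stable w))"
      using dominated_pair.strong_line_analytic[OF S] by blast
    show ?thesis unfolding analytic_line_def Stable
    proof (intro exI[of _ r] conjI allI ballI r(1))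
      show "norm (wedge (e Stable v) (e Stable w)) \<le> 1/2" if "v \<in> square w r" for v w
        using order_trans[OF r(2)[OF that] c02] .
      show "\<exists>\<phi> p. sep_hol r \<phi> \<and> (\<forall>z\<in>polydisc r. norm (\<phi> z) \<le> 1) \<and>
        (\<forall>v\<in>square w r. \<exists>a. a \<noteq> 0 \<and> e Stable v = a *s (\<phi> (real_point (v - w)) *s p + e Stable w))" for w
        using r(3)[of w] by (elim exE) (intro exI)
    qed
  next
    case Unstable
    obtain r where r: "r > 0" "\<And>w v. v \<in> square w r \<Longrightarrow> norm (wedge (e Unstable v) (e Unstable w)) \<le> c0 / 4"
      "\<And>w. \<exists>\<phi>. sep_hol r \<phi> \<and> (\<forall>z\<in>polydisc r. norm (\<phi> z) \<le> 1) \<and>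
       (\<forall>v\<in>square w r. \<exists>a. a \<noteq> 0 \<and> e Unstable v = a *s (\<phi> (real_point (v - w)) *s e Stable w + e Unstable w))"
      using dominated_pair.strong_line_analytic[OF U] by blast
    show ?thesis unfolding analytic_line_def Unstable
    proof (intro exI[of _ r] conjI allI ballI r(1))
      show "norm (wedge (e Unstable v) (e Unstable w)) \<le> 1/2" if "v \<in> square w r" for v w
        using order_trans[OF r(2)[OF that] c02] .
      show "\<exists>\<phi> p. sep_hol r \<phi> \<and> (\<forall>z\<in>polydisc r. norm (\<phi> z) \<le> 1) \<and>
        (\<forall>v\<in>square w r. \<exists>a. a \<noteq> 0 \<and> e Unstable v = a *s (\<phi> (real_point (v - w)) *s p + e Unstable w))" for w
        using r(3)[of w] by (elim exE) (intro exI)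
    qed
  qed
qed

end

section \<open>Smooth lifts of lines and difference equations\<close>

text \<open>A continuous function with discrete values on a connected space is constant.\<close>

lemma exp_const_one:
  fixes g :: "'a::real_normed_vector \<Rightarrow> complex"
  assumes g: "continuous_on UNIV g" and e: "\<And>w. exp (g w) = 1"
  obtains m :: int where "\<And>w. g w = 2 * pi * \<i> * of_int m"
proof -
  define f where "f w = g w / (2 * pi * \<i>)" for w
  have int: "\<exists>n::int. f w = of_int n" for w
  proof -
    obtain n :: int where "g w = of_int (2 * n) * pi * \<i>" using e[of w] complex_eq_iff exp_eq_1
      by (metis (no_types, opaque_lifting) Complex_eq Re_complex_of_real complex_is_Real_iff add_0 exp_eq[of "g w" 0] exp_zero)
    then show ?thesis by (auto simp: f_def)
  qed
  have "f constant_on UNIV"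
  proof (rule continuous_discrete_range_constant)
    show "continuous_on UNIV f" unfolding f_def by (intro continuous_intros g) auto
    fix x :: 'a
    show "\<exists>r>0. \<forall>y. y \<in> UNIV \<and> f y \<noteq> f x \<longrightarrow> r \<le> norm (f y - f x)"
    proof (intro exI[of _ 1] conjI allI impI)
      fix y assume y: "y \<in> UNIV \<and> f y \<noteq> f x"
      obtain n k :: int where n: "f y = of_int n" "f x = of_int k" using int by metis
      then have "n \<noteq> k" using y by auto
      then have "1 \<le> \<bar>n - k\<bar>" by linarith
      moreover have "norm (f y - f x) = \<bar>of_int (n - k)\<bar>" unfolding n by (simp flip: of_int_diff)
      ultimately show "1 \<le> norm (f y - f x)" by (metis of_int_1_le_iff of_int_abs)
    qed simp
  qed auto
  then obtain c where c: "\<And>w. f w = c" by (auto simp: constant_on_def)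
  obtain n :: int where n: "c = of_int n" using int[of 0] c by metis
  have "g w = 2 * pi * \<i> * of_int n" for w
    using c[of w] unfolding f_def n by (simp add: field_simps)
  then show ?thesis using that by blast
qed

lemma continuous_log:
  fixes f :: "'a::real_normed_vector \<Rightarrow> complex"
  assumes "continuous_on UNIV f" "\<And>w. f w \<noteq> 0"
  obtains g where "continuous_on UNIV g" "\<And>w. f w = exp (g w)"
  using continuous_logarithm_on_contractible[OF assms(1) contractible_UNIV] assms(2) by auto

lemma hinner_smult: "hinner (c *s x) y = cnj c * hinner x y" "hinner x (c *s y) = c * hinner x y"
  by (simp_all add: hinner_def sum_2 algebra_simps)

lemma hinner_self_nonzero: "x \<noteq> 0 \<Longrightarrow> hinner x x \<noteq> 0"
  unfolding hinner_self by simp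

lemma lagrange_identity: "(norm (hinner x y))\<^sup>2 + (norm (wedge x y))\<^sup>2 = (norm x)\<^sup>2 * (norm y)\<^sup>2"
proof -
  have "hinner x y * cnj (hinner x y) + wedge x y * cnj (wedge x y) = hinner x x * hinner y y"
    by (simp add: hinner_def wedge_def sum_2) algebra
  then have "complex_of_real ((norm (hinner x y))\<^sup>2 + (norm (wedge x y))\<^sup>2) = complex_of_real ((norm x)\<^sup>2 * (norm y)\<^sup>2)"
    unfolding hinner_self complex_norm_square[symmetric] by simp
  then show ?thesis unfolding of_real_eq_iff .
qed

definition Ckv :: "nat \<Rightarrow> (real^2 \<Rightarrow> complex^2) \<Rightarrow> bool" where
  "Ckv n v \<longleftrightarrow> (\<forall>a. Ck n UNIV (\<lambda>w. v w $ a))"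

lemma Ckv_continuous: "Ckv n v \<Longrightarrow> continuous_on UNIV v"
proof -
  assume "Ckv n v"
  then have "continuous_on UNIV (\<lambda>w. v w $ a)" for a unfolding Ckv_def using Ck_continuous by blast
  then have "continuous_on UNIV (\<lambda>w. \<chi> a. v w $ a)" by (rule continuous_on_vec_lambda)
  then show ?thesis by simp
qed

lemma Ckv_smult: "Ck n UNIV f \<Longrightarrow> Ckv n v \<Longrightarrow> Ckv n (\<lambda>w. f w *s v w)"
  unfolding Ckv_def by (auto intro: Ck_mult)

lemma Ckv_matrix: "(\<And>i j. Ck n UNIV (\<lambda>w. M w $ i $ j)) \<Longrightarrow> Ckv n v \<Longrightarrow> Ckv n (\<lambda>w. M w *v v w)"
  unfolding Ckv_def matrix_vector_mult_def sum_2 vec_lambda_beta by (auto intro!: Ck_add Ck_mult)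

lemma Ckv_shift: "Ckv n v \<Longrightarrow> Ckv n (\<lambda>w. v (w + a))"
  unfolding Ckv_def using Ck_shift by blast

lemma Ck_hinner: "Ckv n u \<Longrightarrow> Ckv n v \<Longrightarrow> Ck n UNIV (\<lambda>w. hinner (u w) (v w))"
  unfolding Ckv_def hinner_def sum_2 by (intro Ck_add Ck_mult Ck_cnj) auto

text \<open>
  The orthogonal projection onto the line is the same for all unit vectors of the line, so the
  uncontrolled phases of \<open>e\<close> disappear.
\<close>

lemma projection_Ck:
  assumes an: "analytic_line e" and unit: "\<And>w. norm (e w) = 1"
  shows "Ck n UNIV (\<lambda>w. e w $ i * cnj (e w $ j))"
proof (rule Ck_cong_local)
  fix w0 :: "real^2"
  obtain r \<phi> p where r: "r > 0" "sep_hol r \<phi>" "\<And>z. z \<in> polydisc r \<Longrightarrow> norm (\<phi> z) \<le> 1"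
    "\<And>v. v \<in> square w0 r \<Longrightarrow> \<exists>a. a \<noteq> 0 \<and> e v = a *s (\<phi> (real_point (v - w0)) *s p + e w0)"
    using an unfolding analytic_line_def by metis
  obtain s where s: "s > 0" "s \<le> r" "Ck n (square w0 s) (\<lambda>w. \<phi> (real_point (w - w0)))"
    using sep_hol_Ck[OF r(2,3,1)] by blast
  define x where "x w = \<phi> (real_point (w - w0)) *s p + e w0" for w
  have xc: "Ck n (square w0 s) (\<lambda>w. x w $ a)" for a
    unfolding x_def vector_add_component vector_smult_component
    by (intro Ck_add Ck_mult Ck_const open_square s(3))
  have ev: "\<exists>a. a \<noteq> 0 \<and> e w = a *s x w" if "w \<in> square w0 s" for w
    using r(4)[of w] that square_mono[OF s(2)] unfolding x_def by blast
  define D where "D w = x w $ 1 * cnj (x w $ 1) + x w $ 2 * cnj (x w $ 2)" for w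
  have D: "D w = of_real ((norm (x w))\<^sup>2)" for w
    unfolding D_def norm_vec2_sq of_real_add complex_norm_square ..
  have x0: "x w \<noteq> 0" if "w \<in> square w0 s" for w using ev[OF that] unit[of w] by auto
  have D0: "D w \<noteq> 0" if "w \<in> square w0 s" for w using x0[OF that] by (simp add: D)
  have "Ck n (square w0 s) (\<lambda>w. x w $ i * cnj (x w $ j) / D w)"
    unfolding D_def by (intro Ck_divide Ck_mult Ck_add Ck_cnj xc open_square) (use D0 in \<open>simp add: D_def\<close>)
  moreover have "e w $ i * cnj (e w $ j) = x w $ i * cnj (x w $ j) / D w" if w: "w \<in> square w0 s" for w
  proof -
    obtain a where a: "e w = a *s x w" using ev[OF w] by blast
    have "norm a * norm (x w) = 1" using unit[of w] unfolding a by simp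
    then have "(norm a)\<^sup>2 * (norm (x w))\<^sup>2 = 1" by (simp add: power_mult_distrib[symmetric])
    then have "a * cnj a * D w = 1" unfolding D complex_norm_square[symmetric] by (metis of_real_mult of_real_1)
    then have "a * cnj a = 1 / D w" using D0[OF w] by (simp add: field_simps)
    moreover have "e w $ i * cnj (e w $ j) = (a * cnj a) * (x w $ i * cnj (x w $ j))" unfolding a by simp
    ultimately show ?thesis by simp
  qed
  ultimately show "\<exists>T g. open T \<and> w0 \<in> T \<and> Ck n T g \<and> (\<forall>w\<in>T. e w $ i * cnj (e w $ j) = g w)"
    using open_square[of w0 s] center_in_square[OF s(1), of w0]
    by (intro exI[of _ "square w0 s"] exI[of _ "\<lambda>w. x w $ i * cnj (x w $ j) / D w"] conjI) auto
qed

text \<open>A smooth staircase of \<open>k\<close> steps, which follows the identity on \<open>[0, k]\<close> up to an error of 1.\<close>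

definition step_sum :: "nat \<Rightarrow> nat \<Rightarrow> real \<Rightarrow> real" where
  "step_sum n k t = (\<Sum>i<k. cutoff n (t - real i))"

lemma step_sum_neg: "t \<le> 0 \<Longrightarrow> step_sum n k t = 0"
  unfolding step_sum_def by (intro sum.neutral) (auto intro: cutoff_0)

lemma step_sum_full: "real k \<le> t \<Longrightarrow> step_sum n k t = real k"
proof -
  assume "real k \<le> t"
  then have "step_sum n k t = (\<Sum>i<k. 1)" unfolding step_sum_def by (intro sum.cong refl cutoff_1) auto
  then show ?thesis by simp
qed

lemma step_sum_close: "0 \<le> t \<Longrightarrow> t \<le> real k \<Longrightarrow> \<bar>step_sum n k t - t\<bar> \<le> 1"
proof (induction k)
  case (Suc k)
  show ?case
  proof (cases "t \<le> real k")
    case True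
    then have "step_sum n (Suc k) t = step_sum n k t" by (simp add: step_sum_def cutoff_0)
    then show ?thesis using Suc True by simp
  next
    case False
    then have "step_sum n (Suc k) t = real k + cutoff n (t - real k)"
      using step_sum_full[of k t n] by (simp add: step_sum_def)
    then show ?thesis using cutoff_range[of n "t - real k"] False Suc.prems by simp
  qed
qed (simp add: step_sum_def)

text \<open>
  Position after \<open>k\<close> steps of a walk from the origin towards \<open>w\<close> whose steps have length at most
  \<open>\<rho>\<close> in each coordinate; the walk comes to rest near \<open>w\<close>, and each position is a smooth
  function of \<open>w\<close>.
\<close>

definition walk :: "nat \<Rightarrow> real \<Rightarrow> nat \<Rightarrow> real^2 \<Rightarrow> real^2" where
  "walk n \<rho> k w = (\<chi> j. \<rho> * (step_sum n k (w $ j / \<rho>) - step_sum n k (- (w $ j / \<rho>))))"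

lemma walk_0: "walk n \<rho> 0 w = 0"
  by (simp add: walk_def step_sum_def vec_eq_iff)

lemma walk_step:
  assumes "\<rho> > 0" shows "\<bar>walk n \<rho> (Suc k) w $ j - walk n \<rho> k w $ j\<bar> \<le> \<rho>"
proof -
  let ?t = "w $ j / \<rho>"
  have "walk n \<rho> (Suc k) w $ j - walk n \<rho> k w $ j = \<rho> * (cutoff n (?t - real k) - cutoff n (- ?t - real k))"
    by (simp add: walk_def step_sum_def algebra_simps)
  moreover have "\<bar>cutoff n (?t - real k) - cutoff n (- ?t - real k)\<bar> \<le> 1"
    using cutoff_range[of n "?t - real k"] cutoff_range[of n "- ?t - real k"] by linarith
  ultimately show ?thesis using assms by (simp add: abs_mult)
qed

lemma walk_stable:
  assumes "\<rho> > 0" "\<And>j. \<bar>w $ j / \<rho>\<bar> \<le> real k" shows "walk n \<rho> (Suc k) w = walk n \<rho> k w"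
proof -
  have "step_sum n (Suc k) t = step_sum n k t" if "t \<le> real k" for t
    using that by (simp add: step_sum_def cutoff_0)
  moreover have "w $ j / \<rho> \<le> real k" "- (w $ j / \<rho>) \<le> real k" for j
    using assms(2)[of j] by linarith+
  ultimately show ?thesis by (simp add: walk_def)
qed

lemma walk_close:
  assumes "\<rho> > 0" "\<And>j. \<bar>w $ j / \<rho>\<bar> \<le> real k" shows "\<bar>w $ j - walk n \<rho> k w $ j\<bar> \<le> \<rho>"
proof -
  let ?t = "w $ j / \<rho>"
  have tk: "?t \<le> real k" "- ?t \<le> real k" using assms(2)[of j] by linarith+
  have "\<bar>?t - (step_sum n k ?t - step_sum n k (- ?t))\<bar> \<le> 1"
  proof (cases "?t \<ge> 0")
    case True
    then show ?thesis using step_sum_close[of ?t k n] step_sum_neg[of "- ?t" n k] tk by (auto simp: abs_minus_commute)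
  next
    case False
    then show ?thesis using step_sum_close[of "- ?t" k n] step_sum_neg[of "?t" n k] tk by (auto simp: abs_minus_commute)
  qed
  then have "\<bar>\<rho> * (?t - (step_sum n k ?t - step_sum n k (- ?t)))\<bar> \<le> \<rho>"
    using assms(1) by (simp add: abs_mult)
  then show ?thesis using assms(1) by (simp add: walk_def right_diff_distrib)
qed

lemma Ck_walk: "Ck n UNIV (\<lambda>w. complex_of_real (walk n \<rho> k w $ j))"
proof -
  have s: "Ck n UNIV (\<lambda>w. complex_of_real (step_sum n k (a * w $ j)))" for a
    unfolding step_sum_def of_real_sum
    using Ck_cutoff[of n a j "- real _"] by (intro Ck_sum open_UNIV) simp
  have s1: "Ck n UNIV (\<lambda>w. complex_of_real (step_sum n k (w $ j / \<rho>)))" using s[of "1 / \<rho>"] by simp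
  have s2: "Ck n UNIV (\<lambda>w. complex_of_real (step_sum n k (- (w $ j / \<rho>))))" using s[of "- 1 / \<rho>"] by simp
  show ?thesis unfolding walk_def vec_lambda_beta of_real_mult of_real_diff
    by (intro Ck_mult Ck_diff Ck_const s1 s2 open_UNIV)
qed

text \<open>
  A vector of the line over the origin is projected successively onto the lines over the points
  of the walk. It stays nonzero because consecutive lines are far from orthogonal, and it
  involves \<open>e\<close> only through projections.
\<close>

primrec transport :: "nat \<Rightarrow> real \<Rightarrow> (real^2 \<Rightarrow> complex^2) \<Rightarrow> nat \<Rightarrow> real^2 \<Rightarrow> complex^2" where
  "transport n \<rho> e 0 w = e 0"
| "transport n \<rho> e (Suc k) w = hinner (e (walk n \<rho> (Suc k) w)) (transport n \<rho> e k w) *s e (walk n \<rho> (Suc k) w)"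

text \<open>
  The vector transported along the walk to \<open>w\<close> is projected once more, onto the line at \<open>w\<close>
  itself. Near a given point a fixed number of steps suffices, since further steps leave the
  walk where it is; so the section inherits the smoothness of the projections.
\<close>

lemma line_lift:
  assumes an: "analytic_line e" and unit: "\<And>w. norm (e w) = 1"
  obtains v where "Ckv n v" "\<And>w. \<exists>c. c \<noteq> 0 \<and> v w = c *s e w"
proof -
  obtain r where r: "r > 0" "\<And>w v. v \<in> square w r \<Longrightarrow> norm (wedge (e v) (e w)) \<le> 1/2"
    using an unfolding analytic_line_def by blast
  define \<rho> where "\<rho> = r / 2"
  have \<rho>: "\<rho> > 0" "\<rho> < r" using r by (auto simp: \<rho>_def)
  have nz: "hinner (e v) (e w) \<noteq> 0" if "v \<in> square w r" for v w
  proof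
    assume "hinner (e v) (e w) = 0"
    then have "(norm (wedge (e v) (e w)))\<^sup>2 = 1" using lagrange_identity[of "e v" "e w"] by (simp add: unit)
    then have "norm (wedge (e v) (e w)) = 1" by (simp add: power2_eq_1_iff) (metis norm_ge_zero not_one_le_zero neg_0_le_iff_le)
    then show False using r(2)[OF that] by simp
  qed
  let ?V = "transport n \<rho> e" and ?Y = "walk n \<rho>"
  have Vline: "\<exists>c. c \<noteq> 0 \<and> ?V k w = c *s e (?Y k w)" for k w
  proof (induction k)
    case 0
    show ?case by (rule exI[of _ 1]) (simp add: walk_0)
  next
    case (Suc k)
    then obtain c where c: "c \<noteq> 0" "?V k w = c *s e (?Y k w)" by blast
    have "?Y (Suc k) w \<in> square (?Y k w) r"
      unfolding square_def using walk_step[OF \<rho>(1), of n k w] \<rho>(2) by (auto intro: le_less_trans)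
    then have "c * hinner (e (?Y (Suc k) w)) (e (?Y k w)) \<noteq> 0" using nz c by simp
    moreover have "?V (Suc k) w = (c * hinner (e (?Y (Suc k) w)) (e (?Y k w))) *s e (?Y (Suc k) w)"
      by (simp add: c(2) hinner_smult)
    ultimately show ?case by blast
  qed
  have proj: "(hinner (e (Y w)) (u w) *s e (Y w)) $ a
      = e (Y w) $ a * cnj (e (Y w) $ 1) * u w $ 1 + e (Y w) $ a * cnj (e (Y w) $ 2) * u w $ 2" for Y u a and w :: "real^2"
    by (simp add: hinner_def sum_2 algebra_simps)
  have PP: "Ckv n (\<lambda>w. hinner (e (Y w)) (u w) *s e (Y w))"
    if P: "\<And>i j. Ck n UNIV (\<lambda>w. e (Y w) $ i * cnj (e (Y w) $ j))" and u: "Ckv n u" for Y and u :: "real^2 \<Rightarrow> complex^2"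
    unfolding Ckv_def proj using u unfolding Ckv_def
    by (intro allI Ck_add[OF open_UNIV Ck_mult[OF open_UNIV P] Ck_mult[OF open_UNIV P]]) blast+
  have Vc: "Ckv n (?V k)" for k
  proof (induction k)
    case 0
    show ?case by (simp add: Ckv_def Ck_const)
  next
    case (Suc k)
    have P: "Ck n UNIV (\<lambda>w. e (?Y (Suc k) w) $ i * cnj (e (?Y (Suc k) w) $ j))" for i j
      by (rule Ck_compose[OF projection_Ck[OF an unit] Ck_walk])
    show ?case unfolding transport.simps by (rule PP[OF P Suc])
  qed
  have Vstable: "?V (Suc k) w = ?V k w" if "\<And>j. \<bar>w $ j / \<rho>\<bar> \<le> real k" for k w
  proof -
    obtain c where c: "?V k w = c *s e (?Y k w)" using Vline by blast
    have "hinner (e (?Y k w)) (e (?Y k w)) = 1" by (simp add: hinner_self unit)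
    then show ?thesis using walk_stable[OF \<rho>(1) that] by (simp add: c hinner_smult)
  qed
  have Vst: "?V m w = ?V k w" if k: "\<And>j. \<bar>w $ j / \<rho>\<bar> \<le> real k" and m: "m \<ge> k" for k m w
    using m
  proof (induction m rule: dec_induct)
    case (step m)
    have "\<bar>w $ j / \<rho>\<bar> \<le> real m" for j using k[of j] step(1) by linarith
    then show ?case using Vstable step by metis
  qed simp
  define K where "K w = nat \<lceil>\<bar>w $ 1 / \<rho>\<bar>\<rceil> + nat \<lceil>\<bar>w $ 2 / \<rho>\<bar>\<rceil>" for w :: "real^2"
  have K: "\<bar>w $ j / \<rho>\<bar> \<le> real (K w)" for w j
  proof -
    have "\<bar>w $ i / \<rho>\<bar> \<le> real (nat \<lceil>\<bar>w $ i / \<rho>\<bar>\<rceil>)" for i by (rule of_nat_ceiling)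
    then have "\<bar>w $ 1 / \<rho>\<bar> \<le> real (K w)" "\<bar>w $ 2 / \<rho>\<bar> \<le> real (K w)"
      unfolding K_def of_nat_add by (rule add_increasing2[OF of_nat_0_le_iff], rule add_increasing[OF of_nat_0_le_iff])
    then show ?thesis using exhaust_2[of j] by (elim disjE) (simp_all only:)
  qed
  define v where "v w = hinner (e w) (?V (K w) w) *s e w" for w
  have vk: "v w = hinner (e w) (?V k w) *s e w" if "\<And>j. \<bar>w $ j / \<rho>\<bar> \<le> real k" for k w
  proof -
    have "?V k w = ?V (K w) w" using Vst[OF that, of "k + K w"] Vst[OF K, of w "k + K w"] by simp
    then show ?thesis by (simp add: v_def)
  qed
  have "\<exists>c. c \<noteq> 0 \<and> v w = c *s e w" for w
  proof -
    obtain c where c: "c \<noteq> 0" "?V (K w) w = c *s e (?Y (K w) w)" using Vline by blast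
    have "w \<in> square (?Y (K w) w) r"
      unfolding square_def using walk_close[OF \<rho>(1) K, of w] \<rho>(2) by (auto intro: le_less_trans)
    then have "hinner (e w) (?V (K w) w) \<noteq> 0" unfolding c hinner_smult using nz c(1) by simp
    then show ?thesis unfolding v_def by blast
  qed
  moreover have "Ckv n v" unfolding Ckv_def
  proof (intro allI, rule Ck_cong_local)
    fix a and w0 :: "real^2"
    define k where "k = nat \<lceil>(\<bar>w0 $ 1\<bar> + \<bar>w0 $ 2\<bar> + 1) / \<rho>\<rceil>"
    have k: "\<bar>w $ j / \<rho>\<bar> \<le> real k" if "w \<in> square w0 1" for w j
    proof -
      have "\<bar>w $ j\<bar> \<le> \<bar>w0 $ 1\<bar> + \<bar>w0 $ 2\<bar> + 1"
        using that exhaust_2[of j] unfolding square_def by (force simp: forall_2)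
      then have "\<bar>w $ j / \<rho>\<bar> \<le> (\<bar>w0 $ 1\<bar> + \<bar>w0 $ 2\<bar> + 1) / \<rho>" using \<rho>(1) by (simp add: divide_right_mono)
      also have "\<dots> \<le> real k" unfolding k_def by (rule of_nat_ceiling)
      finally show ?thesis .
    qed
    have "Ck n UNIV (\<lambda>w. (hinner (e w) (?V k w) *s e w) $ a)"
    proof -
      have "Ck n UNIV (\<lambda>w. e w $ i * cnj (e w $ j))" for i j by (rule projection_Ck[OF an unit])
      then show ?thesis
        using PP[of "\<lambda>w. w", OF _ Vc[of k]] unfolding Ckv_def by blast
    qed
    then have "Ck n (square w0 1) (\<lambda>w. (hinner (e w) (?V k w) *s e w) $ a)" by (rule Ck_subset) simp
    moreover have "\<forall>w\<in>square w0 1. v w $ a = (hinner (e w) (?V k w) *s e w) $ a"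
    proof
      fix w assume "w \<in> square w0 1"
      then show "v w $ a = (hinner (e w) (?V k w) *s e w) $ a" by (simp only: vk[OF k])
    qed
    moreover have "w0 \<in> square w0 1" by (rule center_in_square) simp
    ultimately show "\<exists>T g. open T \<and> w0 \<in> T \<and> Ck n T g \<and> (\<forall>w\<in>T. v w $ a = g w)"
      using open_square by blast
  qed
  ultimately show ?thesis using that by blast
qed

text \<open>
  The sum of all earlier values of \<open>f\<close> and minus the sum of the present and later ones both
  solve the equation. The cutoff in \<open>w $ j\<close> weights the terms so that both sums become locally
  finite, and it does not see the other coordinate.
\<close>

lemma difference_equation:
  assumes f: "Ck n UNIV f"
  obtains \<theta> where "Ck n UNIV \<theta>" "\<And>w. \<theta> (w + axis j 1) = \<theta> w + f w"
    "\<And>i. i \<noteq> j \<Longrightarrow> (\<And>w. f (w + axis i 1) = f w) \<Longrightarrow> (\<And>w. \<theta> (w + axis i 1) = \<theta> w)"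
proof -
  let ?e = "axis j 1 :: real^2"
  define S1 where "S1 K w = (\<Sum>i<K. of_real (cutoff n (w $ j - real (Suc i))) * f (w + (- real (Suc i)) *\<^sub>R ?e))" for K w
  define S2 where "S2 K w = (\<Sum>i<K. (1 - of_real (cutoff n (w $ j + real i))) * f (w + real i *\<^sub>R ?e))" for K w
  have S1s: "S1 (Suc K) w = S1 K w" if "\<bar>w $ j\<bar> + 1 \<le> real K" for K w
    using that by (simp add: S1_def cutoff_0)
  have S2s: "S2 (Suc K) w = S2 K w" if "\<bar>w $ j\<bar> + 1 \<le> real K" for K w
    using that by (simp add: S2_def cutoff_1)
  have st: "S1 M w = S1 K w \<and> S2 M w = S2 K w" if K: "\<bar>w $ j\<bar> + 1 \<le> real K" and M: "M \<ge> K" for M K w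
    using M
  proof (induction M rule: dec_induct)
    case (step M)
    have "\<bar>w $ j\<bar> + 1 \<le> real M" using K step(1) by linarith
    then show ?case using S1s S2s step by metis
  qed simp
  define N where "N w = nat \<lceil>\<bar>w $ j\<bar> + 1\<rceil>" for w :: "real^2"
  have N: "\<bar>w $ j\<bar> + 1 \<le> real (N w)" for w unfolding N_def by (rule of_nat_ceiling)
  define \<theta> where "\<theta> w = S1 (N w) w - S2 (N w) w" for w
  have \<theta>: "\<theta> w = S1 K w - S2 M w" if "\<bar>w $ j\<bar> + 1 \<le> real K" "\<bar>w $ j\<bar> + 1 \<le> real M" for K M w
  proof -
    have "S1 K w = S1 (N w) w" using st[OF that(1), of "K + N w"] st[OF N, of w "K + N w"] by simp
    moreover have "S2 M w = S2 (N w) w" using st[OF that(2), of "M + N w"] st[OF N, of w "M + N w"] by simp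
    ultimately show ?thesis by (simp add: \<theta>_def)
  qed
  have cut: "Ck n UNIV (\<lambda>w. complex_of_real (cutoff n (w $ j + b)))" for b
    using Ck_cutoff[of n 1 j b] by simp
  have cut': "Ck n UNIV (\<lambda>w. complex_of_real (cutoff n (w $ j - b)))" for b
    using cut[of "- b"] by simp
  have "Ck n UNIV (S1 K)" for K unfolding S1_def
    by (intro Ck_sum Ck_mult Ck_shift cut' f open_UNIV)
  moreover have "Ck n UNIV (S2 K)" for K unfolding S2_def
    by (intro Ck_sum Ck_mult Ck_diff Ck_const cut Ck_shift f open_UNIV)
  ultimately have SC: "Ck n UNIV (\<lambda>w. S1 K w - S2 K w)" for K by (intro Ck_diff) auto
  have "Ck n UNIV \<theta>"
  proof (rule Ck_cong_local)
    fix w0 :: "real^2"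
    define K where "K = nat \<lceil>\<bar>w0 $ j\<bar> + 2\<rceil>"
    have "\<bar>w $ j\<bar> + 1 \<le> real K" if "w \<in> square w0 1" for w
    proof -
      have "\<bar>w $ j - w0 $ j\<bar> < 1" using that by (simp add: square_def)
      then have "\<bar>w $ j\<bar> + 1 \<le> \<bar>w0 $ j\<bar> + 2" by linarith
      also have "\<dots> \<le> real K" unfolding K_def by (rule of_nat_ceiling)
      finally show ?thesis .
    qed
    then have "\<forall>w\<in>square w0 1. \<theta> w = S1 K w - S2 K w" using \<theta> by blast
    moreover have "Ck n (square w0 1) (\<lambda>w. S1 K w - S2 K w)" using SC by (rule Ck_subset) simp
    moreover have "w0 \<in> square w0 1" by (rule center_in_square) simp
    ultimately show "\<exists>T g. open T \<and> w0 \<in> T \<and> Ck n T g \<and> (\<forall>x\<in>T. \<theta> x = g x)"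
      using open_square by blast
  qed
  moreover have "\<theta> (w + ?e) = \<theta> w + f w" for w
  proof -
    define M where "M = N w + N (w + ?e)"
    have M: "\<bar>w $ j\<bar> + 1 \<le> real M" "\<bar>(w + ?e) $ j\<bar> + 1 \<le> real M"
      using N[of w] N[of "w + ?e"] by (auto simp: M_def)
    have ve: "w + ?e + (- real (Suc i)) *\<^sub>R ?e = w + (- real i) *\<^sub>R ?e" for i
      by (simp add: algebra_simps)
    have 1: "S1 (Suc M) (w + ?e) = of_real (cutoff n (w $ j)) * f w + S1 M w"
      unfolding S1_def sum.lessThan_Suc_shift ve by (simp add: diff_diff_eq add.commute)
    have 2: "S2 (Suc M) w = (1 - of_real (cutoff n (w $ j))) * f w + S2 M (w + ?e)"
      unfolding S2_def by (subst sum.lessThan_Suc_shift) (simp add: algebra_simps)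
    have 3: "\<theta> (w + ?e) = S1 (Suc M) (w + ?e) - S2 M (w + ?e)" using M by (intro \<theta>) auto
    have 4: "\<theta> w = S1 M w - S2 (Suc M) w" using M by (intro \<theta>) auto
    show ?thesis unfolding 3 4 1 2 by (simp add: algebra_simps)
  qed
  moreover have "\<theta> (w + axis i 1) = \<theta> w" if i: "i \<noteq> j" and per: "\<And>w. f (w + axis i 1) = f w" for i w
  proof -
    have c: "(w + axis i 1) $ j = w $ j" using i by (simp add: axis_def)
    have f': "f (w + axis i 1 + t *\<^sub>R ?e) = f (w + t *\<^sub>R ?e)" for t
      using per[of "w + t *\<^sub>R ?e"] by (simp add: add_ac)
    show ?thesis unfolding \<theta>_def N_def S1_def S2_def c f' ..
  qed
  ultimately show ?thesis using that by blast
qed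

section \<open>Normal form of the cocycle on a line\<close>

text \<open>The sewing rule of an adapted frame, for vectors of any length.\<close>

definition frame_charge :: "(2 \<Rightarrow> real^2 \<Rightarrow> complex^2^2) \<Rightarrow> int \<Rightarrow> (real^2 \<Rightarrow> complex^2) \<Rightarrow> bool" where
  "frame_charge U m v \<longleftrightarrow>
     (\<forall>w. v (w + axis 1 1) = U 1 w *v v w) \<and>
     (\<forall>w. v (w + axis 2 1) = cis (2 * pi * of_int m * w $ 1) *s (U 2 w *v v w))"

lemma one_neq_two_2: "(1::2) \<noteq> 2" "(2::2) \<noteq> 1"
  by simp_all

lemma mv_smult: "M *v (c *s x) = c *s (M *v x)" for x :: "complex^2"
  by (rule vector_scalar_commute)

lemma smult_smult: "a *s (b *s x) = (a * b) *s x" for x :: "complex^2"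
  by (simp add: vec_eq_iff mult.assoc)

lemma continuous_hinner [continuous_intros]:
  assumes "continuous_on S u" "continuous_on S v" shows "continuous_on S (\<lambda>w. hinner (u w) (v w))"
  unfolding hinner_def using assms by (intro continuous_intros)

text \<open>
  A logarithm of a periodic function changes by constants under unit steps, and subtracting the
  linear function with these increments makes it periodic.
\<close>

lemma periodic_coboundary_log:
  assumes p: "continuous_on UNIV p" "periodic p" and nz: "\<And>w. p w \<noteq> 0"
  obtains k H where "continuous_on UNIV H" "periodic H" "\<And>w. p w = exp (2 * pi * \<i> * lattice_dot k w + H w)"
    "\<And>n. Ck n UNIV p \<Longrightarrow> Ck n UNIV H"
proof -
  obtain L where L: "continuous_on UNIV L" "\<And>w. p w = exp (L w)" using continuous_log[OF p(1) nz] by blast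
  have "\<exists>m::int. \<forall>w. L (w + axis j 1) - L w = 2 * pi * \<i> * of_int m" for j
  proof -
    have "continuous_on UNIV (\<lambda>w. L (w + axis j 1) - L w)"
      by (intro continuous_intros L continuous_on_compose2[OF L(1)]) auto
    moreover have "exp (L (w + axis j 1) - L w) = 1" for w
    proof -
      have "exp (L (w + axis j 1)) = exp (L w)" using p(2) unfolding periodic_def L(2)[symmetric] by simp
      then show ?thesis by (simp add: exp_diff)
    qed
    ultimately show ?thesis by (rule exp_const_one[of "\<lambda>w. L (w + axis j 1) - L w"]) blast
  qed
  then have "\<forall>j. \<exists>m::int. \<forall>w. L (w + axis j 1) - L w = 2 * pi * \<i> * of_int m" by blast
  from choice[OF this] obtain k where k: "\<And>j w. L (w + axis j 1) - L w = 2 * pi * \<i> * of_int (k j)" by blast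
  define kv :: "int^2" where "kv = (\<chi> j. k j)"
  define H where "H w = L w - 2 * pi * \<i> * lattice_dot kv w" for w
  have ck: "Ck n UNIV (\<lambda>w. 2 * pi * \<i> * complex_of_real (lattice_dot kv w))" for n
    unfolding lattice_dot_def sum_2 of_real_add of_real_mult by (intro Ck_mult Ck_add Ck_const Ck_coord open_UNIV)
  show ?thesis
  proof
    show "continuous_on UNIV H" unfolding H_def by (intro continuous_intros L)
    show "periodic H" unfolding periodic_def
    proof (intro allI)
      fix j w
      show "H (w + axis j 1) = H w" using k[of w j] by (simp add: H_def kv_def algebra_simps)
    qed
    show "p w = exp (2 * pi * \<i> * lattice_dot kv w + H w)" for w by (simp add: H_def L(2))
    show "Ck n UNIV H" if "Ck n UNIV p" for n
      unfolding H_def by (intro Ck_diff ck open_UNIV Ck_log[OF open_UNIV L(1) L(2)[symmetric] that])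
  qed
qed

context splitting begin

text \<open>
  A lift of the line satisfies the sewing rules up to factors \<open>exp (\<sigma> j w)\<close>. Sewing around the
  cell in the two possible orders shows that \<open>\<sigma>\<close> is a cocycle up to a constant \<open>2 \<pi> i m\<close>. One
  difference equation removes \<open>\<sigma> 1\<close>; the rest of \<open>\<sigma> 2\<close>, corrected by a linear term in \<open>w $ 1\<close>,
  is then periodic in the first direction, and a second equation removes it without disturbing
  the first. The linear term stays behind as the charge.
\<close>

lemma smooth_frame:
  obtains v m where "Ckv n v" "\<And>w. \<exists>c. c \<noteq> 0 \<and> v w = c *s e i w" "frame_charge U m v"
proof -
  obtain v0 where v0: "Ckv n v0" "\<And>w. \<exists>c. c \<noteq> 0 \<and> v0 w = c *s e i w"
    using line_lift[OF lines_analytic e(1)] by blast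
  have v0nz: "v0 w \<noteq> 0" for w using v0(2)[of w] e_nonzero by auto
  have Unz: "U j w *v v0 w \<noteq> 0" for j w
    using unitary_norm[OF sewing(2), of j w "v0 w"] v0nz[of w] by (metis norm_eq_zero)
  have ex: "\<exists>s. s \<noteq> 0 \<and> v0 (w + axis j 1) = s *s (U j w *v v0 w)" for j w
  proof -
    obtain c d where c: "c \<noteq> 0" "v0 w = c *s e i w" and d: "d \<noteq> 0" "v0 (w + axis j 1) = d *s e i (w + axis j 1)"
      using v0(2) by metis
    obtain k where k: "norm k = 1" "e i (w + axis j 1) = k *s (U j w *v e i w)" using e_sew by blast
    have "v0 (w + axis j 1) = (d * k / c) *s (U j w *v v0 w)"
      using c(1) unfolding d(2) k(2) c(2) mv_smult smult_smult by simp
    moreover have "d * k / c \<noteq> 0" using d c k(1) by auto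
    ultimately show ?thesis by blast
  qed
  define s where "s j w = (SOME s. s \<noteq> 0 \<and> v0 (w + axis j 1) = s *s (U j w *v v0 w))" for j w
  have s: "s j w \<noteq> 0" "v0 (w + axis j 1) = s j w *s (U j w *v v0 w)" for j w
    using someI_ex[OF ex[of w j]] unfolding s_def by blast+
  have UC: "Ck n UNIV (\<lambda>w. U j w $ a $ b)" for j a b using uniformly_analytic_Ck[OF analytic(1)] .
  have UV: "Ckv n (\<lambda>w. U j w *v v0 w)" for j by (rule Ckv_matrix[OF UC v0(1)])
  have sC: "Ck n UNIV (s j)" for j
  proof -
    have "s j = (\<lambda>w. hinner (U j w *v v0 w) (v0 (w + axis j 1)) / hinner (U j w *v v0 w) (U j w *v v0 w))"
      using hinner_self_nonzero[OF Unz] by (auto simp: s(2) hinner_smult)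
    then show ?thesis
      by (simp only:) (intro Ck_divide Ck_hinner UV Ckv_shift v0(1) open_UNIV hinner_self_nonzero Unz)
  qed
  have "\<exists>\<sigma>. continuous_on UNIV \<sigma> \<and> (\<forall>w. s j w = exp (\<sigma> w))" for j
    by (rule continuous_log[OF Ck_continuous[OF sC] s(1)]) blast
  then have "\<forall>j. \<exists>\<sigma>. continuous_on UNIV \<sigma> \<and> (\<forall>w. s j w = exp (\<sigma> w))" by blast
  from choice[OF this] obtain \<sigma> where \<sigma>: "\<And>j. continuous_on UNIV (\<sigma> j)" "\<And>j w. s j w = exp (\<sigma> j w)" by blast
  have \<sigma>C: "Ck n UNIV (\<sigma> j)" for j by (rule Ck_log[OF open_UNIV \<sigma>(1) \<sigma>(2)[symmetric] sC])
  let ?a = "axis 1 1 :: real^2" and ?b = "axis 2 1 :: real^2"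
  have cs: "s 1 (w + ?b) * s 2 w = s 2 (w + ?a) * s 1 w" for w
  proof -
    have "v0 (w + ?b + ?a) = (s 1 (w + ?b) * s 2 w) *s ((U 1 (w + ?b) ** U 2 w) *v v0 w)"
      by (simp add: s(2) mv_smult smult_smult matrix_vector_mul_assoc)
    moreover have "v0 (w + ?a + ?b) = (s 2 (w + ?a) * s 1 w) *s ((U 2 (w + ?a) ** U 1 w) *v v0 w)"
      by (simp add: s(2) mv_smult smult_smult matrix_vector_mul_assoc)
    moreover have "w + ?b + ?a = w + ?a + ?b" by (simp add: add_ac)
    moreover have "(U 2 (w + ?a) ** U 1 w) *v v0 w \<noteq> 0"
      using unitary_norm[OF sewing(2), of 2 "w + ?a" "U 1 w *v v0 w"] Unz[of 1 w]
      by (metis matrix_vector_mul_assoc norm_eq_zero)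
    ultimately show ?thesis using sewing(3)[of w] by simp
  qed
  obtain m :: int where m: "\<And>w. \<sigma> 1 (w + ?b) + \<sigma> 2 w - (\<sigma> 2 (w + ?a) + \<sigma> 1 w) = 2 * pi * \<i> * of_int m"
  proof (rule exp_const_one[of "\<lambda>w. \<sigma> 1 (w + ?b) + \<sigma> 2 w - (\<sigma> 2 (w + ?a) + \<sigma> 1 w)"])
    show "continuous_on UNIV (\<lambda>w. \<sigma> 1 (w + ?b) + \<sigma> 2 w - (\<sigma> 2 (w + ?a) + \<sigma> 1 w))"
      by (intro continuous_intros \<sigma> continuous_on_compose2[OF \<sigma>(1)]) auto
    show "exp (\<sigma> 1 (w + ?b) + \<sigma> 2 w - (\<sigma> 2 (w + ?a) + \<sigma> 1 w)) = 1" for w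
      using cs[of w] s(1)[of 2 "w + ?a"] s(1)[of 1 w] unfolding exp_diff exp_add \<sigma>(2)[symmetric] by simp
  qed blast
  obtain \<theta> where \<theta>: "Ck n UNIV \<theta>" "\<And>w. \<theta> (w + ?a) = \<theta> w + \<sigma> 1 w"
    by (rule difference_equation[OF \<sigma>C[of 1], of 1]) (rule that)
  \<comment> \<open>The two sewing orders differ by 2 pi i m; the linear term restores periodicity in the
    first direction.\<close>
  define f where "f w = \<sigma> 2 w - \<theta> (w + ?b) + \<theta> w + 2 * pi * \<i> * of_int m * complex_of_real (w $ 1)" for w
  have fC: "Ck n UNIV f" unfolding f_def
    by (intro Ck_add Ck_diff Ck_mult Ck_const Ck_coord Ck_shift \<sigma>C \<theta>(1) open_UNIV)
  have fa: "f (w + ?a) = f w" for w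
  proof -
    have "\<theta> (w + ?a + ?b) = \<theta> (w + ?b) + \<sigma> 1 (w + ?b)" using \<theta>(2)[of "w + ?b"] by (simp add: add_ac)
    then show ?thesis using m[of w] \<theta>(2)[of w] by (simp add: f_def algebra_simps)
  qed
  obtain \<eta> where \<eta>: "Ck n UNIV \<eta>" "\<And>w. \<eta> (w + ?b) = \<eta> w + f w" "\<And>w. \<eta> (w + ?a) = \<eta> w"

  proof (rule difference_equation[OF fC, of 2])
    fix \<eta>
    assume \<eta>: "Ck n UNIV \<eta>" "\<And>w. \<eta> (w + ?b) = \<eta> w + f w"
      "\<And>i. i \<noteq> 2 \<Longrightarrow> (\<And>w. f (w + axis i 1) = f w) \<Longrightarrow> (\<And>w. \<eta> (w + axis i 1) = \<eta> w)"
    show thesis by (rule that[OF \<eta>(1,2) \<eta>(3)[OF one_neq_two_2(1) fa]])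
  qed
  define v where "v w = exp (- \<theta> w - \<eta> w) *s v0 w" for w
  have "Ckv n v" unfolding v_def
    by (intro Ckv_smult v0(1) Ck_exp Ck_diff Ck_uminus \<theta>(1) \<eta>(1) open_UNIV)
  moreover have "\<exists>c. c \<noteq> 0 \<and> v w = c *s e i w" for w
  proof -
    obtain c where "c \<noteq> 0" "v0 w = c *s e i w" using v0(2) by blast
    then have "v w = (exp (- \<theta> w - \<eta> w) * c) *s e i w" "exp (- \<theta> w - \<eta> w) * c \<noteq> 0"
      by (simp_all add: v_def smult_smult)
    then show ?thesis by blast
  qed
  moreover have "frame_charge U (- m) v" unfolding frame_charge_def
  proof (intro conjI allI)
    fix w
    have "exp (- \<theta> (w + ?a) - \<eta> (w + ?a)) * s 1 w = exp (- \<theta> w - \<eta> w)"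
      unfolding \<sigma>(2) \<theta>(2) \<eta>(3) exp_add[symmetric] by simp
    then show "v (w + ?a) = U 1 w *v v w" unfolding v_def s(2) mv_smult smult_smult by simp
    have "exp (- \<theta> (w + ?b) - \<eta> (w + ?b)) * s 2 w = cis (2 * pi * of_int (- m) * w $ 1) * exp (- \<theta> w - \<eta> w)"
      unfolding \<sigma>(2) \<eta>(2) f_def cis_conv_exp exp_add[symmetric]
      by (intro arg_cong[of _ _ exp]) (simp add: algebra_simps)
    then show "v (w + ?b) = cis (2 * pi * of_int (- m) * w $ 1) *s (U 2 w *v v w)"
      unfolding v_def s(2) mv_smult smult_smult by simp
  qed
  ultimately show ?thesis using that by blast
qed

text \<open>
  Multiplied by the exponential of \<open>2 \<pi> i m \<tau>\<^sub>1 w\<^sub>2\<close>, the multiplier of a smooth frame is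
  periodic, so it has a logarithm with a linear part and a periodic part \<open>H\<close>. Rescaling the
  frame by \<open>exp \<psi>\<close>, with \<open>\<psi>\<close> from the cohomological equation, replaces \<open>H\<close> by its mean.
\<close>

theorem normal_form:
  assumes \<tau>: "\<tau> \<in> diophantine c \<nu>" "c > 0"
  obtains v m k \<eta> where "continuous_on UNIV v" "\<And>w. \<exists>c. c \<noteq> 0 \<and> v w = c *s e i w" "frame_charge U m v"
    "\<And>w. A w *v v w = exp (2 * pi * \<i> * (lattice_dot k w - of_int m * \<tau> $ 1 * w $ 2) + \<eta>) *s v (w + \<tau>)"
proof -
  obtain n :: nat where n: "\<nu> + 4 \<le> real n" using real_arch_simple by blast
  obtain v m where v: "Ckv n v" "\<And>w. \<exists>c. c \<noteq> 0 \<and> v w = c *s e i w" "frame_charge U m v"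
    using smooth_frame by blast
  let ?a = "axis 1 1 :: real^2" and ?b = "axis 2 1 :: real^2"
  have va: "v (w + ?a) = U 1 w *v v w" and vb: "v (w + ?b) = cis (2 * pi * of_int m * w $ 1) *s (U 2 w *v v w)" for w
    using v(3) by (auto simp: frame_charge_def)
  have vnz: "v w \<noteq> 0" for w using v(2)[of w] e_nonzero by auto
  have "\<exists>q. q \<noteq> 0 \<and> A w *v v w = q *s v (w + \<tau>)" for w
  proof -
    obtain c d where c: "c \<noteq> 0" "v w = c *s e i w" and d: "d \<noteq> 0" "v (w + \<tau>) = d *s e i (w + \<tau>)" using v(2) by metis
    obtain k where k: "A w *v e i w = k *s e i (w + \<tau>)" using e_cocycle by blast
    have eq: "A w *v v w = (c * k / d) *s v (w + \<tau>)"
      using d(1) unfolding c(2) d(2) mv_smult smult_smult k by simp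
    have "c * k / d \<noteq> 0"
    proof
      assume "c * k / d = 0"
      then have "A w *v v w = 0" unfolding eq by (simp only: vec.scale_zero_left)
      then have "adjugate2 (A w) *v (A w *v v w) = 0" by simp
      then show False unfolding adjugate2_apply using cocycle(2)[of w] vnz by simp
    qed
    with eq show ?thesis by blast
  qed
  then obtain q where q: "\<And>w. q w \<noteq> 0" "\<And>w. A w *v v w = q w *s v (w + \<tau>)" by metis
  have AC: "Ck n UNIV (\<lambda>w. A w $ a $ b)" for a b using uniformly_analytic_Ck[OF analytic(2)] .
  have qC: "Ck n UNIV q"
  proof -
    have "q = (\<lambda>w. hinner (v (w + \<tau>)) (A w *v v w) / hinner (v (w + \<tau>)) (v (w + \<tau>)))"
      using hinner_self_nonzero[OF vnz] by (auto simp: q(2) hinner_smult)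
    then show ?thesis
      by (simp only:) (intro Ck_divide Ck_hinner Ckv_matrix AC Ckv_shift v(1) open_UNIV hinner_self_nonzero vnz)
  qed
  have Unz: "U j w *v v w' \<noteq> 0" for j w w'
    using unitary_norm[OF sewing(2), of j w "v w'"] vnz[of w'] by (metis norm_eq_zero)
  have sw: "w + x + \<tau> = w + \<tau> + x" for w x by (simp add: add_ac)
  have qa: "q (w + ?a) = q w" for w
  proof -
    have "q (w + ?a) *s (U 1 (w + \<tau>) *v v (w + \<tau>)) = A (w + ?a) *v (U 1 w *v v w)"
      using q(2)[of "w + ?a"] unfolding sw va by simp
    also have "\<dots> = U 1 (w + \<tau>) *v (A w *v v w)" by (simp add: matrix_vector_mul_assoc cocycle(3))
    also have "\<dots> = q w *s (U 1 (w + \<tau>) *v v (w + \<tau>))" unfolding q(2) mv_smult ..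
    finally show ?thesis using Unz by simp
  qed
  have qb: "q (w + ?b) * cis (2 * pi * of_int m * (w + \<tau>) $ 1) = q w * cis (2 * pi * of_int m * w $ 1)" for w
  proof -
    have "(q (w + ?b) * cis (2 * pi * of_int m * (w + \<tau>) $ 1)) *s (U 2 (w + \<tau>) *v v (w + \<tau>))
        = A (w + ?b) *v (cis (2 * pi * of_int m * w $ 1) *s (U 2 w *v v w))"
      using q(2)[of "w + ?b"] unfolding sw vb smult_smult by simp
    also have "\<dots> = cis (2 * pi * of_int m * w $ 1) *s (U 2 (w + \<tau>) *v (A w *v v w))"
      by (simp add: mv_smult matrix_vector_mul_assoc cocycle(3))
    also have "\<dots> = (q w * cis (2 * pi * of_int m * w $ 1)) *s (U 2 (w + \<tau>) *v v (w + \<tau>))"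
      unfolding q(2) mv_smult smult_smult by (simp add: mult.commute)
    finally show ?thesis using Unz by simp
  qed
  define Q where "Q w = q w * exp (2 * pi * \<i> * of_int m * \<tau> $ 1 * w $ 2)" for w
  have QC: "Ck n UNIV Q" unfolding Q_def
    by (intro Ck_mult qC Ck_exp Ck_const Ck_coord open_UNIV)
  have Qnz: "Q w \<noteq> 0" for w by (simp add: Q_def q(1))
  have Qp: "periodic Q" unfolding periodic_def
  proof (intro allI)
    fix j :: 2 and w
    have b: "q (w + ?b) * exp (2 * pi * \<i> * of_int m * \<tau> $ 1) = q w"
    proof -
      have "cis (2 * pi * of_int m * (w + \<tau>) $ 1) = exp (2 * pi * \<i> * of_int m * \<tau> $ 1) * cis (2 * pi * of_int m * w $ 1)"
        unfolding cis_conv_exp exp_add[symmetric] by (simp add: algebra_simps)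
      then have "(q (w + ?b) * exp (2 * pi * \<i> * of_int m * \<tau> $ 1)) * cis (2 * pi * of_int m * w $ 1)
         = q w * cis (2 * pi * of_int m * w $ 1)" using qb[of w] by (simp add: mult.assoc)
      then show ?thesis by simp
    qed
    consider "j = 1" | "j = 2" using exhaust_2 by blast
    then show "Q (w + axis j 1) = Q w"
    proof cases
      case 1
      then show ?thesis using qa[of w] by (simp add: Q_def axis_def)
    next
      case 2
      have "exp (2 * pi * \<i> * of_int m * \<tau> $ 1 * (w + ?b) $ 2) = exp (2 * pi * \<i> * of_int m * \<tau> $ 1) * exp (2 * pi * \<i> * of_int m * \<tau> $ 1 * w $ 2)"
        unfolding exp_add[symmetric] by (simp add: axis_def algebra_simps)
      then show ?thesis unfolding 2 Q_def using b by (simp add: mult.assoc[symmetric])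
    qed
  qed
  obtain k H where H: "continuous_on UNIV H" "periodic H" "\<And>w. Q w = exp (2 * pi * \<i> * lattice_dot k w + H w)" "Ck n UNIV H"
    using periodic_coboundary_log[OF Ck_continuous[OF QC] Qp Qnz] QC by metis
  obtain \<psi> where \<psi>: "continuous_on UNIV \<psi>" "periodic \<psi>" "\<And>w. H w = torus_mean H + \<psi> (w + \<tau>) - \<psi> w"
    using cohomological_equation[OF \<tau> H(4,2) n] by blast
  define vh where "vh w = exp (\<psi> w) *s v w" for w
  have "continuous_on UNIV vh"
  proof -
    have "continuous_on UNIV (\<lambda>w. \<chi> a. exp (\<psi> w) * v w $ a)"
      by (intro continuous_on_vec_lambda continuous_intros \<psi>(1) Ckv_continuous[OF v(1)])
    moreover have "vh = (\<lambda>w. \<chi> a. exp (\<psi> w) * v w $ a)" by (simp add: fun_eq_iff vh_def vec_eq_iff)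
    ultimately show ?thesis by simp
  qed
  moreover have "\<exists>c. c \<noteq> 0 \<and> vh w = c *s e i w" for w
  proof -
    obtain c where "c \<noteq> 0" "v w = c *s e i w" using v(2) by blast
    then have "vh w = (exp (\<psi> w) * c) *s e i w" "exp (\<psi> w) * c \<noteq> 0" by (simp_all add: vh_def smult_smult)
    then show ?thesis by blast
  qed
  moreover have "frame_charge U m vh"
    using \<psi>(2) unfolding frame_charge_def periodic_def vh_def va vb by (simp add: mv_smult smult_smult mult.commute)
  moreover have "A w *v vh w = exp (2 * pi * \<i> * (lattice_dot k w - of_int m * \<tau> $ 1 * w $ 2) + torus_mean H) *s vh (w + \<tau>)" for w
  proof -
    have "q w = Q w * exp (- (2 * pi * \<i> * of_int m * \<tau> $ 1 * w $ 2))" by (simp add: Q_def exp_minus)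
    also have "\<dots> = exp (2 * pi * \<i> * (lattice_dot k w - of_int m * \<tau> $ 1 * w $ 2) + H w)"
      unfolding H(3) exp_add[symmetric] by (simp add: algebra_simps)
    finally have "exp (\<psi> w) * q w = exp (\<psi> w + (2 * pi * \<i> * (lattice_dot k w - of_int m * \<tau> $ 1 * w $ 2) + H w))"
      by (simp add: exp_add)
    also have "\<psi> w + (2 * pi * \<i> * (lattice_dot k w - of_int m * \<tau> $ 1 * w $ 2) + H w)
        = (2 * pi * \<i> * (lattice_dot k w - of_int m * \<tau> $ 1 * w $ 2) + torus_mean H) + \<psi> (w + \<tau>)"
      using \<psi>(3)[of w] by simp
    finally have "exp (\<psi> w) * q w = exp (2 * pi * \<i> * (lattice_dot k w - of_int m * \<tau> $ 1 * w $ 2) + torus_mean H) * exp (\<psi> (w + \<tau>))"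
      by (simp only: exp_add)
    then show ?thesis unfolding vh_def mv_smult q(2) smult_smult by simp
  qed
  ultimately show ?thesis using that by blast
qed

end

section \<open>Charge, winding vector and Lyapunov exponent\<close>

text \<open>
  A logarithm of \<open>x\<close> grows by a constant along the first unit vector and by \<open>2 \<pi> i d w\<^sub>1\<close> plus a
  constant along the second one; following the cell boundary in the two orders gives values that
  differ by \<open>2 \<pi> i d\<close>.
\<close>

lemma charge_shift_zero:
  fixes x :: "real^2 \<Rightarrow> complex"
  assumes x: "continuous_on UNIV x" "\<And>w. x w \<noteq> 0" and "\<And>w. x (w + axis 1 1) = x w"
    and "\<And>w. x (w + axis 2 1) = cis (2 * pi * of_int d * w $ 1) * x w"
  shows "d = 0"
proof -
  let ?a = "axis 1 1 :: real^2" and ?b = "axis 2 1 :: real^2"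
  obtain L where L: "continuous_on UNIV L" "\<And>w. x w = exp (L w)" using continuous_log[OF x] by blast
  obtain r :: int where r: "\<And>w. L (w + ?a) - L w = 2 * pi * \<i> * of_int r"
  proof (rule exp_const_one[of "\<lambda>w. L (w + ?a) - L w"])
    show "continuous_on UNIV (\<lambda>w. L (w + ?a) - L w)"
      by (intro continuous_intros L continuous_on_compose2[OF L(1)]) auto
    show "exp (L (w + ?a) - L w) = 1" for w
      using assms(3)[of w] by (simp add: exp_diff L(2))
  qed blast
  obtain s :: int where s: "\<And>w. L (w + ?b) - L w - 2 * pi * \<i> * of_int d * complex_of_real (w $ 1) = 2 * pi * \<i> * of_int s"
  proof (rule exp_const_one[of "\<lambda>w. L (w + ?b) - L w - 2 * pi * \<i> * of_int d * complex_of_real (w $ 1)"])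
    show "continuous_on UNIV (\<lambda>w. L (w + ?b) - L w - 2 * pi * \<i> * of_int d * complex_of_real (w $ 1))"
      by (intro continuous_intros L continuous_on_compose2[OF L(1)]) auto
    show "exp (L (w + ?b) - L w - 2 * pi * \<i> * of_int d * complex_of_real (w $ 1)) = 1" for w
      using assms(4)[of w] by (simp add: exp_diff L(2) cis_conv_exp mult_ac)
  qed blast
  have "L (?b + ?a) = L (?a + ?b)" by (simp only: add.commute)
  moreover have "L (?b + ?a) = L 0 + 2 * pi * \<i> * of_int s + 2 * pi * \<i> * of_int r"
    using r[of ?b] s[of 0] by (simp add: algebra_simps)
  moreover have "L (?a + ?b) = L 0 + 2 * pi * \<i> * of_int s + 2 * pi * \<i> * of_int r + 2 * pi * \<i> * of_int d"
    using r[of 0] s[of ?a] by (simp add: algebra_simps axis_def)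
  ultimately show ?thesis by simp
qed

lemma periodic_minimum:
  fixes R :: "real^2 \<Rightarrow> real"
  assumes "continuous_on UNIV R" "periodic R"
  obtains z where "\<And>w. R z \<le> R w"
proof -
  have "compact (cbox 0 (\<chi> i. 1) :: (real^2) set)" "cbox 0 (\<chi> i. 1) \<noteq> ({} :: (real^2) set)"
    by (auto simp: interval_ne_empty_cart)
  from continuous_attains_inf[OF this continuous_on_subset[OF assms(1) subset_UNIV]]
  obtain z where z: "\<And>w. w \<in> cbox 0 (\<chi> i. 1) \<Longrightarrow> R z \<le> R w" by blast
  have "R z \<le> R w" for w
  proof -
    obtain n v where v: "v \<in> unit_cell" "w = v + (\<chi> j. of_int (n $ j))" by (rule periodic_reduce)
    then show ?thesis using z[of v] unit_cell_subset_cbox periodic_int_shift[OF assms(2), of v n] by auto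
  qed
  then show ?thesis using that by blast
qed

lemma torus_mean_Re_Im:
  assumes "torus_bounded f"
  shows "torus_mean (\<lambda>w. Re (f w)) = Re (torus_mean f)" "torus_mean (\<lambda>w. Im (f w)) = Im (torus_mean f)"
proof -
  have "integrable lebesgue (\<lambda>w. indicator unit_cell w *\<^sub>R f w)"
    using torus_bounded_integrable[OF assms] by (simp add: set_integrable_def)
  from integral_Re[OF this] integral_Im[OF this]
  show "torus_mean (\<lambda>w. Re (f w)) = Re (torus_mean f)" "torus_mean (\<lambda>w. Im (f w)) = Im (torus_mean f)"
    unfolding torus_mean_def set_lebesgue_integral_def by simp_all
qed

lemma torus_mean_coboundary:
  assumes "continuous_on UNIV H" "periodic H"
  shows "torus_mean (\<lambda>w. H w - H (w + \<tau>) + c) = c" "torus_bounded (\<lambda>w. H w - H (w + \<tau>) + c)"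
proof -
  have H: "torus_bounded H" using torus_bounded_continuous[OF assms] .
  have H2: "torus_bounded (\<lambda>w. (-1) * H (w + \<tau>))"
    by (intro torus_bounded_mult torus_bounded_const torus_bounded_shift H)
  have H3: "torus_bounded (\<lambda>w. H w + (-1) * H (w + \<tau>))" by (intro torus_bounded_add H H2)
  have eq: "(\<lambda>w. H w - H (w + \<tau>) + c) = (\<lambda>w. (H w + (-1) * H (w + \<tau>)) + c)" by auto
  show "torus_bounded (\<lambda>w. H w - H (w + \<tau>) + c)" unfolding eq by (intro torus_bounded_add H3 torus_bounded_const)
  show "torus_mean (\<lambda>w. H w - H (w + \<tau>) + c) = c"
    unfolding eq torus_mean_add[OF H3 torus_bounded_const] torus_mean_add[OF H H2] torus_mean_cmult torus_mean_shift[OF H] by simp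
qed

context splitting begin

definition line_frame :: "branch \<Rightarrow> int \<Rightarrow> (real^2 \<Rightarrow> complex^2) \<Rightarrow> bool" where
  "line_frame i m v \<longleftrightarrow> continuous_on UNIV v \<and> (\<forall>w. v w \<noteq> 0 \<and> v w \<in> l i w) \<and> frame_charge U m v"

lemma adapted_line_frame: "adapted_frame U (l i) m v \<Longrightarrow> line_frame i m v"
  unfolding adapted_frame_def line_frame_def frame_charge_def by (metis norm_zero zero_neq_one)

text \<open>
  The quotient of two frames of a line is a nowhere vanishing function whose sewing rule
  contains the difference of the charges.
\<close>

lemma frame_ratio:
  assumes v: "line_frame i m v" and v': "line_frame i m' v'"
  obtains x where "continuous_on UNIV x" "\<And>w. x w \<noteq> 0" "\<And>w. v' w = x w *s v w" "periodic x" "m' = m"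
proof -
  have nz: "v w \<noteq> 0" "v' w \<noteq> 0" for w using v v' by (auto simp: line_frame_def)
  have "\<exists>x. v' w = x *s v w" for w
  proof -
    obtain c where c: "v w = c *s e i w" using v in_line unfolding line_frame_def by blast
    obtain c' where c': "v' w = c' *s e i w" using v' in_line unfolding line_frame_def by blast
    have "c \<noteq> 0" using nz(1)[of w] c by auto
    then have "v' w = (c' / c) *s v w" unfolding c c' smult_smult by simp
    then show ?thesis by blast
  qed
  then obtain x where x: "\<And>w. v' w = x w *s v w" by metis
  have xnz: "x w \<noteq> 0" for w using nz(2)[of w] x[of w] by auto
  have xc: "continuous_on UNIV x"
  proof -
    have "x = (\<lambda>w. hinner (v w) (v' w) / hinner (v w) (v w))"
      using hinner_self_nonzero[OF nz(1)] by (auto simp: x hinner_smult)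
    moreover have "continuous_on UNIV (\<lambda>w. hinner (v w) (v' w) / hinner (v w) (v w))"
      using v v' hinner_self_nonzero[OF nz(1)] unfolding line_frame_def by (intro continuous_intros) auto
    ultimately show ?thesis by simp
  qed
  have Unz: "U j w *v v w' \<noteq> 0" for j w w'
    using unitary_norm[OF sewing(2), of j w "v w'"] nz(1)[of w'] by (metis norm_eq_zero)
  have xa: "x (w + axis 1 1) = x w" for w
  proof -
    have "x (w + axis 1 1) *s (U 1 w *v v w) = v' (w + axis 1 1)"
      using v unfolding x line_frame_def frame_charge_def by simp
    also have "\<dots> = x w *s (U 1 w *v v w)"
      using v' unfolding line_frame_def frame_charge_def by (simp add: x mv_smult)
    finally show ?thesis using Unz by simp
  qed
  have xb: "x (w + axis 2 1) = cis (2 * pi * of_int (m' - m) * w $ 1) * x w" for w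
  proof -
    have "(x (w + axis 2 1) * cis (2 * pi * of_int m * w $ 1)) *s (U 2 w *v v w) = v' (w + axis 2 1)"
      using v unfolding x line_frame_def frame_charge_def by (simp add: smult_smult)
    also have "\<dots> = (cis (2 * pi * of_int m' * w $ 1) * x w) *s (U 2 w *v v w)"
      using v' unfolding line_frame_def frame_charge_def by (simp add: x mv_smult smult_smult)
    finally have "x (w + axis 2 1) * cis (2 * pi * of_int m * w $ 1) = cis (2 * pi * of_int m' * w $ 1) * x w"
      using Unz by simp
    moreover have "cis (2 * pi * of_int m' * w $ 1) = cis (2 * pi * of_int (m' - m) * w $ 1) * cis (2 * pi * of_int m * w $ 1)"
      unfolding cis_mult by (simp add: algebra_simps)
    ultimately show ?thesis by simp
  qed
  have m: "m' - m = 0" using charge_shift_zero[OF xc xnz xa xb] .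
  have "periodic x" unfolding periodic_def
  proof (intro allI)
    fix j :: 2 and w
    consider "j = 1" | "j = 2" using exhaust_2 by blast
    then show "x (w + axis j 1) = x w" using xa xb[of w] m by cases simp_all
  qed
  then show ?thesis using that xc xnz x m by simp
qed

lemma norm_frame_periodic:
  assumes "frame_charge U m v" shows "periodic (\<lambda>w. norm (v w))"
  unfolding periodic_def
proof (intro allI)
  fix j :: 2 and w
  consider "j = 1" | "j = 2" using exhaust_2 by blast
  then show "norm (v (w + axis j 1)) = norm (v w)"
    using assms unfolding frame_charge_def by cases (simp_all add: unitary_norm[OF sewing(2)])
qed

lemma in_line_smult: "x \<in> l i w \<Longrightarrow> c *s x \<in> l i w"
  unfolding e(2)[of i w] by (rule vec.span_scale)

lemma line_frame_normalize:
  assumes v: "line_frame i m v"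
  shows "adapted_frame U (l i) m (\<lambda>w. (1 / complex_of_real (norm (v w))) *s v w)"
proof -
  have nz: "v w \<noteq> 0" for w using v by (auto simp: line_frame_def)
  have fc: "frame_charge U m v" using v by (simp add: line_frame_def)
  note per = norm_frame_periodic[OF fc, unfolded periodic_def, rule_format]
  have "continuous_on UNIV (\<lambda>w. \<chi> a. 1 / complex_of_real (norm (v w)) * v w $ a)"
    using v nz unfolding line_frame_def by (intro continuous_on_vec_lambda continuous_intros) auto
  moreover have "(\<lambda>w. (1 / complex_of_real (norm (v w))) *s v w) = (\<lambda>w. \<chi> a. 1 / complex_of_real (norm (v w)) * v w $ a)"
    by (simp add: fun_eq_iff vec_eq_iff)
  ultimately have "continuous_on UNIV (\<lambda>w. (1 / complex_of_real (norm (v w))) *s v w)" by (simp only:)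
  moreover have "(1 / complex_of_real (norm (v w))) *s v w \<in> l i w" for w
    using v unfolding line_frame_def by (intro in_line_smult) auto
  moreover have "norm ((1 / complex_of_real (norm (v w))) *s v w) = 1" for w
    using nz[of w] by (simp add: norm_divide)
  ultimately show ?thesis
    using fc unfolding adapted_frame_def frame_charge_def per by (simp add: mv_smult smult_smult mult.commute)
qed

lemma charge_eq:
  assumes v: "line_frame i m v" shows "charge U (l i) = m"
  unfolding charge_def
proof (rule the_equality)
  show "\<exists>e. adapted_frame U (l i) m e" using line_frame_normalize[OF v] by blast
next
  fix m' assume "\<exists>e. adapted_frame U (l i) m' e"
  then obtain e' where "adapted_frame U (l i) m' e'" by blast
  from frame_ratio[OF v adapted_line_frame[OF this]] show "m' = m" by metis
qed

lemma charge_trivial: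
  assumes "topologically_trivial U (l i)" shows "charge U (l i) = 0"
proof -
  obtain v where "continuous_on UNIV v \<and> (\<forall>w. v w \<noteq> 0 \<and> v w \<in> l i w) \<and> (\<forall>j w. v (w + axis j 1) = U j w *v v w)"
    using assms unfolding topologically_trivial_def by blast
  then have "line_frame i 0 v" by (simp add: line_frame_def frame_charge_def)
  then show ?thesis by (rule charge_eq)
qed

definition normal_frame :: "branch \<Rightarrow> int \<Rightarrow> int^2 \<Rightarrow> complex \<Rightarrow> (real^2 \<Rightarrow> complex^2) \<Rightarrow> bool" where
  "normal_frame i m k \<eta> v \<longleftrightarrow> line_frame i m v \<and>
    (\<forall>w. A w *v v w = exp (2 * pi * \<i> * (lattice_dot k w - of_int m * \<tau> $ 1 * w $ 2) + \<eta>) *s v (w + \<tau>))"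

lemma normal_frame_exists:
  assumes "\<tau> \<in> diophantine c \<nu>" "c > 0"
  obtains m k \<eta> v where "normal_frame i m k \<eta> v"
proof -
  obtain v m k \<eta> where v: "continuous_on UNIV v" "\<And>w. \<exists>c. c \<noteq> 0 \<and> v w = c *s e i w" "frame_charge U m v"
    "\<And>w. A w *v v w = exp (2 * pi * \<i> * (lattice_dot k w - of_int m * \<tau> $ 1 * w $ 2) + \<eta>) *s v (w + \<tau>)"
    using normal_form[OF assms, of i] by blast
  have "v w \<noteq> 0 \<and> v w \<in> l i w" for w using v(2)[of w] e_nonzero[of i w] in_line_smult[OF e_in_line] by auto
  then have "normal_frame i m k \<eta> v" using v by (simp add: normal_frame_def line_frame_def)
  then show ?thesis by (rule that)
qed

text \<open>
  Changing the frame by a periodic factor changes the multiplier by a coboundary; the linear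
  part of the logarithm of the factor contributes only the constant character value at \<open>\<tau>\<close>.
\<close>

lemma normal_frame_multiplier:
  assumes v: "normal_frame i m k \<eta> v" and e': "adapted_frame U (l i) m e'"
  obtains H n where "continuous_on UNIV H" "periodic H"
    "\<And>w. multiplier A \<tau> e' w = exp (2 * pi * \<i> * (lattice_dot k w - of_int m * \<tau> $ 1 * w $ 2)
        + (H w - H (w + \<tau>) + (\<eta> - 2 * pi * \<i> * lattice_dot n \<tau>)))"
proof -
  obtain x where x: "continuous_on UNIV x" "\<And>w. x w \<noteq> 0" "\<And>w. e' w = x w *s v w" "periodic x"
    using frame_ratio[OF _ adapted_line_frame[OF e']] v unfolding normal_frame_def by metis
  obtain n H where H: "continuous_on UNIV H" "periodic H" "\<And>w. x w = exp (2 * pi * \<i> * lattice_dot n w + H w)"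
    using periodic_coboundary_log[OF x(1,4,2)] by metis
  have "multiplier A \<tau> e' w = exp (2 * pi * \<i> * (lattice_dot k w - of_int m * \<tau> $ 1 * w $ 2)
        + (H w - H (w + \<tau>) + (\<eta> - 2 * pi * \<i> * lattice_dot n \<tau>)))" for w
  proof -
    have E: "A w *v v w = exp (2 * pi * \<i> * (lattice_dot k w - of_int m * \<tau> $ 1 * w $ 2) + \<eta>) *s v (w + \<tau>)"
      using v by (simp add: normal_frame_def)
    have "A w *v e' w = (x w * exp (2 * pi * \<i> * (lattice_dot k w - of_int m * \<tau> $ 1 * w $ 2) + \<eta>) / x (w + \<tau>)) *s e' (w + \<tau>)"
      unfolding x(3) mv_smult E smult_smult using x(2)[of "w + \<tau>"] by simp
    moreover have "hinner (e' (w + \<tau>)) (e' (w + \<tau>)) = 1" using e' by (simp add: adapted_frame_def hinner_self)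
    ultimately have "multiplier A \<tau> e' w = x w * exp (2 * pi * \<i> * (lattice_dot k w - of_int m * \<tau> $ 1 * w $ 2) + \<eta>) / x (w + \<tau>)"
      by (simp add: multiplier_def hinner_smult)
    also have "\<dots> = exp ((2 * pi * \<i> * lattice_dot n w + H w) + (2 * pi * \<i> * (lattice_dot k w - of_int m * \<tau> $ 1 * w $ 2) + \<eta>)
        - (2 * pi * \<i> * lattice_dot n (w + \<tau>) + H (w + \<tau>)))"
      unfolding H(3) by (simp only: exp_add exp_diff)
    also have "\<dots> = exp (2 * pi * \<i> * (lattice_dot k w - of_int m * \<tau> $ 1 * w $ 2)
        + (H w - H (w + \<tau>) + (\<eta> - 2 * pi * \<i> * lattice_dot n \<tau>)))"
      by (intro arg_cong[of _ _ exp]) (simp add: algebra_simps)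
    finally show ?thesis .
  qed
  then show ?thesis using that H by blast
qed

lemma norm_exp_phase: "norm (exp (2 * pi * \<i> * complex_of_real t + z)) = exp (Re z)"
  by simp

text \<open>
  A coboundary has mean zero, so the mean of the logarithm of the multiplier is \<open>\<eta>\<close> up to the
  constant from the winding of the change of frame. For two descriptions of the same phase the
  values of \<open>k \<cdot> w + g w\<close> differ by a constant integer, and periodicity of \<open>g\<close> makes the linear
  parts equal.
\<close>

lemma normal_frame_data:
  assumes v: "normal_frame i m k \<eta> v" and e': "adapted_frame U (l i) m e'"
  shows "\<exists>g. phase_data A \<tau> m e' k g"
    and "lyapunov A \<tau> e' = Re \<eta>"
    and "phase_data A \<tau> m e' k' g' \<Longrightarrow> k' = k"
    and "phase_data A \<tau> m e' k' g' \<Longrightarrow> \<exists>n. base_eigenvalue A \<tau> e' g' = exp \<eta> * torus_char n \<tau>"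
proof -
  obtain H n where H: "continuous_on UNIV H" "periodic H"
    "\<And>w. multiplier A \<tau> e' w = exp (2 * pi * \<i> * (lattice_dot k w - of_int m * \<tau> $ 1 * w $ 2)
        + (H w - H (w + \<tau>) + (\<eta> - 2 * pi * \<i> * lattice_dot n \<tau>)))"
    using normal_frame_multiplier[OF v e'] by metis
  define G where "G w = H w - H (w + \<tau>) + (\<eta> - 2 * pi * \<i> * lattice_dot n \<tau>)" for w
  have Gm: "torus_mean G = \<eta> - 2 * pi * \<i> * lattice_dot n \<tau>" "torus_bounded G"
    using torus_mean_coboundary[OF H(1,2)] unfolding G_def by auto
  have Gc: "continuous_on UNIV G" unfolding G_def by (intro continuous_intros H continuous_on_compose2[OF H(1)]) auto
  have Gp: "periodic G" unfolding periodic_def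
  proof (intro allI)
    fix j w
    have "H (w + axis j 1 + \<tau>) = H (w + \<tau>)" using H(2)[unfolded periodic_def, rule_format, of "w + \<tau>" j] by (simp add: add_ac)
    then show "G (w + axis j 1) = G w" using H(2)[unfolded periodic_def, rule_format, of w j] by (simp add: G_def)
  qed
  have q: "multiplier A \<tau> e' w = exp (2 * pi * \<i> * complex_of_real (lattice_dot k w - of_int m * \<tau> $ 1 * w $ 2) + G w)" for w
    by (simp add: H(3) G_def)
  have nq: "norm (multiplier A \<tau> e' w) = exp (Re (G w))" for w unfolding q norm_exp_phase ..
  have "lyapunov A \<tau> e' = torus_mean (\<lambda>w. Re (G w))" unfolding lyapunov_def nq by simp
  also have "\<dots> = Re \<eta>" unfolding torus_mean_Re_Im(1)[OF Gm(2)] Gm(1) by simp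
  finally show ly: "lyapunov A \<tau> e' = Re \<eta>" .
  have ph: "multiplier_phase A \<tau> m e' w = cis (2 * pi * (lattice_dot k w + Im (G w) / (2 * pi)))" for w
  proof -
    have "multiplier_phase A \<tau> m e' w = exp (2 * pi * \<i> * complex_of_real (lattice_dot k w - of_int m * \<tau> $ 1 * w $ 2) + G w)
       / exp (complex_of_real (Re (G w))) * exp (\<i> * complex_of_real (2 * pi * of_int m * \<tau> $ 1 * w $ 2))"
      unfolding multiplier_phase_def nq unfolding q by (simp only: exp_of_real cis_conv_exp)
    also have "\<dots> = exp (2 * pi * \<i> * complex_of_real (lattice_dot k w - of_int m * \<tau> $ 1 * w $ 2) + G w - complex_of_real (Re (G w))
          + \<i> * complex_of_real (2 * pi * of_int m * \<tau> $ 1 * w $ 2))"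
      by (simp only: exp_add exp_diff)
    also have "\<dots> = exp (\<i> * complex_of_real (2 * pi * (lattice_dot k w + Im (G w) / (2 * pi))))"
      by (intro arg_cong[of _ _ exp]) (auto simp: complex_eq_iff algebra_simps)
    finally show ?thesis by (simp only: cis_conv_exp)
  qed
  have "phase_data A \<tau> m e' k (\<lambda>w. Im (G w) / (2 * pi))"
    unfolding phase_data_def using Gp ph by (auto simp: periodic_def intro!: continuous_intros Gc)
  then show "\<exists>g. phase_data A \<tau> m e' k g" by blast
  assume pd: "phase_data A \<tau> m e' k' g'"
  define D where "D w = 2 * pi * \<i> * complex_of_real (lattice_dot k' w + g' w - (lattice_dot k w + Im (G w) / (2 * pi)))" for w
  have g': "continuous_on UNIV g'" "periodic g'" using pd by (auto simp: phase_data_def)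
  obtain z :: int where z: "\<And>w. D w = 2 * pi * \<i> * of_int z"
  proof (rule exp_const_one[of D])
    show "continuous_on UNIV D" unfolding D_def by (intro continuous_intros g' Gc) simp
    show "exp (D w) = 1" for w
    proof -
      have "cis (2 * pi * (lattice_dot k' w + g' w)) = cis (2 * pi * (lattice_dot k w + Im (G w) / (2 * pi)))"
        using pd ph[of w] unfolding phase_data_def by simp
      then have "exp (\<i> * complex_of_real (2 * pi * (lattice_dot k' w + g' w)) - \<i> * complex_of_real (2 * pi * (lattice_dot k w + Im (G w) / (2 * pi)))) = 1"
        by (simp add: cis_conv_exp exp_diff)
      then show ?thesis unfolding D_def by (simp only: of_real_diff of_real_mult right_diff_distrib mult_ac of_real_numeral)
    qed
  qed blast
  have z': "lattice_dot k' w + g' w - (lattice_dot k w + Im (G w) / (2 * pi)) = of_int z" for w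
  proof -
    have "complex_of_real (lattice_dot k' w + g' w - (lattice_dot k w + Im (G w) / (2 * pi))) = of_int z"
      using z[of w] unfolding D_def by simp
    then have "complex_of_real (lattice_dot k' w + g' w - (lattice_dot k w + Im (G w) / (2 * pi))) = complex_of_real (of_int z)" by simp
    then show ?thesis by (simp only: of_real_eq_iff)
  qed
  show k: "k' = k"
  proof -
    have "k' $ j = k $ j" for j
      using z'[of "axis j 1"] z'[of 0] g'(2)[unfolded periodic_def, rule_format, of 0 j] Gp[unfolded periodic_def, rule_format, of 0 j]
      by (simp add: lattice_dot_def[of _ 0])
    then show ?thesis by (simp add: vec_eq_iff)
  qed
  have "g' w = Im (complex_of_real (1 / (2 * pi)) * (\<i> * complex_of_real (2 * pi * of_int z) + G w))" for w
    using z'[of w] unfolding k by (simp add: field_simps)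
  then have "torus_mean g' = torus_mean (\<lambda>w. Im (complex_of_real (1 / (2 * pi)) * (\<i> * complex_of_real (2 * pi * of_int z) + G w)))"
    by presburger
  also have "\<dots> = Im (complex_of_real (1 / (2 * pi)) * (\<i> * complex_of_real (2 * pi * of_int z) + torus_mean G))"
    unfolding torus_mean_Re_Im(2)[OF torus_bounded_mult[OF torus_bounded_const torus_bounded_add[OF torus_bounded_const Gm(2)]]]
      torus_mean_cmult torus_mean_add[OF torus_bounded_const Gm(2)] by simp
  also have "\<dots> = of_int z + Im \<eta> / (2 * pi) - lattice_dot n \<tau>"
    unfolding Gm(1) by (simp add: field_simps)
  finally have mg: "torus_mean g' = of_int z + Im \<eta> / (2 * pi) - lattice_dot n \<tau>" .
  have "base_eigenvalue A \<tau> e' g' = exp (\<eta> + \<i> * complex_of_real (2 * pi * lattice_dot (- n) \<tau>) + \<i> * complex_of_real (2 * pi * of_int z))"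
    unfolding base_eigenvalue_def ly mg
    by (intro arg_cong[of _ _ exp]) (auto simp: complex_eq_iff algebra_simps lattice_dot_minus_left)
  also have "\<dots> = exp \<eta> * torus_char (- n) \<tau>"
    unfolding exp_add cis_conv_exp[symmetric] torus_char_def by simp
  finally show "\<exists>n. base_eigenvalue A \<tau> e' g' = exp \<eta> * torus_char n \<tau>" by blast
qed

lemma winding_vector_eq:
  assumes v: "normal_frame i m k \<eta> v" shows "winding_vector U A \<tau> (l i) = k"
proof -
  have lf: "line_frame i m v" using v by (simp add: normal_frame_def)
  show ?thesis unfolding winding_vector_def charge_eq[OF lf]
  proof (rule the_equality)
    show "\<exists>e g. adapted_frame U (l i) m e \<and> phase_data A \<tau> m e k g"
      using line_frame_normalize[OF lf] normal_frame_data(1)[OF v] by blast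
  next
    fix k' assume "\<exists>e g. adapted_frame U (l i) m e \<and> phase_data A \<tau> m e k' g"
    then show "k' = k" using normal_frame_data(3)[OF v] by blast
  qed
qed

lemma line_spectrum_eq:
  assumes v: "normal_frame i m k \<eta> v" and e': "adapted_frame U (l i) m e'" and g': "phase_data A \<tau> m e' k' g'"
  shows "line_spectrum A \<tau> e' g' = {exp \<eta> * torus_char n \<tau> | n. True}"
proof -
  obtain n0 where n0: "base_eigenvalue A \<tau> e' g' = exp \<eta> * torus_char n0 \<tau>" using normal_frame_data(4)[OF v e' g'] by blast
  have c: "cis (- 2 * pi * lattice_dot n \<tau>) = torus_char (- n) \<tau>" for n
    by (simp add: torus_char_def lattice_dot_minus_left)
  have eq: "base_eigenvalue A \<tau> e' g' * cis (- 2 * pi * lattice_dot n \<tau>) = exp \<eta> * torus_char (n0 - n) \<tau>" for n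
    unfolding n0 c using torus_char_add_left[of n0 "- n" \<tau>] by simp
  have "exp \<eta> * torus_char n \<tau> = exp \<eta> * torus_char (n0 - (n0 - n)) \<tau>" for n by simp
  then show ?thesis unfolding line_spectrum_def eq by blast
qed

lemma normal_frame_iterate:
  assumes v: "normal_frame i m k \<eta> v"
  shows "norm (cocycle_iterate A \<tau> n w *v v w) = exp (real n * Re \<eta>) * norm (v (w + real n *\<^sub>R \<tau>))"
proof -
  have "\<exists>z. norm z = exp (real n * Re \<eta>) \<and> cocycle_iterate A \<tau> n w *v v w = z *s v (w + real n *\<^sub>R \<tau>)"
  proof (induction n)
    case 0
    show ?case by (rule exI[of _ 1]) simp
  next
    case (Suc n)
    then obtain z where z: "norm z = exp (real n * Re \<eta>)" "cocycle_iterate A \<tau> n w *v v w = z *s v (w + real n *\<^sub>R \<tau>)" by blast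
    let ?w = "w + real n *\<^sub>R \<tau>"
    let ?E = "exp (2 * pi * \<i> * complex_of_real (lattice_dot k ?w - of_int m * \<tau> $ 1 * ?w $ 2) + \<eta>)"
    have "A ?w *v v ?w = ?E *s v (?w + \<tau>)" using v by (simp add: normal_frame_def)
    moreover have "?w + \<tau> = w + real (Suc n) *\<^sub>R \<tau>" by (simp add: algebra_simps)
    ultimately have "cocycle_iterate A \<tau> (Suc n) w *v v w = (z * ?E) *s v (w + real (Suc n) *\<^sub>R \<tau>)"
      by (simp only: cocycle_iterate.simps matrix_vector_mul_assoc[symmetric] z(2) mv_smult smult_smult)
    moreover have "norm (z * ?E) = exp (real (Suc n) * Re \<eta>)"
      unfolding norm_mult z(1) norm_exp_phase exp_add[symmetric] by (simp add: algebra_simps)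
    ultimately show ?case by blast
  qed
  then show ?thesis by auto
qed

text \<open>
  The quotient of the lengths of the two frames is evaluated at its minimum: there the ratio of
  the growth over \<open>n\<close> steps is at least \<open>exp (n (Re \<eta>s - Re \<eta>u))\<close>, while domination makes it at
  most \<open>1/2\<close>.
\<close>

lemma lyapunov_gap:
  assumes s: "normal_frame Stable ms ks \<eta>s vs" and u: "normal_frame Unstable mu ku \<eta>u vu"
  shows "Re \<eta>s < Re \<eta>u"
proof -
  obtain n where n: "\<And>w. norm (b Stable n w) \<le> (1/2) * norm (b Unstable n w)"
    using strongly_dominated[of "1/2"] by auto
  have nb: "norm (b i n w) * norm (v w) = exp (real n * Re \<eta>) * norm (v (w + real n *\<^sub>R \<tau>))"
    if v: "normal_frame i m k \<eta> v" for i m k \<eta> v w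
  proof -
    have "v w \<in> l i w" using v by (simp add: normal_frame_def line_frame_def)
    then obtain c where c: "v w = c *s e i w" using in_line by blast
    have "norm (cocycle_iterate A \<tau> n w *v v w) = norm c * norm (b i n w)" unfolding c mv_smult norm_smult norm_b ..
    moreover have "norm (v w) = norm c" unfolding c norm_smult e(1) by simp
    ultimately show ?thesis using normal_frame_iterate[OF v, of n w] by (simp add: mult.commute)
  qed
  have nz: "norm (vs w) > 0" "norm (vu w) > 0" for w using s u by (auto simp: normal_frame_def line_frame_def)
  define R where "R w = norm (vs w) / norm (vu w)" for w
  have "continuous_on UNIV R" unfolding R_def
    using s u nz(2) unfolding normal_frame_def line_frame_def by (intro continuous_intros) auto
  moreover have "periodic R"
    using norm_frame_periodic[of ms vs] norm_frame_periodic[of mu vu] s u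
    unfolding R_def normal_frame_def line_frame_def periodic_def by simp
  ultimately obtain z where z: "\<And>w. R z \<le> R w" using periodic_minimum by blast
  have Rp: "R w > 0" for w using nz by (simp add: R_def)
  let ?z = "z + real n *\<^sub>R \<tau>"
  have "exp (real n * Re \<eta>s) * norm (vs ?z) / norm (vs z) \<le> (1/2) * (exp (real n * Re \<eta>u) * norm (vu ?z) / norm (vu z))"
    using n[of z] unfolding nb[OF s, symmetric] nb[OF u, symmetric] using nz[of z] by simp
  then have "exp (real n * Re \<eta>s) * R ?z \<le> (1/2) * exp (real n * Re \<eta>u) * R z"
    using nz[of z] nz[of ?z] unfolding R_def by (simp add: field_simps)
  moreover have "exp (real n * Re \<eta>s) * R z \<le> exp (real n * Re \<eta>s) * R ?z" using z[of ?z] by simp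
  ultimately have "exp (real n * Re \<eta>s) * R z \<le> (1/2) * exp (real n * Re \<eta>u) * R z" by linarith
  then have "exp (real n * Re \<eta>s) \<le> (1/2) * exp (real n * Re \<eta>u)" using Rp[of z] by simp
  moreover have "exp (real n * Re \<eta>u) > 0" by simp
  ultimately have "exp (real n * Re \<eta>s) < exp (real n * Re \<eta>u)" by linarith
  then have "real n * Re \<eta>s < real n * Re \<eta>u" by simp
  then show ?thesis by (simp add: mult_less_cancel_left)
qed

end

section \<open>Measurable solutions of the scalar equation\<close>

text \<open>A nonconstant phase \<open>cis (t \<rho>)\<close> takes uncountably many values.\<close>

lemma phase_frequency_zero:
  assumes C: "countable C" and "\<And>t. cis (t * \<rho>) \<in> C"
  shows "\<rho> = 0"
proof (rule ccontr)
  assume \<rho>: "\<rho> \<noteq> 0"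
  have "cos t \<in> Re ` C" for t
  proof -
    have "cos t = Re (cis ((t / \<rho>) * \<rho>))" using \<rho> by simp
    then show ?thesis using assms(2)[of "t / \<rho>"] by (simp only: image_eqI)
  qed
  then have "cos ` {0<..<1} \<subseteq> Re ` C" by blast
  then have "countable (cos ` {0<..<1::real})" using C by (meson countable_image countable_subset)
  moreover have "inj_on cos {0<..<1::real}"
  proof (rule inj_onI)
    fix x y :: real assume "x \<in> {0<..<1}" "y \<in> {0<..<1}" "cos x = cos y"
    then show "x = y" using cos_inj_pi[of x y] pi_gt3 by auto
  qed
  ultimately have "countable {0<..<1::real}" by (rule countable_image_inj_on)
  then show False using uncountable_open_interval[of 0 "1::real"] by simp
qed

lemma countable_characters: "countable (range (\<lambda>n. torus_char n \<tau>))"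
  by (rule countable_image) simp

lemma nonresonant_inj:
  assumes "nonresonant \<tau>" "torus_char n \<tau> = torus_char n' \<tau>" shows "n = n'"
proof (rule ccontr)
  assume "n \<noteq> n'"
  then have "torus_char (n - n') \<tau> \<noteq> 1" using assms(1) by (simp add: nonresonant_def)
  moreover have "torus_char (n - n') \<tau> * torus_char n' \<tau> = torus_char n \<tau>" using torus_char_add_left[of "n - n'" n' \<tau>] by simp
  ultimately show False using assms(2) by simp
qed

text \<open>
  The equation for the coefficient of an eigensection along a normal frame; \<open>f\<close> is only known to
  be measurable.
\<close>

locale scalar_eigenfunction =
  fixes f :: "real^2 \<Rightarrow> complex" and m :: int and k :: "int^2" and \<eta> lam :: complex and \<tau> :: "real^2"
  assumes nonres: "nonresonant \<tau>"
    and f_meas: "f \<in> borel_measurable lebesgue"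
    and f1: "AE w in lebesgue. f (w + axis 1 1) = f w"
    and f2: "AE w in lebesgue. f (w + axis 2 1) = cis (- 2 * pi * of_int m * w $ 1) * f w"
    and eigen: "AE w in lebesgue. exp (2 * pi * \<i> * (lattice_dot k w - of_int m * \<tau> $ 1 * w $ 2) + \<eta>) * f w = lam * f (w + \<tau>)"
    and nonzero: "\<not> (AE w in lebesgue. f w = 0)"
begin

lemma norm_periodic: "AE w in lebesgue. norm (f (w + axis j 1)) = norm (f w)"
proof -
  consider "j = 1" | "j = 2" using exhaust_2 by blast
  then show ?thesis
  proof cases
    case 1
    show ?thesis unfolding 1 using f1 by eventually_elim simp
  next
    case 2
    show ?thesis unfolding 2 using f2 by eventually_elim (simp add: norm_mult)
  qed
qed

lemma lam_nonzero: "lam \<noteq> 0"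
proof
  assume l: "lam = 0"
  have "AE w in lebesgue. f w = 0" using eigen by eventually_elim (simp add: l)
  then show False using nonzero by simp
qed

lemma norm_eigen: "AE w in lebesgue. exp (Re \<eta>) * norm (f w) = norm lam * norm (f (w + \<tau>))"
  using eigen
proof eventually_elim
  case (elim w)
  have "norm (exp (2 * pi * \<i> * complex_of_real (lattice_dot k w - of_int m * \<tau> $ 1 * w $ 2) + \<eta>) * f w) = norm (lam * f (w + \<tau>))"
    using elim by simp
  then show ?case by (simp add: norm_mult)
qed

text \<open>
  For every real \<open>t\<close> the function \<open>|f|\<close> to the power \<open>it\<close> is a bounded eigenfunction of the
  translation with eigenvalue \<open>cis (t \<rho>)\<close>. There are countably many eigenvalues, so \<open>\<rho> = 0\<close>.
\<close>

lemma norm_lam: "norm lam = exp (Re \<eta>)"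
proof -
  define \<rho> where "\<rho> = Re \<eta> - ln (norm lam)"
  have "cis (t * \<rho>) \<in> range (\<lambda>n. torus_char n \<tau>)" for t
  proof -
    define D where "D w = (if f w = 0 then 0 else cis (t * ln (norm (f w))))" for w
    have "(\<lambda>w. cis (t * ln (norm (f w)))) \<in> borel_measurable lebesgue"
    proof -
      have "(\<lambda>w. cis (t * ln (norm (f w)))) = (\<lambda>w. exp (\<i> * complex_of_real (t * ln (norm (f w)))))" by (simp add: cis_conv_exp)
      moreover have "(\<lambda>w. exp (\<i> * complex_of_real (t * ln (norm (f w))))) \<in> borel_measurable lebesgue"
        using f_meas by measurable
      ultimately show ?thesis by simp
    qed
    then have "D \<in> borel_measurable lebesgue" unfolding D_def using f_meas
      by measurable
    moreover have "AE w in lebesgue. D (w + axis j 1) = D w" for j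
      using norm_periodic[of j]
    proof eventually_elim
      case (elim w)
      then have "f (w + axis j 1) = 0 \<longleftrightarrow> f w = 0" by (metis norm_eq_zero)
      then show ?case using elim by (simp add: D_def)
    qed
    moreover have "norm (D w) \<le> 1" for w by (simp add: D_def)
    ultimately have D: "torus_bounded D" unfolding torus_bounded_def by blast
    have "AE w in lebesgue. D (w + \<tau>) = cis (t * \<rho>) * D w"
      using norm_eigen
    proof eventually_elim
      case (elim w)
      show ?case
      proof (cases "f w = 0")
        case True
        then show ?thesis using elim lam_nonzero by (simp add: D_def)
      next
        case False
        then have nz: "f (w + \<tau>) \<noteq> 0" using elim by auto
        have "ln (exp (Re \<eta>) * norm (f w)) = ln (norm lam * norm (f (w + \<tau>)))" using elim by simp
        then have "ln (norm (f (w + \<tau>))) = \<rho> + ln (norm (f w))"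
          using False nz lam_nonzero by (simp add: ln_mult \<rho>_def)
        then have "cis (t * ln (norm (f (w + \<tau>)))) = cis (t * \<rho>) * cis (t * ln (norm (f w)))"
          by (simp add: cis_mult distrib_left)
        then show ?thesis using False nz by (simp add: D_def)
      qed
    qed
    moreover have "\<not> (AE w in lebesgue. D w = 0)"
    proof
      assume "AE w in lebesgue. D w = 0"
      then have "AE w in lebesgue. f w = 0" by eventually_elim (metis D_def cis_neq_zero)
      then show False using nonzero by simp
    qed
    ultimately obtain n where "cis (t * \<rho>) = torus_char n \<tau>"
      using torus_rotation_eigenfunction[OF nonres D] by metis
    then show ?thesis by simp
  qed
  then have "\<rho> = 0" using phase_frequency_zero[OF countable_characters] by blast
  then have "Re \<eta> = ln (norm lam)" by (simp add: \<rho>_def)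
  then show ?thesis using lam_nonzero by simp
qed

text \<open>The modulus is invariant under the translation; the function \<open>x / (1 + x)\<close> makes it bounded.\<close>

lemma norm_constant: obtains r where "r > 0" "AE w in lebesgue. norm (f w) = r"
proof -
  define D where "D w = complex_of_real (norm (f w) / (1 + norm (f w)))" for w
  have "D \<in> borel_measurable lebesgue" unfolding D_def using f_meas by measurable
  moreover have "AE w in lebesgue. D (w + axis j 1) = D w" for j
    using norm_periodic[of j] by eventually_elim (simp add: D_def)
  moreover have nD: "norm (D w) = norm (f w) / (1 + norm (f w))" for w
    by (simp add: D_def norm_divide add_nonneg_nonneg del: of_real_add of_real_divide)
  have "norm (D w) \<le> 1" for w
  proof -
    have "1 + norm (f w) > 0" using norm_ge_zero[of "f w"] by linarith
    then show ?thesis unfolding nD by (simp add: divide_le_eq_1_pos)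
  qed
  ultimately have D: "torus_bounded D" unfolding torus_bounded_def by blast
  have ev: "AE w in lebesgue. D (w + \<tau>) = 1 * D w"
    using norm_eigen by eventually_elim (simp add: norm_lam D_def)
  have D0: "D w = 0 \<longleftrightarrow> f w = 0" for w
  proof -
    have "1 + norm (f w) \<noteq> 0" using norm_ge_zero[of "f w"] by linarith
    then have "norm (f w) / (1 + norm (f w)) = 0 \<longleftrightarrow> f w = 0" by simp
    then show ?thesis unfolding D_def of_real_eq_0_iff .
  qed
  have "\<not> (AE w in lebesgue. D w = 0)" using nonzero by (simp add: D0)
  then obtain n c where n: "c \<noteq> 0" "1 = torus_char n \<tau>" "AE w in lebesgue. D w = c * torus_char n w"
    by (rule torus_rotation_eigenfunction[OF nonres D ev])
  have n0: "n = 0" using nonresonant_inj[OF nonres, of n 0] n(2) by simp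
  have *: "norm (f w) = norm c / (1 - norm c) \<and> norm c > 0 \<and> norm c < 1" if "D w = c * torus_char n w" for w
  proof -
    have p: "1 + norm (f w) > 0" using norm_ge_zero[of "f w"] by linarith
    have c: "norm c = norm (f w) / (1 + norm (f w))" using that n0 nD[of w] by simp
    then have d: "1 - norm c = 1 / (1 + norm (f w))" using p by (simp add: field_simps)
    then have "norm c / (1 - norm c) = norm (f w)" using p unfolding c by simp
    moreover have "1 - norm c > 0" unfolding d using p by simp
    ultimately show ?thesis using n(1) by simp
  qed
  show ?thesis
  proof
    show "AE w in lebesgue. norm (f w) = norm c / (1 - norm c)" using n(3) by eventually_elim (rule *[THEN conjunct1])
    show "norm c / (1 - norm c) > 0"
    proof (rule ccontr)
      assume np: "\<not> norm c / (1 - norm c) > 0"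
      have "AE w in lebesgue. f w = 0" using n(3)
      proof eventually_elim
        case (elim w)
        from *[OF elim] show ?case using np by auto
      qed
      then show False using nonzero by simp
    qed
  qed
qed

lemma sgn_eigen:
  "AE w in lebesgue. sgn (f (w + \<tau>)) = cis (2 * pi * (lattice_dot k w - of_int m * \<tau> $ 1 * w $ 2) + Im \<eta>) / sgn lam * sgn (f w)"
  using eigen
proof eventually_elim
  case (elim w)
  have "sgn (exp (2 * pi * \<i> * complex_of_real (lattice_dot k w - of_int m * \<tau> $ 1 * w $ 2) + \<eta>)) * sgn (f w) = sgn lam * sgn (f (w + \<tau>))"
    using elim by (simp flip: sgn_mult)
  moreover have "sgn (exp z) = cis (Im z)" for z :: complex
    by (simp add: sgn_eq exp_eq_polar norm_mult)
  ultimately show ?case using lam_nonzero by (simp add: field_simps sgn_zero_iff)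
qed

lemma sgn_measurable: "(\<lambda>w. sgn (f w)) \<in> borel_measurable lebesgue"
  unfolding sgn_eq using f_meas by measurable

text \<open>
  The phase of the translate of \<open>f\<close> by \<open>x\<close> is divided by that of \<open>f\<close>; the remaining sewing
  factor is constant and is compensated by a phase linear in \<open>w\<^sub>2\<close>. The resulting periodic
  function is an eigenfunction of the translation by \<open>\<tau>\<close>.
\<close>

lemma correlation_phase:
  "cis (2 * pi * (lattice_dot k x - of_int m * \<tau> $ 1 * x $ 2 + of_int m * \<tau> $ 2 * x $ 1)) \<in> range (\<lambda>n. torus_char n \<tau>)"
proof -
  define D where "D w = sgn (f (w + x)) * cnj (sgn (f w)) * cis (2 * pi * of_int m * x $ 1 * w $ 2)" for w
  have fx: "(\<lambda>w. sgn (f (w + x))) \<in> borel_measurable lebesgue"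
    using measurable_compose[OF distr_lebesgue_shift(2) sgn_measurable] by blast
  have cm: "(\<lambda>w. cis (2 * pi * of_int m * x $ 1 * (w::real^2) $ 2)) \<in> borel_measurable lebesgue"
    by (intro borel_measurable_lebesgue_continuous continuous_intros)
  have "(\<lambda>w. cnj (sgn (f w))) \<in> borel_measurable lebesgue"
    by (rule measurable_compose[OF sgn_measurable]) (intro borel_measurable_continuous_onI continuous_intros)
  then have "D \<in> borel_measurable lebesgue" unfolding D_def
    by (intro borel_measurable_times fx cm)
  moreover have "norm (D w) \<le> 1" for w by (simp add: D_def norm_mult norm_sgn)
  moreover have "AE w in lebesgue. D (w + axis j 1) = D w" for j
  proof -
    consider "j = 1" | "j = 2" using exhaust_2 by blast
    then show ?thesis
    proof cases
      case 1
      show ?thesis unfolding 1 using f1 AE_shift[OF f1, of x]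
        by eventually_elim (simp add: D_def axis_def add_ac)
    next
      case 2
      show ?thesis unfolding 2 using f2 AE_shift[OF f2, of x]
      proof eventually_elim
        case (elim w)
        have "D (w + axis 2 1) = (cis (- 2 * pi * of_int m * (w + x) $ 1) * cnj (cis (- 2 * pi * of_int m * w $ 1))
            * cis (2 * pi * of_int m * x $ 1 * (w + axis 2 1) $ 2)) * (sgn (f (w + x)) * cnj (sgn (f w)))"
          using elim by (simp add: D_def add_ac sgn_mult sgn_eq[of "cis _"])
        also have "cis (- 2 * pi * of_int m * (w + x) $ 1) * cnj (cis (- 2 * pi * of_int m * w $ 1))
            * cis (2 * pi * of_int m * x $ 1 * (w + axis 2 1) $ 2) = cis (2 * pi * of_int m * x $ 1 * w $ 2)"
          unfolding cis_cnj cis_mult by (simp add: axis_def algebra_simps)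
        finally show ?case by (simp add: D_def mult_ac)
      qed
    qed
  qed
  ultimately have D: "torus_bounded D" unfolding torus_bounded_def by blast
  let ?th = "2 * pi * (lattice_dot k x - of_int m * \<tau> $ 1 * x $ 2 + of_int m * \<tau> $ 2 * x $ 1)"
  have "AE w in lebesgue. D (w + \<tau>) = cis ?th * D w"
    using sgn_eigen AE_shift[OF sgn_eigen, of x]
  proof eventually_elim
    case (elim w)
    let ?E = "\<lambda>w. cis (2 * pi * (lattice_dot k w - of_int m * \<tau> $ 1 * w $ 2) + Im \<eta>)"
    have s: "sgn lam * cnj (sgn lam) = 1"
      using lam_nonzero complex_norm_square[of "sgn lam"] by (simp add: norm_sgn)
    have "D (w + \<tau>) = (?E (w + x) / sgn lam * sgn (f (w + x))) * cnj (?E w / sgn lam * sgn (f w)) * cis (2 * pi * of_int m * x $ 1 * (w + \<tau>) $ 2)"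
      using elim by (simp add: D_def add_ac)
    also have "\<dots> = (?E (w + x) * cnj (?E w) * cis (2 * pi * of_int m * x $ 1 * (w + \<tau>) $ 2)) * (sgn (f (w + x)) * cnj (sgn (f w))) / (sgn lam * cnj (sgn lam))"
      by (simp add: mult_ac)
    also have "?E (w + x) * cnj (?E w) * cis (2 * pi * of_int m * x $ 1 * (w + \<tau>) $ 2) = cis ?th * cis (2 * pi * of_int m * x $ 1 * w $ 2)"
      unfolding cis_cnj cis_mult by (simp add: algebra_simps)
    finally show ?case by (simp add: s D_def mult_ac)
  qed
  moreover have "\<not> (AE w in lebesgue. D w = 0)"
  proof
    assume a: "AE w in lebesgue. D w = 0"
    obtain r where r: "r > 0" "AE w in lebesgue. norm (f w) = r" by (rule norm_constant)
    have "AE w in lebesgue. f w = 0" using a r(2) AE_shift[OF r(2), of x]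
    proof eventually_elim
      case (elim w)
      then show ?case using r(1) by (auto simp: D_def sgn_zero_iff)
    qed
    then show False using nonzero by simp
  qed
  ultimately obtain n where "cis ?th = torus_char n \<tau>"
    using torus_rotation_eigenfunction[OF nonres D] by metis
  then show ?thesis by simp
qed

text \<open>
  The phase of the correlations is linear in \<open>x\<close>, so its frequencies \<open>k\<^sub>1 + m \<tau>\<^sub>2\<close> and
  \<open>k\<^sub>2 - m \<tau>\<^sub>1\<close> vanish. Then \<open>m \<tau>\<^sub>1\<close> is an integer, which nonresonance admits only for \<open>m = 0\<close>.
\<close>

lemma invariants_zero: "m = 0" "k = 0"
proof -
  have "2 * pi * (of_int (k $ 1) + of_int m * \<tau> $ 2) = 0"
  proof (rule phase_frequency_zero[OF countable_characters])
    fix t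
    show "cis (t * (2 * pi * (of_int (k $ 1) + of_int m * \<tau> $ 2))) \<in> range (\<lambda>n. torus_char n \<tau>)"
      using correlation_phase[of "t *\<^sub>R axis 1 1"] by (simp add: axis_def[of _ "1::real"] lattice_dot_def sum_2 algebra_simps)
  qed
  then have 1: "of_int (k $ 1) + of_int m * \<tau> $ 2 = 0" by simp
  have "2 * pi * (of_int (k $ 2) - of_int m * \<tau> $ 1) = 0"
  proof (rule phase_frequency_zero[OF countable_characters])
    fix t
    show "cis (t * (2 * pi * (of_int (k $ 2) - of_int m * \<tau> $ 1))) \<in> range (\<lambda>n. torus_char n \<tau>)"
      using correlation_phase[of "t *\<^sub>R axis 2 1"] by (simp add: axis_def[of _ "1::real"] lattice_dot_def sum_2 algebra_simps)
  qed
  then have 2: "of_int m * \<tau> $ 1 = of_int (k $ 2)" by simp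
  have "torus_char (axis 1 m) \<tau> = cis (2 * pi * (of_int m * \<tau> $ 1))"
    by (simp add: torus_char_def lattice_dot_def sum_2 axis_def)
  also have "\<dots> = torus_char 0 \<tau>" unfolding 2 by simp
  finally have "axis 1 m = (0 :: int^2)" by (rule nonresonant_inj[OF nonres])
  then show m: "m = 0" by (simp add: axis_eq_0_iff)
  have "k $ j = 0" for j
    using exhaust_2[of j] 1 2 by (auto simp: m)
  then show "k = 0" by (simp add: vec_eq_iff)
qed

text \<open>
  With trivial invariants the phase of \<open>f\<close> is itself a bounded eigenfunction of the translation,
  hence a multiple of a character.
\<close>

theorem character: obtains n C where "lam = exp \<eta> * torus_char (- n) \<tau>" "AE w in lebesgue. f w = C * torus_char n w"
proof -
  have e: "AE w in lebesgue. exp \<eta> * f w = lam * f (w + \<tau>)" using eigen by (simp add: invariants_zero lattice_dot_def)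
  have "AE w in lebesgue. sgn (f (w + axis j 1)) = sgn (f w)" for j
  proof -
    consider "j = 1" | "j = 2" using exhaust_2 by blast
    then show ?thesis
    proof cases
      case 1
      show ?thesis unfolding 1 using f1 by eventually_elim simp
    next
      case 2
      show ?thesis unfolding 2 using f2 by eventually_elim (simp add: invariants_zero)
    qed
  qed
  then have D: "torus_bounded (\<lambda>w. sgn (f w))"
    unfolding torus_bounded_def using sgn_measurable by (auto simp: norm_sgn intro!: exI[of _ 1])
  have ev: "AE w in lebesgue. sgn (f (w + \<tau>)) = (cis (Im \<eta>) / sgn lam) * sgn (f w)"
    using sgn_eigen by (simp add: invariants_zero lattice_dot_def)
  have "\<not> (AE w in lebesgue. sgn (f w) = 0)" using nonzero by (simp add: sgn_zero_iff)
  then obtain n c where n: "AE w in lebesgue. sgn (f w) = c * torus_char n w"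
    by (rule torus_rotation_eigenfunction[OF nonres D ev])
  obtain r where r: "r > 0" "AE w in lebesgue. norm (f w) = r" by (rule norm_constant)
  let ?C = "of_real r * c"
  have f: "AE w in lebesgue. f w = ?C * torus_char n w"
    using n r(2)
  proof eventually_elim
    case (elim w)
    have "f w = of_real (norm (f w)) * sgn (f w)" by (simp add: sgn_eq)
    then show ?case using elim by (simp add: mult_ac)
  qed
  have "lam = exp \<eta> * torus_char (- n) \<tau>"
  proof (rule ccontr)
    assume ne: "lam \<noteq> exp \<eta> * torus_char (- n) \<tau>"
    have "AE w in lebesgue. f w = 0" using f AE_shift[OF f, of \<tau>] e
    proof eventually_elim
      case (elim w)
      have "f (w + \<tau>) = torus_char n \<tau> * f w" using elim by (simp add: torus_char_add)
      then have "(exp \<eta> - lam * torus_char n \<tau>) * f w = 0" using elim by (simp add: algebra_simps)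
      moreover have "exp \<eta> - lam * torus_char n \<tau> \<noteq> 0"
      proof
        assume "exp \<eta> - lam * torus_char n \<tau> = 0"
        then have "exp \<eta> * torus_char (- n) \<tau> = lam" by (simp add: torus_char_minus field_simps)
        then show False using ne by simp
      qed
      ultimately show ?case by simp
    qed
    then show False using nonzero by simp
  qed
  then show ?thesis using that f by blast
qed

end

section \<open>The point spectrum\<close>

lemma measurable_lebesgue_compose_continuous:
  assumes "F \<in> borel_measurable lebesgue" "continuous_on UNIV g"
  shows "(\<lambda>w. g (F w)) \<in> borel_measurable lebesgue"
  by (rule measurable_compose[OF assms(1)]) (rule borel_measurable_continuous_onI[OF assms(2)])

lemma transfer_eigen_iff:
  "transfer_op A \<tau> (abs_ae_field F) = cscale lam (abs_ae_field F) \<longleftrightarrow> (AE w in lebesgue. A w *v F w = lam *s F (w + \<tau>))"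
proof -
  have "transfer_op A \<tau> (abs_ae_field F) = cscale lam (abs_ae_field F) \<longleftrightarrow> (AE w in lebesgue. A (w - \<tau>) *v F (w - \<tau>) = lam *s F w)"
    by (simp add: transfer_op.abs_eq cscale.abs_eq ae_field.abs_eq_iff)
  also have "\<dots> \<longleftrightarrow> (AE w in lebesgue. A w *v F w = lam *s F (w + \<tau>))"
    using AE_shift[of "\<lambda>w. A (w - \<tau>) *v F (w - \<tau>) = lam *s F w" \<tau>] AE_shift[of "\<lambda>w. A w *v F w = lam *s F (w + \<tau>)" "- \<tau>"]
    unfolding diff_add_cancel add_diff_cancel diff_minus_eq_add[symmetric] minus_minus by (intro iffI) simp_all
  finally show ?thesis .
qed

lemma zero_ae_field_iff: "abs_ae_field F = 0 \<longleftrightarrow> (AE w in lebesgue. F w = 0)"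
  by (simp add: zero_ae_field_def ae_field.abs_eq_iff)

lemma eigenspaceD:
  assumes "\<Phi> \<in> eigenspace U A \<tau> lam"
  obtains F where "\<Phi> = abs_ae_field F" "measurable_section U F" "AE w in lebesgue. A w *v F w = lam *s F (w + \<tau>)"
proof -
  obtain F where F: "\<Phi> = abs_ae_field F" "measurable_section U F" using assms unfolding eigenspace_def L2_sections_def by blast
  then have "AE w in lebesgue. A w *v F w = lam *s F (w + \<tau>)"
    using assms transfer_eigen_iff[of A \<tau> F lam] unfolding eigenspace_def by blast
  with F show ?thesis by (rule that)
qed

context splitting begin

lemma independent_lines:
  assumes "i \<noteq> j" "x \<in> l i w" "x \<noteq> 0" "y \<in> l j w" "y \<noteq> 0"
  shows "wedge x y \<noteq> 0"
proof -
  obtain c d where c: "x = c *s e i w" and d: "y = d *s e j w" using assms in_line by metis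
  obtain c0 where c0: "c0 > 0" "\<And>w. c0 \<le> norm (wedge (e Stable w) (e Unstable w))" by (rule angle_bound) (rule that)
  have su: "wedge (e Stable w) (e Unstable w) \<noteq> 0" using c0(1) c0(2)[of w] by auto
  have "wedge (e i w) (e j w) \<noteq> 0"
    using assms(1) su wedge_commute[of "e i w" "e j w"] by (cases i; cases j) auto
  then show ?thesis using assms(3,5) unfolding c d by (auto simp: wedge_simps)
qed

text \<open>
  The wedge with the frame of the other line annihilates the component along that line. Its
  equation follows since matrices act on wedges by their determinants, and in the two frames the
  determinant of \<open>A\<close> is the product of the multipliers.
\<close>

lemma coordinate_eigenfunction:
  assumes nr: "nonresonant \<tau>" and ij: "i \<noteq> j" and v: "normal_frame i m k \<eta> v" and v': "normal_frame j m' k' \<eta>' v'"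
    and F: "measurable_section U F" "AE w in lebesgue. A w *v F w = lam *s F (w + \<tau>)"
    and nz: "\<not> (AE w in lebesgue. wedge (F w) (v' w) = 0)"
  shows "m = 0" "k = 0" "norm lam = exp (Re \<eta>)"
    and "\<exists>n C. lam = exp \<eta> * torus_char (- n) \<tau> \<and> (AE w in lebesgue. wedge (F w) (v' w) = C * torus_char n w * wedge (v w) (v' w))"
proof -
  have W: "wedge (v w) (v' w) \<noteq> 0" for w
    using v v' independent_lines[OF ij] unfolding normal_frame_def line_frame_def by blast
  have c: "continuous_on UNIV v" "continuous_on UNIV v'" using v v' by (auto simp: normal_frame_def line_frame_def)
  have fc: "frame_charge U m v" "frame_charge U m' v'" using v v' by (auto simp: normal_frame_def line_frame_def)
  define f where "f w = wedge (F w) (v' w) / wedge (v w) (v' w)" for w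
  have f_eq: "wedge (F w) (v' w) = f w * wedge (v w) (v' w)" for w using W by (simp add: f_def)
  interpret scalar_eigenfunction f m k \<eta> lam \<tau>
  proof
    show "nonresonant \<tau>" by fact
    show "f \<in> borel_measurable lebesgue"
    proof -
      have Fc: "(\<lambda>w. F w $ a) \<in> borel_measurable lebesgue" for a
        using measurable_lebesgue_compose_continuous[of F "\<lambda>x. x $ a"] F(1) unfolding measurable_section_def by (simp add: continuous_intros)
      have vc: "(\<lambda>w. v w $ a) \<in> borel_measurable lebesgue" "(\<lambda>w. v' w $ a) \<in> borel_measurable lebesgue" for a
        by (intro borel_measurable_lebesgue_continuous continuous_intros c)+
      show ?thesis unfolding f_def wedge_def by (intro borel_measurable_divide borel_measurable_diff borel_measurable_times Fc vc)
    qed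
    have det: "det (U j w) \<noteq> 0" for j w using unitary_det[OF sewing(2), of j w] by auto
    have F1: "AE w in lebesgue. F (w + axis j 1) = U j w *v F w" for j using F(1) by (simp add: measurable_section_def)
    show "AE w in lebesgue. f (w + axis 1 1) = f w"
      using F1[of 1] by eventually_elim (use fc det[of 1] in \<open>simp add: f_def frame_charge_def wedge_matrix\<close>)
    show "AE w in lebesgue. f (w + axis 2 1) = cis (- 2 * pi * of_int m * w $ 1) * f w"
      using F1[of 2]
    proof eventually_elim
      case (elim w)
      have "f (w + axis 2 1) = f w / cis (2 * pi * of_int m * w $ 1)"
        using elim fc det[of 2 w] by (simp add: f_def frame_charge_def wedge_matrix wedge_simps field_simps)
      then show ?case by (simp add: divide_inverse cis_inverse mult.commute)
    qed
    show "AE w in lebesgue. exp (2 * pi * \<i> * (lattice_dot k w - of_int m * \<tau> $ 1 * w $ 2) + \<eta>) * f w = lam * f (w + \<tau>)"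
      using F(2)
    proof eventually_elim
      case (elim w)
      define E where "E = exp (2 * pi * \<i> * (lattice_dot k w - of_int m * \<tau> $ 1 * w $ 2) + \<eta>)"
      define E' where "E' = exp (2 * pi * \<i> * (lattice_dot k' w - of_int m' * \<tau> $ 1 * w $ 2) + \<eta>')"
      have E: "A w *v v w = E *s v (w + \<tau>)" "A w *v v' w = E' *s v' (w + \<tau>)" "E \<noteq> 0" "E' \<noteq> 0"
        using v v' by (simp_all add: normal_frame_def E_def E'_def)
      have 1: "det (A w) * wedge (F w) (v' w) = lam * E' * wedge (F (w + \<tau>)) (v' (w + \<tau>))"
        unfolding wedge_matrix[symmetric] elim E wedge_simps by simp
      have 2: "det (A w) * wedge (v w) (v' w) = E * E' * wedge (v (w + \<tau>)) (v' (w + \<tau>))"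
        unfolding wedge_matrix[symmetric] E wedge_simps by simp
      have "E * E' * wedge (v (w + \<tau>)) (v' (w + \<tau>)) * f w = lam * E' * f (w + \<tau>) * wedge (v (w + \<tau>)) (v' (w + \<tau>))"
        using 1 unfolding 2[symmetric] f_eq by (simp add: mult_ac)
      then have "E * f w = lam * f (w + \<tau>)" using E W[of "w + \<tau>"] by simp
      then show ?case unfolding E_def .
    qed
    show "\<not> (AE w in lebesgue. f w = 0)" using nz W by (simp add: f_def)
  qed
  show "m = 0" "k = 0" by (rule invariants_zero)+
  show "norm lam = exp (Re \<eta>)" by (rule norm_lam)
  obtain n C where n: "lam = exp \<eta> * torus_char (- n) \<tau>" "AE w in lebesgue. f w = C * torus_char n w" by (rule character)
  have "AE w in lebesgue. wedge (F w) (v' w) = C * torus_char n w * wedge (v w) (v' w)"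
    using n(2) by eventually_elim (simp add: f_eq)
  then show "\<exists>n C. lam = exp \<eta> * torus_char (- n) \<tau> \<and> (AE w in lebesgue. wedge (F w) (v' w) = C * torus_char n w * wedge (v w) (v' w))"
    using n(1) by blast
qed

lemma character_section:
  fixes n :: "int^2"
  assumes v: "normal_frame i 0 0 \<eta> v"
  defines "G \<equiv> \<lambda>w. torus_char n w *s v w"
  shows "cscale C (abs_ae_field G) \<in> eigenspace U A \<tau> (exp \<eta> * torus_char (- n) \<tau>)" "abs_ae_field G \<noteq> 0"
proof -
  have v1: "continuous_on UNIV v" "\<And>w. v w \<noteq> 0" "\<And>w. A w *v v w = exp \<eta> *s v (w + \<tau>)"
    and fc: "frame_charge U 0 v"
    using v by (auto simp: normal_frame_def line_frame_def lattice_dot_def)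
  have vper: "v (w + axis j 1) = U j w *v v w" for j w
    using fc exhaust_2[of j] unfolding frame_charge_def by auto
  define F where "F w = C *s G w" for w
  have Fv: "F w = (C * torus_char n w) *s v w" for w by (simp add: F_def G_def smult_smult)
  have Fc: "continuous_on UNIV F"
  proof -
    have "continuous_on UNIV (\<lambda>w. \<chi> a. C * torus_char n w * v w $ a)"
      by (intro continuous_on_vec_lambda continuous_intros v1(1))
    moreover have "F = (\<lambda>w. \<chi> a. C * torus_char n w * v w $ a)" by (simp add: fun_eq_iff Fv vec_eq_iff)
    ultimately show ?thesis by (simp only:)
  qed
  have ms: "measurable_section U F"
    unfolding measurable_section_def
    using borel_measurable_lebesgue_continuous[OF Fc] by (simp add: Fv vper mv_smult torus_char_add)
  obtain B where B: "\<And>w. norm (F w) \<le> B"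
  proof -
    have "norm (F w) = norm C * norm (v w)" for w by (simp add: Fv norm_mult)
    moreover obtain B where "\<And>w. norm (norm (v w)) \<le> B"
      using continuous_periodic_bounded[OF continuous_on_norm[OF v1(1)] norm_frame_periodic[OF fc]] by blast
    ultimately have "norm (F w) \<le> norm C * B" for w by (simp add: mult_left_mono)
    then show thesis by (rule that)
  qed
  have "(\<integral>\<^sup>+ w\<in>unit_cell. ennreal ((norm (F w))\<^sup>2) \<partial>lebesgue) \<le> (\<integral>\<^sup>+ w\<in>unit_cell. ennreal (B\<^sup>2) \<partial>lebesgue)"
    using B by (intro nn_integral_mono mult_right_mono ennreal_leI power_mono) auto
  also have "\<dots> < \<infinity>"
    using emeasure_unit_cell by (simp add: nn_integral_cmult_indicator)
  finally have "(\<integral>\<^sup>+ w\<in>unit_cell. ennreal ((norm (F w))\<^sup>2) \<partial>lebesgue) < \<infinity>" .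
  with ms have L2: "abs_ae_field F \<in> L2_sections U" unfolding L2_sections_def by blast
  have "A w *v F w = (exp \<eta> * torus_char (- n) \<tau>) *s F (w + \<tau>)" for w
    by (simp add: Fv mv_smult v1(3) smult_smult torus_char_add torus_char_minus mult_ac)
  then have "transfer_op A \<tau> (abs_ae_field F) = cscale (exp \<eta> * torus_char (- n) \<tau>) (abs_ae_field F)"
    unfolding transfer_eigen_iff by simp
  moreover have "cscale C (abs_ae_field G) = abs_ae_field F" by (simp add: cscale.abs_eq F_def[abs_def])
  ultimately show "cscale C (abs_ae_field G) \<in> eigenspace U A \<tau> (exp \<eta> * torus_char (- n) \<tau>)"
    using L2 by (simp add: eigenspace_def)
  show "abs_ae_field G \<noteq> 0"
  proof
    assume "abs_ae_field G = 0"
    then have "AE w in lebesgue. norm (v w) = 0"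
      unfolding zero_ae_field_iff by eventually_elim (simp add: G_def)
    then have "norm (v 0) = 0" by (rule continuous_AE_zero[OF continuous_on_norm[OF v1(1)]])
    then show False using v1(2) by simp
  qed
qed

end

locale normalized_splitting = splitting +
  fixes m :: "branch \<Rightarrow> int" and k :: "branch \<Rightarrow> int^2" and \<eta> :: "branch \<Rightarrow> complex" and v :: "branch \<Rightarrow> real^2 \<Rightarrow> complex^2"
  assumes nr: "nonresonant \<tau>" and nf: "\<And>i. normal_frame i (m i) (k i) (\<eta> i) (v i)"
begin

definition other :: "branch \<Rightarrow> branch" where "other i = (case i of Stable \<Rightarrow> Unstable | Unstable \<Rightarrow> Stable)"

lemma other: "other i \<noteq> i" "j \<noteq> i \<longleftrightarrow> j = other i"
  by (cases i; cases j; simp add: other_def)+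

lemma gap: "Re (\<eta> Stable) < Re (\<eta> Unstable)"
  using lyapunov_gap[OF nf nf] .

lemma Re_inj: "Re (\<eta> i) = Re (\<eta> j) \<longleftrightarrow> i = j"
  using gap by (cases i; cases j) auto

text \<open>
  The eigenvalue has modulus \<open>exp (Re (\<eta> i))\<close> for each line \<open>i\<close> with a nonzero coefficient, and
  these moduli differ; so there is just one such line.
\<close>

lemma eigenspace_structure:
  assumes "\<Phi> \<in> eigenspace U A \<tau> lam" "\<Phi> \<noteq> 0"
  obtains i n C where "m i = 0" "k i = 0" "lam = exp (\<eta> i) * torus_char (- n) \<tau>"
    "\<Phi> = cscale C (abs_ae_field (\<lambda>w. torus_char n w *s v i w))"
proof -
  obtain F where F: "\<Phi> = abs_ae_field F" "measurable_section U F" "AE w in lebesgue. A w *v F w = lam *s F (w + \<tau>)"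
    using eigenspaceD[OF assms(1)] by blast
  have W: "wedge (v i w) (v (other i) w) \<noteq> 0" for i w
    using nf independent_lines[of i "other i"] other(1)[of i] unfolding normal_frame_def line_frame_def by metis
  have "\<exists>i. \<not> (AE w in lebesgue. wedge (F w) (v (other i) w) = 0)"
  proof (rule ccontr)
    assume "\<not> ?thesis"
    then have z: "AE w in lebesgue. wedge (F w) (v (other i) w) = 0" for i by blast
    have "AE w in lebesgue. F w = 0" using z[of Stable] z[of Unstable]
    proof eventually_elim
      case (elim w)
      have "wedge (v Stable w) (v Unstable w) *s F w = 0"
        using elim wedge_basis[of "v Stable w" "v Unstable w" "F w"] wedge_commute[of "v Stable w" "F w"]
        by (simp add: other_def)
      then show ?case using W[of Stable w] by (simp add: other_def)
    qed
    then show False using assms(2) by (simp add: F(1) zero_ae_field_iff)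
  qed
  then obtain i where i: "\<not> (AE w in lebesgue. wedge (F w) (v (other i) w) = 0)" by blast
  note ci = coordinate_eigenfunction[OF nr other(1)[symmetric] nf nf F(2,3) i]
  have o: "other (other i) = i" by (cases i) (simp_all add: other_def)
  have z: "AE w in lebesgue. wedge (F w) (v i w) = 0"
  proof (rule ccontr)
    assume "\<not> ?thesis"
    then have "norm lam = exp (Re (\<eta> (other i)))"
      using coordinate_eigenfunction(3)[OF nr other(1) nf nf F(2,3)] by blast
    then show False using ci(3) Re_inj[of "other i" i] other(1)[of i] by simp
  qed
  obtain n C where n: "lam = exp (\<eta> i) * torus_char (- n) \<tau>"
    "AE w in lebesgue. wedge (F w) (v (other i) w) = C * torus_char n w * wedge (v i w) (v (other i) w)"
    using ci(4) by blast
  have "AE w in lebesgue. F w = C *s (torus_char n w *s v i w)"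
    using n(2) z
  proof eventually_elim
    case (elim w)
    have "wedge (v i w) (v (other i) w) *s F w = wedge (F w) (v (other i) w) *s v i w + wedge (v i w) (F w) *s v (other i) w"
      by (rule wedge_basis)
    also have "\<dots> = wedge (v i w) (v (other i) w) *s (C *s (torus_char n w *s v i w))"
      using elim wedge_commute[of "v i w" "F w"] by (simp add: smult_smult mult_ac)
    finally show ?case by (rule vec.scale_left_imp_eq[OF W])
  qed
  then have "\<Phi> = cscale C (abs_ae_field (\<lambda>w. torus_char n w *s v i w))"
    by (simp add: F(1) cscale.abs_eq ae_field.abs_eq_iff)
  with ci(1,2) n(1) show ?thesis by (rule that)
qed

lemma character_eigenvector:
  assumes "m i = 0" "k i = 0"
  shows "cscale C (abs_ae_field (\<lambda>w. torus_char n w *s v i w)) \<in> eigenspace U A \<tau> (exp (\<eta> i) * torus_char (- n) \<tau>)"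
    "abs_ae_field (\<lambda>w. torus_char n w *s v i w) \<noteq> 0"
  using character_section[of i "\<eta> i" "v i"] nf[of i] unfolding assms by blast+

theorem point_spectrum_eq:
  "point_spectrum U A \<tau> = (\<Union>i\<in>{i. m i = 0 \<and> k i = 0}. {exp (\<eta> i) * torus_char n \<tau> | n. True})"
proof (intro equalityI subsetI)
  fix lam assume "lam \<in> point_spectrum U A \<tau>"
  then obtain \<Phi> where "\<Phi> \<in> eigenspace U A \<tau> lam" "\<Phi> \<noteq> 0" by (auto simp: point_spectrum_def)
  then obtain i n where "m i = 0" "k i = 0" "lam = exp (\<eta> i) * torus_char (- n) \<tau>" by (rule eigenspace_structure)
  then show "lam \<in> (\<Union>i\<in>{i. m i = 0 \<and> k i = 0}. {exp (\<eta> i) * torus_char n \<tau> | n. True})" by blast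
next
  fix lam assume "lam \<in> (\<Union>i\<in>{i. m i = 0 \<and> k i = 0}. {exp (\<eta> i) * torus_char n \<tau> | n. True})"
  then obtain i n where i: "m i = 0" "k i = 0" "lam = exp (\<eta> i) * torus_char n \<tau>" by blast
  have "abs_ae_field (\<lambda>w. torus_char (- n) w *s v i w) \<in> eigenspace U A \<tau> lam"
    using character_eigenvector(1)[OF i(1,2), of 1 "- n"] i(3) by simp
  then show "lam \<in> point_spectrum U A \<tau>"
    unfolding point_spectrum_def using character_eigenvector(2)[OF i(1,2), of "- n"] by blast
qed

text \<open>The value \<open>lam\<close> determines the line by its modulus and then the character by nonresonance.\<close>

theorem eigenspace_dim:
  assumes "lam \<in> point_spectrum U A \<tau>"
  shows "ae_field.dim (eigenspace U A \<tau> lam) = 1"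
proof -
  obtain \<Phi> where "\<Phi> \<in> eigenspace U A \<tau> lam" "\<Phi> \<noteq> 0" using assms by (auto simp: point_spectrum_def)
  then obtain i n where i: "m i = 0" "k i = 0" "lam = exp (\<eta> i) * torus_char (- n) \<tau>" by (rule eigenspace_structure)
  define X where "X = abs_ae_field (\<lambda>w. torus_char n w *s v i w)"
  have "eigenspace U A \<tau> lam = ae_field.span {X}"
  proof (intro equalityI subsetI)
    fix \<Psi> assume \<Psi>: "\<Psi> \<in> eigenspace U A \<tau> lam"
    show "\<Psi> \<in> ae_field.span {X}"
    proof (cases "\<Psi> = 0")
      case True
      then show ?thesis by (simp add: ae_field.span_zero)
    next
      case False
      with \<Psi> obtain i' n' C where i': "lam = exp (\<eta> i') * torus_char (- n') \<tau>"
        "\<Psi> = cscale C (abs_ae_field (\<lambda>w. torus_char n' w *s v i' w))" by (rule eigenspace_structure)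
      have "norm lam = exp (Re (\<eta> i))" "norm lam = exp (Re (\<eta> i'))"
        by (simp add: i(3) norm_mult) (simp add: i'(1) norm_mult)
      then have ii: "i' = i" using Re_inj[of i' i] by simp
      have "torus_char (- n') \<tau> = torus_char (- n) \<tau>" using i(3) i'(1) by (simp add: ii)
      then have "n' = n" using nonresonant_inj[OF nr] by fastforce
      then have "\<Psi> = cscale C X" using i'(2) by (simp add: ii X_def)
      then show ?thesis by (simp add: ae_field.span_base ae_field.span_scale)
    qed
  next
    fix \<Psi> assume "\<Psi> \<in> ae_field.span {X}"
    then obtain C where "\<Psi> = cscale C X" by (auto simp: ae_field.span_singleton)
    then show "\<Psi> \<in> eigenspace U A \<tau> lam" unfolding i(3) X_def using character_eigenvector(1)[OF i(1,2)] by simp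
  qed
  moreover have "X \<noteq> 0" unfolding X_def by (rule character_eigenvector(2)[OF i(1,2)])
  ultimately show ?thesis
    using ae_field.dim_eq_card_independent[of "{X}"] ae_field.dim_span[of "{X}"] by (simp add: ae_field.dependent_single)
qed

end

section \<open>Second derivatives and derivatives of matrices\<close>

lemma vector_derivative_bound:
  fixes g :: "real \<Rightarrow> complex"
  assumes "0 \<le> h" "\<And>t. (g has_vector_derivative g' t) (at t)" "\<And>t. 0 \<le> t \<Longrightarrow> t \<le> h \<Longrightarrow> norm (g' t) \<le> B"
  shows "norm (g h - g 0) \<le> B * h"
proof -
  have "norm (g h - g 0) \<le> B * norm (h - 0)"
  proof (rule differentiable_bound[of "{0..h}" g "\<lambda>t s. s *\<^sub>R g' t"])
    show "(g has_derivative (\<lambda>s. s *\<^sub>R g' t)) (at t within {0..h})" if "t \<in> {0..h}" for t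
      using assms(2)[of t] by (simp add: has_vector_derivative_def has_derivative_at_withinI)
    show "onorm (\<lambda>s. s *\<^sub>R g' t) \<le> B" if "t \<in> {0..h}" for t
      using assms(3)[of t] that by (intro onorm_le) (simp add: mult.commute[of B] mult_left_mono)
  qed (use assms(1) in auto)
  then show ?thesis using assms(1) by simp
qed

text \<open>
  The mean value estimate is applied in the direction \<open>j\<close> and then in the direction \<open>i\<close>. The
  second difference is symmetric in \<open>i\<close> and \<open>j\<close>, and this symmetry passes to the derivatives.
\<close>

lemma mixed_difference:
  assumes f: "Ck (Suc (Suc 0)) UNIV f" and \<epsilon>: "\<epsilon> > 0"
  obtains \<delta> where "\<delta> > 0" "\<And>h. 0 < h \<Longrightarrow> h < \<delta> \<Longrightarrow>
    norm (f (w + h *\<^sub>R axis i 1 + h *\<^sub>R axis j 1) - f (w + h *\<^sub>R axis i 1) - f (w + h *\<^sub>R axis j 1) + f w - of_real (h * h) * pd i (pd j f) w) \<le> \<epsilon> * (h * h)"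
proof -
  let ?i = "axis i 1 :: real^2" and ?j = "axis j 1 :: real^2" and ?P = "pd i (pd j f) w"
  have f1: "Ck (Suc 0) UNIV f" using Ck_SucD[OF f] .
  have f2: "Ck (Suc 0) UNIV (pd j f)" using f by simp
  have "continuous_on UNIV (pd i (pd j f))" using f2 by simp
  then have "isCont (pd i (pd j f)) w" by (simp add: continuous_on_eq_continuous_at)
  then obtain d where d: "d > 0" "\<And>x. dist x w < d \<Longrightarrow> dist (pd i (pd j f) x) ?P < \<epsilon>"
    using \<epsilon> unfolding continuous_at_eps_delta by blast
  have close: "norm (pd i (pd j f) (w + s *\<^sub>R ?i + t *\<^sub>R ?j) - ?P) \<le> \<epsilon>"
    if "0 \<le> s" "s \<le> h" "0 \<le> t" "t \<le> h" "h < d / 2" for s t h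
  proof -
    have "dist (w + s *\<^sub>R ?i + t *\<^sub>R ?j) w = norm (s *\<^sub>R ?i + t *\<^sub>R ?j)" by (simp add: dist_norm algebra_simps)
    also have "\<dots> \<le> s + t" using norm_triangle_ineq[of "s *\<^sub>R ?i" "t *\<^sub>R ?j"] that by simp
    also have "\<dots> < d" using that by simp
    finally show ?thesis using d(2) by (simp add: dist_norm less_imp_le)
  qed
  have "norm (f (w + h *\<^sub>R ?i + h *\<^sub>R ?j) - f (w + h *\<^sub>R ?i) - f (w + h *\<^sub>R ?j) + f w - of_real (h * h) * ?P) \<le> \<epsilon> * (h * h)"
    if h: "0 < h" "h < d / 2" for h
  proof -
    define G where "G t = f (w + h *\<^sub>R ?i + t *\<^sub>R ?j) - f (w + t *\<^sub>R ?j) - t *\<^sub>R (of_real h * ?P)" for t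
    define G' where "G' t = pd j f (w + h *\<^sub>R ?i + t *\<^sub>R ?j) - pd j f (w + t *\<^sub>R ?j) - of_real h * ?P" for t
    have "norm (G h - G 0) \<le> (\<epsilon> * h) * h"
    proof (rule vector_derivative_bound[of _ _ G'])
      have "((\<lambda>t. t *\<^sub>R (of_real h * ?P)) has_vector_derivative 1 *\<^sub>R (of_real h * ?P)) (at t)" for t
        by (auto intro!: derivative_eq_intros simp: has_vector_derivative_def)
      then show "(G has_vector_derivative G' t) (at t)" for t
        unfolding G_def G'_def by (intro has_vector_derivative_diff pd_line f1) simp
      fix t assume t: "0 \<le> t" "t \<le> h"
      define K where "K s = pd j f (w + t *\<^sub>R ?j + s *\<^sub>R ?i) - s *\<^sub>R ?P" for s
      have "norm (K h - K 0) \<le> \<epsilon> * h"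
      proof (rule vector_derivative_bound[of _ _ "\<lambda>s. pd i (pd j f) (w + t *\<^sub>R ?j + s *\<^sub>R ?i) - ?P"])
        have "((\<lambda>s. s *\<^sub>R ?P) has_vector_derivative ?P) (at s)" for s
          by (auto intro!: derivative_eq_intros simp: has_vector_derivative_def)
        then show "(K has_vector_derivative pd i (pd j f) (w + t *\<^sub>R ?j + s *\<^sub>R ?i) - ?P) (at s)" for s
          unfolding K_def by (intro has_vector_derivative_diff pd_line f2)
        show "norm (pd i (pd j f) (w + t *\<^sub>R ?j + s *\<^sub>R ?i) - ?P) \<le> \<epsilon>" if "0 \<le> s" "s \<le> h" for s
          using close[of s h t] that t h by (simp add: add_ac)
      qed (use h in simp)
      moreover have "K h - K 0 = G' t" by (simp add: K_def G'_def scaleR_conv_of_real add_ac)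
      ultimately show "norm (G' t) \<le> \<epsilon> * h" by simp
    qed (use h in simp)
    then show ?thesis by (simp add: G_def scaleR_conv_of_real algebra_simps)
  qed
  then show ?thesis using that[of "d / 2"] d(1) by simp
qed

lemma pd_commute:
  assumes f: "Ck (Suc (Suc 0)) UNIV f"
  shows "pd i (pd j f) w = pd j (pd i f) w"
proof (rule ccontr)
  let ?P = "pd i (pd j f) w" and ?Q = "pd j (pd i f) w"
  assume "?P \<noteq> ?Q"
  then have e: "norm (?P - ?Q) / 4 > 0" by simp
  obtain \<delta> where \<delta>: "\<delta> > 0" "\<And>h. 0 < h \<Longrightarrow> h < \<delta> \<Longrightarrow>
    norm (f (w + h *\<^sub>R axis i 1 + h *\<^sub>R axis j 1) - f (w + h *\<^sub>R axis i 1) - f (w + h *\<^sub>R axis j 1) + f w - of_real (h * h) * ?P) \<le> norm (?P - ?Q) / 4 * (h * h)"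
    by (rule mixed_difference[OF f e]) (rule that)
  obtain \<delta>' where \<delta>': "\<delta>' > 0" "\<And>h. 0 < h \<Longrightarrow> h < \<delta>' \<Longrightarrow>
    norm (f (w + h *\<^sub>R axis j 1 + h *\<^sub>R axis i 1) - f (w + h *\<^sub>R axis j 1) - f (w + h *\<^sub>R axis i 1) + f w - of_real (h * h) * ?Q) \<le> norm (?P - ?Q) / 4 * (h * h)"
    by (rule mixed_difference[OF f e]) (rule that)
  define h where "h = min \<delta> \<delta>' / 2"
  have h: "0 < h" "h < \<delta>" "h < \<delta>'" using \<delta>(1) \<delta>'(1) by (auto simp: h_def)
  define D where "D = f (w + h *\<^sub>R axis i 1 + h *\<^sub>R axis j 1) - f (w + h *\<^sub>R axis i 1) - f (w + h *\<^sub>R axis j 1) + f w"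
  have 1: "norm (D - of_real (h * h) * ?P) \<le> norm (?P - ?Q) / 4 * (h * h)" using \<delta>(2)[OF h(1,2)] by (simp add: D_def)
  have "f (w + h *\<^sub>R axis j 1 + h *\<^sub>R axis i 1) - f (w + h *\<^sub>R axis j 1) - f (w + h *\<^sub>R axis i 1) + f w = D"
    by (simp add: D_def add_ac)
  then have 2: "norm (D - of_real (h * h) * ?Q) \<le> norm (?P - ?Q) / 4 * (h * h)" using \<delta>'(2)[OF h(1,3)] by simp
  have "h * h * norm (?P - ?Q) = norm (of_real (h * h) * (?P - ?Q))" using h(1) by (simp add: norm_mult)
  also have "of_real (h * h) * (?P - ?Q) = (D - of_real (h * h) * ?Q) - (D - of_real (h * h) * ?P)" by (simp add: algebra_simps)
  also have "norm \<dots> \<le> norm (?P - ?Q) / 4 * (h * h) + norm (?P - ?Q) / 4 * (h * h)"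
    using norm_triangle_ineq4[of "D - of_real (h * h) * ?Q" "D - of_real (h * h) * ?P"] 1 2 by linarith
  finally have "h * h * norm (?P - ?Q) \<le> (h * h) * (norm (?P - ?Q) / 2)" by (simp add: algebra_simps)
  then have "norm (?P - ?Q) \<le> norm (?P - ?Q) / 2" using h(1) by simp
  then show False using e by simp
qed

lemma pd_add: "f differentiable at w \<Longrightarrow> g differentiable at w \<Longrightarrow> pd j (\<lambda>w. f w + g w) w = pd j f w + pd j g w"
proof -
  assume "f differentiable at w" "g differentiable at w"
  then have "(f has_derivative frechet_derivative f (at w)) (at w)" "(g has_derivative frechet_derivative g (at w)) (at w)"
    by (simp_all add: frechet_derivative_works)
  from pd_eqI[OF has_derivative_add[OF this]] show ?thesis by (simp add: pd_def)
qed

lemma pd_diff: "f differentiable at w \<Longrightarrow> g differentiable at w \<Longrightarrow> pd j (\<lambda>w. f w - g w) w = pd j f w - pd j g w"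
proof -
  assume "f differentiable at w" "g differentiable at w"
  then have "(f has_derivative frechet_derivative f (at w)) (at w)" "(g has_derivative frechet_derivative g (at w)) (at w)"
    by (simp_all add: frechet_derivative_works)
  from pd_eqI[OF has_derivative_diff[OF this]] show ?thesis by (simp add: pd_def)
qed

lemma pd_mult: "f differentiable at w \<Longrightarrow> g differentiable at w \<Longrightarrow> pd j (\<lambda>w. f w * g w) w = pd j f w * g w + f w * pd j g w"
proof -
  assume "f differentiable at w" "g differentiable at w"
  then have "(f has_derivative frechet_derivative f (at w)) (at w)" "(g has_derivative frechet_derivative g (at w)) (at w)"
    by (simp_all add: frechet_derivative_works)
  from pd_eqI[OF has_derivative_mult[OF this]] show ?thesis by (simp add: pd_def add.commute)
qed

lemma pd_const [simp]: "pd j (\<lambda>w. c) w = 0"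
  by (rule pd_eqI[of _ "\<lambda>h. 0", simplified]) simp

lemma pd_coord: "pd j (\<lambda>w. complex_of_real (w $ i)) w = (if i = j then 1 else 0)"
proof -
  have "((\<lambda>w. complex_of_real (w $ i)) has_derivative (\<lambda>h. complex_of_real (h $ i))) (at w)"
    by (intro bounded_linear.has_derivative[OF bounded_linear_of_real] bounded_linear.has_derivative[OF bounded_linear_vec_nth] has_derivative_ident)
  from pd_eqI[OF this, of j] show ?thesis by (simp add: axis_def)
qed

lemma pd_shift: "f differentiable at (w + a) \<Longrightarrow> pd j (\<lambda>w. f (w + a)) w = pd j f (w + a)"
proof -
  assume "f differentiable at (w + a)"
  then have "(f has_derivative frechet_derivative f (at (w + a))) (at (w + a))" by (simp add: frechet_derivative_works)
  moreover have "((\<lambda>x. x + a) has_derivative (\<lambda>h. h)) (at w)" by (auto intro!: derivative_eq_intros)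
  ultimately have "((\<lambda>x. f (x + a)) has_derivative frechet_derivative f (at (w + a))) (at w)"
    using has_derivative_compose[of "\<lambda>x. x + a" "\<lambda>h. h" w UNIV f] by simp
  from pd_eqI[OF this, of j] show ?thesis by (simp add: pd_def)
qed

lemma pd_log:
  assumes "continuous_on UNIV L" "\<And>w. exp (L w) = f w" "f differentiable at w"
  shows "L differentiable at w" "f w * pd j L w = pd j f w"
proof -
  have "(L has_derivative (\<lambda>h. frechet_derivative f (at w) h / f w)) (at w)"
    by (rule has_derivative_log[OF open_UNIV UNIV_I assms(1,2)]) (use assms(3) in \<open>simp add: frechet_derivative_works\<close>)
  from pd_eqI[OF this, of j] this show "L differentiable at w" "f w * pd j L w = pd j f w"
    using assms(2)[of w] by (auto simp: pd_def differentiable_def)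
qed

lemma has_derivative_vec2:
  fixes f :: "'a::real_normed_vector \<Rightarrow> 'b::euclidean_space^2"
  assumes "\<And>a. ((\<lambda>w. f w $ a) has_derivative (\<lambda>h. f' h $ a)) (at w)"
  shows "(f has_derivative f') (at w)"
proof -
  have ax: "bounded_linear (axis a :: 'b \<Rightarrow> 'b^2)" for a
    by (intro linear_conv_bounded_linear[THEN iffD1] linearI) (auto simp: axis_def vec_eq_iff)
  have dec: "x = axis 1 (x $ 1) + axis 2 (x $ 2)" for x :: "'b^2"
    by (simp add: vec_eq_iff forall_2 axis_def)
  have "((\<lambda>w. axis 1 (f w $ 1) + axis 2 (f w $ 2) :: 'b^2) has_derivative (\<lambda>h. axis 1 (f' h $ 1) + axis 2 (f' h $ 2))) (at w)"
    by (intro has_derivative_add bounded_linear.has_derivative[OF ax] assms)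
  then show ?thesis by (simp only: dec[symmetric])
qed

lemma matrix_differentiableI:
  fixes M :: "real^2 \<Rightarrow> complex^2^2"
  assumes "\<And>a b. (\<lambda>w. M w $ a $ b) differentiable at w"
  shows "M differentiable at w"
proof -
  have "(M has_derivative (\<lambda>h. \<chi> a b. frechet_derivative (\<lambda>w. M w $ a $ b) (at w) h)) (at w)"
    by (intro has_derivative_vec2) (use assms in \<open>simp add: frechet_derivative_works\<close>)
  then show ?thesis unfolding differentiable_def by blast
qed

lemma partial_entry:
  assumes "M differentiable at w"
  shows "(\<lambda>w. M w $ a $ b) differentiable at w" "partial j M w $ a $ b = pd j (\<lambda>w. M w $ a $ b) w"
proof -
  have "(M has_derivative frechet_derivative M (at w)) (at w)" using assms by (simp add: frechet_derivative_works)
  then have *: "((\<lambda>w. M w $ a $ b) has_derivative (\<lambda>h. frechet_derivative M (at w) h $ a $ b)) (at w)"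
    by (intro bounded_linear.has_derivative[OF bounded_linear_vec_nth])
  then show "(\<lambda>w. M w $ a $ b) differentiable at w" unfolding differentiable_def by blast
  show "partial j M w $ a $ b = pd j (\<lambda>w. M w $ a $ b) w" using pd_eqI[OF *, of j] by (simp add: partial_def)
qed

section \<open>The Chern number\<close>

lemma matrix_eq_on_basis:
  fixes M N :: "complex^2^2"
  assumes W: "wedge x y \<noteq> 0" and "M *v x = N *v x" "M *v y = N *v y"
  shows "M = N"
proof -
  have "M *v z = N *v z" for z
  proof -
    have z: "wedge x y *s z = wedge z y *s x + wedge x z *s y" by (rule wedge_basis)
    have "wedge x y *s (M *v z) = wedge x y *s (N *v z)"
      unfolding mv_smult[symmetric] z by (simp add: matrix_vector_right_distrib mv_smult assms(2,3))
    then show ?thesis by (rule vec.scale_left_imp_eq[OF W])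
  qed
  then show ?thesis unfolding matrix_eq by blast
qed

context splitting begin

lemma U_Ck: "Ck n UNIV (\<lambda>w. U j w $ r $ c)"
  using uniformly_analytic_Ck[OF analytic(1)] .

lemma U_diff: "U j differentiable at w"
  using U_Ck[of "Suc 0" j] by (intro matrix_differentiableI) simp

lemma det_U_Ck: "Ck n UNIV (\<lambda>w. det (U j w))"
  unfolding det_2 by (intro Ck_diff Ck_mult U_Ck open_UNIV)

lemma det_U_nonzero: "det (U j w) \<noteq> 0"
  using unitary_det[OF sewing(2), of j w] by auto

lemma frames_independent:
  assumes "\<exists>c. c \<noteq> 0 \<and> x = c *s e Stable w" "\<exists>c. c \<noteq> 0 \<and> y = c *s e Unstable w"
  shows "wedge x y \<noteq> 0"
  using assms independent_lines[of Stable Unstable "e Stable w" w "e Unstable w"] e_in_line e_nonzero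
  by (auto simp: wedge_simps)

lemma connection_entry_Ck:
  assumes "connection U a" shows "Ck (Suc 0) UNIV (\<lambda>w. a k w $ r $ c)"
proof -
  have d: "a k differentiable at w" for w using assms by (simp add: connection_def)
  have "continuous_on UNIV (\<lambda>w. partial l (a k) w $ r $ c)" for l
    using assms unfolding connection_def by (intro continuous_on_component) auto
  then have "continuous_on UNIV (pd l (\<lambda>w. a k w $ r $ c))" for l
    unfolding partial_entry(2)[OF d] by (simp add: eta_contract_eq)
  then show ?thesis using partial_entry(1)[OF d] by simp
qed

text \<open>
  Jacobi's formula for the derivative of a determinant, applied to the trace of the
  transformation rule of a connection.
\<close>

lemma connection_trace:
  assumes "connection U a"
  shows "det (U j w) * (trace (a k w) - trace (a k (w + axis j 1))) = pd k (\<lambda>w. det (U j w)) w"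
proof -
  have d: "(\<lambda>w. U j w $ r $ c) differentiable at w" for r c by (rule partial_entry(1)[OF U_diff])
  have dm: "(\<lambda>w. U j w $ r $ c * U j w $ r' $ c') differentiable at w" for r c r' c'
    using Ck_differentiable[OF Ck_mult[OF open_UNIV U_Ck U_Ck]] by simp
  have eq: "a k (w + axis j 1) ** U j w + partial k (U j) w = U j w ** a k w"
    using assms by (simp add: connection_def)
  have e: "a k (w + axis j 1) $ r $ 1 * U j w $ 1 $ c + a k (w + axis j 1) $ r $ 2 * U j w $ 2 $ c + pd k (\<lambda>w. U j w $ r $ c) w
      = U j w $ r $ 1 * a k w $ 1 $ c + U j w $ r $ 2 * a k w $ 2 $ c" for r c
    using arg_cong[OF eq, of "\<lambda>M. M $ r $ c"] by (simp add: matrix_matrix_mult_def sum_2 partial_entry(2)[OF U_diff])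
  have det: "pd k (\<lambda>w. det (U j w)) w = pd k (\<lambda>w. U j w $ 1 $ 1) w * U j w $ 2 $ 2 + U j w $ 1 $ 1 * pd k (\<lambda>w. U j w $ 2 $ 2) w
      - (pd k (\<lambda>w. U j w $ 1 $ 2) w * U j w $ 2 $ 1 + U j w $ 1 $ 2 * pd k (\<lambda>w. U j w $ 2 $ 1) w)"
    unfolding det_2 pd_diff[OF dm dm] pd_mult[OF d d] by (simp add: mult.commute)
  have p: "pd k (\<lambda>w. U j w $ r $ c) w = U j w $ r $ 1 * a k w $ 1 $ c + U j w $ r $ 2 * a k w $ 2 $ c
      - (a k (w + axis j 1) $ r $ 1 * U j w $ 1 $ c + a k (w + axis j 1) $ r $ 2 * U j w $ 2 $ c)" for r c
    using e[of r c] by (simp add: algebra_simps)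
  show ?thesis unfolding det unfolding p trace_def sum_2 det_2 by (simp add: algebra_simps)
qed

text \<open>
  Let \<open>L\<close> be a logarithm of the determinant of the two frames. The sewing factor of the
  determinant is that of the bundle times a phase with the total charge \<open>M\<close>, so
  \<open>trace (a k) + pd k L\<close> is invariant under unit steps except for an increment \<open>2 \<pi> i M\<close> along
  the second direction when \<open>k = 1\<close>. Subtracting the linear function \<open>Y k\<close> makes it periodic. In
  the curvature the second derivatives of \<open>L\<close> cancel, the periodic terms have mean zero, and the
  derivative of \<open>Y 1\<close> remains.
\<close>

lemma connection_chern:
  assumes a: "connection U a" and vs: "Ckv (Suc (Suc 0)) vs" "\<And>w. \<exists>c. c \<noteq> 0 \<and> vs w = c *s e Stable w" "frame_charge U ms vs"
    and vu: "Ckv (Suc (Suc 0)) vu" "\<And>w. \<exists>c. c \<noteq> 0 \<and> vu w = c *s e Unstable w" "frame_charge U mu vu"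
  shows "torus_mean (\<lambda>w. \<i> / (2 * of_real pi) * trace (curvature a w)) = of_int (ms + mu)"
proof -
  define M where "M = ms + mu"
  define \<delta> where "\<delta> w = wedge (vs w) (vu w)" for w
  have \<delta>nz: "\<delta> w \<noteq> 0" for w unfolding \<delta>_def by (rule frames_independent[OF vs(2) vu(2)])
  have \<delta>C: "Ck (Suc (Suc 0)) UNIV \<delta>"
    unfolding \<delta>_def wedge_def using vs(1) vu(1) unfolding Ckv_def by (intro Ck_diff Ck_mult open_UNIV) blast+
  obtain L where L: "continuous_on UNIV L" "\<And>w. \<delta> w = exp (L w)"
    by (rule continuous_log[OF Ck_continuous[OF \<delta>C] \<delta>nz]) (rule that)
  have LC: "Ck (Suc (Suc 0)) UNIV L" by (rule Ck_log[OF open_UNIV L(1) L(2)[symmetric] \<delta>C])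
  have "\<exists>u. continuous_on UNIV u \<and> (\<forall>w. det (U j w) = exp (u w))" for j
    by (rule continuous_log[OF Ck_continuous[OF det_U_Ck] det_U_nonzero]) blast
  then have "\<forall>j. \<exists>u. continuous_on UNIV u \<and> (\<forall>w. det (U j w) = exp (u w))" by blast
  from choice[OF this] obtain u where u: "\<And>j. continuous_on UNIV (u j)" "\<And>j w. det (U j w) = exp (u j w)" by blast
  define X where "X j w = (if j = (2::2) then 2 * pi * \<i> * of_int M * complex_of_real ((w::real^2) $ 1) else 0)" for j w
  have XC: "Ck n UNIV (X j)" for n j
  proof (cases "j = 2")
    case True
    have "Ck n UNIV (\<lambda>w. 2 * pi * \<i> * of_int M * complex_of_real (w $ 1))" by (intro Ck_mult Ck_const Ck_coord open_UNIV)
    then show ?thesis using True by (simp add: X_def[abs_def])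
  next
    case False
    then show ?thesis using Ck_const[OF open_UNIV, of n 0] by (simp add: X_def[abs_def])
  qed
  have \<delta>shift: "\<delta> (w + axis j 1) = exp (u j w + X j w + L w)" for j w
  proof -
    consider "j = 1" | "j = 2" using exhaust_2 by blast
    then have "\<delta> (w + axis j 1) = det (U j w) * exp (X j w) * \<delta> w"
    proof cases
      case 1
      then show ?thesis using vs(3) vu(3) by (simp add: \<delta>_def frame_charge_def wedge_matrix X_def)
    next
      case 2
      have "exp (X 2 w) = cis (2 * pi * of_int ms * w $ 1) * cis (2 * pi * of_int mu * w $ 1)"
        unfolding cis_conv_exp exp_add[symmetric] X_def M_def by (simp add: algebra_simps)
      then show ?thesis unfolding 2 using vs(3) vu(3) by (simp add: \<delta>_def frame_charge_def wedge_matrix wedge_simps)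
    qed
    then show ?thesis unfolding u(2) L(2)[of w] by (simp only: exp_add)
  qed
  have dL: "L differentiable at w" for w using LC by simp
  have dX: "X j differentiable at w" for j w using XC[of "Suc 0" j] by simp
  have ddet: "(\<lambda>w. det (U j w)) differentiable at w" for j w using det_U_Ck[of "Suc 0" j] by simp
  have du: "u j differentiable at w" "det (U j w) * pd k (u j) w = pd k (\<lambda>w. det (U j w)) w" for j k w
    using pd_log[OF u(1) u(2)[symmetric] ddet] by blast+
  have pdX: "pd k (X j) w = (if j = 2 \<and> k = 1 then 2 * pi * \<i> * of_int M else 0)" for k j w
  proof (cases "j = 2")
    case True
    have "pd k (\<lambda>w. (2 * pi * \<i> * of_int M) * complex_of_real (w $ 1)) w = (2 * pi * \<i> * of_int M) * (if 1 = k then 1 else 0)"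
    proof -
      have "(\<lambda>w. complex_of_real (w $ 1)) differentiable at w" "(\<lambda>w::real^2. (2 * pi * \<i> * of_int M) :: complex) differentiable at w"
        using Ck_coord[of "Suc 0" 1] by simp_all
      then show ?thesis by (simp add: pd_mult pd_coord)
    qed
    then show ?thesis using True by (auto simp: X_def[abs_def])
  next
    case False
    then show ?thesis by (simp add: X_def[abs_def])
  qed
  have Lshift: "pd k L (w + axis j 1) = pd k (u j) w + pd k (X j) w + pd k L w" for k j w
  proof -
    obtain z :: int where z: "\<And>w. L (w + axis j 1) - (u j w + X j w + L w) = 2 * pi * \<i> * of_int z"
    proof (rule exp_const_one[of "\<lambda>w. L (w + axis j 1) - (u j w + X j w + L w)"])
      show "continuous_on UNIV (\<lambda>w. L (w + axis j 1) - (u j w + X j w + L w))"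
        by (intro continuous_intros L u Ck_continuous[OF XC] continuous_on_compose2[OF L(1)]) auto
      show "exp (L (w + axis j 1) - (u j w + X j w + L w)) = 1" for w
        unfolding exp_diff L(2)[symmetric] \<delta>shift by simp
    qed blast
    have "(\<lambda>w. L (w + axis j 1)) = (\<lambda>w. u j w + X j w + L w + 2 * pi * \<i> * of_int z)"
      using z by (auto simp: algebra_simps)
    then have "pd k L (w + axis j 1) = pd k (\<lambda>w. u j w + X j w + L w + 2 * pi * \<i> * of_int z) w"
      using pd_shift[OF dL, of k] by metis
    also have "\<dots> = pd k (u j) w + pd k (X j) w + pd k L w"
      by (simp add: pd_add differentiable_add du(1) dX dL)
    finally show ?thesis .
  qed
  define tr where "tr k w = trace (a k w)" for k w
  have trC: "Ck (Suc 0) UNIV (tr k)" for k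
    unfolding tr_def trace_def sum_2 by (intro Ck_add connection_entry_Ck[OF a] open_UNIV)
  have trs: "tr k (w + axis j 1) = tr k w - pd k (u j) w" for k j w
  proof -
    have "det (U j w) * (tr k w - tr k (w + axis j 1)) = det (U j w) * pd k (u j) w"
      using connection_trace[OF a, of j w k] du(2)[of j w k] by (simp add: tr_def)
    then have "tr k w - tr k (w + axis j 1) = pd k (u j) w" using det_U_nonzero[of j w] by simp
    then show ?thesis by (simp add: algebra_simps)
  qed
  define Y where "Y k w = (if k = (1::2) then 2 * pi * \<i> * of_int M else 0) * complex_of_real ((w::real^2) $ 2)" for k w
  have YC: "Ck n UNIV (Y k)" for n k unfolding Y_def by (intro Ck_mult Ck_const Ck_coord open_UNIV)
  have pdLC: "Ck (Suc 0) UNIV (pd k L)" for k using LC by simp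
  define \<gamma> where "\<gamma> k w = tr k w + pd k L w - Y k w" for k w
  have \<gamma>C: "Ck (Suc 0) UNIV (\<gamma> k)" for k unfolding \<gamma>_def by (intro Ck_diff Ck_add trC pdLC YC open_UNIV)
  have \<gamma>p: "periodic (\<gamma> k)" for k unfolding periodic_def
  proof (intro allI)
    fix j :: 2 and w
    consider "j = 1" | "j = 2" using exhaust_2 by blast
    then have "Y k (w + axis j 1) = Y k w + pd k (X j) w"
      by cases (simp_all add: Y_def pdX axis_def distrib_left)
    then show "\<gamma> k (w + axis j 1) = \<gamma> k w" by (simp add: \<gamma>_def trs Lshift)
  qed
  have dtr: "tr k differentiable at w" and dpl: "pd k L differentiable at w" and dY: "Y k differentiable at w" for k w
    using trC[of k] pdLC[of k] YC[of "Suc 0" k] by simp_all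
  have p\<gamma>: "pd j (\<gamma> k) w = pd j (tr k) w + pd j (pd k L) w - pd j (Y k) w" for j k w
    unfolding \<gamma>_def by (simp add: pd_diff pd_add differentiable_add dtr dpl dY)
  have pdY: "pd 1 (Y 2) w = 0" "pd 2 (Y 1) w = 2 * pi * \<i> * of_int M" for w
  proof -
    have "(\<lambda>w. complex_of_real (w $ 2)) differentiable at w" using Ck_coord[of "Suc 0" 2] by simp
    then have "pd j (Y k) w = (if k = (1::2) then 2 * pi * \<i> * of_int M else 0) * pd j (\<lambda>w. complex_of_real (w $ 2)) w" for j k
      unfolding Y_def by (subst pd_mult) simp_all
    then show "pd 1 (Y 2) w = 0" "pd 2 (Y 1) w = 2 * pi * \<i> * of_int M" by (simp_all add: pd_coord)
  qed
  have curv: "trace (curvature a w) = pd 1 (\<gamma> 2) w + (-1) * pd 2 (\<gamma> 1) w + (- 2 * pi * \<i> * of_int M)" for w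
  proof -
    have da: "a k differentiable at w" for k using a by (simp add: connection_def)
    have tp: "trace (partial j (a k) w) = pd j (tr k) w" for j k
      unfolding trace_def sum_2 partial_entry(2)[OF da] tr_def using partial_entry(1)[OF da]
      by (simp add: pd_add)
    have "trace (curvature a w) = trace (partial 1 (a 2) w) - trace (partial 2 (a 1) w)"
      unfolding curvature_def trace_add trace_sub trace_mul_sym[of "a 2 w" "a 1 w"] by simp
    then show ?thesis unfolding tp p\<gamma> pdY pd_commute[OF LC, of 1 2] by simp
  qed
  have tb: "torus_bounded (pd j (\<gamma> k))" for j k
    using \<gamma>C[of k] by (intro torus_bounded_continuous periodic_pd[OF \<gamma>p \<gamma>C]) simp
  have tb2: "torus_bounded (\<lambda>w. (-1) * pd 2 (\<gamma> 1) w)" by (intro torus_bounded_mult torus_bounded_const tb)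
  have "torus_mean (\<lambda>w. \<i> / (2 * of_real pi) * trace (curvature a w)) = \<i> / (2 * of_real pi) * (- 2 * pi * \<i> * of_int M)"
    unfolding torus_mean_cmult curv torus_mean_add[OF torus_bounded_add[OF tb tb2] torus_bounded_const]
      torus_mean_add[OF tb tb2] torus_mean_pd[OF \<gamma>C \<gamma>p] by simp
  also have "\<dots> = of_int M" by simp
  finally show ?thesis by (simp add: M_def)
qed

text \<open>
  The connection is diagonal in the two frames: the covariant derivative of \<open>v i\<close> in the
  direction \<open>k\<close> is \<open>\<theta> k i\<close> times \<open>v i\<close>. The function \<open>\<theta> 1 i\<close> is linear in \<open>w\<^sub>2\<close> and grows by the
  logarithmic derivative of the phase that the charge puts into the sewing rule.
\<close>

lemma connection_exists:
  assumes vC: "\<And>i. Ckv (Suc (Suc 0)) (v i)" and vl: "\<And>i w. \<exists>c. c \<noteq> 0 \<and> v i w = c *s e i w"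
    and vf: "\<And>i. frame_charge U (m i) (v i)"
  shows "\<exists>a. connection U a"
proof -
  define \<delta> where "\<delta> w = wedge (v Stable w) (v Unstable w)" for w
  have \<delta>nz: "\<delta> w \<noteq> 0" for w unfolding \<delta>_def by (rule frames_independent[OF vl vl])
  have vr: "Ck (Suc (Suc 0)) UNIV (\<lambda>w. v i w $ r)" for i r using vC by (simp add: Ckv_def)
  have vr1: "Ck (Suc 0) UNIV (\<lambda>w. v i w $ r)" for i r using Ck_SucD[OF vr] .
  have dv: "(\<lambda>w. v i w $ r) differentiable at w" for i r w using vr1[of i r] by simp
  define \<theta> where "\<theta> k i w = (if k = (1::2) then 2 * pi * \<i> * of_int (m i) else 0) * complex_of_real ((w::real^2) $ 2)" for k i w
  define y where "y k i w = (\<chi> r. \<theta> k i w * v i w $ r - pd k (\<lambda>w. v i w $ r) w)" for k i w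
  have yC: "Ck (Suc 0) UNIV (\<lambda>w. y k i w $ r)" for k i r
  proof -
    have "Ck (Suc 0) UNIV (pd k (\<lambda>w. v i w $ r))" using vr[of i r] by simp
    moreover have "Ck (Suc 0) UNIV (\<theta> k i)" unfolding \<theta>_def by (intro Ck_mult Ck_const Ck_coord open_UNIV)
    ultimately show ?thesis unfolding y_def vec_lambda_beta by (intro Ck_diff Ck_mult vr1 open_UNIV)
  qed
  define a where "a k w = (\<chi> r c. (wedge (axis c 1) (v Unstable w) * y k Stable w $ r + wedge (v Stable w) (axis c 1) * y k Unstable w $ r) / \<delta> w)" for k w
  have av: "a k w *v v i w = y k i w" for k i w
  proof -
    have "(a k w *v v i w) $ r = (wedge (v i w) (v Unstable w) * y k Stable w $ r + wedge (v Stable w) (v i w) * y k Unstable w $ r) / \<delta> w" for r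
      using \<delta>nz[of w] by (simp add: a_def matrix_vector_mult_def sum_2 wedge_def axis_def field_simps)
    then show ?thesis using \<delta>nz[of w] by (cases i) (simp_all add: vec_eq_iff \<delta>_def wedge_simps)
  qed
  have aC: "Ck (Suc 0) UNIV (\<lambda>w. a k w $ r $ c)" for k r c
    unfolding a_def vec_lambda_beta \<delta>_def wedge_def
    by (intro Ck_divide Ck_add Ck_mult Ck_diff Ck_const yC vr1 open_UNIV) (use \<delta>nz in \<open>simp add: \<delta>_def wedge_def\<close>)
  have ad: "a k differentiable at w" for k w using aC by (intro matrix_differentiableI) simp
  have ac: "continuous_on UNIV (partial l (a k))" for l k
  proof -
    have "partial l (a k) = (\<lambda>w. \<chi> r c. pd l (\<lambda>w. a k w $ r $ c) w)"
      using partial_entry(2)[OF ad] by (auto simp: fun_eq_iff vec_eq_iff)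
    moreover have "continuous_on UNIV (\<lambda>w. \<chi> r c. pd l (\<lambda>w. a k w $ r $ c) w)"
      using aC[of k] by (intro continuous_on_vec_lambda) (simp add: eta_contract_eq)
    ultimately show ?thesis by simp
  qed
  have sew: "a k (w + axis j 1) ** U j w + partial k (U j) w = U j w ** a k w" for j k w
  proof (rule matrix_eq_on_basis[OF \<delta>nz[unfolded \<delta>_def]])
    have key: "(a k (w + axis j 1) ** U j w + partial k (U j) w) *v v i w = (U j w ** a k w) *v v i w" for i
    proof -
      define \<psi> where "\<psi> w = (if j = (2::2) then 2 * pi * \<i> * of_int (m i) else 0) * complex_of_real ((w::real^2) $ 1)" for w
      have \<psi>C: "Ck n UNIV \<psi>" for n unfolding \<psi>_def by (intro Ck_mult Ck_const Ck_coord open_UNIV)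
      have d\<psi>: "\<psi> differentiable at w" and dexp: "(\<lambda>w. exp (\<psi> w)) differentiable at w" for w
        using \<psi>C[of "Suc 0"] Ck_exp[OF open_UNIV \<psi>C[of "Suc 0"]] by simp_all
      have pd\<psi>: "pd k \<psi> w = \<theta> k i (w + axis j 1) - \<theta> k i w"
      proof -
        have "(\<lambda>w. complex_of_real (w $ 1)) differentiable at w" using Ck_coord[of "Suc 0" 1] by simp
        then have "pd k \<psi> w = (if j = (2::2) then 2 * pi * \<i> * of_int (m i) else 0) * pd k (\<lambda>w. complex_of_real (w $ 1)) w"
          unfolding \<psi>_def by (subst pd_mult) simp_all
        then show ?thesis by (auto simp: pd_coord \<theta>_def axis_def distrib_left)
      qed
      have pexp: "pd k (\<lambda>w. exp (\<psi> w)) w = exp (\<psi> w) * (\<theta> k i (w + axis j 1) - \<theta> k i w)"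
        using pd_log(2)[OF Ck_continuous[OF \<psi>C[of 0]] refl dexp, of w k] pd\<psi> by simp
      have vs: "v i (w + axis j 1) = exp (\<psi> w) *s (U j w *v v i w)" for w
      proof -
        consider "j = 1" | "j = 2" using exhaust_2 by blast
        then show ?thesis
          using vf[of i] unfolding frame_charge_def by cases (simp_all add: \<psi>_def cis_conv_exp mult_ac)
      qed
      define z where "z r w = U j w $ r $ 1 * v i w $ 1 + U j w $ r $ 2 * v i w $ 2" for r w
      have z: "(U j w *v v i w) $ r = z r w" for r w by (simp add: z_def matrix_vector_mult_def sum_2)
      have dU: "(\<lambda>w. U j w $ r $ c) differentiable at w" for r c w by (rule partial_entry(1)[OF U_diff])
      have dm: "(\<lambda>w. U j w $ r $ c * v i w $ c) differentiable at w" for r c w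
        using Ck_mult[OF open_UNIV U_Ck vr1, of j r c i c] by simp
      have dz: "z r differentiable at w" for r w unfolding z_def by (intro differentiable_add dm)
      have pz: "pd k (z r) w = (pd k (\<lambda>w. U j w $ r $ 1) w * v i w $ 1 + U j w $ r $ 1 * pd k (\<lambda>w. v i w $ 1) w)
          + (pd k (\<lambda>w. U j w $ r $ 2) w * v i w $ 2 + U j w $ r $ 2 * pd k (\<lambda>w. v i w $ 2) w)" for r
        unfolding z_def by (simp add: pd_add dm pd_mult dU dv)
      have vsr: "(\<lambda>w. v i (w + axis j 1) $ r) = (\<lambda>w. exp (\<psi> w) * z r w)" for r
        by (simp add: vs z fun_eq_iff)
      have pv: "pd k (\<lambda>w. v i w $ r) (w + axis j 1) = exp (\<psi> w) * (\<theta> k i (w + axis j 1) - \<theta> k i w) * z r w + exp (\<psi> w) * pd k (z r) w" for r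
        using pd_shift[OF dv[of i r "w + axis j 1"], of k] unfolding vsr pd_mult[OF dexp dz] pexp by simp
      have "U j w *v v i w = exp (- \<psi> w) *s v i (w + axis j 1)" unfolding vs by (simp add: smult_smult flip: exp_add)
      then have 1: "(a k (w + axis j 1) ** U j w) *v v i w = exp (- \<psi> w) *s y k i (w + axis j 1)"
        unfolding matrix_vector_mul_assoc[symmetric] by (simp add: mv_smult av)
      have yr: "(exp (- \<psi> w) *s y k i (w + axis j 1)) $ r = \<theta> k i w * z r w - pd k (z r) w" for r
      proof -
        have vz: "v i (w + axis j 1) $ r = exp (\<psi> w) * z r w" by (simp add: vs z)
        have "(exp (- \<psi> w) *s y k i (w + axis j 1)) $ r
            = exp (- \<psi> w) * (exp (\<psi> w) * (\<theta> k i w * z r w - pd k (z r) w))"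
          unfolding y_def vector_smult_component vec_lambda_beta pv vz by (simp add: algebra_simps)
        also have "\<dots> = \<theta> k i w * z r w - pd k (z r) w" by (simp add: exp_minus)
        finally show ?thesis .
      qed
      have "((a k (w + axis j 1) ** U j w + partial k (U j) w) *v v i w) $ r = ((U j w ** a k w) *v v i w) $ r" for r
      proof -
        have "((a k (w + axis j 1) ** U j w + partial k (U j) w) *v v i w) $ r
            = \<theta> k i w * z r w - pd k (z r) w + (pd k (\<lambda>w. U j w $ r $ 1) w * v i w $ 1 + pd k (\<lambda>w. U j w $ r $ 2) w * v i w $ 2)"
          unfolding matrix_vector_mult_add_rdistrib 1 vector_add_component yr
          by (simp add: matrix_vector_mult_def sum_2 partial_entry(2)[OF U_diff])
        also have "\<dots> = (U j w *v y k i w) $ r"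
          unfolding pz by (simp add: matrix_vector_mult_def sum_2 y_def z_def algebra_simps)
        finally show ?thesis unfolding matrix_vector_mul_assoc[symmetric] av .
      qed
      then show ?thesis by (simp add: vec_eq_iff)
    qed
    show "(a k (w + axis j 1) ** U j w + partial k (U j) w) *v v Stable w = (U j w ** a k w) *v v Stable w"
      "(a k (w + axis j 1) ** U j w + partial k (U j) w) *v v Unstable w = (U j w ** a k w) *v v Unstable w"
      by (rule key)+
  qed
  show ?thesis unfolding connection_def using ad ac sew by blast
qed

theorem chern_number_eq: "chern_number U = of_int (charge U (l Stable) + charge U (l Unstable))"
proof -
  have "\<exists>v m. Ckv (Suc (Suc 0)) v \<and> (\<forall>w. \<exists>c. c \<noteq> 0 \<and> v w = c *s e i w) \<and> frame_charge U m v" for i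
    by (rule smooth_frame[of "Suc (Suc 0)" i]) blast
  then obtain v m where v: "\<And>i. Ckv (Suc (Suc 0)) (v i)" "\<And>i w. \<exists>c. c \<noteq> 0 \<and> v i w = c *s e i w" "\<And>i. frame_charge U (m i) (v i)"
    by metis
  have lf: "line_frame i (m i) (v i)" for i
  proof -
    have "v i w \<noteq> 0 \<and> v i w \<in> l i w" for w using v(2)[of i w] e_nonzero[of i w] in_line_smult[OF e_in_line] by auto
    then show ?thesis using v(3) Ckv_continuous[OF v(1)] by (simp add: line_frame_def)
  qed
  have mean: "torus_mean (\<lambda>w. \<i> / (2 * of_real pi) * trace (curvature a w)) = of_int (m Stable + m Unstable)"
    if "connection U a" for a
    by (rule connection_chern[OF that v(1) v(2) v(3) v(1) v(2) v(3)])
  obtain a0 where "connection U a0" using connection_exists[OF v(1) v(2) v(3)] by blast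
  then have "chern_number U = of_int (m Stable + m Unstable)"
    unfolding chern_number_def by (intro the_equality) (use mean in auto)
  then show ?thesis by (simp add: charge_eq[OF lf])
qed

end

section \<open>Spectrum and Chern number of a dominated cocycle\<close>

theorem corollary9p7:
  fixes U :: "2 \<Rightarrow> real^2 \<Rightarrow> complex^2^2" and A :: "real^2 \<Rightarrow> complex^2^2"
    and \<tau> :: "real^2" and l :: "branch \<Rightarrow> real^2 \<Rightarrow> (complex^2) set"
    and c \<nu> :: real and m :: "branch \<Rightarrow> int" and k :: "branch \<Rightarrow> int^2"
  assumes "strip_admissible U A \<tau>"
    and "dominated_splitting U A \<tau> l"
    and "c > 0" and "\<nu> \<ge> 1" and "\<tau> \<in> diophantine c \<nu>"
    and "\<And>i. m i = charge U (l i)"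
    and "\<And>i. k i = winding_vector U A \<tau> (l i)"
  shows
    "(\<forall>e g. (\<forall>i. adapted_frame U (l i) (m i) (e i) \<and> phase_data A \<tau> (m i) (e i) (k i) (g i)) \<longrightarrow>
        point_spectrum U A \<tau> =
          (\<Union>i\<in>{i. m i = 0 \<and> k i = 0}. line_spectrum A \<tau> (e i) (g i)) \<and>
        disjoint_family_on (\<lambda>i. line_spectrum A \<tau> (e i) (g i)) {i. m i = 0 \<and> k i = 0} \<and>
        (\<forall>i. m i = 0 \<and> k i = 0 \<longrightarrow>
           (\<forall>lam\<in>line_spectrum A \<tau> (e i) (g i). norm lam = exp (lyapunov A \<tau> (e i)))) \<and>
        exp (lyapunov A \<tau> (e Stable)) < exp (lyapunov A \<tau> (e Unstable)))
     \<and> (point_spectrum U A \<tau> \<noteq> {} \<longleftrightarrow> (\<exists>i. m i = 0 \<and> k i = 0))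
     \<and> (\<forall>lam\<in>point_spectrum U A \<tau>. ae_field.dim (eigenspace U A \<tau> lam) = 1)
     \<and> of_int (m Stable + m Unstable) = chern_number U
     \<and> (chern_number U \<noteq> 0 \<longrightarrow>
          (\<forall>i j. m i = 0 \<and> k i = 0 \<and> m j = 0 \<and> k j = 0 \<longrightarrow> i = j))
     \<and> (chern_number U \<noteq> 0 \<longrightarrow>
          (point_spectrum U A \<tau> \<noteq> {} \<longleftrightarrow> (\<exists>i. m i = 0 \<and> k i = 0)))
     \<and> (chern_number U \<noteq> 0 \<longrightarrow>
          (\<forall>i. topologically_trivial U (l i) \<longrightarrow> (point_spectrum U A \<tau> \<noteq> {} \<longleftrightarrow> k i = 0)))"
proof -
  interpret S: splitting U A \<tau> l by unfold_locales (rule assms)+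
  have "\<exists>\<eta> v. S.normal_frame i (m i) (k i) \<eta> v" for i
  proof -
    obtain m' k' \<eta> v where v: "S.normal_frame i m' k' \<eta> v" by (rule S.normal_frame_exists[OF assms(5,3)])
    then have "m i = m'" "k i = k'"
      using S.charge_eq[of i m' v] S.winding_vector_eq[OF v] assms(6,7) by (simp_all add: S.normal_frame_def)
    with v show ?thesis by blast
  qed
  then have "\<forall>i. \<exists>\<eta> v. S.normal_frame i (m i) (k i) \<eta> v" by blast
  from choice[OF this] obtain \<eta> where "\<forall>i. \<exists>v. S.normal_frame i (m i) (k i) (\<eta> i) v" by blast
  from choice[OF this] obtain v where nf: "\<And>i. S.normal_frame i (m i) (k i) (\<eta> i) (v i)" by blast
  interpret N: normalized_splitting U A \<tau> l m k \<eta> v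
    by unfold_locales (rule diophantine_nonresonant[OF assms(5,3)], rule nf)
  have spec: "point_spectrum U A \<tau> \<noteq> {} \<longleftrightarrow> (\<exists>i. m i = 0 \<and> k i = 0)"
    unfolding N.point_spectrum_eq by blast
  have chern: "of_int (m Stable + m Unstable) = chern_number U"
    unfolding S.chern_number_eq assms(6) ..
  have at_most_one: "i = j" if "chern_number U \<noteq> 0" "m i = 0" "m j = 0" for i j
    using that chern by (cases i; cases j) auto
  have modulus: "norm lam = exp (Re (\<eta> i))" if "lam \<in> {exp (\<eta> i) * torus_char n \<tau> | n. True}" for lam i
    using that by (auto simp: norm_mult)
  have frames: "point_spectrum U A \<tau> = (\<Union>i\<in>{i. m i = 0 \<and> k i = 0}. line_spectrum A \<tau> (e i) (g i)) \<and>
        disjoint_family_on (\<lambda>i. line_spectrum A \<tau> (e i) (g i)) {i. m i = 0 \<and> k i = 0} \<and>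
        (\<forall>i. m i = 0 \<and> k i = 0 \<longrightarrow>
           (\<forall>lam\<in>line_spectrum A \<tau> (e i) (g i). norm lam = exp (lyapunov A \<tau> (e i)))) \<and>
        exp (lyapunov A \<tau> (e Stable)) < exp (lyapunov A \<tau> (e Unstable))"
    if "\<forall>i. adapted_frame U (l i) (m i) (e i) \<and> phase_data A \<tau> (m i) (e i) (k i) (g i)" for e g
  proof -
    have ad: "adapted_frame U (l i) (m i) (e i)" "phase_data A \<tau> (m i) (e i) (k i) (g i)" for i using that by blast+
    have ls: "line_spectrum A \<tau> (e i) (g i) = {exp (\<eta> i) * torus_char n \<tau> | n. True}" for i
      by (rule S.line_spectrum_eq[OF nf ad])
    have ly: "lyapunov A \<tau> (e i) = Re (\<eta> i)" for i by (rule S.normal_frame_data(2)[OF nf ad(1)])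
    have "disjoint_family_on (\<lambda>i. line_spectrum A \<tau> (e i) (g i)) {i. m i = 0 \<and> k i = 0}"
      unfolding disjoint_family_on_def
    proof (intro ballI impI)
      fix i j :: branch assume "i \<noteq> j"
      then have "exp (Re (\<eta> i)) \<noteq> exp (Re (\<eta> j))" using N.Re_inj[of i j] by simp
      then show "line_spectrum A \<tau> (e i) (g i) \<inter> line_spectrum A \<tau> (e j) (g j) = {}"
        using modulus[of _ i] modulus[of _ j] unfolding ls by (metis (lifting) disjoint_iff)
    qed
    moreover have "\<forall>i. m i = 0 \<and> k i = 0 \<longrightarrow> (\<forall>lam\<in>line_spectrum A \<tau> (e i) (g i). norm lam = exp (lyapunov A \<tau> (e i)))"
      unfolding ls ly using modulus by blast
    ultimately show ?thesis
      using N.gap by (simp add: N.point_spectrum_eq ls ly)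
  qed
  have trivial: "point_spectrum U A \<tau> \<noteq> {} \<longleftrightarrow> k i = 0" if "chern_number U \<noteq> 0" "topologically_trivial U (l i)" for i
  proof -
    have "m i = 0" using S.charge_trivial[OF that(2)] assms(6) by simp
    then show ?thesis using spec at_most_one[OF that(1)] by blast
  qed
  show ?thesis
    by (intro conjI)
      (use frames spec N.eigenspace_dim chern at_most_one trivial in \<open>blast+\<close>)
qed

end
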